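(* Let $\varphi:G\to\mathrm{Homeo}(X)$ be an action of a discrete group $G$ on a locally compact Hausdorff space $X$, let $\alpha$ be the corresponding action on $C_0(X)$ and let $u\in Z^2(G,C_u(X))$ be a normalised $2$-cocycle. For any non-empty $P\subseteq[1,\infty]$ and any $b\in F(\alpha,u)$, $$\|b\|_{P,\mathrm r}=\sup\|\mathrm{Ind}_p(\pi)(b)\|,$$ where the supremum is over all $p\in P$ and all non-degenerate representations $\pi:C_0(X)\to B(E)$, where $E$ is an $L^p$-space if $p\in P\setminus\{\infty\}$, and $E$ is a $C_0$-space if $p=\infty\in P$. If $P\subseteq\{1,\infty\}$, then $F^P(\alpha,u)=F^P_{\mathrm r}(\alpha,u)$. If the action $\varphi$ is amenable, then $F^P(\alpha,u)=F^P_{\mathrm r}(\alpha,u)$ for any $P\subseteq[1,\infty]$. (Equality means that the norms defining the two completions of $F(\alpha,u)$ coincide.)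
   Context: Setting: $\alpha_s(a)=a\circ\varphi_{s^{-1}}$ for $a\in C_0(X)$, and also for $a\in C_b(X)$. $C_u(X)=\{a\in C_b(X):|a(x)|=1\ \forall x\in X\}$. A normalised $2$-cocycle $u\in Z^2(G,C_u(X))$ is a map $u:G\times G\to C_u(X)$ with $\alpha_r(u(s,t))u(r,st)=u(r,s)u(rs,t)$ for all $r,s,t\in G$ and $u(1,1)=1$. $F(\alpha,u)=\ell^1(G,C_0(X))$ is the Banach algebra with norm $\|b\|_1=\sum_{g}\|b(g)\|_\infty$ and product $(a*b)(r)=\sum_{st=r}a(s)\alpha_s(b(t))u(s,t)$. A representation of a Banach algebra $B$ on a Banach space $E$ is a contractive homomorphism $B\to B(E)$; it is non-degenerate if $\overline{\pi(B)E}=E$. A non-degenerate representation $\pi$ of $C_0(X)$ extends uniquely to a unital representation $\overline\pi$ of $C_b(X)$. An $L^p$-space is a Banach space isometrically isomorphic to some $L^p(\mu)$; a $C_0$-space is a Banach space isometrically isomorphic to $C_0(\Omega)$ for some topological space $\Omega$. For $p\in[1,\infty)$, $\|b\|_{L^p}$ is the supremum of $\|\psi(b)\|$ over non-degenerate representations $\psi$ of $F(\alpha,u)$ on $L^p$-spaces; $\|b\|_{L^\infty}$ is the supremum over non-degenerate representations on $C_0$-spaces. Let $$\Lambda_p(b)\xi(x,t)=\sum_{s\in G}b(s)(x)\,u(s,s^{-1}t)(x)\,\xi(\varphi_{s^{-1}}(x),s^{-1}t),$$ a representation on $\ell^p(X\times G)$ for $p<\infty$ and on $c_0(X\times G)$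 for $p=\infty$, and $\|b\|_{L^p,\mathrm r}=\|\Lambda_p(b)\|$. For non-empty $P\subseteq[1,\infty]$, $\|b\|_P=\sup_{p\in P}\|b\|_{L^p}$ and $\|b\|_{P,\mathrm r}=\sup_{p\in P}\|b\|_{L^p,\mathrm r}$, and $F^P(\alpha,u)$, $F^P_{\mathrm r}(\alpha,u)$ are the completions of $F(\alpha,u)$ in $\|\cdot\|_P$, $\|\cdot\|_{P,\mathrm r}$. By convention $F^\emptyset(\alpha,u)=F^\emptyset_{\mathrm r}(\alpha,u)=F(\alpha,u)$. For a non-degenerate representation $\pi:C_0(X)\to B(E)$, the induced representation $\mathrm{Ind}_p(\pi)$ of $F(\alpha,u)$ on $\ell^p(G,E)$ (for $p<\infty$) or on $c_0(G,E)$ (for $p=\infty$) is $$\mathrm{Ind}_p(\pi)(b)\xi(t)=\sum_{s\in G}\pi\big(\alpha_t^{-1}(b(s)u(s,s^{-1}t))\big)\xi(s^{-1}t).$$ Amenability of $\varphi$: there is a net $(f_i)$ of finitely supported functions $f_i:G\to C_c(X)^+$ such that $\sum_{t}f_i(t)\to1$ and, for every $s\in G$, $\sum_t|\alpha_s(f_i(t))-f_i(st)|\to0$, both uniformly on compact subsets of $X$. *)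

theory Defs
  imports "HOL-Analysis.Analysis" "HOL-Algebra.Module"
begin

section \<open>Complex Banach spaces with explicit carriers\<close>

text \<open>
  The statement takes suprema over all representations on a class of Banach spaces, so Banach
  spaces have to be objects rather than types.  The fields \<open>mult\<close> and \<open>one\<close> inherited from the
  module record are left unspecified unless the space is made into a Banach algebra, in which
  case only \<open>mult\<close> is given (the algebras below need not be unital).
\<close>

record 'e nspace = "(complex, 'e) module" +
  nrm :: "'e \<Rightarrow> real"

definition complex_ring :: "complex ring" where
  "complex_ring = \<lparr>carrier = UNIV, mult = (*), one = 1, zero = 0, add = (+)\<rparr>"

text \<open>The case distinction makes \<open>ndist E\<close> a metric in the sense of \<open>Metric_space\<close>, which asks for
  symmetry and non-negativity also off the carrier.\<close>

definition ndist :: "'e nspace \<Rightarrow> 'e \<Rightarrow> 'e \<Rightarrow> real" where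
  "ndist E x y = (if x \<in> carrier E \<and> y \<in> carrier E then nrm E (x \<ominus>\<^bsub>E\<^esub> y) else 0)"

definition complex_banach_space :: "'e nspace \<Rightarrow> bool" where
  "complex_banach_space E \<longleftrightarrow>
     Module.module complex_ring E \<and>
     (\<forall>x\<in>carrier E. 0 \<le> nrm E x \<and> (nrm E x = 0 \<longleftrightarrow> x = \<zero>\<^bsub>E\<^esub>)) \<and>
     (\<forall>x\<in>carrier E. \<forall>y\<in>carrier E. nrm E (x \<oplus>\<^bsub>E\<^esub> y) \<le> nrm E x + nrm E y) \<and>
     (\<forall>c. \<forall>x\<in>carrier E. nrm E (c \<odot>\<^bsub>E\<^esub> x) = cmod c * nrm E x) \<and>
     Metric_space.mcomplete (carrier E) (ndist E)"

definition linear_map :: "'e nspace \<Rightarrow> 'f nspace \<Rightarrow> ('e \<Rightarrow> 'f) \<Rightarrow> bool" where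
  "linear_map E F T \<longleftrightarrow>
     T \<in> carrier E \<rightarrow> carrier F \<and>
     (\<forall>x\<in>carrier E. \<forall>y\<in>carrier E. T (x \<oplus>\<^bsub>E\<^esub> y) = T x \<oplus>\<^bsub>F\<^esub> T y) \<and>
     (\<forall>c. \<forall>x\<in>carrier E. T (c \<odot>\<^bsub>E\<^esub> x) = c \<odot>\<^bsub>F\<^esub> T x)"

definition isometrically_isomorphic :: "'e nspace \<Rightarrow> 'f nspace \<Rightarrow> bool" where
  "isometrically_isomorphic E F \<longleftrightarrow>
     (\<exists>T. linear_map E F T \<and> bij_betw T (carrier E) (carrier F) \<and>
          (\<forall>x\<in>carrier E. nrm F (T x) = nrm E x))"

definition bounded_operator :: "'e nspace \<Rightarrow> ('e \<Rightarrow> 'e) \<Rightarrow> bool" where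
  "bounded_operator E T \<longleftrightarrow>
     linear_map E E T \<and> (\<exists>C. \<forall>x\<in>carrier E. nrm E (T x) \<le> C * nrm E x)"

definition opnorm :: "'e nspace \<Rightarrow> ('e \<Rightarrow> 'e) \<Rightarrow> real" where
  "opnorm E T = Sup {nrm E (T x) | x. x \<in> carrier E \<and> nrm E x \<le> 1}"

text \<open>Sum of a family in norm, over the net of finite partial sums.\<close>

definition infsum_in :: "'e nspace \<Rightarrow> ('i \<Rightarrow> 'e) \<Rightarrow> 'i set \<Rightarrow> 'e" where
  "infsum_in E f A =
     (THE y. limitin (Metric_space.mtopology (carrier E) (ndist E))
               (\<lambda>F. finsum E f F) y (finite_subsets_at_top A))"

section \<open>Concrete spaces\<close>

definition complex_space :: "complex nspace" where
  "complex_space = \<lparr>carrier = UNIV, mult = (*), one = 1, zero = 0, add = (+),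
                     smult = (*), nrm = cmod\<rparr>"

text \<open>
  Functions on (the carrier of) a topological space are total functions that vanish
  off \<open>topspace\<close>; the suprema below range over the whole type for this reason.
\<close>

definition Cb :: "'x topology \<Rightarrow> ('x \<Rightarrow> complex) set" where
  "Cb X = {f. continuous_map X euclidean f \<and> (\<forall>x. x \<notin> topspace X \<longrightarrow> f x = 0) \<and>
              bounded (range f)}"

definition Cu :: "'x topology \<Rightarrow> ('x \<Rightarrow> complex) set" where
  "Cu X = {f \<in> Cb X. \<forall>x\<in>topspace X. cmod (f x) = 1}"

definition Cc_pos :: "'x topology \<Rightarrow> ('x \<Rightarrow> real) set" where
  "Cc_pos X = {f. continuous_map X euclideanreal f \<and> (\<forall>x. x \<notin> topspace X \<longrightarrow> f x = 0) \<and>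
                  (\<forall>x. 0 \<le> f x) \<and> compactin X (X closure_of {x \<in> topspace X. f x \<noteq> 0})}"

definition C0 :: "'x topology \<Rightarrow> ('x \<Rightarrow> complex) nspace" where
  "C0 X = \<lparr>carrier = {f. continuous_map X euclidean f \<and> (\<forall>x. x \<notin> topspace X \<longrightarrow> f x = 0) \<and>
                       (\<forall>\<epsilon>>0. compactin X {x \<in> topspace X. \<epsilon> \<le> cmod (f x)})},
            mult = (\<lambda>f g x. f x * g x),
            one = undefined,
            zero = (\<lambda>_. 0),
            add = (\<lambda>f g x. f x + g x),
            smult = (\<lambda>c f x. c * f x),
            nrm = (\<lambda>f. SUP x. cmod (f x))\<rparr>"

definition AE_class :: "'m measure \<Rightarrow> ('m \<Rightarrow> complex) \<Rightarrow> ('m \<Rightarrow> complex) set" where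
  "AE_class M f = {g \<in> borel_measurable M. AE x in M. g x = f x}"

definition Lp :: "'m measure \<Rightarrow> real \<Rightarrow> ('m \<Rightarrow> complex) set nspace" where
  "Lp M p = \<lparr>carrier = AE_class M ` {f \<in> borel_measurable M. integrable M (\<lambda>x. cmod (f x) powr p)},
              mult = undefined,
              one = undefined,
              zero = AE_class M (\<lambda>_. 0),
              add = (\<lambda>A B. \<Union>f\<in>A. \<Union>g\<in>B. AE_class M (\<lambda>x. f x + g x)),
              smult = (\<lambda>c A. \<Union>f\<in>A. AE_class M (\<lambda>x. c * f x)),
              nrm = (\<lambda>A. (LINT x|M. cmod ((SOME f. f \<in> A) x) powr p) powr (1 / p))\<rparr>"

text \<open>
  \<open>lp_sum p I E\<close> is \<open>\<ell>\<^sup>p(I, E)\<close> for \<open>p < \<infinity>\<close>, and \<open>c\<^sub>0(I, E)\<close> (not \<open>\<ell>\<^sup>\<infinity>(I, E)\<close>) for \<open>p = \<infinity>\<close>.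
  Its elements take the value zero off \<open>I\<close>.
\<close>

definition lp_sum :: "ereal \<Rightarrow> 'i set \<Rightarrow> 'e nspace \<Rightarrow> ('i \<Rightarrow> 'e) nspace" where
  "lp_sum p I E =
     \<lparr>carrier = {\<xi>. (\<forall>i\<in>I. \<xi> i \<in> carrier E) \<and> (\<forall>i. i \<notin> I \<longrightarrow> \<xi> i = \<zero>\<^bsub>E\<^esub>) \<and>
                    (if p = \<infinity> then \<forall>\<epsilon>>0. finite {i \<in> I. \<epsilon> \<le> nrm E (\<xi> i)}
                     else (\<lambda>i. nrm E (\<xi> i) powr real_of_ereal p) summable_on I)},
      mult = undefined,
      one = undefined,
      zero = (\<lambda>_. \<zero>\<^bsub>E\<^esub>),
      add = (\<lambda>\<xi> \<eta> i. \<xi> i \<oplus>\<^bsub>E\<^esub> \<eta> i),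
      smult = (\<lambda>c \<xi> i. c \<odot>\<^bsub>E\<^esub> \<xi> i),
      nrm = (\<lambda>\<xi>. if p = \<infinity> then SUP i. nrm E (\<xi> i)
                 else (\<Sum>\<^sub>\<infinity>i\<in>I. nrm E (\<xi> i) powr real_of_ereal p) powr (1 / real_of_ereal p))\<rparr>"

text \<open>
  There is no quantification over types in HOL, so the measure spaces and the topological
  spaces are taken over a type \<open>'m\<close> of points, which is made explicit as a parameter.
\<close>

definition is_Lp_space :: "'m itself \<Rightarrow> ereal \<Rightarrow> 'e nspace \<Rightarrow> bool" where
  "is_Lp_space _ p E \<longleftrightarrow>
     complex_banach_space E \<and>
     (\<exists>M :: 'm measure. isometrically_isomorphic E (Lp M (real_of_ereal p)))"

definition is_C0_space :: "'m itself \<Rightarrow> 'e nspace \<Rightarrow> bool" where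
  "is_C0_space _ E \<longleftrightarrow>
     complex_banach_space E \<and>
     (\<exists>\<Omega> :: 'm topology. isometrically_isomorphic E (C0 \<Omega>))"

definition space_for_exponent :: "'m itself \<Rightarrow> ereal \<Rightarrow> 'e nspace \<Rightarrow> bool" where
  "space_for_exponent T p E \<longleftrightarrow> (if p = \<infinity> then is_C0_space T E else is_Lp_space T p E)"

section \<open>Representations\<close>

definition representation ::
  "'a nspace \<Rightarrow> 'e nspace \<Rightarrow> ('a \<Rightarrow> 'e \<Rightarrow> 'e) \<Rightarrow> bool" where
  "representation B E \<pi> \<longleftrightarrow>
     (\<forall>a\<in>carrier B. bounded_operator E (\<pi> a)) \<and>
     (\<forall>a\<in>carrier B. \<forall>b\<in>carrier B. \<forall>\<xi>\<in>carrier E. \<pi> (a \<oplus>\<^bsub>B\<^esub> b) \<xi> = \<pi> a \<xi> \<oplus>\<^bsub>E\<^esub> \<pi> b \<xi>) \<and>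
     (\<forall>c. \<forall>a\<in>carrier B. \<forall>\<xi>\<in>carrier E. \<pi> (c \<odot>\<^bsub>B\<^esub> a) \<xi> = c \<odot>\<^bsub>E\<^esub> \<pi> a \<xi>) \<and>
     (\<forall>a\<in>carrier B. \<forall>b\<in>carrier B. \<forall>\<xi>\<in>carrier E. \<pi> (a \<otimes>\<^bsub>B\<^esub> b) \<xi> = \<pi> a (\<pi> b \<xi>)) \<and>
     (\<forall>a\<in>carrier B. opnorm E (\<pi> a) \<le> nrm B a)"

definition nondegenerate_representation ::
  "'a nspace \<Rightarrow> 'e nspace \<Rightarrow> ('a \<Rightarrow> 'e \<Rightarrow> 'e) \<Rightarrow> bool" where
  "nondegenerate_representation B E \<pi> \<longleftrightarrow>
     representation B E \<pi> \<and>
     Metric_space.mtopology (carrier E) (ndist E) closure_of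
       {\<pi> a \<xi> | a \<xi>. a \<in> carrier B \<and> \<xi> \<in> carrier E} = carrier E"

section \<open>Twisted actions and their algebras\<close>

text \<open>
  The discrete group is a type of class \<open>group_add\<close>.  This class is not assumed commutative; it
  only writes the group additively, so \<open>st\<close>, \<open>s\<inverse>\<close> and \<open>1\<close> become \<open>s + t\<close>, \<open>- s\<close> and \<open>0\<close>.
\<close>

definition group_action_on :: "'x topology \<Rightarrow> ('g::group_add \<Rightarrow> 'x \<Rightarrow> 'x) \<Rightarrow> bool" where
  "group_action_on X \<phi> \<longleftrightarrow>
     (\<forall>s. homeomorphic_map X X (\<phi> s)) \<and>
     (\<forall>x\<in>topspace X. \<phi> 0 x = x) \<and>
     (\<forall>s t. \<forall>x\<in>topspace X. \<phi> (s + t) x = \<phi> s (\<phi> t x))"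

definition alpha ::
  "'x topology \<Rightarrow> ('g::group_add \<Rightarrow> 'x \<Rightarrow> 'x) \<Rightarrow> 'g \<Rightarrow> ('x \<Rightarrow> 'c::zero) \<Rightarrow> 'x \<Rightarrow> 'c" where
  "alpha X \<phi> s a = (\<lambda>x. if x \<in> topspace X then a (\<phi> (- s) x) else 0)"

definition normalised_cocycle ::
  "'x topology \<Rightarrow> ('g::group_add \<Rightarrow> 'x \<Rightarrow> 'x) \<Rightarrow> ('g \<Rightarrow> 'g \<Rightarrow> 'x \<Rightarrow> complex) \<Rightarrow> bool" where
  "normalised_cocycle X \<phi> u \<longleftrightarrow>
     (\<forall>s t. u s t \<in> Cu X) \<and>
     (\<forall>r s t. \<forall>x\<in>topspace X.
        alpha X \<phi> r (u s t) x * u r (s + t) x = u r s x * u (r + s) t x) \<and>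
     (\<forall>x\<in>topspace X. u 0 0 x = 1)"

text \<open>
  The sum defining the product is evaluated pointwise; it converges absolutely in \<open>C\<^sub>0(X)\<close>.
\<close>

definition twisted_conv ::
  "'x topology \<Rightarrow> ('g::group_add \<Rightarrow> 'x \<Rightarrow> 'x) \<Rightarrow> ('g \<Rightarrow> 'g \<Rightarrow> 'x \<Rightarrow> complex) \<Rightarrow>
   ('g \<Rightarrow> 'x \<Rightarrow> complex) \<Rightarrow> ('g \<Rightarrow> 'x \<Rightarrow> complex) \<Rightarrow> 'g \<Rightarrow> 'x \<Rightarrow> complex" where
  "twisted_conv X \<phi> u a b = (\<lambda>r x.
     \<Sum>\<^sub>\<infinity>(s, t)\<in>{(s, t). s + t = r}. a s x * alpha X \<phi> s (b t) x * u s t x)"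

definition F_alg ::
  "'x topology \<Rightarrow> ('g::group_add \<Rightarrow> 'x \<Rightarrow> 'x) \<Rightarrow> ('g \<Rightarrow> 'g \<Rightarrow> 'x \<Rightarrow> complex) \<Rightarrow>
   ('g \<Rightarrow> 'x \<Rightarrow> complex) nspace" where
  "F_alg X \<phi> u = (lp_sum 1 UNIV (C0 X))\<lparr>mult := twisted_conv X \<phi> u\<rparr>"

definition Lambda ::
  "'x topology \<Rightarrow> ('g::group_add \<Rightarrow> 'x \<Rightarrow> 'x) \<Rightarrow> ('g \<Rightarrow> 'g \<Rightarrow> 'x \<Rightarrow> complex) \<Rightarrow>
   ('g \<Rightarrow> 'x \<Rightarrow> complex) \<Rightarrow> ('x \<times> 'g \<Rightarrow> complex) \<Rightarrow> 'x \<times> 'g \<Rightarrow> complex" where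
  "Lambda X \<phi> u b \<xi> = (\<lambda>(x, t).
     if x \<in> topspace X
     then \<Sum>\<^sub>\<infinity>s\<in>UNIV. b s x * u s (- s + t) x * \<xi> (\<phi> (- s) x, - s + t)
     else 0)"

definition Ind ::
  "'x topology \<Rightarrow> ('g::group_add \<Rightarrow> 'x \<Rightarrow> 'x) \<Rightarrow> ('g \<Rightarrow> 'g \<Rightarrow> 'x \<Rightarrow> complex) \<Rightarrow>
   'e nspace \<Rightarrow> (('x \<Rightarrow> complex) \<Rightarrow> 'e \<Rightarrow> 'e) \<Rightarrow>
   ('g \<Rightarrow> 'x \<Rightarrow> complex) \<Rightarrow> ('g \<Rightarrow> 'e) \<Rightarrow> 'g \<Rightarrow> 'e" where
  "Ind X \<phi> u E \<pi> b \<xi> = (\<lambda>t.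
     infsum_in E
       (\<lambda>s. \<pi> (alpha X \<phi> (- t) (\<lambda>x. b s x * u s (- s + t) x)) (\<xi> (- s + t))) UNIV)"

text \<open>
  Suprema over ``all'' \<open>L\<^sup>p\<close>- and \<open>C\<^sub>0\<close>-spaces.  The points of the measure spaces and topological
  spaces range over the type \<open>'x \<times> 'g + 'i\<close> with \<open>'i\<close> arbitrary: the first summand makes room for
  \<open>X \<times> G\<close>, and letting \<open>'i\<close> vary reaches every \<open>L\<^sup>p(\<mu>)\<close> and every \<open>C\<^sub>0(\<Omega>)\<close> up to isometric
  isomorphism.  The carrier type \<open>universe\<close> of the Banach spaces themselves is that of \<open>Lp\<close> over
  these points, and so is large enough for a copy of each of these spaces.
\<close>

type_synonym ('x, 'g, 'i) points = "'x \<times> 'g + 'i"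

type_synonym ('x, 'g, 'i) universe = "(('x, 'g, 'i) points \<Rightarrow> complex) set"

definition norm_Lp ::
  "'i itself \<Rightarrow> 'x topology \<Rightarrow> ('g::group_add \<Rightarrow> 'x \<Rightarrow> 'x) \<Rightarrow> ('g \<Rightarrow> 'g \<Rightarrow> 'x \<Rightarrow> complex) \<Rightarrow>
   ereal \<Rightarrow> ('g \<Rightarrow> 'x \<Rightarrow> complex) \<Rightarrow> real" where
  "norm_Lp _ X \<phi> u p b =
     Sup {opnorm E (\<psi> b) | (E :: ('x, 'g, 'i) universe nspace) \<psi>.
            space_for_exponent TYPE(('x, 'g, 'i) points) p E \<and>
            nondegenerate_representation (F_alg X \<phi> u) E \<psi>}"

definition norm_Lp_red ::
  "'x topology \<Rightarrow> ('g::group_add \<Rightarrow> 'x \<Rightarrow> 'x) \<Rightarrow> ('g \<Rightarrow> 'g \<Rightarrow> 'x \<Rightarrow> complex) \<Rightarrow>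
   ereal \<Rightarrow> ('g \<Rightarrow> 'x \<Rightarrow> complex) \<Rightarrow> real" where
  "norm_Lp_red X \<phi> u p b =
     opnorm (lp_sum p (topspace X \<times> UNIV) complex_space) (Lambda X \<phi> u b)"

text \<open>The norms of \<open>F\<^sup>P(\<alpha>, u)\<close> and \<open>F\<^sup>P\<^sub>r(\<alpha>, u)\<close>, including the convention for empty \<open>P\<close>.\<close>

definition norm_P ::
  "'i itself \<Rightarrow> 'x topology \<Rightarrow> ('g::group_add \<Rightarrow> 'x \<Rightarrow> 'x) \<Rightarrow> ('g \<Rightarrow> 'g \<Rightarrow> 'x \<Rightarrow> complex) \<Rightarrow>
   ereal set \<Rightarrow> ('g \<Rightarrow> 'x \<Rightarrow> complex) \<Rightarrow> real" where
  "norm_P T X \<phi> u P b =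
     (if P = {} then nrm (F_alg X \<phi> u) b else SUP p\<in>P. norm_Lp T X \<phi> u p b)"

definition norm_P_red ::
  "'x topology \<Rightarrow> ('g::group_add \<Rightarrow> 'x \<Rightarrow> 'x) \<Rightarrow> ('g \<Rightarrow> 'g \<Rightarrow> 'x \<Rightarrow> complex) \<Rightarrow>
   ereal set \<Rightarrow> ('g \<Rightarrow> 'x \<Rightarrow> complex) \<Rightarrow> real" where
  "norm_P_red X \<phi> u P b =
     (if P = {} then nrm (F_alg X \<phi> u) b else SUP p\<in>P. norm_Lp_red X \<phi> u p b)"

text \<open>
  Amenability.  A net is given by its eventuality filter, here a proper filter on the space of
  functions \<open>G \<rightarrow> C\<^sub>c(X)\<^sup>+\<close> themselves.  All sums over the group have finite support.
\<close>

definition amenable_action :: "'x topology \<Rightarrow> ('g::group_add \<Rightarrow> 'x \<Rightarrow> 'x) \<Rightarrow> bool" where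
  "amenable_action X \<phi> \<longleftrightarrow>
     (\<exists>\<F> :: ('g \<Rightarrow> 'x \<Rightarrow> real) filter.
        \<F> \<noteq> bot \<and>
        (\<forall>\<^sub>F f in \<F>. (\<forall>t. f t \<in> Cc_pos X) \<and> finite {t. f t \<noteq> (\<lambda>_. 0)}) \<and>
        (\<forall>K. compactin X K \<longrightarrow>
           uniform_limit K (\<lambda>f x. \<Sum>\<^sub>\<infinity>t\<in>UNIV. f t x) (\<lambda>_. 1) \<F>) \<and>
        (\<forall>s K. compactin X K \<longrightarrow>
           uniform_limit K (\<lambda>f x. \<Sum>\<^sub>\<infinity>t\<in>UNIV. \<bar>alpha X \<phi> s (f t) x - f (s + t) x\<bar>) (\<lambda>_. 0) \<F>))"

end

theory Submission
  imports Defs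
begin

text \<open>
  On the orbit of a point \<open>x\<close> the operator \<open>\<Lambda>\<^sub>p(b)\<close> is multiplication by the scalar matrix
  \<open>mat b t r x\<close>, so \<open>\<parallel>b\<parallel>\<close> in the reduced norm is the least common bound of these matrices on
  \<open>\<ell>\<^sup>p(G)\<close>.  The key fact is that a matrix of functions in \<open>C\<^sub>0(X)\<close> whose values are bounded by \<open>C\<close>
  on \<open>\<ell>\<^sup>p\<close> stays bounded by \<open>C\<close> after applying a non-degenerate representation on an \<open>L\<^sup>p\<close>- or
  \<open>C\<^sub>0\<close>-space.  Indeed real functions act as Hermitian operators; for \<open>p \<noteq> 2\<close> these are local, that
  is, act as multiplication operators, and for \<open>p = 2\<close> the representation respects adjoints, so
  that a C*-type argument applies.  This bounds all induced representations, and point evaluations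
  \<open>C\<^sub>0(X) \<rightarrow> \<complex>\<close> show that the bound is attained.

  The full norm dominates the reduced one because the matrices of \<open>b\<close> at \<open>x\<close> define a representation
  on \<open>\<ell>\<^sup>p(G)\<close>.  Conversely, for \<open>p = 1\<close> and \<open>p = \<infinity>\<close> the norm of a matrix is read off its columns or
  rows, and these are seen in any representation; if the action is amenable, then \<open>\<psi>(b)\<close> is
  approximated by a compression of an induced operator, obtained from \<open>f\<^sub>i(t)\<^bsup>1/p\<^esup>\<close> and
  \<open>f\<^sub>i(t)\<^bsup>1/q\<^esup>\<close>.
\<close>

text \<open>The obstacle is that a representation of \<open>C0 X\<close> on an L^p-space comes
  without a pointwise description, while the reduced norm speaks of scalar matrices at points of X;
  on a general Banach space a bound for all values of a matrix need not carry over to its image. The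
  link is infinitesimal: for real \<open>a\<close> the norm of 1 + i\<theta>a is 1 + O(\<theta>^2),
  so a supporting functional at a vector sees no linear term and the operator has real numerical
  range. The geometry of the space does the rest: peak functions at a point of \<Omega>, disjointly
  supported functions in L^p for p other than 2, polarisation in L^2. Two choices recur. Estimates
  are made for finite sections in \<open>lpn\<close>, where p = \<infinity> is one more exponent,
  and sums over the group enter as limits of such sections. And as \<open>C0 X\<close> and the
  convolution algebra may have no unit, neither 1 nor the group elements act on the space: a
  \<open>cutoff\<close> k stands in for the unit, and \<open>act s k\<close> for the invertible
  isometries of a covariant representation.\<close>

section \<open>Finite \<open>\<ell>\<^sup>p\<close>-norms\<close>

text \<open>This is Young's inequality for b and a^(r-1) with the conjugate exponent q = r/(r-1),
  cleared of denominators; geometrically, the tangent of y^r at a lies below the graph. It yields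
  Hoelder's inequality below and, after integration, the supporting functionals of L^r.\<close>

lemma powr_tangent:
  fixes a b r :: real
  assumes "1 \<le> r" "0 \<le> a" "0 \<le> b"
  shows "r * (a powr (r - 1) * b) \<le> (r - 1) * a powr r + b powr r"
proof (cases "r = 1")
  case True
  then show ?thesis using assms by (cases "a = 0") auto
next
  case False
  then have r: "1 < r" using assms by simp
  define q where "q = r / (r - 1)"
  have q: "1 < q" "1 / r + 1 / q = 1" using r by (auto simp: q_def field_simps)
  have "b * a powr (r - 1) \<le> b powr r / r + (a powr (r - 1)) powr q / q"
    using Youngs_inequality[of r q b "a powr (r - 1)"] r q assms by auto
  moreover have "(a powr (r - 1)) powr q = a powr r"
    using r by (simp add: powr_powr q_def)
  ultimately have "r * (b * a powr (r - 1)) \<le> r * (b powr r / r + a powr r / q)"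
    using r by (intro mult_left_mono) auto
  also have "\<dots> = b powr r + (r - 1) * a powr r"
    using r by (simp add: q_def field_simps)
  finally show ?thesis by (simp add: mult.commute mult.left_commute)
qed

lemma powr_diff_one_mult:
  assumes "0 \<le> (x::real)"
  shows "x powr (r - 1) * x = x powr r"
proof (cases "x = 0")
  case False
  then have "x powr (r - 1 + 1) = x powr (r - 1) * x powr 1" by (simp only: powr_add)
  then show ?thesis using assms by simp
qed simp

text \<open>The 0 put into the maximum gives the empty family norm 0, as for finite p, and makes
  nonnegativity hold throughout. Values off \<open>I\<close> do not count, so finite sections of a
  family are had by varying \<open>I\<close>.\<close>

definition lpn :: "ereal \<Rightarrow> 'i set \<Rightarrow> ('i \<Rightarrow> real) \<Rightarrow> real" where
  "lpn p I v = (if p = \<infinity> then Max (insert 0 ((\<lambda>i. \<bar>v i\<bar>) ` I))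
     else (\<Sum>i\<in>I. \<bar>v i\<bar> powr real_of_ereal p) powr (1 / real_of_ereal p))"

lemma exponent_cases:
  assumes "1 \<le> (p::ereal)"
  obtains "p = \<infinity>" | r where "p = ereal r" "1 \<le> r"
  using assms by (cases p) auto

lemma lpn_inf: "lpn \<infinity> I v = Max (insert 0 ((\<lambda>i. \<bar>v i\<bar>) ` I))"
  by (simp add: lpn_def)

lemma lpn_real: "lpn (ereal r) I v = (\<Sum>i\<in>I. \<bar>v i\<bar> powr r) powr (1 / r)"
  by (simp add: lpn_def)

lemma lpn_nonneg [simp]: "finite I \<Longrightarrow> 0 \<le> lpn p I v"
  by (auto simp: lpn_def)

lemma lpn_inf_le_iff: "finite I \<Longrightarrow> lpn \<infinity> I v \<le> C \<longleftrightarrow> 0 \<le> C \<and> (\<forall>i\<in>I. \<bar>v i\<bar> \<le> C)"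
  by (auto simp: lpn_inf)

lemma lpn_powr:
  assumes "1 \<le> r"
  shows "lpn (ereal r) I v powr r = (\<Sum>i\<in>I. \<bar>v i\<bar> powr r)"
  using assms by (simp add: lpn_real powr_powr sum_nonneg)

lemma powr_root_le_iff:
  assumes "1 \<le> r" "0 \<le> s" "0 \<le> C"
  shows "s powr (1 / r) \<le> C \<longleftrightarrow> s \<le> C powr (r::real)"
proof -
  have "(s powr (1/r)) powr r = s" using assms by (simp add: powr_powr)
  then show ?thesis
    using powr_mono2[of r "s powr (1/r)" C] powr_less_mono2[of r C "s powr (1/r)"] assms
    by (auto simp: not_le[symmetric])
qed

lemma lpn_real_le_iff:
  assumes "1 \<le> r" "0 \<le> C"
  shows "lpn (ereal r) I v \<le> C \<longleftrightarrow> (\<Sum>i\<in>I. \<bar>v i\<bar> powr r) \<le> C powr r"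
  unfolding lpn_real using assms by (intro powr_root_le_iff) (auto simp: sum_nonneg)

lemma lpn_cong: "(\<And>i. i \<in> I \<Longrightarrow> v i = w i) \<Longrightarrow> lpn p I v = lpn p I w"
  by (auto simp: lpn_def cong: image_cong sum.cong)

lemma lpn_mono:
  assumes "finite I" "1 \<le> p" "\<And>i. i \<in> I \<Longrightarrow> \<bar>v i\<bar> \<le> \<bar>w i\<bar>"
  shows "lpn p I v \<le> lpn p I w"
  using assms(2)
proof (cases rule: exponent_cases)
  case 1
  have "\<And>i. i \<in> I \<Longrightarrow> \<bar>w i\<bar> \<le> lpn \<infinity> I w" using assms(1) by (auto simp: lpn_inf)
  then show ?thesis using assms 1 by (auto simp: lpn_inf_le_iff intro: order_trans)
next
  case (2 r)
  then show ?thesis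
    using assms by (auto simp: lpn_real intro!: powr_mono2 sum_mono sum_nonneg)
qed

lemma lpn_mono_set:
  assumes "finite J" "1 \<le> p" "I \<subseteq> J"
  shows "lpn p I v \<le> lpn p J v"
  using assms(2)
proof (cases rule: exponent_cases)
  case 1
  then show ?thesis using assms by (auto simp: lpn_inf intro!: Max_mono)
next
  case (2 r)
  then show ?thesis
    using assms by (auto simp: lpn_real intro!: powr_mono2 sum_mono2 sum_nonneg)
qed

lemma lpn_empty [simp]: "lpn p {} v = 0"
  by (simp add: lpn_def)

lemma lpn_singleton [simp]: "1 \<le> p \<Longrightarrow> lpn p {i} v = \<bar>v i\<bar>"
  by (erule exponent_cases) (auto simp: lpn_inf lpn_real powr_powr)

lemma lpn_member: "finite I \<Longrightarrow> 1 \<le> p \<Longrightarrow> i \<in> I \<Longrightarrow> \<bar>v i\<bar> \<le> lpn p I v"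
  using lpn_mono_set[of I p "{i}" v] by simp

lemma lpn_zero: "finite I \<Longrightarrow> 1 \<le> p \<Longrightarrow> (\<And>i. i \<in> I \<Longrightarrow> v i = 0) \<Longrightarrow> lpn p I v = 0"
  by (erule exponent_cases) (auto simp: lpn_real lpn_inf intro!: antisym)

lemma lpn_scale:
  assumes "finite I" "1 \<le> p"
  shows "lpn p I (\<lambda>i. c * v i) = \<bar>c\<bar> * lpn p I v"
  using assms(2)
proof (cases rule: exponent_cases)
  case 1
  have le: "lpn p I (\<lambda>i. c * v i) \<le> \<bar>c\<bar> * lpn p I v" for c v
    using assms 1 lpn_member[of I p _ v]
    by (auto simp: lpn_inf_le_iff abs_mult intro!: mult_left_mono)
  show ?thesis
  proof (cases "c = 0")
    case True
    then show ?thesis using assms by (simp add: lpn_zero)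
  next
    case False
    \<comment> \<open>The reverse inequality is the first one for the factor 1/c.\<close>
    have "\<bar>c\<bar> * lpn p I (\<lambda>i. inverse c * (c * v i)) \<le> \<bar>c\<bar> * (\<bar>inverse c\<bar> * lpn p I (\<lambda>i. c * v i))"
      by (intro mult_left_mono le) auto
    then have "\<bar>c\<bar> * lpn p I v \<le> lpn p I (\<lambda>i. c * v i)"
      using False by (simp add: mult.assoc[symmetric] abs_mult[symmetric])
    with le[of c v] show ?thesis by simp
  qed
next
  case (2 r)
  then show ?thesis
    by (simp add: lpn_real abs_mult powr_mult sum_distrib_left[symmetric] sum_nonneg powr_powr)
qed

text \<open>Scaled to norm one, the two families satisfy the summed tangent inequality with right
  side (r - 1) + 1 = r. Writing the dual vector as a power r - 1 keeps r = 1 inside the statement,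
  where the conjugate exponent is infinite.\<close>

lemma lpn_holder:
  assumes "finite I" "1 \<le> r"
  shows "(\<Sum>i\<in>I. \<bar>a i\<bar> powr (r - 1) * \<bar>b i\<bar>) \<le> lpn (ereal r) I a powr (r - 1) * lpn (ereal r) I b"
    (is "_ \<le> ?A powr (r-1) * ?B")
proof -
  have r: "1 \<le> ereal r" using assms by simp
  have m: "\<bar>a i\<bar> \<le> ?A" "\<bar>b i\<bar> \<le> ?B" if "i \<in> I" for i
    using lpn_member[OF assms(1) r that] by blast+
  show ?thesis
  proof (cases "?A = 0 \<or> ?B = 0")
    case True
    then have "a i = 0 \<or> b i = 0" if "i \<in> I" for i using m[OF that] by auto
    then have "(\<Sum>i\<in>I. \<bar>a i\<bar> powr (r - 1) * \<bar>b i\<bar>) = 0" by (intro sum.neutral) fastforce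
    then show ?thesis using assms by simp
  next
    case False
    then have pos: "?A > 0" "?B > 0" using assms(1) by (simp_all add: less_le)
    have "r * (\<Sum>i\<in>I. (\<bar>a i\<bar> / ?A) powr (r - 1) * (\<bar>b i\<bar> / ?B))
        = (\<Sum>i\<in>I. r * ((\<bar>a i\<bar> / ?A) powr (r - 1) * (\<bar>b i\<bar> / ?B)))"
      by (simp add: sum_distrib_left)
    also have "\<dots> \<le> (\<Sum>i\<in>I. (r - 1) * (\<bar>a i\<bar> / ?A) powr r + (\<bar>b i\<bar> / ?B) powr r)"
      using pos assms by (intro sum_mono powr_tangent) auto
    also have "\<dots> = (r - 1) * ((\<Sum>i\<in>I. \<bar>a i\<bar> powr r) / ?A powr r) + (\<Sum>i\<in>I. \<bar>b i\<bar> powr r) / ?B powr r"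
      using pos by (simp add: powr_divide sum.distrib sum_distrib_left sum_divide_distrib)
    also have "\<dots> = r"
      using pos assms(2) by (simp add: lpn_powr[symmetric])
    finally have "(\<Sum>i\<in>I. (\<bar>a i\<bar> / ?A) powr (r - 1) * (\<bar>b i\<bar> / ?B)) \<le> 1"
      using assms by simp
    moreover have "(\<Sum>i\<in>I. (\<bar>a i\<bar> / ?A) powr (r - 1) * (\<bar>b i\<bar> / ?B))
        = (\<Sum>i\<in>I. \<bar>a i\<bar> powr (r - 1) * \<bar>b i\<bar>) / (?A powr (r - 1) * ?B)"
      using pos by (simp add: powr_divide sum_divide_distrib)
    ultimately show ?thesis using pos by (simp add: divide_le_eq)
  qed
qed

text \<open>For finite r the r-th power of the left side is split with weights |v + w|^(r-1) and
  estimated by \<open>lpn_holder\<close>; one power r - 1 is then cancelled, hence the separate case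
  of norm 0.\<close>

lemma lpn_triangle:
  assumes "finite I" "1 \<le> p"
  shows "lpn p I (\<lambda>i. v i + w i) \<le> lpn p I v + lpn p I w"
  using assms(2)
proof (cases rule: exponent_cases)
  case 1
  have "\<bar>v i + w i\<bar> \<le> lpn p I v + lpn p I w" if "i \<in> I" for i
    using lpn_member[OF assms that, of v] lpn_member[OF assms that, of w] by linarith
  then show ?thesis using assms 1 by (auto simp: lpn_inf_le_iff)
next
  case (2 r)
  let ?S = "lpn p I (\<lambda>i. v i + w i)"
  show ?thesis
  proof (cases "?S = 0")
    case True
    then show ?thesis using assms by simp
  next
    case False
    then have S: "?S > 0" using assms(1) by (simp add: less_le)
    have "?S powr (r - 1) * ?S = ?S powr r"
      using S by (simp add: powr_diff_one_mult)
    also have "\<dots> = (\<Sum>i\<in>I. \<bar>v i + w i\<bar> powr r)" using 2 by (simp add: lpn_powr)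
    also have "\<dots> = (\<Sum>i\<in>I. \<bar>v i + w i\<bar> powr (r-1) * \<bar>v i + w i\<bar>)"
      by (simp add: powr_diff_one_mult)
    also have "\<dots> \<le> (\<Sum>i\<in>I. \<bar>v i + w i\<bar> powr (r-1) * (\<bar>v i\<bar> + \<bar>w i\<bar>))"
      by (intro sum_mono mult_left_mono) auto
    also have "\<dots> \<le> ?S powr (r - 1) * lpn p I v + ?S powr (r - 1) * lpn p I w"
      using lpn_holder[OF assms(1) 2(2), of "\<lambda>i. v i + w i"] unfolding 2(1)
      by (simp add: distrib_left sum.distrib add_mono)
    finally have "?S powr (r - 1) * ?S \<le> ?S powr (r - 1) * (lpn p I v + lpn p I w)"
      by (simp add: distrib_left)
    then show ?thesis using S by simp
  qed
qed

lemma lpn_sum_le: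
  assumes "finite I" "1 \<le> p" "finite S"
  shows "lpn p I (\<lambda>i. \<Sum>s\<in>S. v s i) \<le> (\<Sum>s\<in>S. lpn p I (v s))"
  using assms(3)
proof induction
  case empty
  then show ?case using assms by (simp add: lpn_zero)
next
  case (insert s S)
  then show ?case
    using lpn_triangle[OF assms(1,2), of "v s" "\<lambda>i. \<Sum>s\<in>S. v s i"] by simp
qed

lemma lpn_limit_le:
  assumes "finite I" "1 \<le> p" "F \<noteq> bot" "\<And>i. i \<in> I \<Longrightarrow> ((\<lambda>n. v n i) \<longlongrightarrow> w i) F"
    and "eventually (\<lambda>n. lpn p I (v n) \<le> C) F"
  shows "lpn p I w \<le> C"
proof -
  have C: "0 \<le> C"
    using eventually_happens[OF assms(5)] assms(3) lpn_nonneg[OF assms(1)] order_trans by blast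
  show ?thesis
    using assms(2)
  proof (cases rule: exponent_cases)
    case 1
    have "\<bar>w i\<bar> \<le> C" if "i \<in> I" for i
    proof (rule tendsto_upperbound[OF tendsto_rabs[OF assms(4)[OF that]] _ assms(3)])
      show "eventually (\<lambda>n. \<bar>v n i\<bar> \<le> C) F"
        using assms(5) by eventually_elim (use 1 that assms(1) in \<open>auto simp: lpn_inf_le_iff\<close>)
    qed
    then show ?thesis using 1 C assms(1) by (simp add: lpn_inf_le_iff)
  next
    case (2 r)
    have "(\<Sum>i\<in>I. \<bar>w i\<bar> powr r) \<le> C powr r"
    proof (rule tendsto_upperbound[OF _ _ assms(3)])
      show "((\<lambda>n. \<Sum>i\<in>I. \<bar>v n i\<bar> powr r) \<longlongrightarrow> (\<Sum>i\<in>I. \<bar>w i\<bar> powr r)) F"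
        using 2(2) by (intro tendsto_sum tendsto_powr' tendsto_rabs assms(4) tendsto_const) auto
      show "eventually (\<lambda>n. (\<Sum>i\<in>I. \<bar>v n i\<bar> powr r) \<le> C powr r) F"
        using assms(5) by eventually_elim (use 2 C in \<open>auto simp: lpn_real_le_iff\<close>)
    qed
    then show ?thesis using 2 C by (simp add: lpn_real_le_iff)
  qed
qed

lemma lpn_reindex:
  assumes "inj_on h I"
  shows "lpn p (h ` I) v = lpn p I (\<lambda>i. v (h i))"
  using assms by (simp add: lpn_def sum.reindex image_image)

text \<open>For p = \<infinity> both sides have the same upper bounds; otherwise it is iterated
  summation. It lets the regular representation be treated orbit by orbit.\<close>

lemma lpn_Sigma:
  assumes "finite A" "\<And>a. a \<in> A \<Longrightarrow> finite (B a)" "1 \<le> p"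
  shows "lpn p (Sigma A B) v = lpn p A (\<lambda>a. lpn p (B a) (\<lambda>b. v (a, b)))"
  using assms(3)
proof (cases rule: exponent_cases)
  case 1
  have "lpn p (Sigma A B) v \<le> C \<longleftrightarrow> lpn p A (\<lambda>a. lpn p (B a) (\<lambda>b. v (a, b))) \<le> C" for C
    using assms 1 by (auto simp: lpn_inf_le_iff)
  from this[of "lpn p (Sigma A B) v"] this[of "lpn p A (\<lambda>a. lpn p (B a) (\<lambda>b. v (a, b)))"]
  show ?thesis by (intro order_antisym) simp_all
next
  case (2 r)
  have "(\<Sum>x\<in>Sigma A B. \<bar>v x\<bar> powr r) = (\<Sum>a\<in>A. \<Sum>b\<in>B a. \<bar>v (a, b)\<bar> powr r)"
    using assms by (simp add: sum.Sigma split_def)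
  also have "\<dots> = (\<Sum>a\<in>A. \<bar>lpn p (B a) (\<lambda>b. v (a, b))\<bar> powr r)"
    using 2 assms by (intro sum.cong) (auto simp: lpn_powr[symmetric])
  finally show ?thesis using 2 by (simp add: lpn_real)
qed

section \<open>A pointwise bound for matrices\<close>

lemma sum3_delta:
  fixes Y :: "'i \<Rightarrow> 'j \<Rightarrow> 'k \<Rightarrow> complex"
  assumes "finite I" "finite J" "finite K" "i0 \<in> I" "j0 \<in> J"
  shows "(\<Sum>i\<in>I. \<Sum>j\<in>J. \<Sum>k\<in>K. (if i = i0 \<and> j = j0 then 1 else 0) * l k * Y i j k)
       = (\<Sum>k\<in>K. l k * Y i0 j0 k)"
proof -
  have "(\<Sum>i\<in>I. \<Sum>j\<in>J. \<Sum>k\<in>K. (if i = i0 \<and> j = j0 then 1 else 0) * l k * Y i j k)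
      = (\<Sum>i\<in>I. if i = i0 then (\<Sum>j\<in>J. if j = j0 then (\<Sum>k\<in>K. l k * Y i j k) else 0) else 0)"
    by (intro sum.cong refl) (auto intro!: sum.cong)
  then show ?thesis using assms by simp
qed

text \<open>Testing \<open>H\<close> on elementary matrices \<open>d\<close> shows that \<open>Y i j k\<close> depends on \<open>k\<close> only through
  \<open>z k\<close>, so \<open>Y i j j\<close> is an operator with entries \<open>y i j\<close> applied to \<open>z\<close>; testing on rank one
  matrices bounds its norm by \<open>C\<close>.\<close>

lemma pointwise_matrix_bound:
  fixes a :: "'i \<Rightarrow> 'j \<Rightarrow> 'x \<Rightarrow> complex" and Y :: "'i \<Rightarrow> 'j \<Rightarrow> 'j \<Rightarrow> complex"
  assumes fin: "finite I" "finite J" and p: "1 \<le> p" and C0: "0 \<le> C"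
    and C: "\<And>x c. x \<in> X \<Longrightarrow> lpn p I (\<lambda>i. cmod (\<Sum>j\<in>J. a i j x * c j)) \<le> C * lpn p J (\<lambda>j. cmod (c j))"
    and H: "\<And>d l M. 0 \<le> M \<Longrightarrow> (\<And>x. x \<in> X \<Longrightarrow> cmod (\<Sum>i\<in>I. \<Sum>j\<in>J. d i j * a i j x) \<le> M) \<Longrightarrow>
        cmod (\<Sum>i\<in>I. \<Sum>j\<in>J. \<Sum>k\<in>J. d i j * l k * Y i j k) \<le> M * cmod (\<Sum>k\<in>J. l k * z k)"
  shows "lpn p I (\<lambda>i. cmod (\<Sum>j\<in>J. Y i j j)) \<le> C * lpn p J (\<lambda>j. cmod (z j))"
proof -
  have bdd: "\<exists>M\<ge>0. \<forall>x\<in>X. cmod (\<Sum>i\<in>I. \<Sum>j\<in>J. (if i = i0 \<and> j = j0 then 1 else 0) * a i j x) \<le> M"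
    if ij: "i0 \<in> I" "j0 \<in> J" for i0 j0
  proof (intro exI conjI ballI)
    show "0 \<le> C * lpn p J (\<lambda>j. cmod (if j = j0 then 1 else 0))" using C0 fin by simp
    fix x assume x: "x \<in> X"
    have "(\<Sum>i\<in>I. \<Sum>j\<in>J. (if i = i0 \<and> j = j0 then 1 else 0) * a i j x) = a i0 j0 x"
      using sum3_delta[OF fin(1,2) _ ij, of "{()}" "\<lambda>_. 1" "\<lambda>i j _. a i j x"] by simp
    moreover have "(\<Sum>j\<in>J. a i j x * (if j = j0 then 1 else 0)) = a i j0 x" for i
      using fin ij by (simp add: if_distrib[of "\<lambda>c. _ * c"] cong: if_cong)
    ultimately show "cmod (\<Sum>i\<in>I. \<Sum>j\<in>J. (if i = i0 \<and> j = j0 then 1 else 0) * a i j x)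
        \<le> C * lpn p J (\<lambda>j. cmod (if j = j0 then 1 else 0))"
      using C[OF x, of "\<lambda>j. if j = j0 then 1 else 0"]
        lpn_member[OF fin(1) p ij(1), of "\<lambda>i. cmod (a i j0 x)"] by simp
  qed
  \<comment> \<open>The size of \<open>M\<close> is immaterial, as it gets multiplied by 0; only its
    existence, from \<open>bdd\<close>, counts.\<close>
  have ker: "(\<Sum>k\<in>J. l k * Y i0 j0 k) = 0" if ij: "i0 \<in> I" "j0 \<in> J" and l: "(\<Sum>k\<in>J. l k * z k) = 0" for i0 j0 l
  proof -
    obtain M where M: "M \<ge> 0"
        "\<forall>x\<in>X. cmod (\<Sum>i\<in>I. \<Sum>j\<in>J. (if i = i0 \<and> j = j0 then 1 else 0) * a i j x) \<le> M"
      using bdd[OF ij] by blast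
    have "cmod (\<Sum>i\<in>I. \<Sum>j\<in>J. \<Sum>k\<in>J. (if i = i0 \<and> j = j0 then 1 else 0) * l k * Y i j k)
       \<le> M * cmod (\<Sum>k\<in>J. l k * z k)"
      using M by (intro H) auto
    then show ?thesis using sum3_delta[OF fin(1,2,2) ij, of l Y] l by simp
  qed
  show ?thesis
  proof (cases "\<forall>k\<in>J. z k = 0")
    case True
    have "Y i j j = 0" if "i \<in> I" "j \<in> J" for i j
    proof -
      have "(\<Sum>k\<in>J. (if k = j then 1 else 0) * Y i j k) = 0" using True by (intro ker that) auto
      then show ?thesis using fin that by (simp add: if_distrib[of "\<lambda>c. c * _"] cong: if_cong)
    qed
    then have "lpn p I (\<lambda>i. cmod (\<Sum>j\<in>J. Y i j j)) = 0" using fin p by (intro lpn_zero) auto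
    then show ?thesis using C0 fin by simp
  next
    case False
    then obtain k0 where k0: "k0 \<in> J" "z k0 \<noteq> 0" by blast
    define y where "y i j = Y i j k0 / z k0" for i j
    have Y: "Y i j k = y i j * z k" if "i \<in> I" "j \<in> J" "k \<in> J" for i j k
    proof -
      \<comment> \<open>The functional z k0 e_k - z k e_k0 annihilates \<open>z\<close>, so
        \<open>ker\<close> compares the entries at k and k0.\<close>
      have e: "(\<Sum>k'\<in>J. ((if k' = k then z k0 else 0) - (if k' = k0 then z k else 0)) * f k') = z k0 * f k - z k * f k0" for f
        using fin that k0 by (simp add: left_diff_distrib sum_subtractf if_distrib[of "\<lambda>c. c * _"] cong: if_cong)
      have "z k0 * Y i j k - z k * Y i j k0 = 0"
        unfolding e[symmetric] by (rule ker[OF that(1,2)]) (simp add: e)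
      then show ?thesis using k0 by (simp add: y_def field_simps)
    qed
    define W where "W i = (\<Sum>j\<in>J. y i j * z j)" for i
    have WY: "(\<Sum>j\<in>J. Y i j j) = W i" if "i \<in> I" for i
      using Y that by (simp add: W_def)
    \<comment> \<open>The rank one choice is d i j = h i * z j, with l the unit vector at k0; both
      sides then carry the factor |z k0|, which cancels.\<close>
    have key: "cmod (\<Sum>i\<in>I. h i * W i) \<le> M"
      if "0 \<le> M" "\<And>x. x \<in> X \<Longrightarrow> cmod (\<Sum>i\<in>I. h i * (\<Sum>j\<in>J. a i j x * z j)) \<le> M" for h M
    proof -
      have e: "(\<Sum>k\<in>J. (if k = k0 then 1 else 0) * f k) = f k0" for f :: "'j \<Rightarrow> complex"
        using fin k0 by (simp add: if_distrib[of "\<lambda>c. c * _"] cong: if_cong)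
      have "(\<Sum>i\<in>I. \<Sum>j\<in>J. \<Sum>k\<in>J. h i * z j * (if k = k0 then 1 else 0) * Y i j k)
          = (\<Sum>i\<in>I. \<Sum>j\<in>J. h i * z j * (y i j * z k0))"
      proof (intro sum.cong refl)
        fix i j assume "i \<in> I" "j \<in> J"
        then show "(\<Sum>k\<in>J. h i * z j * (if k = k0 then 1 else 0) * Y i j k) = h i * z j * (y i j * z k0)"
          using e[of "\<lambda>k. Y i j k"] k0 Y[of i j k0] by (simp add: mult.assoc sum_distrib_left[symmetric])
      qed
      also have "\<dots> = z k0 * (\<Sum>i\<in>I. h i * W i)"
        by (simp add: W_def sum_distrib_left sum_distrib_right mult_ac)
      finally have eq: "(\<Sum>i\<in>I. \<Sum>j\<in>J. \<Sum>k\<in>J. h i * z j * (if k = k0 then 1 else 0) * Y i j k) = z k0 * (\<Sum>i\<in>I. h i * W i)" .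
      have "cmod (\<Sum>i\<in>I. \<Sum>j\<in>J. \<Sum>k\<in>J. h i * z j * (if k = k0 then 1 else 0) * Y i j k) \<le> M * cmod (\<Sum>k\<in>J. (if k = k0 then 1 else 0) * z k)"
      proof (rule H[OF that(1)])
        fix x assume "x \<in> X"
        from that(2)[OF this] show "cmod (\<Sum>i\<in>I. \<Sum>j\<in>J. h i * z j * a i j x) \<le> M"
          by (simp add: sum_distrib_left mult_ac)
      qed
      then show ?thesis unfolding eq e using k0 by (simp add: norm_mult mult.commute)
    qed
    have "lpn p I (\<lambda>i. cmod (W i)) \<le> C * lpn p J (\<lambda>j. cmod (z j))"
      using p
    proof (cases rule: exponent_cases)
      case 1
      have "cmod (W i) \<le> C * lpn p J (\<lambda>j. cmod (z j))" if i: "i \<in> I" for i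
      proof -
        have e: "(\<Sum>i'\<in>I. (if i' = i then 1 else 0) * f i') = f i" for f :: "'i \<Rightarrow> complex"
          using fin i by (simp add: if_distrib[of "\<lambda>c. c * _"] cong: if_cong)
        have "cmod (\<Sum>i'\<in>I. (if i' = i then 1 else 0) * W i') \<le> C * lpn p J (\<lambda>j. cmod (z j))"
        proof (rule key)
          fix x assume x: "x \<in> X"
          show "cmod (\<Sum>i'\<in>I. (if i' = i then 1 else 0) * (\<Sum>j\<in>J. a i' j x * z j)) \<le> C * lpn p J (\<lambda>j. cmod (z j))"
            unfolding e using C[OF x, of z] lpn_member[OF fin(1) p i, of "\<lambda>i. cmod (\<Sum>j\<in>J. a i j x * z j)"] by simp
        qed (use C0 fin in simp)
        then show ?thesis unfolding e .
      qed
      then show ?thesis using 1 fin C0 by (simp add: lpn_inf_le_iff)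
    next
      case (2 r)
      let ?S = "lpn p I (\<lambda>i. cmod (W i))" and ?Z = "lpn p J (\<lambda>j. cmod (z j))"
      \<comment> \<open>h is the duality map of the l^r-space at W: h i * W i = |W i|^r and |h i| =
        |W i|^(r-1), also where W i = 0. Testing with it turns the bound \<open>key\<close> for
        functionals into a bound for the norm of W.\<close>
      define h where "h i = cnj (W i) * of_real (cmod (W i) powr (r - 2))" for i
      have h: "cmod (h i) = cmod (W i) powr (r - 1)" for i
      proof (cases "W i = 0")
        case False
        then have "cmod (W i) * cmod (W i) powr (r - 2) = cmod (W i) powr (1 + (r - 2))"
          by (subst powr_add) simp
        then show ?thesis by (simp add: h_def norm_mult)
      qed (simp add: h_def)
      have hW: "h i * W i = of_real (cmod (W i) powr r)" for i
      proof (cases "W i = 0")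
        case False
        then have "cmod (W i) ^ 2 * cmod (W i) powr (r - 2) = cmod (W i) powr (2 + (r - 2))"
          by (subst powr_add) (simp add: powr_numeral)
        moreover have "h i * W i = of_real (cmod (W i) ^ 2 * cmod (W i) powr (r - 2))"
          using complex_norm_square[of "W i"] by (simp add: h_def mult_ac)
        ultimately show ?thesis by simp
      qed (simp add: h_def)
      have "cmod (\<Sum>i\<in>I. h i * W i) \<le> ?S powr (r - 1) * (C * ?Z)"
      proof (rule key)
        fix x assume x: "x \<in> X"
        have "cmod (\<Sum>i\<in>I. h i * (\<Sum>j\<in>J. a i j x * z j)) \<le> (\<Sum>i\<in>I. cmod (h i * (\<Sum>j\<in>J. a i j x * z j)))"
          by (rule norm_sum)
        also have "\<dots> = (\<Sum>i\<in>I. \<bar>cmod (W i)\<bar> powr (r - 1) * \<bar>cmod (\<Sum>j\<in>J. a i j x * z j)\<bar>)"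
          by (simp add: norm_mult h)
        also have "\<dots> \<le> ?S powr (r - 1) * lpn p I (\<lambda>i. cmod (\<Sum>j\<in>J. a i j x * z j))"
          using lpn_holder[OF fin(1) 2(2), of "\<lambda>i. cmod (W i)" "\<lambda>i. cmod (\<Sum>j\<in>J. a i j x * z j)"] 2(1) by simp
        also have "\<dots> \<le> ?S powr (r - 1) * (C * ?Z)"
          by (intro mult_left_mono C x) auto
        finally show "cmod (\<Sum>i\<in>I. h i * (\<Sum>j\<in>J. a i j x * z j)) \<le> ?S powr (r - 1) * (C * ?Z)" .
      qed (use C0 fin in simp)
      also have "(\<Sum>i\<in>I. h i * W i) = of_real (?S powr r)"
        unfolding hW 2(1) lpn_powr[OF 2(2)] by simp
      finally have le: "?S powr r \<le> ?S powr (r - 1) * (C * ?Z)" by simp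
      show ?thesis
      proof (cases "?S = 0")
        case True
        then show ?thesis using C0 fin by simp
      next
        case False
        then have S: "?S > 0" using fin(1) by (simp add: less_le)
        then have "?S powr r = ?S powr (r - 1) * ?S"
          by (simp add: powr_diff_one_mult)
        with le S show ?thesis by simp
      qed
    qed
    then show ?thesis using lpn_cong[of I "\<lambda>i. cmod (\<Sum>j\<in>J. Y i j j)" "\<lambda>i. cmod (W i)" p] WY by simp
  qed
qed

section \<open>Banach spaces with explicit carriers\<close>

lemma complex_ring_simps [simp]:
  "carrier complex_ring = UNIV" "a \<oplus>\<^bsub>complex_ring\<^esub> b = a + b" "a \<otimes>\<^bsub>complex_ring\<^esub> b = a * b"
  "\<zero>\<^bsub>complex_ring\<^esub> = 0" "\<one>\<^bsub>complex_ring\<^esub> = 1"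
  by (simp_all add: complex_ring_def)

lemma summable_on_tail:
  fixes g :: "'i \<Rightarrow> real"
  assumes "g summable_on I" "0 < \<epsilon>"
  obtains F0 where "finite F0" "F0 \<subseteq> I"
    "\<And>F. finite F \<Longrightarrow> F \<subseteq> I \<Longrightarrow> F \<inter> F0 = {} \<Longrightarrow> sum g F \<le> \<epsilon>"
proof -
  have "(g has_sum infsum g I) I" using assms by (simp add: has_sum_infsum)
  then have "(sum g \<longlongrightarrow> infsum g I) (finite_subsets_at_top I)" by (simp add: has_sum_def)
  then have "eventually (\<lambda>F. dist (sum g F) (infsum g I) < \<epsilon> / 2) (finite_subsets_at_top I)"
    using assms(2) tendstoD half_gt_zero by blast
  then obtain F0 where F0: "finite F0" "F0 \<subseteq> I"
      "\<And>F. finite F \<Longrightarrow> F0 \<subseteq> F \<Longrightarrow> F \<subseteq> I \<Longrightarrow> dist (sum g F) (infsum g I) < \<epsilon> / 2"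
    unfolding eventually_finite_subsets_at_top by metis
  show ?thesis
  proof (rule that[OF F0(1,2)])
    fix F assume F: "finite F" "F \<subseteq> I" "F \<inter> F0 = {}"
    have "dist (sum g (F \<union> F0)) (infsum g I) < \<epsilon> / 2" using F F0 by (intro F0(3)) auto
    moreover have "dist (sum g F0) (infsum g I) < \<epsilon> / 2" using F0 by (intro F0(3)) auto
    moreover have "sum g (F \<union> F0) = sum g F + sum g F0"
      using F F0 by (intro sum.union_disjoint) auto
    ultimately show "sum g F \<le> \<epsilon>" unfolding dist_real_def by linarith
  qed
qed

text \<open>Completeness is left out so that \<open>complex_banach_spaceI\<close> can use the metric
  given by \<open>ndist\<close> while completeness is still to be proved.\<close>

locale cnormed =
  fixes E :: "'e nspace" (structure)
  assumes module_E: "Module.module complex_ring E"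
    and nrm_nonneg [simp]: "x \<in> carrier E \<Longrightarrow> 0 \<le> nrm E x"
    and nrm_eq_0: "x \<in> carrier E \<Longrightarrow> nrm E x = 0 \<longleftrightarrow> x = \<zero>"
    and nrm_triangle: "x \<in> carrier E \<Longrightarrow> y \<in> carrier E \<Longrightarrow> nrm E (x \<oplus> y) \<le> nrm E x + nrm E y"
    and nrm_scale: "x \<in> carrier E \<Longrightarrow> nrm E (c \<odot> x) = cmod c * nrm E x"
begin

sublocale module complex_ring E
  by (rule module_E)

lemma scale_closed [simp, intro]: "x \<in> carrier E \<Longrightarrow> c \<odot> x \<in> carrier E"
  by (rule smult_closed) simp_all

lemma nrm_0 [simp]: "nrm E \<zero> = 0"
  by (simp add: nrm_eq_0)

lemma scale_one [simp]: "x \<in> carrier E \<Longrightarrow> 1 \<odot> x = x"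
  using smult_one by simp

lemma scale_zero_left [simp]: "x \<in> carrier E \<Longrightarrow> 0 \<odot> x = \<zero>"
  using smult_l_null by simp

lemma scale_zero_right [simp]: "c \<odot> \<zero> = \<zero>"
  using smult_r_null by simp

lemma scale_add_left: "x \<in> carrier E \<Longrightarrow> (a + b) \<odot> x = a \<odot> x \<oplus> b \<odot> x"
  using smult_l_distr[of a b x] by simp

lemma scale_add_right: "x \<in> carrier E \<Longrightarrow> y \<in> carrier E \<Longrightarrow> a \<odot> (x \<oplus> y) = a \<odot> x \<oplus> a \<odot> y"
  using smult_r_distr[of a x y] by simp

lemma scale_scale: "x \<in> carrier E \<Longrightarrow> a \<odot> (b \<odot> x) = (a * b) \<odot> x"
  using smult_assoc1[of a b x] by simp

lemma uminus_eq_scale: "x \<in> carrier E \<Longrightarrow> \<ominus> x = (-1) \<odot> x"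
proof -
  assume x: "x \<in> carrier E"
  have "(-1) \<odot> x \<oplus> x = \<zero>" using scale_add_left[OF x, of "-1" 1] x by simp
  then show ?thesis using x by (simp add: M.minus_equality)
qed

lemma diff_eq: "x \<in> carrier E \<Longrightarrow> y \<in> carrier E \<Longrightarrow> x \<ominus> y = x \<oplus> (-1) \<odot> y"
  by (simp add: M.minus_eq uminus_eq_scale)

lemma diff_self [simp]: "x \<in> carrier E \<Longrightarrow> x \<ominus> x = \<zero>"
  by (simp add: M.minus_eq M.r_neg)

lemma nrm_uminus: "x \<in> carrier E \<Longrightarrow> nrm E (\<ominus> x) = nrm E x"
  by (simp add: uminus_eq_scale nrm_scale)

lemma diff_add_cancel: "x \<in> carrier E \<Longrightarrow> y \<in> carrier E \<Longrightarrow> (x \<ominus> y) \<oplus> y = x"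
  by (simp add: M.minus_eq M.a_assoc M.l_neg)

lemma add_diff_cancel: "x \<in> carrier E \<Longrightarrow> y \<in> carrier E \<Longrightarrow> (x \<oplus> y) \<ominus> y = x"
  by (simp add: M.minus_eq M.a_assoc M.r_neg)

lemma diff_add_diff:
  "x \<in> carrier E \<Longrightarrow> y \<in> carrier E \<Longrightarrow> z \<in> carrier E \<Longrightarrow> (x \<ominus> y) \<oplus> (y \<ominus> z) = x \<ominus> z"
  by (simp add: M.minus_eq M.a_assoc[symmetric]) (simp add: M.a_assoc M.l_neg)

lemma nrm_diff_commute:
  assumes "x \<in> carrier E" "y \<in> carrier E"
  shows "nrm E (x \<ominus> y) = nrm E (y \<ominus> x)"
proof -
  have "\<ominus> (x \<ominus> y) = y \<ominus> x"
    using assms by (simp add: M.minus_eq M.minus_add M.minus_minus M.a_comm)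
  then show ?thesis using nrm_uminus[of "x \<ominus> y"] assms by simp
qed

lemma nrm_diff_triangle:
  "x \<in> carrier E \<Longrightarrow> y \<in> carrier E \<Longrightarrow> z \<in> carrier E
    \<Longrightarrow> nrm E (x \<ominus> z) \<le> nrm E (x \<ominus> y) + nrm E (y \<ominus> z)"
  using nrm_triangle[of "x \<ominus> y" "y \<ominus> z"] by (simp add: diff_add_diff)

lemma nrm_le_diff: "x \<in> carrier E \<Longrightarrow> y \<in> carrier E \<Longrightarrow> nrm E x \<le> nrm E y + nrm E (x \<ominus> y)"
  using nrm_triangle[of "x \<ominus> y" y] by (simp add: diff_add_cancel)

lemma abs_nrm_diff_le:
  "x \<in> carrier E \<Longrightarrow> y \<in> carrier E \<Longrightarrow> \<bar>nrm E x - nrm E y\<bar> \<le> nrm E (x \<ominus> y)"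
  using nrm_le_diff[of x y] nrm_le_diff[of y x] nrm_diff_commute[of x y] by auto

lemma Metric_space_ndist: "Metric_space (carrier E) (ndist E)"
proof
  fix x y z
  show "0 \<le> ndist E x y" by (simp add: ndist_def)
  show "ndist E x y = ndist E y x" by (simp add: ndist_def nrm_diff_commute)
  show "x \<in> carrier E \<Longrightarrow> y \<in> carrier E \<Longrightarrow> ndist E x y = 0 \<longleftrightarrow> x = y"
    using diff_add_cancel[of x y] by (auto simp: ndist_def nrm_eq_0)
  show "x \<in> carrier E \<Longrightarrow> y \<in> carrier E \<Longrightarrow> z \<in> carrier E \<Longrightarrow> ndist E x z \<le> ndist E x y + ndist E y z"
    by (simp add: ndist_def nrm_diff_triangle)
qed

sublocale metric: Metric_space "carrier E" "ndist E"
  by (rule Metric_space_ndist)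

lemma closure_approx:
  assumes "metric.mtopology closure_of S = carrier E" "\<xi> \<in> carrier E" "0 < \<epsilon>"
  obtains \<eta> where "\<eta> \<in> S" "\<eta> \<in> carrier E" "nrm E (\<xi> \<ominus> \<eta>) < \<epsilon>"
proof -
  have "\<exists>y\<in>S. y \<in> metric.mball \<xi> \<epsilon>" using assms unfolding metric.metric_closure_of by blast
  then show ?thesis using that by (auto simp: ndist_def)
qed

lemma finsum_sub_closed: "(\<And>i. i \<in> I \<Longrightarrow> f i \<in> carrier E) \<Longrightarrow> finsum E f I \<in> carrier E"
  by (intro M.finsum_closed) auto

lemma finsum_insert':
  "finite I \<Longrightarrow> i \<notin> I \<Longrightarrow> (\<And>j. j \<in> insert i I \<Longrightarrow> f j \<in> carrier E)
    \<Longrightarrow> finsum E f (insert i I) = f i \<oplus> finsum E f I"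
  by (intro M.finsum_insert) auto

lemma nrm_finsum_le:
  assumes "finite I" "\<And>i. i \<in> I \<Longrightarrow> f i \<in> carrier E"
  shows "nrm E (finsum E f I) \<le> (\<Sum>i\<in>I. nrm E (f i))"
  using assms
proof (induction I rule: finite_induct)
  case (insert i I)
  then show ?case
    using nrm_triangle[of "f i" "finsum E f I"] by (simp add: finsum_insert' finsum_sub_closed)
qed simp

lemma finsum_diff_subset:
  assumes "finite F" "F0 \<subseteq> F" "\<And>i. i \<in> F \<Longrightarrow> f i \<in> carrier E"
  shows "finsum E f F \<ominus> finsum E f F0 = finsum E f (F - F0)"
proof -
  have "finsum E f ((F - F0) \<union> F0) = finsum E f (F - F0) \<oplus> finsum E f F0"
    using assms finite_subset by (intro M.finsum_Un_disjoint) auto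
  moreover have "(F - F0) \<union> F0 = F" using assms by auto
  ultimately show ?thesis using assms by (auto simp: add_diff_cancel finsum_sub_closed subset_iff)
qed

end

locale cbanach =
  fixes E :: "'e nspace" (structure)
  assumes banach: "complex_banach_space E"
begin

sublocale cnormed E
  by (rule cnormed.intro) (use banach in \<open>auto simp: complex_banach_space_def\<close>)

lemma mcomplete: "Metric_space.mcomplete (carrier E) (ndist E)"
  using banach by (simp add: complex_banach_space_def)

text \<open>The net of finite partial sums is reduced to a sequence: sums over sets that miss
  \<open>G n\<close> are at most 1/(n+1), so the sums over \<open>F n\<close> form a Cauchy
  sequence, and the same tail estimate turns its limit into a limit of the whole net. Uniqueness of
  limits in the metric topology then evaluates the \<open>THE\<close> in
  \<open>infsum_in\<close>.\<close>

lemma infsum_in_approx: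
  assumes f: "\<And>i. i \<in> I \<Longrightarrow> f i \<in> carrier E" and sm: "(\<lambda>i. nrm E (f i)) summable_on I"
  shows infsum_in_closed: "infsum_in E f I \<in> carrier E"
    and infsum_in_lim: "((\<lambda>F. nrm E (infsum_in E f I \<ominus> finsum E f F)) \<longlongrightarrow> 0) (finite_subsets_at_top I)"
proof -
  have "\<exists>F0. finite F0 \<and> F0 \<subseteq> I \<and> (\<forall>F. finite F \<longrightarrow> F \<subseteq> I \<longrightarrow> F \<inter> F0 = {} \<longrightarrow> (\<Sum>i\<in>F. nrm E (f i)) \<le> 1 / Suc n)" for n
    using summable_on_tail[OF sm, of "1 / Suc n"] by (metis of_nat_0_less_iff zero_less_Suc zero_less_divide_1_iff)
  then obtain G where G: "\<And>n. finite (G n)" "\<And>n. G n \<subseteq> I"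
      "\<And>n F. finite F \<Longrightarrow> F \<subseteq> I \<Longrightarrow> F \<inter> G n = {} \<Longrightarrow> (\<Sum>i\<in>F. nrm E (f i)) \<le> 1 / Suc n"
    by metis
  \<comment> \<open>Unions make the exhausting sets increasing, so that later partial sums extend
    earlier ones.\<close>
  define F where "F n = (\<Union>m\<le>n. G m)" for n
  have F: "finite (F n)" "F n \<subseteq> I" "G n \<subseteq> F n" for n using G by (auto simp: F_def)
  have Fmono: "F m \<subseteq> F n" if "m \<le> n" for m n using that by (force simp: F_def)
  have near: "nrm E (finsum E f H \<ominus> finsum E f (F n)) \<le> 1 / Suc n"
    if "finite H" "H \<subseteq> I" "F n \<subseteq> H" for H n
  proof -
    have "finsum E f H \<ominus> finsum E f (F n) = finsum E f (H - F n)"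
      using that f by (intro finsum_diff_subset) auto
    also have "nrm E \<dots> \<le> (\<Sum>i\<in>H - F n. nrm E (f i))" using that f by (intro nrm_finsum_le) auto
    also have "\<dots> \<le> 1 / Suc n" using that F[of n] by (intro G) auto
    finally show ?thesis .
  qed
  have cl: "finsum E f H \<in> carrier E" if "H \<subseteq> I" for H using that f by (intro finsum_sub_closed) auto
  let ?s = "\<lambda>n. finsum E f (F n)"
  have scl: "?s n \<in> carrier E" for n using F cl by blast
  have "metric.MCauchy ?s"
    unfolding metric.MCauchy_def
  proof (intro conjI allI impI)
    show "range ?s \<subseteq> carrier E" using scl by auto
    fix \<epsilon> :: real assume "0 < \<epsilon>"
    then obtain N where N: "1 / Suc N < \<epsilon> / 2"
      using nat_approx_posE[of "\<epsilon> / 2"] by auto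
    have "ndist E (?s n) (?s m) < \<epsilon>" if "N \<le> n" "N \<le> m" for n m
    proof -
      have "nrm E (?s n \<ominus> ?s m) \<le> nrm E (?s n \<ominus> ?s N) + nrm E (?s N \<ominus> ?s m)"
        using scl by (intro nrm_diff_triangle) auto
      moreover have "nrm E (?s n \<ominus> ?s N) \<le> 1 / Suc N" using Fmono that F by (intro near) auto
      moreover have "nrm E (?s m \<ominus> ?s N) \<le> 1 / Suc N" using Fmono that F by (intro near) auto
      ultimately show ?thesis using N scl nrm_diff_commute[of "?s N" "?s m"] by (simp add: ndist_def)
    qed
    then show "\<exists>N. \<forall>n n'. N \<le> n \<longrightarrow> N \<le> n' \<longrightarrow> ndist E (?s n) (?s n') < \<epsilon>" by blast
  qed
  then obtain y where y: "limitin metric.mtopology ?s y sequentially"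
    using mcomplete metric.mcomplete_def by blast
  then have ycl: "y \<in> carrier E" using metric.limitin_metric by blast
  have lim: "((\<lambda>H. nrm E (y \<ominus> finsum E f H)) \<longlongrightarrow> 0) (finite_subsets_at_top I)"
  proof (rule tendstoI)
    fix \<epsilon> :: real assume \<epsilon>: "0 < \<epsilon>"
    then obtain N where N: "1 / Suc N < \<epsilon> / 2" using nat_approx_posE[of "\<epsilon> / 2"] by auto
    have "eventually (\<lambda>n. ?s n \<in> carrier E \<and> ndist E (?s n) y < \<epsilon> / 2) sequentially"
      using y \<epsilon> unfolding metric.limitin_metric by (meson half_gt_zero)
    then obtain M where "\<And>n. n \<ge> M \<Longrightarrow> ndist E (?s n) y < \<epsilon> / 2" by (auto simp: eventually_sequentially)
    then have M: "nrm E (?s (max M N) \<ominus> y) < \<epsilon> / 2" using scl ycl by (metis max.cobounded1 ndist_def)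
    show "eventually (\<lambda>H. dist (nrm E (y \<ominus> finsum E f H)) 0 < \<epsilon>) (finite_subsets_at_top I)"
      unfolding eventually_finite_subsets_at_top
    proof (intro exI[of _ "F (max M N)"] conjI allI impI)
      fix H assume H: "finite H \<and> F (max M N) \<subseteq> H \<and> H \<subseteq> I"
      have "nrm E (finsum E f H \<ominus> y) \<le> nrm E (finsum E f H \<ominus> ?s (max M N)) + nrm E (?s (max M N) \<ominus> y)"
        using H cl ycl scl by (intro nrm_diff_triangle) auto
      moreover have "nrm E (finsum E f H \<ominus> ?s (max M N)) \<le> 1 / Suc (max M N)" using H by (intro near) auto
      moreover have "1 / real (Suc (max M N)) \<le> 1 / Suc N" by (simp add: frac_le)
      ultimately show "dist (nrm E (y \<ominus> finsum E f H)) 0 < \<epsilon>"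
        using M N H cl ycl nrm_diff_commute[of y "finsum E f H"] by simp
    qed (use F in auto)
  qed
  have "limitin metric.mtopology (\<lambda>H. finsum E f H) y (finite_subsets_at_top I)"
    unfolding metric.limitin_metric
  proof (intro conjI ycl allI impI)
    fix \<epsilon> :: real assume "0 < \<epsilon>"
    have e: "eventually (\<lambda>H. H \<subseteq> I) (finite_subsets_at_top I)"
      by (auto simp: eventually_finite_subsets_at_top)
    from tendstoD[OF lim \<open>0 < \<epsilon>\<close>] e
    show "eventually (\<lambda>H. finsum E f H \<in> carrier E \<and> ndist E (finsum E f H) y < \<epsilon>) (finite_subsets_at_top I)"
      by eventually_elim (use ycl cl nrm_diff_commute in \<open>simp add: ndist_def\<close>)
  qed
  then have eq: "infsum_in E f I = y"
    unfolding infsum_in_def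
    by (intro the_equality) (auto intro: metric.limitin_metric_unique finite_subsets_at_top_neq_bot)
  show "infsum_in E f I \<in> carrier E"
    "((\<lambda>F. nrm E (infsum_in E f I \<ominus> finsum E f F)) \<longlongrightarrow> 0) (finite_subsets_at_top I)"
    unfolding eq using ycl lim by auto
qed

text \<open>Norms of values of \<open>Ind\<close> are reached through this limit, so that only
  finite sums have to be estimated.\<close>

lemma nrm_infsum_in_tendsto:
  assumes f: "\<And>i. i \<in> I \<Longrightarrow> f i \<in> carrier E" and sm: "(\<lambda>i. nrm E (f i)) summable_on I"
  shows "((\<lambda>F. nrm E (finsum E f F)) \<longlongrightarrow> nrm E (infsum_in E f I)) (finite_subsets_at_top I)"
proof (rule Lim_null[THEN iffD2], rule Lim_null_comparison[OF _ infsum_in_lim[OF assms]])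
  have e: "eventually (\<lambda>H. H \<subseteq> I) (finite_subsets_at_top I)"
    by (auto simp: eventually_finite_subsets_at_top)
  then show "\<forall>\<^sub>F F in finite_subsets_at_top I. norm (nrm E (finsum E f F) - nrm E (infsum_in E f I))
      \<le> nrm E (infsum_in E f I \<ominus> finsum E f F)"
  proof eventually_elim
    case (elim F)
    have "finsum E f F \<in> carrier E" using elim f by (intro finsum_sub_closed) auto
    then show ?case
      using abs_nrm_diff_le[of "infsum_in E f I" "finsum E f F"] infsum_in_closed[OF assms] by auto
  qed
qed

end

text \<open>Differences appear as x + (-1) y because subtraction in the record refers to additive
  inverses, which exist only once the group axioms are known. Completeness is asked for in the
  sequential form that \<open>lp_complete\<close> delivers.\<close>

lemma complex_banach_spaceI:
  fixes E :: "'e nspace" (structure)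
  assumes zero: "\<zero> \<in> carrier E" and add: "\<And>x y. x \<in> carrier E \<Longrightarrow> y \<in> carrier E \<Longrightarrow> x \<oplus> y \<in> carrier E"
    and scale: "\<And>c x. x \<in> carrier E \<Longrightarrow> c \<odot> x \<in> carrier E"
    and assoc: "\<And>x y z. x \<in> carrier E \<Longrightarrow> y \<in> carrier E \<Longrightarrow> z \<in> carrier E \<Longrightarrow> (x \<oplus> y) \<oplus> z = x \<oplus> (y \<oplus> z)"
    and comm: "\<And>x y. x \<in> carrier E \<Longrightarrow> y \<in> carrier E \<Longrightarrow> x \<oplus> y = y \<oplus> x"
    and zero_add: "\<And>x. x \<in> carrier E \<Longrightarrow> \<zero> \<oplus> x = x"
    and neg: "\<And>x. x \<in> carrier E \<Longrightarrow> (-1) \<odot> x \<oplus> x = \<zero>"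
    and distl: "\<And>a b x. x \<in> carrier E \<Longrightarrow> (a + b) \<odot> x = a \<odot> x \<oplus> b \<odot> x"
    and distr: "\<And>a x y. x \<in> carrier E \<Longrightarrow> y \<in> carrier E \<Longrightarrow> a \<odot> (x \<oplus> y) = a \<odot> x \<oplus> a \<odot> y"
    and smult_assoc: "\<And>a b x. x \<in> carrier E \<Longrightarrow> (a * b) \<odot> x = a \<odot> (b \<odot> x)"
    and one: "\<And>x. x \<in> carrier E \<Longrightarrow> 1 \<odot> x = x"
    and nonneg: "\<And>x. x \<in> carrier E \<Longrightarrow> 0 \<le> nrm E x"
    and eq_0: "\<And>x. x \<in> carrier E \<Longrightarrow> nrm E x = 0 \<longleftrightarrow> x = \<zero>"
    and triangle: "\<And>x y. x \<in> carrier E \<Longrightarrow> y \<in> carrier E \<Longrightarrow> nrm E (x \<oplus> y) \<le> nrm E x + nrm E y"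
    and nrm_scale: "\<And>c x. x \<in> carrier E \<Longrightarrow> nrm E (c \<odot> x) = cmod c * nrm E x"
    and complete: "\<And>\<sigma> :: nat \<Rightarrow> 'e. (\<And>n. \<sigma> n \<in> carrier E) \<Longrightarrow>
        (\<And>\<epsilon>. 0 < \<epsilon> \<Longrightarrow> \<exists>N. \<forall>m\<ge>N. \<forall>n\<ge>N. nrm E (\<sigma> m \<oplus> (-1) \<odot> \<sigma> n) < \<epsilon>) \<Longrightarrow>
        \<exists>x\<in>carrier E. \<forall>\<epsilon>>0. \<exists>N. \<forall>n\<ge>N. nrm E (\<sigma> n \<oplus> (-1) \<odot> x) < \<epsilon>"
  shows "complex_banach_space E"
proof -
  have "cring complex_ring"
    by (intro cringI abelian_groupI comm_monoidI)
      (auto simp: complex_ring_def algebra_simps intro: exI[of _ "- x" for x] left_minus)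
  moreover have "abelian_group E"
  proof (rule abelian_groupI)
    fix x assume "x \<in> carrier E"
    then show "\<exists>y\<in>carrier E. y \<oplus> x = \<zero>" using neg scale by blast
  qed (use zero add assoc comm zero_add in auto)
  ultimately have m: "Module.module complex_ring E"
    by (intro moduleI) (use scale distl distr smult_assoc one in auto)
  interpret cnormed E
    by (rule cnormed.intro) (use m nonneg eq_0 triangle nrm_scale in auto)
  have "metric.mcomplete"
    unfolding metric.mcomplete_def
  proof (intro allI impI)
    fix \<sigma> assume C: "metric.MCauchy \<sigma>"
    then have cl: "\<sigma> n \<in> carrier E" for n by (auto simp: metric.MCauchy_def)
    have "\<exists>x\<in>carrier E. \<forall>\<epsilon>>0. \<exists>N. \<forall>n\<ge>N. nrm E (\<sigma> n \<oplus> (-1) \<odot> x) < \<epsilon>"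
    proof (rule complete[OF cl])
      fix \<epsilon> :: real assume "0 < \<epsilon>"
      then obtain N where "\<forall>n n'. N \<le> n \<longrightarrow> N \<le> n' \<longrightarrow> ndist E (\<sigma> n) (\<sigma> n') < \<epsilon>"
        using C by (auto simp: metric.MCauchy_def)
      then show "\<exists>N. \<forall>m\<ge>N. \<forall>n\<ge>N. nrm E (\<sigma> m \<oplus> (-1) \<odot> \<sigma> n) < \<epsilon>"
        using cl by (auto simp: ndist_def diff_eq)
    qed
    then obtain x where x: "x \<in> carrier E" "\<And>\<epsilon>. 0 < \<epsilon> \<Longrightarrow> \<exists>N. \<forall>n\<ge>N. nrm E (\<sigma> n \<oplus> (-1) \<odot> x) < \<epsilon>"
      by blast
    then have "limitin metric.mtopology \<sigma> x sequentially"
      using cl by (auto simp: metric.limitin_metric eventually_sequentially ndist_def diff_eq)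
    then show "\<exists>x. limitin metric.mtopology \<sigma> x sequentially" by blast
  qed
  then show ?thesis
    unfolding complex_banach_space_def using m nonneg eq_0 triangle nrm_scale by auto
qed

subsection \<open>Operators and representations\<close>

lemma opnorm_le:
  assumes "\<exists>x\<in>carrier E. nrm E x \<le> 1"
    and "\<And>x. x \<in> carrier E \<Longrightarrow> nrm E x \<le> 1 \<Longrightarrow> nrm E (T x) \<le> C"
  shows "opnorm E T \<le> C"
  unfolding opnorm_def using assms by (intro cSup_least) auto

text \<open>\<open>opnorm\<close> is a supremum of reals and bounds its members only if they are
  bounded above; \<open>C\<close> provides this and does not enter the conclusion.\<close>

lemma le_opnorm:
  assumes "\<And>x. x \<in> carrier E \<Longrightarrow> nrm E x \<le> 1 \<Longrightarrow> nrm E (T x) \<le> C"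
    and "x \<in> carrier E" "nrm E x \<le> 1"
  shows "nrm E (T x) \<le> opnorm E T"
  unfolding opnorm_def
proof (rule cSup_upper)
  show "bdd_above {nrm E (T x) |x. x \<in> carrier E \<and> nrm E x \<le> 1}"
    unfolding bdd_above_def using assms(1) by blast
qed (use assms in auto)

context cbanach
begin

lemma opnorm_leI:
  assumes "\<And>x. x \<in> carrier E \<Longrightarrow> nrm E (T x) \<le> C * nrm E x" "0 \<le> C"
  shows "opnorm E T \<le> C"
proof (rule opnorm_le)
  show "\<exists>x\<in>carrier E. nrm E x \<le> 1" by (intro bexI[of _ \<zero>]) auto
  show "nrm E (T x) \<le> C" if "x \<in> carrier E" "nrm E x \<le> 1" for x
    using assms(1)[OF that(1)] mult_left_mono[OF that(2) assms(2)] by simp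
qed

lemma nrm_le_opnorm:
  assumes "bounded_operator E T" "x \<in> carrier E"
  shows "nrm E (T x) \<le> opnorm E T * nrm E x"
proof -
  obtain C where C: "\<And>x. x \<in> carrier E \<Longrightarrow> nrm E (T x) \<le> C * nrm E x"
    using assms(1) unfolding bounded_operator_def by blast
  have cl: "T x \<in> carrier E" and sc: "T (c \<odot> x) = c \<odot> T x" if "x \<in> carrier E" for c x
    using assms(1) that unfolding bounded_operator_def linear_map_def by auto
  show ?thesis
  proof (cases "nrm E x = 0")
    case True
    then show ?thesis using C[OF assms(2)] by simp
  next
    case False
    then have pos: "0 < nrm E x" using nrm_nonneg[OF assms(2)] by linarith
    define y where "y = of_real (1 / nrm E x) \<odot> x"
    have y: "y \<in> carrier E" "nrm E y = 1" using assms(2) pos by (auto simp: y_def nrm_scale norm_divide)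
    have "nrm E (T y) \<le> opnorm E T"
    proof (rule le_opnorm)
      fix z assume z: "z \<in> carrier E" "nrm E z \<le> 1"
      have "nrm E (T z) \<le> C * nrm E z" by (rule C[OF z(1)])
      also have "\<dots> \<le> \<bar>C\<bar> * 1" using z by (intro mult_mono) auto
      finally show "nrm E (T z) \<le> \<bar>C\<bar>" by simp
    qed (use y in auto)
    moreover have "nrm E (T y) = nrm E (T x) / nrm E x"
      using assms(2) pos by (simp add: y_def sc nrm_scale cl norm_divide)
    ultimately show ?thesis using pos by (simp add: divide_le_eq)
  qed
qed

lemma opnorm_nonneg:
  assumes T: "bounded_operator E T"
  shows "0 \<le> opnorm E T"
proof -
  from T obtain C where C: "\<And>x. x \<in> carrier E \<Longrightarrow> nrm E (T x) \<le> C * nrm E x"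
    unfolding bounded_operator_def by blast
  have cl: "T x \<in> carrier E" if "x \<in> carrier E" for x
    using T that unfolding bounded_operator_def linear_map_def by auto
  have "nrm E (T \<zero>) \<le> opnorm E T"
  proof (rule le_opnorm)
    fix z assume z: "z \<in> carrier E" "nrm E z \<le> 1"
    have "nrm E (T z) \<le> C * nrm E z" by (rule C[OF z(1)])
    also have "\<dots> \<le> \<bar>C\<bar> * 1" using z by (intro mult_mono) auto
    finally show "nrm E (T z) \<le> \<bar>C\<bar>" by simp
  qed auto
  then show ?thesis using nrm_nonneg[OF cl[OF M.zero_closed]] by linarith
qed

end

locale banach_rep = cbanach E for E :: "'e nspace" (structure) +
  fixes B :: "'a nspace" and \<pi> :: "'a \<Rightarrow> 'e \<Rightarrow> 'e"
  assumes rep: "representation B E \<pi>"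
begin

lemma rep_bounded: "a \<in> carrier B \<Longrightarrow> bounded_operator E (\<pi> a)"
  using rep by (simp add: representation_def)

lemma rep_closed [simp, intro]: "a \<in> carrier B \<Longrightarrow> \<xi> \<in> carrier E \<Longrightarrow> \<pi> a \<xi> \<in> carrier E"
  using rep_bounded[of a] by (auto simp: bounded_operator_def linear_map_def)

lemma rep_add: "a \<in> carrier B \<Longrightarrow> \<xi> \<in> carrier E \<Longrightarrow> \<eta> \<in> carrier E \<Longrightarrow> \<pi> a (\<xi> \<oplus> \<eta>) = \<pi> a \<xi> \<oplus> \<pi> a \<eta>"
  using rep_bounded[of a] by (auto simp: bounded_operator_def linear_map_def)

lemma rep_scale: "a \<in> carrier B \<Longrightarrow> \<xi> \<in> carrier E \<Longrightarrow> \<pi> a (c \<odot> \<xi>) = c \<odot> \<pi> a \<xi>"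
  using rep_bounded[of a] by (auto simp: bounded_operator_def linear_map_def)

lemma rep_zero [simp]: "a \<in> carrier B \<Longrightarrow> \<pi> a \<zero> = \<zero>"
  using rep_scale[of a \<zero> 0] by simp

lemma rep_diff: "a \<in> carrier B \<Longrightarrow> \<xi> \<in> carrier E \<Longrightarrow> \<eta> \<in> carrier E \<Longrightarrow> \<pi> a (\<xi> \<ominus> \<eta>) = \<pi> a \<xi> \<ominus> \<pi> a \<eta>"
  by (simp add: diff_eq rep_add rep_scale)

lemma rep_finsum:
  assumes "a \<in> carrier B" "finite I" "\<And>i. i \<in> I \<Longrightarrow> f i \<in> carrier E"
  shows "\<pi> a (finsum E f I) = finsum E (\<lambda>i. \<pi> a (f i)) I"
  using assms(2,3)
proof (induction I rule: finite_induct)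
  case (insert i I)
  then show ?case using assms(1) by (simp add: finsum_insert' finsum_sub_closed rep_add)
qed (use assms in simp)

lemma rep_plus: "a \<in> carrier B \<Longrightarrow> b \<in> carrier B \<Longrightarrow> \<xi> \<in> carrier E \<Longrightarrow> \<pi> (a \<oplus>\<^bsub>B\<^esub> b) \<xi> = \<pi> a \<xi> \<oplus> \<pi> b \<xi>"
  and rep_smult: "a \<in> carrier B \<Longrightarrow> \<xi> \<in> carrier E \<Longrightarrow> \<pi> (c \<odot>\<^bsub>B\<^esub> a) \<xi> = c \<odot> \<pi> a \<xi>"
  and rep_mult: "a \<in> carrier B \<Longrightarrow> b \<in> carrier B \<Longrightarrow> \<xi> \<in> carrier E \<Longrightarrow> \<pi> (a \<otimes>\<^bsub>B\<^esub> b) \<xi> = \<pi> a (\<pi> b \<xi>)"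
  and rep_opnorm: "a \<in> carrier B \<Longrightarrow> opnorm E (\<pi> a) \<le> nrm B a"
  using rep by (auto simp: representation_def)

lemma rep_nrm_le:
  assumes "a \<in> carrier B" "\<xi> \<in> carrier E"
  shows "nrm E (\<pi> a \<xi>) \<le> nrm B a * nrm E \<xi>"
  using nrm_le_opnorm[OF rep_bounded[OF assms(1)] assms(2)]
    mult_right_mono[OF rep_opnorm[OF assms(1)] nrm_nonneg[OF assms(2)]] by simp

end

locale nondeg_rep = banach_rep +
  assumes nondeg: "nondegenerate_representation B E \<pi>"
begin

lemma nondeg_approx:
  assumes "\<xi> \<in> carrier E" "0 < \<epsilon>"
  obtains a \<eta> where "a \<in> carrier B" "\<eta> \<in> carrier E" "nrm E (\<xi> \<ominus> \<pi> a \<eta>) < \<epsilon>"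
proof -
  have "metric.mtopology closure_of {\<pi> a \<xi> |a \<xi>. a \<in> carrier B \<and> \<xi> \<in> carrier E} = carrier E"
    using nondeg by (simp add: nondegenerate_representation_def)
  from closure_approx[OF this assms] show ?thesis using that by blast
qed

end

lemma nondeg_repI:
  assumes "complex_banach_space E" "nondegenerate_representation B E \<pi>"
  shows "nondeg_rep E B \<pi>"
  using assms by unfold_locales (auto simp: nondegenerate_representation_def)

section \<open>Calculus in \<open>C\<^sub>0(X)\<close>\<close>

lemma C0_simps [simp]:
  "zero (C0 X) = (\<lambda>_. 0)" "add (C0 X) f g = (\<lambda>x. f x + g x)" "mult (C0 X) f g = (\<lambda>x. f x * g x)"
  "smult (C0 X) c f = (\<lambda>x. c * f x)"
  by (simp_all add: C0_def)

lemma C0_nrm: "nrm (C0 X) f = (SUP x. cmod (f x))"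
  by (simp add: C0_def)

lemma C0_iff:
  "f \<in> carrier (C0 X) \<longleftrightarrow> continuous_map X euclidean f \<and> (\<forall>x. x \<notin> topspace X \<longrightarrow> f x = 0) \<and>
     (\<forall>\<epsilon>>0. compactin X {x \<in> topspace X. \<epsilon> \<le> cmod (f x)})"
  by (simp add: C0_def)

lemma C0_level_compact:
  "f \<in> carrier (C0 X) \<Longrightarrow> 0 < \<epsilon> \<Longrightarrow> compactin X {x \<in> topspace X. \<epsilon> \<le> cmod (f x)}"
  by (simp add: C0_iff)

lemma C0_continuous: "f \<in> carrier (C0 X) \<Longrightarrow> continuous_map X euclidean f"
  and C0_outside: "f \<in> carrier (C0 X) \<Longrightarrow> x \<notin> topspace X \<Longrightarrow> f x = 0"
  by (auto simp: C0_iff)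

lemma C0_bounded:
  assumes "f \<in> carrier (C0 X)"
  shows "bdd_above (range (\<lambda>x. cmod (f x)))"
proof -
  let ?K = "{x \<in> topspace X. 1 \<le> cmod (f x)}"
  have "compactin X ?K" using assms by (simp add: C0_iff)
  then have "compactin euclidean (f ` ?K)"
    using assms image_compactin C0_continuous by blast
  then have "bounded (f ` ?K)" by (simp add: compact_imp_bounded)
  then obtain M where M: "\<And>x. x \<in> ?K \<Longrightarrow> cmod (f x) \<le> M" by (auto simp: bounded_iff)
  have "cmod (f x) \<le> max 1 M" for x
    using M[of x] C0_outside[OF assms, of x] by (cases "x \<in> topspace X"; cases "1 \<le> cmod (f x)") auto
  then show ?thesis by (auto simp: bdd_above_def)
qed

lemma C0_le_nrm: "f \<in> carrier (C0 X) \<Longrightarrow> cmod (f x) \<le> nrm (C0 X) f"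
  unfolding C0_nrm by (rule cSUP_upper[OF UNIV_I C0_bounded])

lemma C0_nrm_le: "(\<And>x. cmod (f x) \<le> M) \<Longrightarrow> nrm (C0 X) f \<le> M"
  unfolding C0_nrm by (rule cSUP_least) auto

lemma C0_nrm_le_on:
  assumes "f \<in> carrier (C0 X)" "0 \<le> M" "\<And>x. x \<in> topspace X \<Longrightarrow> cmod (f x) \<le> M"
  shows "nrm (C0 X) f \<le> M"
proof (rule C0_nrm_le)
  fix x show "cmod (f x) \<le> M" using assms C0_outside[OF assms(1), of x] by (cases "x \<in> topspace X") auto
qed

lemma C0_nrm_nonneg [simp]: "f \<in> carrier (C0 X) \<Longrightarrow> 0 \<le> nrm (C0 X) f"
  using C0_le_nrm[of f X undefined] norm_ge_zero order_trans by blast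

lemma closedin_level:
  fixes f :: "'x \<Rightarrow> complex"
  assumes "continuous_map X euclidean f"
  shows "closedin X {x \<in> topspace X. \<epsilon> \<le> cmod (f x)}"
proof -
  have "closed {z. \<epsilon> \<le> cmod z}" by (intro closed_Collect_le continuous_intros)
  then have "closedin euclidean {z. \<epsilon> \<le> cmod z}" by simp
  from closedin_continuous_map_preimage[OF assms this] show ?thesis by simp
qed

lemma C0_dominated:
  assumes f: "f \<in> carrier (C0 X)" and g: "continuous_map X euclidean g"
    and le: "\<And>x. cmod (g x) \<le> K * cmod (f x)"
  shows "g \<in> carrier (C0 X)"
  unfolding C0_iff
proof (intro conjI allI impI g)
  fix x assume "x \<notin> topspace X"
  then show "g x = 0" using le[of x] C0_outside[OF f, of x] by simp
next
  fix \<epsilon> :: real assume \<epsilon>: "0 < \<epsilon>"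
  \<comment> \<open>The level \<epsilon> is divided by the constant, so it must be positive, while
    \<open>K\<close> may be 0 or negative.\<close>
  define K' where "K' = max 1 K"
  have K': "K' > 0" by (simp add: K'_def)
  have le': "cmod (g x) \<le> K' * cmod (f x)" for x
    by (rule order_trans[OF le]) (auto simp: K'_def intro: mult_right_mono)
  have "compactin X {x \<in> topspace X. \<epsilon> / K' \<le> cmod (f x)}" using f \<epsilon> K' by (simp add: C0_iff)
  moreover have "{x \<in> topspace X. \<epsilon> \<le> cmod (g x)} \<subseteq> {x \<in> topspace X. \<epsilon> / K' \<le> cmod (f x)}"
    using le' K' by (auto simp: divide_le_eq mult.commute intro: order_trans)
  ultimately show "compactin X {x \<in> topspace X. \<epsilon> \<le> cmod (g x)}"
    using closedin_level[OF g] closed_compactin by blast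
qed

lemma continuous_map_euclidean_compose:
  assumes "continuous_map X euclidean f" "continuous_on UNIV h"
  shows "continuous_map X euclidean (\<lambda>x. h (f x))"
  using continuous_map_compose[OF assms(1), of euclidean h] assms(2) by (simp add: o_def)

lemma continuous_map_complex_mult:
  fixes f g :: "'x \<Rightarrow> complex"
  assumes "continuous_map X euclidean f" "continuous_map X euclidean g"
  shows "continuous_map X euclidean (\<lambda>x. f x * g x)"
proof -
  have "continuous_map X (prod_topology euclidean euclidean) (\<lambda>x. (f x, g x))"
    by (rule continuous_map_pairedI[OF assms])
  moreover have "continuous_on UNIV (\<lambda>z::complex \<times> complex. fst z * snd z)"
    by (intro continuous_intros)
  ultimately show ?thesis
    using continuous_map_compose[of X "prod_topology euclidean euclidean" "\<lambda>x. (f x, g x)" euclidean "\<lambda>z. fst z * snd z"]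
    by (simp add: o_def euclidean_product_topology)
qed

lemma C0_zero [simp]: "(\<lambda>_. 0) \<in> carrier (C0 X)"
  by (simp add: C0_iff)

lemma C0_add:
  assumes f: "f \<in> carrier (C0 X)" and g: "g \<in> carrier (C0 X)"
  shows "(\<lambda>x. f x + g x) \<in> carrier (C0 X)"
  unfolding C0_iff
proof (intro conjI allI impI)
  show c: "continuous_map X euclidean (\<lambda>x. f x + g x)"
    using f g by (intro continuous_map_add C0_continuous)
  fix \<epsilon> :: real assume \<epsilon>: "0 < \<epsilon>"
  have "compactin X ({x \<in> topspace X. \<epsilon> / 2 \<le> cmod (f x)} \<union> {x \<in> topspace X. \<epsilon> / 2 \<le> cmod (g x)})"
    by (rule compactin_Un[OF C0_level_compact[OF f half_gt_zero[OF \<epsilon>]] C0_level_compact[OF g half_gt_zero[OF \<epsilon>]]])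
  moreover have "{x \<in> topspace X. \<epsilon> \<le> cmod (f x + g x)}
      \<subseteq> {x \<in> topspace X. \<epsilon> / 2 \<le> cmod (f x)} \<union> {x \<in> topspace X. \<epsilon> / 2 \<le> cmod (g x)}"
  proof
    fix x assume x: "x \<in> {x \<in> topspace X. \<epsilon> \<le> cmod (f x + g x)}"
    then have "\<epsilon> \<le> cmod (f x) + cmod (g x)" using norm_triangle_ineq[of "f x" "g x"] by auto
    then have "\<epsilon> / 2 \<le> cmod (f x) \<or> \<epsilon> / 2 \<le> cmod (g x)" by linarith
    with x show "x \<in> {x \<in> topspace X. \<epsilon> / 2 \<le> cmod (f x)} \<union> {x \<in> topspace X. \<epsilon> / 2 \<le> cmod (g x)}" by auto
  qed
  ultimately show "compactin X {x \<in> topspace X. \<epsilon> \<le> cmod (f x + g x)}"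
    using closedin_level[OF c] closed_compactin by blast
qed (use f g in \<open>auto simp: C0_iff\<close>)

lemma C0_mult_bounded:
  assumes f: "f \<in> carrier (C0 X)" and g: "continuous_map X euclidean g" "\<And>x. cmod (g x) \<le> M"
  shows "(\<lambda>x. f x * g x) \<in> carrier (C0 X)"
proof (rule C0_dominated[OF f])
  show "continuous_map X euclidean (\<lambda>x. f x * g x)"
    by (intro continuous_map_complex_mult C0_continuous[OF f] g(1))
  show "cmod (f x * g x) \<le> M * cmod (f x)" for x
    using mult_left_mono[OF g(2)[of x], of "cmod (f x)"] by (simp add: norm_mult mult.commute)
qed

lemma C0_mult:
  assumes f: "f \<in> carrier (C0 X)" and g: "g \<in> carrier (C0 X)"
  shows "(\<lambda>x. f x * g x) \<in> carrier (C0 X)"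
  by (rule C0_mult_bounded[OF f C0_continuous[OF g] C0_le_nrm[OF g]])

lemma C0_scale: "f \<in> carrier (C0 X) \<Longrightarrow> (\<lambda>x. c * f x) \<in> carrier (C0 X)"
  using C0_mult_bounded[of f X "\<lambda>_. c" "cmod c"] by (simp add: mult.commute)

lemma C0_diff: "f \<in> carrier (C0 X) \<Longrightarrow> g \<in> carrier (C0 X) \<Longrightarrow> (\<lambda>x. f x - g x) \<in> carrier (C0 X)"
  using C0_add[of f X "\<lambda>x. (-1) * g x"] C0_scale[of g X "-1"] by simp

lemma C0_sum:
  assumes "finite I" "\<And>i. i \<in> I \<Longrightarrow> f i \<in> carrier (C0 X)"
  shows "(\<lambda>x. \<Sum>i\<in>I. f i x) \<in> carrier (C0 X)"
  using assms by (induction I rule: finite_induct) (auto intro: C0_add)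

lemma C0_compose:
  assumes "f \<in> carrier (C0 X)" "continuous_on UNIV h" "\<And>z. cmod (h z) \<le> K * cmod z"
  shows "(\<lambda>x. h (f x)) \<in> carrier (C0 X)"
  by (rule C0_dominated[OF assms(1) continuous_map_euclidean_compose[OF C0_continuous[OF assms(1)] assms(2)] assms(3)])

lemma C0_cnj: "f \<in> carrier (C0 X) \<Longrightarrow> (\<lambda>x. cnj (f x)) \<in> carrier (C0 X)"
  by (erule C0_compose[of _ _ _ 1]) (auto intro!: continuous_intros)

lemma C0_Re: "f \<in> carrier (C0 X) \<Longrightarrow> (\<lambda>x. of_real (Re (f x))) \<in> carrier (C0 X)"
  by (erule C0_compose[of _ _ _ 1]) (auto intro!: continuous_intros simp: abs_Re_le_cmod)

lemma C0_Im: "f \<in> carrier (C0 X) \<Longrightarrow> (\<lambda>x. of_real (Im (f x))) \<in> carrier (C0 X)"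
  by (erule C0_compose[of _ _ _ 1]) (auto intro!: continuous_intros simp: abs_Im_le_cmod)

lemma C0_norm: "f \<in> carrier (C0 X) \<Longrightarrow> (\<lambda>x. of_real (cmod (f x))) \<in> carrier (C0 X)"
  by (erule C0_compose[of _ _ _ 1]) (auto intro!: continuous_intros)

text \<open>A member of an approximate unit of \<open>C0 X\<close>. The compact set off which it
  vanishes is where amenability gives uniform estimates.\<close>

definition cutoff :: "'x topology \<Rightarrow> ('x \<Rightarrow> real) \<Rightarrow> bool" where
  "cutoff X k \<longleftrightarrow> (\<lambda>x. complex_of_real (k x)) \<in> carrier (C0 X) \<and> (\<forall>x. 0 \<le> k x \<and> k x \<le> 1) \<and>
     (\<exists>K. compactin X K \<and> (\<forall>x. k x \<noteq> 0 \<longrightarrow> x \<in> K))"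

text \<open>The cutoff is made from the given functions: with c the sum of their moduli and \<delta>
  = \<epsilon>/2, it is 0 where c \<le> \<delta> and 1 where c \<ge> 2\<delta>. Where it differs
  from 1, every |a i| is below \<epsilon>, and it lives on the compact set {c \<ge>
  \<delta>}.\<close>

lemma cutoff_exists:
  assumes "finite I" "\<And>i. i \<in> I \<Longrightarrow> a i \<in> carrier (C0 X)" "0 < \<epsilon>"
  obtains k where "cutoff X k" "\<And>i x. i \<in> I \<Longrightarrow> cmod (a i x - of_real (k x) * a i x) \<le> \<epsilon>"
proof -
  define c where "c x = (\<Sum>i\<in>I. cmod (a i x))" for x
  define \<delta> where "\<delta> = \<epsilon> / 2"
  define k where "k x = min 1 (max 0 (c x / \<delta> - 1))" for x
  have \<delta>: "\<delta> > 0" using assms by (simp add: \<delta>_def)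
  have c: "(\<lambda>x. complex_of_real (c x)) \<in> carrier (C0 X)"
    unfolding c_def of_real_sum by (intro C0_sum C0_norm assms)
  have c0: "0 \<le> c x" for x by (simp add: c_def sum_nonneg)
  have k0: "\<delta> \<le> c x" if "k x \<noteq> 0" for x
  proof (rule ccontr)
    assume "\<not> \<delta> \<le> c x"
    then have "c x / \<delta> < 1" using \<delta> by simp
    then show False using that by (simp add: k_def)
  qed
  have kC0: "(\<lambda>x. complex_of_real (k x)) \<in> carrier (C0 X)"
  proof (rule C0_dominated[OF c, of _ "1 / \<delta>"])
    have "continuous_map X euclidean (\<lambda>x. complex_of_real (min 1 (max 0 (Re (complex_of_real (c x)) / \<delta> - 1))))"
      by (rule continuous_map_euclidean_compose[OF C0_continuous[OF c]]) (use \<delta> in \<open>auto intro!: continuous_intros\<close>)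
    then show "continuous_map X euclidean (\<lambda>x. complex_of_real (k x))" by (simp add: k_def)
    show "cmod (complex_of_real (k x)) \<le> 1 / \<delta> * cmod (complex_of_real (c x))" for x
    proof (cases "k x = 0")
      case False
      from k0[OF this] have "1 \<le> c x / \<delta>" using \<delta> by simp
      moreover have "0 \<le> k x" "k x \<le> 1" by (auto simp: k_def)
      ultimately show ?thesis using c0 by simp
    qed (use \<delta> c0 in simp)
  qed
  show ?thesis
  proof (rule that)
    have "compactin X {x \<in> topspace X. \<delta> \<le> cmod (complex_of_real (c x))}" using c \<delta> by (simp add: C0_iff)
    moreover have "x \<in> {x \<in> topspace X. \<delta> \<le> cmod (complex_of_real (c x))}" if "k x \<noteq> 0" for x
      using k0[OF that] c0[of x] C0_outside[OF c, of x] \<delta> by (cases "x \<in> topspace X") auto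
    ultimately show "cutoff X k" using kC0 unfolding cutoff_def by (auto simp: k_def)
    fix i x assume i: "i \<in> I"
    have ci: "cmod (a i x) \<le> c x" unfolding c_def using assms i by (intro member_le_sum) auto
    have "a i x - of_real (k x) * a i x = of_real (1 - k x) * a i x" by (simp add: algebra_simps)
    then have e: "cmod (a i x - of_real (k x) * a i x) = (1 - k x) * cmod (a i x)"
      by (simp add: norm_mult k_def del: of_real_diff)
    show "cmod (a i x - of_real (k x) * a i x) \<le> \<epsilon>"
    proof (cases "c x \<ge> 2 * \<delta>")
      case True
      then have "2 \<le> c x / \<delta>" using \<delta> by (simp add: le_divide_eq)
      then have "k x = 1" by (simp add: k_def)
      then show ?thesis using e assms(3) by simp
    next
      case False
      have "(1 - k x) * cmod (a i x) \<le> 1 * c x" using ci by (intro mult_mono) (auto simp: k_def)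
      then show ?thesis using e False by (simp add: \<delta>_def)
    qed
  qed
qed

section \<open>Non-degenerate representations of \<open>C\<^sub>0(X)\<close>\<close>

locale C0_rep = nondeg_rep E "C0 X" \<pi> for E :: "'e nspace" (structure) and X :: "'x topology" and \<pi>
begin

lemma rep_bound:
  assumes "a \<in> carrier (C0 X)" "\<xi> \<in> carrier E" "0 \<le> M" "\<And>x. x \<in> topspace X \<Longrightarrow> cmod (a x) \<le> M"
  shows "nrm E (\<pi> a \<xi>) \<le> M * nrm E \<xi>"
  using rep_nrm_le[OF assms(1,2)] mult_right_mono[OF C0_nrm_le_on[OF assms(1,3,4)] nrm_nonneg[OF assms(2)]]
  by simp

lemma rep_C0_add: "a \<in> carrier (C0 X) \<Longrightarrow> b \<in> carrier (C0 X) \<Longrightarrow> \<xi> \<in> carrier E \<Longrightarrow>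
    \<pi> (\<lambda>x. a x + b x) \<xi> = \<pi> a \<xi> \<oplus> \<pi> b \<xi>"
  using rep_plus[of a b \<xi>] by simp

lemma rep_C0_scale: "a \<in> carrier (C0 X) \<Longrightarrow> \<xi> \<in> carrier E \<Longrightarrow> \<pi> (\<lambda>x. c * a x) \<xi> = c \<odot> \<pi> a \<xi>"
  using rep_smult[of a \<xi> c] by simp

lemma rep_C0_mult: "a \<in> carrier (C0 X) \<Longrightarrow> b \<in> carrier (C0 X) \<Longrightarrow> \<xi> \<in> carrier E \<Longrightarrow>
    \<pi> (\<lambda>x. a x * b x) \<xi> = \<pi> a (\<pi> b \<xi>)"
  using rep_mult[of a b \<xi>] by simp

lemma rep_C0_zero: "\<xi> \<in> carrier E \<Longrightarrow> \<pi> (\<lambda>_. 0) \<xi> = \<zero>"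
  using rep_C0_scale[of "\<lambda>_. 0" \<xi> 0] by simp

lemma rep_C0_sum:
  assumes "finite I" "\<And>i. i \<in> I \<Longrightarrow> a i \<in> carrier (C0 X)" "\<xi> \<in> carrier E"
  shows "\<pi> (\<lambda>x. \<Sum>i\<in>I. a i x) \<xi> = finsum E (\<lambda>i. \<pi> (a i) \<xi>) I"
  using assms(1,2)
proof (induction I rule: finite_induct)
  case (insert i I)
  have "\<pi> (\<lambda>x. a i x + (\<Sum>i\<in>I. a i x)) \<xi> = \<pi> (a i) \<xi> \<oplus> \<pi> (\<lambda>x. \<Sum>i\<in>I. a i x) \<xi>"
    using insert assms by (intro rep_C0_add C0_sum) auto
  then show ?case using insert assms by (simp add: finsum_insert')
qed (use assms rep_C0_zero in simp)

lemma rep_C0_diff: "a \<in> carrier (C0 X) \<Longrightarrow> b \<in> carrier (C0 X) \<Longrightarrow> \<xi> \<in> carrier E \<Longrightarrow>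
    \<pi> (\<lambda>x. a x - b x) \<xi> = \<pi> a \<xi> \<ominus> \<pi> b \<xi>"
  using rep_C0_add[of a "\<lambda>x. (-1) * b x" \<xi>] rep_C0_scale[of b \<xi> "-1"] C0_scale[of b X "-1"]
  by (simp add: diff_eq)

text \<open>Non-degeneracy puts \<xi> near some \<pi> a \<eta>. A cutoff that nearly fixes
  \<open>a\<close> nearly fixes this vector, and it acts as a contraction on the remaining
  error.\<close>

lemma rep_unit_approx:
  assumes \<xi>: "\<xi> \<in> carrier E" and \<epsilon>: "0 < \<epsilon>"
  obtains k where "cutoff X k" "nrm E (\<xi> \<ominus> \<pi> (\<lambda>x. of_real (k x)) \<xi>) \<le> \<epsilon>"
proof -
  obtain a \<eta> where a: "a \<in> carrier (C0 X)" "\<eta> \<in> carrier E" "nrm E (\<xi> \<ominus> \<pi> a \<eta>) < \<epsilon> / 3"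
    using nondeg_approx[OF \<xi>, of "\<epsilon> / 3"] \<epsilon> by auto
  \<comment> \<open>The added 1 avoids division by 0 when \<eta> = 0.\<close>
  define \<delta> where "\<delta> = \<epsilon> / (3 * (1 + nrm E \<eta>))"
  have \<eta>: "0 \<le> nrm E \<eta>" using a by simp
  have \<delta>: "\<delta> > 0" using \<eta> \<epsilon> by (simp add: \<delta>_def)
  obtain k where k: "cutoff X k" "\<And>x. cmod (a x - of_real (k x) * a x) \<le> \<delta>"
    using cutoff_exists[of "{()}" "\<lambda>_. a" X \<delta>] a(1) \<delta> by auto
  let ?k = "\<lambda>x. complex_of_real (k x)"
  have kC: "?k \<in> carrier (C0 X)" using k by (simp add: cutoff_def)
  have "\<pi> a \<eta> \<ominus> \<pi> ?k (\<pi> a \<eta>) = \<pi> (\<lambda>x. a x - ?k x * a x) \<eta>"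
    using kC a by (simp add: rep_C0_diff C0_mult rep_C0_mult)
  also have "nrm E \<dots> \<le> \<delta> * nrm E \<eta>"
    using kC a \<delta> k by (intro rep_bound C0_diff C0_mult) auto
  also have "\<dots> \<le> \<epsilon> / 3"
    using \<eta> \<epsilon> by (simp add: \<delta>_def field_simps)
  finally have 1: "nrm E (\<pi> a \<eta> \<ominus> \<pi> ?k (\<pi> a \<eta>)) \<le> \<epsilon> / 3" .
  have "\<pi> ?k (\<pi> a \<eta>) \<ominus> \<pi> ?k \<xi> = \<pi> ?k (\<pi> a \<eta> \<ominus> \<xi>)" using kC a \<xi> by (simp add: rep_diff)
  also have "nrm E \<dots> \<le> 1 * nrm E (\<pi> a \<eta> \<ominus> \<xi>)"
    using kC a \<xi> k(1) by (intro rep_bound) (auto simp: cutoff_def)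
  also have "\<dots> \<le> \<epsilon> / 3" using a \<xi> nrm_diff_commute[of "\<pi> a \<eta>" \<xi>] by simp
  finally have 2: "nrm E (\<pi> ?k (\<pi> a \<eta>) \<ominus> \<pi> ?k \<xi>) \<le> \<epsilon> / 3" .
  have cl: "\<pi> a \<eta> \<in> carrier E" "\<pi> ?k (\<pi> a \<eta>) \<in> carrier E" "\<pi> ?k \<xi> \<in> carrier E" using a kC \<xi> by auto
  have "nrm E (\<xi> \<ominus> \<pi> ?k \<xi>) \<le> nrm E (\<xi> \<ominus> \<pi> a \<eta>) + (nrm E (\<pi> a \<eta> \<ominus> \<pi> ?k (\<pi> a \<eta>)) + nrm E (\<pi> ?k (\<pi> a \<eta>) \<ominus> \<pi> ?k \<xi>))"
    using nrm_diff_triangle[OF \<xi> cl(1,3)] nrm_diff_triangle[OF cl] by linarith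
  then have "nrm E (\<xi> \<ominus> \<pi> ?k \<xi>) \<le> \<epsilon>" using 1 2 a(3) by linarith
  with k(1) show ?thesis by (rule that)
qed

text \<open>Real functions act as Hermitian elements of the algebra of operators on \<open>E\<close>.\<close>

lemma rep_hermitian:
  assumes a: "(\<lambda>x. complex_of_real (a x)) \<in> carrier (C0 X)" and K: "0 \<le> K" "\<And>x. \<bar>a x\<bar> \<le> K"
    and \<xi>: "\<xi> \<in> carrier E"
  shows "nrm E (\<xi> \<oplus> (\<i> * of_real \<theta>) \<odot> \<pi> (\<lambda>x. of_real (a x)) \<xi>) \<le> (1 + K\<^sup>2 * \<theta>\<^sup>2) * nrm E \<xi>"
proof (rule field_le_epsilon)
  fix e :: real assume e: "0 < e"
  \<comment> \<open>Chosen so that the error \<epsilon> + |\<theta>| K \<epsilon> from replacing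
    \<xi> by its cut-off version is exactly e.\<close>
  define \<epsilon> where "\<epsilon> = e / (1 + \<bar>\<theta>\<bar> * K)"
  have \<epsilon>: "\<epsilon> > 0" and \<epsilon>e: "\<epsilon> + \<bar>\<theta>\<bar> * (K * \<epsilon>) = e"
    using e K add_pos_nonneg[of 1 "\<bar>\<theta>\<bar> * K"] by (auto simp: \<epsilon>_def field_simps add_nonneg_eq_0_iff)
  obtain k where k: "cutoff X k" "nrm E (\<xi> \<ominus> \<pi> (\<lambda>x. of_real (k x)) \<xi>) \<le> \<epsilon>"
    using rep_unit_approx[OF \<xi> \<epsilon>] by blast
  let ?a = "\<lambda>x. complex_of_real (a x)" and ?k = "\<lambda>x. complex_of_real (k x)" and ?c = "\<i> * complex_of_real \<theta>"
  have kC: "?k \<in> carrier (C0 X)" using k by (simp add: cutoff_def)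
  let ?y = "\<pi> ?k \<xi>"
  have y: "?y \<in> carrier E" using kC \<xi> by auto
  \<comment> \<open>1 + i\<theta>a need not lie in \<open>C0 X\<close>; multiplied by
    \<open>k\<close> it does. Its modulus is at most sqrt(1 + \<theta>^2 K^2), which has no term
    linear in \<theta>.\<close>
  have "\<pi> (\<lambda>x. ?k x + ?c * (?a x * ?k x)) \<xi> = ?y \<oplus> ?c \<odot> \<pi> ?a ?y"
    using kC a \<xi> by (simp add: rep_C0_add C0_scale C0_mult rep_C0_scale rep_C0_mult)
  moreover have "nrm E (\<pi> (\<lambda>x. ?k x + ?c * (?a x * ?k x)) \<xi>) \<le> (1 + K\<^sup>2 * \<theta>\<^sup>2) * nrm E \<xi>"
  proof (rule rep_bound)
    fix x
    have "?k x + ?c * (?a x * ?k x) = ?k x * (1 + ?c * ?a x)" by (simp add: algebra_simps)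
    then have "cmod (?k x + ?c * (?a x * ?k x)) = \<bar>k x\<bar> * cmod (1 + ?c * ?a x)" by (simp add: norm_mult)
    also have "\<dots> \<le> 1 * cmod (1 + ?c * ?a x)" using k(1) by (intro mult_right_mono) (auto simp: cutoff_def)
    also have "cmod (1 + ?c * ?a x) = sqrt (1 + \<theta>\<^sup>2 * (a x)\<^sup>2)" by (simp add: cmod_def power_mult_distrib)
    also have "\<dots> \<le> 1 + \<theta>\<^sup>2 * (a x)\<^sup>2"
    proof (rule real_le_lsqrt)
      show "1 + \<theta>\<^sup>2 * (a x)\<^sup>2 \<le> (1 + \<theta>\<^sup>2 * (a x)\<^sup>2)\<^sup>2" by (rule self_le_power) auto
    qed auto
    also have "(a x)\<^sup>2 \<le> K\<^sup>2" using K(2)[of x] K(1) by (metis abs_ge_zero power2_abs power_mono)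
    then have "1 + \<theta>\<^sup>2 * (a x)\<^sup>2 \<le> 1 + K\<^sup>2 * \<theta>\<^sup>2" using mult_left_mono[of "(a x)\<^sup>2" "K\<^sup>2" "\<theta>\<^sup>2"] by (simp add: mult.commute)
    finally show "cmod (?k x + ?c * (?a x * ?k x)) \<le> 1 + K\<^sup>2 * \<theta>\<^sup>2" by simp
  qed (use kC a \<xi> in \<open>auto intro!: C0_add C0_scale C0_mult\<close>)
  ultimately have 1: "nrm E (?y \<oplus> ?c \<odot> \<pi> ?a ?y) \<le> (1 + K\<^sup>2 * \<theta>\<^sup>2) * nrm E \<xi>" by simp
  let ?d = "\<xi> \<ominus> ?y"
  have d: "?d \<in> carrier E" using y \<xi> by auto
  have xi: "\<xi> = ?d \<oplus> ?y" using y \<xi> by (simp add: diff_add_cancel)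
  have "\<xi> \<oplus> ?c \<odot> \<pi> ?a \<xi> = (?d \<oplus> ?y) \<oplus> ?c \<odot> \<pi> ?a (?d \<oplus> ?y)"
    by (simp add: xi[symmetric])
  also have "\<dots> = (?d \<oplus> ?c \<odot> \<pi> ?a ?d) \<oplus> (?y \<oplus> ?c \<odot> \<pi> ?a ?y)"
    using d y a by (simp add: rep_add scale_add_right M.a_ac)
  finally have eq: "\<xi> \<oplus> ?c \<odot> \<pi> ?a \<xi> = (?d \<oplus> ?c \<odot> \<pi> ?a ?d) \<oplus> (?y \<oplus> ?c \<odot> \<pi> ?a ?y)" .
  have "nrm E (?d \<oplus> ?c \<odot> \<pi> ?a ?d) \<le> nrm E ?d + nrm E (?c \<odot> \<pi> ?a ?d)"
    using d a by (intro nrm_triangle) auto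
  also have "nrm E (?c \<odot> \<pi> ?a ?d) = \<bar>\<theta>\<bar> * nrm E (\<pi> ?a ?d)" using d a by (simp add: nrm_scale norm_mult)
  also have "nrm E ?d + \<bar>\<theta>\<bar> * nrm E (\<pi> ?a ?d) \<le> \<epsilon> + \<bar>\<theta>\<bar> * (K * \<epsilon>)"
  proof (intro add_mono mult_left_mono)
    have "nrm E (\<pi> ?a ?d) \<le> K * nrm E ?d" using d a K by (intro rep_bound) auto
    also have "\<dots> \<le> K * \<epsilon>" using k(2) K by (intro mult_left_mono)
    finally show "nrm E (\<pi> ?a ?d) \<le> K * \<epsilon>" .
  qed (use k in auto)
  finally have "nrm E (?d \<oplus> ?c \<odot> \<pi> ?a ?d) \<le> e" using \<epsilon>e by simp
  moreover have "nrm E (\<xi> \<oplus> ?c \<odot> \<pi> ?a \<xi>) \<le> nrm E (?d \<oplus> ?c \<odot> \<pi> ?a ?d) + nrm E (?y \<oplus> ?c \<odot> \<pi> ?a ?y)"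
    unfolding eq using d y a by (intro nrm_triangle) auto
  ultimately show "nrm E (\<xi> \<oplus> ?c \<odot> \<pi> ?a \<xi>) \<le> (1 + K\<^sup>2 * \<theta>\<^sup>2) * nrm E \<xi> + e" using 1 by linarith
qed

end

section \<open>Representations acting locally on functions\<close>

text \<open>A filter is used so that \<open>C\<^sub>0\<close>-spaces (evaluation at a point) and
  \<open>L\<^sup>p\<close>-spaces (evaluation almost everywhere) are covered by the same argument.\<close>

locale function_model = cbanach E for E :: "'e nspace" (structure) +
  fixes R :: "'e \<Rightarrow> 'm \<Rightarrow> complex" and F :: "'m filter"
  assumes R_add: "x \<in> carrier E \<Longrightarrow> y \<in> carrier E \<Longrightarrow> eventually (\<lambda>w. R (x \<oplus> y) w = R x w + R y w) F"
    and R_scale: "x \<in> carrier E \<Longrightarrow> eventually (\<lambda>w. R (c \<odot> x) w = c * R x w) F"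
begin

lemma R_zero: "eventually (\<lambda>w. R \<zero> w = 0) F"
  using R_scale[of \<zero> 0] by simp

lemma R_finsum:
  assumes "finite I" "\<And>i. i \<in> I \<Longrightarrow> f i \<in> carrier E"
  shows "eventually (\<lambda>w. R (finsum E f I) w = (\<Sum>i\<in>I. R (f i) w)) F"
  using assms
proof (induction I rule: finite_induct)
  case empty
  then show ?case using R_zero by simp
next
  case (insert i I)
  have "eventually (\<lambda>w. R (f i \<oplus> finsum E f I) w = R (f i) w + R (finsum E f I) w) F"
    using insert by (intro R_add finsum_sub_closed) auto
  moreover have "eventually (\<lambda>w. R (finsum E f I) w = (\<Sum>i\<in>I. R (f i) w)) F"
    using insert by auto
  ultimately have "eventually (\<lambda>w. R (f i \<oplus> finsum E f I) w = R (f i) w + (\<Sum>i\<in>I. R (f i) w)) F"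
    by eventually_elim simp
  moreover have "finsum E f (insert i I) = f i \<oplus> finsum E f I"
    using insert by (intro finsum_insert') auto
  ultimately show ?case using insert by simp
qed

lemma R_diff:
  assumes "x \<in> carrier E" "y \<in> carrier E"
  shows "eventually (\<lambda>w. R (x \<ominus> y) w = R x w - R y w) F"
proof -
  have "eventually (\<lambda>w. R (x \<oplus> (-1) \<odot> y) w = R x w + R ((-1) \<odot> y) w) F"
    using assms by (intro R_add) auto
  moreover have "eventually (\<lambda>w. R ((-1) \<odot> y) w = -1 * R y w) F" using assms by (intro R_scale)
  ultimately show ?thesis unfolding diff_eq[OF assms] by eventually_elim simp
qed

end

text \<open>The assumption expresses that operators act like multiplication by a function bounded by
  \<open>M\<close>; stated as domination, it spares the construction of a multiplier.\<close>

locale local_rep = C0_rep E X \<pi> + function_model E R F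
  for E :: "'e nspace" (structure) and X :: "'x topology" and \<pi> and R :: "'e \<Rightarrow> 'm \<Rightarrow> complex" and F +
  assumes local: "a \<in> carrier (C0 X) \<Longrightarrow> \<xi> \<in> carrier E \<Longrightarrow> 0 \<le> M \<Longrightarrow> (\<And>x. x \<in> topspace X \<Longrightarrow> cmod (a x) \<le> M)
      \<Longrightarrow> eventually (\<lambda>w. cmod (R (\<pi> a \<xi>) w) \<le> M * cmod (R \<xi> w)) F"
begin

text \<open>Brings the action of one combined function on one combined vector into the triple sum
  that the hypothesis \<open>H\<close> of \<open>pointwise_matrix_bound\<close> speaks of.\<close>

lemma R_rep_combination:
  assumes fin: "finite I" "finite J" "finite K" and a: "\<And>i j. i \<in> I \<Longrightarrow> j \<in> J \<Longrightarrow> a i j \<in> carrier (C0 X)"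
    and \<xi>: "\<And>k. k \<in> K \<Longrightarrow> \<xi> k \<in> carrier E"
  shows "eventually (\<lambda>w. R (\<pi> (\<lambda>x. \<Sum>i\<in>I. \<Sum>j\<in>J. d i j * a i j x) (finsum E (\<lambda>k. l k \<odot> \<xi> k) K)) w
      = (\<Sum>i\<in>I. \<Sum>j\<in>J. \<Sum>k\<in>K. d i j * l k * R (\<pi> (a i j) (\<xi> k)) w)) F"
proof -
  let ?P = "I \<times> J \<times> K" and ?f = "\<lambda>(i, j, k). (d i j * l k) \<odot> \<pi> (a i j) (\<xi> k)"
  have cl: "?f z \<in> carrier E" if "z \<in> ?P" for z using that a \<xi> by auto
  have y: "finsum E (\<lambda>k. l k \<odot> \<xi> k) K \<in> carrier E" using \<xi> by (intro finsum_sub_closed) auto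
  let ?y = "finsum E (\<lambda>k. l k \<odot> \<xi> k) K"
  have 1: "\<pi> (\<lambda>x. d i j * a i j x) ?y = finsum E (\<lambda>k. (d i j * l k) \<odot> \<pi> (a i j) (\<xi> k)) K"
    if "i \<in> I" "j \<in> J" for i j
  proof -
    have "\<pi> (\<lambda>x. d i j * a i j x) ?y = finsum E (\<lambda>k. \<pi> (\<lambda>x. d i j * a i j x) (l k \<odot> \<xi> k)) K"
      using that a \<xi> fin by (intro rep_finsum C0_scale) auto
    also have "\<dots> = finsum E (\<lambda>k. (d i j * l k) \<odot> \<pi> (a i j) (\<xi> k)) K"
      using that a \<xi> by (intro M.finsum_cong') (auto simp: rep_C0_scale rep_scale scale_scale)
    finally show ?thesis .
  qed
  have ev1: "eventually (\<lambda>w. \<forall>z\<in>?P. R (?f z) w = (case z of (i, j, k) \<Rightarrow> d i j * l k * R (\<pi> (a i j) (\<xi> k)) w)) F"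
    using fin a \<xi> by (intro eventually_ball_finite) (auto intro!: R_scale)
  have "eventually (\<lambda>w. \<forall>z\<in>I \<times> J. R (\<pi> (\<lambda>x. d (fst z) (snd z) * a (fst z) (snd z) x) ?y) w
      = (\<Sum>k\<in>K. R (?f (fst z, snd z, k)) w)) F"
  proof (intro eventually_ball_finite ballI)
    fix z assume z: "z \<in> I \<times> J"
    then have e: "\<pi> (\<lambda>x. d (fst z) (snd z) * a (fst z) (snd z) x) ?y = finsum E (\<lambda>k. ?f (fst z, snd z, k)) K"
      using 1[of "fst z" "snd z"] by auto
    show "eventually (\<lambda>w. R (\<pi> (\<lambda>x. d (fst z) (snd z) * a (fst z) (snd z) x) ?y) w
      = (\<Sum>k\<in>K. R (?f (fst z, snd z, k)) w)) F"
      unfolding e using z cl fin by (intro R_finsum) auto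
  qed (use fin in auto)
  moreover have "eventually (\<lambda>w. R (\<pi> (\<lambda>x. \<Sum>i\<in>I. \<Sum>j\<in>J. d i j * a i j x) ?y) w
      = (\<Sum>z\<in>I\<times>J. R (\<pi> (\<lambda>x. d (fst z) (snd z) * a (fst z) (snd z) x) ?y) w)) F"
  proof -
    have "\<pi> (\<lambda>x. \<Sum>z\<in>I\<times>J. d (fst z) (snd z) * a (fst z) (snd z) x) ?y
        = finsum E (\<lambda>z. \<pi> (\<lambda>x. d (fst z) (snd z) * a (fst z) (snd z) x) ?y) (I \<times> J)"
      using fin a y by (intro rep_C0_sum) (auto intro!: C0_scale)
    moreover have "(\<lambda>x. \<Sum>i\<in>I. \<Sum>j\<in>J. d i j * a i j x) = (\<lambda>x. \<Sum>z\<in>I\<times>J. d (fst z) (snd z) * a (fst z) (snd z) x)"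
      by (simp add: sum.cartesian_product split_def)
    ultimately have e: "\<pi> (\<lambda>x. \<Sum>i\<in>I. \<Sum>j\<in>J. d i j * a i j x) ?y
        = finsum E (\<lambda>z. \<pi> (\<lambda>x. d (fst z) (snd z) * a (fst z) (snd z) x) ?y) (I \<times> J)" by simp
    show ?thesis unfolding e using fin a y by (intro R_finsum) (auto intro!: C0_scale)
  qed
  ultimately show ?thesis using ev1
  proof eventually_elim
    case (elim w)
    have "R (\<pi> (\<lambda>x. \<Sum>i\<in>I. \<Sum>j\<in>J. d i j * a i j x) ?y) w
       = (\<Sum>z\<in>I\<times>J. \<Sum>k\<in>K. R (?f (fst z, snd z, k)) w)"
      unfolding elim(2) using elim(1) by (intro sum.cong refl) blast
    also have "\<dots> = (\<Sum>z\<in>I\<times>J. \<Sum>k\<in>K. d (fst z) (snd z) * l k * R (\<pi> (a (fst z) (snd z)) (\<xi> k)) w)"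
      using elim(3) by (intro sum.cong refl) auto
    also have "\<dots> = (\<Sum>i\<in>I. \<Sum>j\<in>J. \<Sum>k\<in>K. d i j * l k * R (\<pi> (a i j) (\<xi> k)) w)"
      by (rule trans[OF _ sum.cartesian_product[symmetric]]) (simp add: split_def)
    finally show ?case .
  qed
qed

text \<open>For fixed coefficients d and l, locality gives hypothesis \<open>H\<close> of
  \<open>pointwise_matrix_bound\<close> off an exceptional set that depends on them. Coefficients
  from a countable dense set share one exceptional set, by \<open>ctble\<close>, and off it all
  other coefficients follow by continuity.\<close>

lemma local_matrix_bound:
  fixes a :: "'i \<Rightarrow> 'j \<Rightarrow> 'x \<Rightarrow> complex"
  assumes ctble: "\<And>S (P :: ('i \<times> 'j \<Rightarrow> complex) \<times> ('j \<Rightarrow> complex) \<Rightarrow> 'm \<Rightarrow> bool). countable S \<Longrightarrow>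
        (\<And>s. s \<in> S \<Longrightarrow> eventually (P s) F) \<Longrightarrow> eventually (\<lambda>w. \<forall>s\<in>S. P s w) F"
    and fin: "finite I" "finite J" and p: "1 \<le> p" and C0: "0 \<le> C"
    and a: "\<And>i j. i \<in> I \<Longrightarrow> j \<in> J \<Longrightarrow> a i j \<in> carrier (C0 X)"
    and C: "\<And>x c. x \<in> topspace X \<Longrightarrow> lpn p I (\<lambda>i. cmod (\<Sum>j\<in>J. a i j x * c j)) \<le> C * lpn p J (\<lambda>j. cmod (c j))"
    and \<xi>: "\<And>j. j \<in> J \<Longrightarrow> \<xi> j \<in> carrier E"
  shows "eventually (\<lambda>w. lpn p I (\<lambda>i. cmod (R (finsum E (\<lambda>j. \<pi> (a i j) (\<xi> j)) J) w))
      \<le> C * lpn p J (\<lambda>j. cmod (R (\<xi> j) w))) F"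
proof -
  obtain D :: "complex set" where D: "countable D" "\<And>S. open S \<Longrightarrow> S \<noteq> {} \<Longrightarrow> \<exists>z\<in>D. z \<in> S"
    using countable_dense_exists by metis
  have dens: "\<exists>f. (\<forall>n. f n \<in> D) \<and> f \<longlonglongrightarrow> z" for z
  proof -
    have "\<exists>y\<in>D. y \<in> ball z (1 / Suc n)" for n by (intro D(2)) auto
    then obtain f where f: "\<And>n. f n \<in> D \<and> f n \<in> ball z (1 / Suc n)" by metis
    have "f \<longlonglongrightarrow> z"
    proof (rule LIM_zero_cancel, rule LIMSEQ_norm_0)
      fix n show "cmod (f n - z) < 1 / Suc n" using f[of n] by (simp add: dist_norm norm_minus_commute)
    qed
    then show ?thesis using f by blast
  qed
  let ?S = "PiE (I \<times> J) (\<lambda>_. D) \<times> PiE J (\<lambda>_. D)"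
  have cS: "countable ?S" using fin D by (intro countable_SIGMA countable_PiE) auto
  define B where "B i j = nrm (C0 X) (a i j)" for i j
  define N where "N d = (\<Sum>i\<in>I. \<Sum>j\<in>J. cmod (d (i, j)) * B i j)" for d :: "'i \<times> 'j \<Rightarrow> complex"
  have aB: "cmod (a i j x) \<le> B i j" if "i \<in> I" "j \<in> J" for i j x
    unfolding B_def using a[OF that] by (rule C0_le_nrm)
  have dN: "cmod (\<Sum>i\<in>I. \<Sum>j\<in>J. d (i, j) * a i j x) \<le> N d" for d x
    unfolding N_def by (intro sum_norm_le) (auto simp: norm_mult intro!: mult_left_mono aB)
  \<comment> \<open>The least bound for the combined function, with 0 inserted in case
    \<open>topspace X\<close> is empty; it makes \<open>Q\<close> a condition on the coefficients
    alone.\<close>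
  define K where "K d = Sup (insert 0 ((\<lambda>x. cmod (\<Sum>i\<in>I. \<Sum>j\<in>J. d (i, j) * a i j x)) ` topspace X))" for d
  have bdd: "bdd_above (insert 0 ((\<lambda>x. cmod (\<Sum>i\<in>I. \<Sum>j\<in>J. d (i, j) * a i j x)) ` topspace X))" for d
    using dN[of d] by (auto simp: bdd_above_def intro!: exI[of _ "max 0 (N d)"] le_max_iff_disj[THEN iffD2])
  have K: "0 \<le> K d" "x \<in> topspace X \<Longrightarrow> cmod (\<Sum>i\<in>I. \<Sum>j\<in>J. d (i, j) * a i j x) \<le> K d" for d x
    unfolding K_def by (rule cSup_upper[OF _ bdd]; simp)+
  have Kle: "K d \<le> M" if "0 \<le> M" "\<And>x. x \<in> topspace X \<Longrightarrow> cmod (\<Sum>i\<in>I. \<Sum>j\<in>J. d (i, j) * a i j x) \<le> M" for d M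
    unfolding K_def using that by (intro cSup_least) auto
  define Y where "Y w i j k = R (\<pi> (a i j) (\<xi> k)) w" for w i j k
  define Q where "Q s w \<longleftrightarrow> cmod (\<Sum>i\<in>I. \<Sum>j\<in>J. \<Sum>k\<in>J. fst s (i, j) * snd s k * Y w i j k)
      \<le> K (fst s) * cmod (\<Sum>k\<in>J. snd s k * R (\<xi> k) w)" for s w
  have ev1: "eventually (\<lambda>w. \<forall>s\<in>?S. Q s w) F"
  proof (rule ctble[OF cS])
    fix s :: "('i \<times> 'j \<Rightarrow> complex) \<times> ('j \<Rightarrow> complex)"
    let ?d = "\<lambda>i j. fst s (i, j)" and ?l = "snd s"
    let ?b = "\<lambda>x. \<Sum>i\<in>I. \<Sum>j\<in>J. ?d i j * a i j x" and ?y = "finsum E (\<lambda>k. ?l k \<odot> \<xi> k) J"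
    have "eventually (\<lambda>w. cmod (R (\<pi> ?b ?y) w) \<le> K (fst s) * cmod (R ?y w)) F"
      using fin a \<xi> K by (intro local) (auto intro!: C0_sum C0_scale finsum_sub_closed)
    moreover have "eventually (\<lambda>w. R (\<pi> ?b ?y) w = (\<Sum>i\<in>I. \<Sum>j\<in>J. \<Sum>k\<in>J. ?d i j * ?l k * Y w i j k)) F"
      unfolding Y_def using fin a \<xi> by (intro R_rep_combination) auto
    moreover have "eventually (\<lambda>w. R ?y w = (\<Sum>k\<in>J. R (?l k \<odot> \<xi> k) w)) F"
      using fin \<xi> by (intro R_finsum) auto
    moreover have "eventually (\<lambda>w. \<forall>k\<in>J. R (?l k \<odot> \<xi> k) w = ?l k * R (\<xi> k) w) F"
      using fin \<xi> by (intro eventually_ball_finite ballI R_scale) auto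
    ultimately show "eventually (Q s) F"
      unfolding Q_def by eventually_elim simp
  qed
  have "eventually (\<lambda>w. \<forall>i\<in>I. R (finsum E (\<lambda>j. \<pi> (a i j) (\<xi> j)) J) w = (\<Sum>j\<in>J. Y w i j j)) F"
    unfolding Y_def using fin a \<xi> by (intro eventually_ball_finite ballI R_finsum) auto
  with ev1 show ?thesis
  proof eventually_elim
    case (elim w)
    have "lpn p I (\<lambda>i. cmod (\<Sum>j\<in>J. Y w i j j)) \<le> C * lpn p J (\<lambda>j. cmod (R (\<xi> j) w))"
    proof (rule pointwise_matrix_bound[OF fin p C0, where X = "topspace X" and a = a and Y = "Y w" and z = "\<lambda>j. R (\<xi> j) w"])
      fix x c assume "x \<in> topspace X"
      then show "lpn p I (\<lambda>i. cmod (\<Sum>j\<in>J. a i j x * c j)) \<le> C * lpn p J (\<lambda>j. cmod (c j))" by (rule C)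
    next
      fix d l M assume M: "0 \<le> (M::real)"
        "\<And>x. x \<in> topspace X \<Longrightarrow> cmod (\<Sum>i\<in>I. \<Sum>j\<in>J. d i j * a i j x) \<le> M"
      obtain \<delta> where \<delta>: "\<And>z n. \<delta> z n \<in> D" "\<And>z. \<delta> z \<longlonglongrightarrow> z" using dens by metis
      define d' where "d' n = restrict (\<lambda>(i, j). \<delta> (d i j) n) (I \<times> J)" for n
      define l' where "l' n = restrict (\<lambda>k. \<delta> (l k) n) J" for n
      have d': "d' n (i, j) = \<delta> (d i j) n" if "i \<in> I" "j \<in> J" for n i j using that by (simp add: d'_def)
      have l': "l' n k = \<delta> (l k) n" if "k \<in> J" for n k using that by (simp add: l'_def)
      have S: "(d' n, l' n) \<in> ?S" for n using \<delta>(1) by (auto simp: d'_def l'_def)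
      \<comment> \<open>Moving the coefficients into the dense set raises the bound by at most this
        amount, which tends to 0.\<close>
      let ?e = "\<lambda>n. \<Sum>i\<in>I. \<Sum>j\<in>J. cmod (\<delta> (d i j) n - d i j) * B i j"
      have Kd: "K (d' n) \<le> M + ?e n" for n
      proof (rule Kle)
        fix x assume x: "x \<in> topspace X"
        have "(\<Sum>i\<in>I. \<Sum>j\<in>J. d' n (i, j) * a i j x)
            = (\<Sum>i\<in>I. \<Sum>j\<in>J. d i j * a i j x) + (\<Sum>i\<in>I. \<Sum>j\<in>J. (\<delta> (d i j) n - d i j) * a i j x)"
          by (simp add: sum.distrib[symmetric] d' algebra_simps)
        moreover have "cmod (\<Sum>i\<in>I. \<Sum>j\<in>J. (\<delta> (d i j) n - d i j) * a i j x) \<le> ?e n"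
          by (intro sum_norm_le) (auto simp: norm_mult intro!: mult_left_mono aB)
        ultimately show "cmod (\<Sum>i\<in>I. \<Sum>j\<in>J. d' n (i, j) * a i j x) \<le> M + ?e n"
          using norm_triangle_mono[OF M(2)[OF x]] by simp
      next
        have "0 \<le> ?e n" using a by (intro sum_nonneg mult_nonneg_nonneg) (auto simp: B_def)
        then show "0 \<le> M + ?e n" using M by simp
      qed
      have "cmod (\<Sum>i\<in>I. \<Sum>j\<in>J. \<Sum>k\<in>J. \<delta> (d i j) n * \<delta> (l k) n * Y w i j k)
          \<le> (M + ?e n) * cmod (\<Sum>k\<in>J. \<delta> (l k) n * R (\<xi> k) w)" for n
      proof -
        have "Q (d' n, l' n) w" using elim(1) S by blast
        then have "cmod (\<Sum>i\<in>I. \<Sum>j\<in>J. \<Sum>k\<in>J. \<delta> (d i j) n * \<delta> (l k) n * Y w i j k)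
            \<le> K (d' n) * cmod (\<Sum>k\<in>J. \<delta> (l k) n * R (\<xi> k) w)"
          by (simp add: Q_def d' l')
        also have "\<dots> \<le> (M + ?e n) * cmod (\<Sum>k\<in>J. \<delta> (l k) n * R (\<xi> k) w)"
          by (intro mult_right_mono Kd) auto
        finally show ?thesis .
      qed
      note le = this
      have 1: "(\<lambda>n. cmod (\<Sum>i\<in>I. \<Sum>j\<in>J. \<Sum>k\<in>J. \<delta> (d i j) n * \<delta> (l k) n * Y w i j k))
          \<longlonglongrightarrow> cmod (\<Sum>i\<in>I. \<Sum>j\<in>J. \<Sum>k\<in>J. d i j * l k * Y w i j k)"
        by (intro tendsto_norm tendsto_sum tendsto_mult \<delta> tendsto_const)
      have 2: "(\<lambda>n. (M + ?e n) * cmod (\<Sum>k\<in>J. \<delta> (l k) n * R (\<xi> k) w))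
          \<longlonglongrightarrow> (M + (\<Sum>i\<in>I. \<Sum>j\<in>J. cmod (d i j - d i j) * B i j)) * cmod (\<Sum>k\<in>J. l k * R (\<xi> k) w)"
        by (intro tendsto_norm tendsto_sum tendsto_mult tendsto_add tendsto_diff \<delta> tendsto_const)
      from LIMSEQ_le[OF 1 2] le
      show "cmod (\<Sum>i\<in>I. \<Sum>j\<in>J. \<Sum>k\<in>J. d i j * l k * Y w i j k) \<le> M * cmod (\<Sum>k\<in>J. l k * R (\<xi> k) w)"
        by simp
    qed
    moreover have "lpn p I (\<lambda>i. cmod (R (finsum E (\<lambda>j. \<pi> (a i j) (\<xi> j)) J) w)) = lpn p I (\<lambda>i. cmod (\<Sum>j\<in>J. Y w i j j))"
      using elim(2) by (intro lpn_cong) simp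
    ultimately show ?case by simp
  qed
qed

end

text \<open>This is how first-order terms are shown to vanish: at \<theta> = c/L, with L > K and L
  \<ge> |c|, the hypothesis says c^2 L \<le> K c^2.\<close>

lemma linear_le_quadratic:
  fixes c K :: real
  assumes "\<And>\<theta>. \<bar>\<theta>\<bar> \<le> 1 \<Longrightarrow> \<theta> * c \<le> K * \<theta>\<^sup>2"
  shows "c = 0"
proof (rule ccontr)
  assume "c \<noteq> 0"
  define L where "L = \<bar>K\<bar> + \<bar>c\<bar> + 1"
  have L: "L > 0" "K < L" "\<bar>c\<bar> \<le> L" by (auto simp: L_def)
  have "(c / L) * c \<le> K * (c / L)\<^sup>2" using L by (intro assms) (simp add: abs_divide)
  then have "c * c * L \<le> K * (c * c)" using L by (simp add: field_simps power2_eq_square)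
  moreover have "K * (c * c) < L * (c * c)"
    using \<open>c \<noteq> 0\<close> L by (intro mult_strict_right_mono) (auto simp: zero_less_mult_iff)
  ultimately show False by (simp add: mult_ac)
qed

section \<open>Representations on \<open>C\<^sub>0\<close>-spaces\<close>

locale C0_rep_on_C0 = C0_rep E X \<pi> for E :: "'e nspace" (structure) and X :: "'x topology" and \<pi> +
  fixes \<Omega> :: "'m topology" and T :: "'e \<Rightarrow> 'm \<Rightarrow> complex"
  assumes T_lin: "linear_map E (C0 \<Omega>) T" and T_bij: "bij_betw T (carrier E) (carrier (C0 \<Omega>))"
    and T_iso: "x \<in> carrier E \<Longrightarrow> nrm (C0 \<Omega>) (T x) = nrm E x"
begin

lemma T_closed: "x \<in> carrier E \<Longrightarrow> T x \<in> carrier (C0 \<Omega>)"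
  and T_add: "x \<in> carrier E \<Longrightarrow> y \<in> carrier E \<Longrightarrow> T (x \<oplus> y) w = T x w + T y w"
  and T_scale: "x \<in> carrier E \<Longrightarrow> T (c \<odot> x) w = c * T x w"
  using T_lin by (auto simp: linear_map_def)

lemma T_le: "x \<in> carrier E \<Longrightarrow> cmod (T x w) \<le> nrm E x"
  using C0_le_nrm[OF T_closed] T_iso by metis

lemma T_surj: "f \<in> carrier (C0 \<Omega>) \<Longrightarrow> \<exists>x\<in>carrier E. T x = f"
  using T_bij by (metis bij_betw_imp_surj_on imageE)

text \<open>At a peak point of \<open>f\<close>, a Hermitian operator takes a real value.\<close>

lemma peak_real:
  assumes a: "(\<lambda>x. complex_of_real (a x)) \<in> carrier (C0 X)"
    and \<xi>: "\<xi> \<in> carrier E" "nrm E \<xi> \<le> 1" "T \<xi> w = 1"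
  shows "Im (T (\<pi> (\<lambda>x. of_real (a x)) \<xi>) w) = 0"
proof -
  let ?v = "T (\<pi> (\<lambda>x. of_real (a x)) \<xi>) w"
  define K where "K = nrm (C0 X) (\<lambda>x. complex_of_real (a x))"
  have K: "0 \<le> K" "\<bar>a x\<bar> \<le> K" for x using a C0_le_nrm[OF a, of x] by (auto simp: K_def)
  have "\<theta> * (- Im ?v) \<le> K\<^sup>2 * \<theta>\<^sup>2" for \<theta>
  proof -
    have "1 - \<theta> * Im ?v = Re (1 + (\<i> * of_real \<theta>) * ?v)" by simp
    also have "\<dots> \<le> cmod (T (\<xi> \<oplus> (\<i> * of_real \<theta>) \<odot> \<pi> (\<lambda>x. of_real (a x)) \<xi>) w)"
      using \<xi> a complex_Re_le_cmod[of "1 + (\<i> * of_real \<theta>) * ?v"] by (simp add: T_add T_scale)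
    also have "\<dots> \<le> nrm E (\<xi> \<oplus> (\<i> * of_real \<theta>) \<odot> \<pi> (\<lambda>x. of_real (a x)) \<xi>)"
      using \<xi> a by (intro T_le) auto
    also have "\<dots> \<le> (1 + K\<^sup>2 * \<theta>\<^sup>2) * nrm E \<xi>" using K a \<xi> by (intro rep_hermitian) auto
    also have "\<dots> \<le> (1 + K\<^sup>2 * \<theta>\<^sup>2) * 1" using \<xi> by (intro mult_left_mono) auto
    finally show ?thesis by simp
  qed
  from linear_le_quadratic[OF this] show ?thesis by simp
qed

text \<open>\<Omega> is an arbitrary topological space, so the peak function is made from \<zeta>
  itself, by truncating |T \<zeta>| / |T \<zeta> w| at 1.\<close>

lemma peak_exists:
  assumes "\<zeta> \<in> carrier E" "T \<zeta> w \<noteq> 0"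
  obtains \<eta> g where "\<eta> \<in> carrier E" "T \<eta> = (\<lambda>v. complex_of_real (g v))" "g w = 1" "\<And>v. 0 \<le> g v \<and> g v \<le> 1"
proof -
  define c where "c = cmod (T \<zeta> w)"
  have c: "c > 0" using assms by (simp add: c_def)
  define g where "g v = min 1 (cmod (T \<zeta> v) / c)" for v
  have "(\<lambda>v. complex_of_real (g v)) \<in> carrier (C0 \<Omega>)"
    unfolding g_def
    by (rule C0_compose[OF T_closed[OF assms(1)], of "\<lambda>z. complex_of_real (min 1 (cmod z / c))" "1 / c"])
      (use c in \<open>auto intro!: continuous_intros\<close>)
  from T_surj[OF this] obtain \<eta> where "\<eta> \<in> carrier E" "T \<eta> = (\<lambda>v. complex_of_real (g v))" by blast
  moreover have "g w = 1" using c by (simp add: g_def c_def)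
  moreover have "0 \<le> g v \<and> g v \<le> 1" for v using c by (auto simp: g_def)
  ultimately show ?thesis by (rule that)
qed

text \<open>Let f be T \<xi> scaled into the unit ball, so that f w = 0, and let g peak at w. For
  every |\<mu>| = 1 the function g(1 - |f|) + \<mu> f has norm at most 1 and value 1 at w, so by
  \<open>peak_real\<close> its image takes a real value there. This is possible for all such \<mu>
  only if the coefficient of \<mu>, the value of the image of f, is 0.\<close>

lemma rep_real_local:
  assumes a: "(\<lambda>x. complex_of_real (a x)) \<in> carrier (C0 X)"
    and \<xi>: "\<xi> \<in> carrier E" "T \<xi> w = 0"
  shows "T (\<pi> (\<lambda>x. of_real (a x)) \<xi>) w = 0"
proof (rule ccontr)
  let ?H = "\<pi> (\<lambda>x. complex_of_real (a x))"
  assume nz: "T (?H \<xi>) w \<noteq> 0"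
  have H\<xi>: "?H \<xi> \<in> carrier E" using a \<xi> by auto
  obtain \<eta> g where g: "\<eta> \<in> carrier E" "T \<eta> = (\<lambda>v. complex_of_real (g v))" "g w = 1" "\<And>v. 0 \<le> g v \<and> g v \<le> 1"
    using peak_exists[OF H\<xi> nz] by blast
  have pos: "nrm E \<xi> > 0"
  proof (rule ccontr)
    assume "\<not> nrm E \<xi> > 0"
    then have "\<xi> = \<zero>" using nrm_nonneg[OF \<xi>(1)] nrm_eq_0[OF \<xi>(1)] by auto
    then have "?H \<xi> = \<zero>" using a by simp
    then show False using nz T_le[of \<zero> w] by simp
  qed
  define f where "f v = T \<xi> v / of_real (nrm E \<xi>)" for v
  have f1: "cmod (f v) \<le> 1" for v using T_le[OF \<xi>(1), of v] pos by (simp add: f_def norm_divide)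
  have fC: "f \<in> carrier (C0 \<Omega>)"
    using C0_scale[OF T_closed[OF \<xi>(1)], of "1 / of_real (nrm E \<xi>)"] by (simp add: f_def[abs_def])
  have gC: "(\<lambda>v. complex_of_real (g v)) \<in> carrier (C0 \<Omega>)" using T_closed[OF g(1)] g(2) by simp
  let ?G = "\<lambda>v. complex_of_real (g v) - of_real (g v) * of_real (cmod (f v))"
  have "?G \<in> carrier (C0 \<Omega>)" by (intro C0_diff C0_mult gC C0_norm fC)
  then obtain \<zeta> where \<zeta>: "\<zeta> \<in> carrier E" "T \<zeta> = ?G" using T_surj by blast
  let ?c = "of_real (1 / nrm E \<xi>)"
  have real: "Im (T (?H \<zeta>) w + \<mu> * (?c * T (?H \<xi>) w)) = 0" if "cmod \<mu> = 1" for \<mu>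
  proof -
    let ?F = "\<zeta> \<oplus> (\<mu> * ?c) \<odot> \<xi>"
    have F: "?F \<in> carrier E" using \<zeta> \<xi> by auto
    have TF: "T ?F v = ?G v + \<mu> * f v" for v
      using \<zeta> \<xi> by (simp add: T_add T_scale f_def)
    have "Im (T (?H ?F) w) = 0"
    proof (rule peak_real[OF a F])
      show "T ?F w = 1" unfolding TF using g(3) \<xi>(2) by (simp add: f_def)
      have "nrm (C0 \<Omega>) (T ?F) \<le> 1"
      proof (rule C0_nrm_le)
        fix v
        have "?G v = of_real (g v * (1 - cmod (f v)))" by (simp add: algebra_simps)
        then have "cmod (T ?F v) \<le> \<bar>g v * (1 - cmod (f v))\<bar> + cmod (\<mu> * f v)"
          unfolding TF by (metis norm_of_real norm_triangle_ineq)
        also have "\<dots> = g v * (1 - cmod (f v)) + cmod (f v)"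
          using that f1[of v] g(4)[of v] by (simp add: norm_mult)
        also have "\<dots> \<le> 1 * (1 - cmod (f v)) + cmod (f v)"
          using f1[of v] g(4)[of v] by (intro add_mono mult_right_mono) auto
        finally show "cmod (T ?F v) \<le> 1" by simp
      qed
      then show "nrm E ?F \<le> 1" using T_iso[OF F] by simp
    qed
    then show ?thesis using \<zeta> \<xi> a by (simp add: rep_add rep_scale T_add T_scale mult.assoc)
  qed
  define z where "z = ?c * T (?H \<xi>) w"
  \<comment> \<open>Comparing \<mu> = 1 with -1 kills the imaginary part of z, comparing i with -i
    the real part.\<close>
  have "z = 0"
    unfolding complex_eq_iff using real[folded z_def, of 1] real[folded z_def, of "-1"]
      real[folded z_def, of "\<i>"] real[folded z_def, of "-\<i>"] by simp
  then show False using nz pos by (simp add: z_def)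
qed

lemma rep_local:
  assumes a: "a \<in> carrier (C0 X)" and \<xi>: "\<xi> \<in> carrier E" "T \<xi> w = 0"
  shows "T (\<pi> a \<xi>) w = 0"
proof -
  let ?r = "\<lambda>x. complex_of_real (Re (a x))" and ?i = "\<lambda>x. complex_of_real (Im (a x))"
  have "a = (\<lambda>x. ?r x + \<i> * ?i x)" by (simp add: complex_eq_iff fun_eq_iff)
  then have "\<pi> a \<xi> = \<pi> (\<lambda>x. ?r x + \<i> * ?i x) \<xi>" by metis
  also have "\<dots> = \<pi> ?r \<xi> \<oplus> \<i> \<odot> \<pi> ?i \<xi>"
    using C0_Re[OF a] C0_Im[OF a] \<xi> by (simp add: rep_C0_add C0_scale rep_C0_scale)
  finally show ?thesis
    using C0_Re[OF a] C0_Im[OF a] \<xi> by (simp add: T_add T_scale rep_real_local)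
qed

text \<open>By \<open>rep_local\<close> the value of T (\<pi> a \<xi>) at w depends only on T \<xi>
  w, so it may be computed on a multiple of a peak vector of norm at most 1, where the norm bound of
  \<pi> a applies.\<close>

lemma local_rep_T: "local_rep E X \<pi> T (principal {w})"
proof unfold_locales
  fix a \<xi> M assume a: "a \<in> carrier (C0 X)" and \<xi>: "\<xi> \<in> carrier E"
    and M: "0 \<le> M" "\<And>x. x \<in> topspace X \<Longrightarrow> cmod (a x) \<le> M"
  have "cmod (T (\<pi> a \<xi>) w) \<le> M * cmod (T \<xi> w)"
  proof (cases "T \<xi> w = 0")
    case True
    then show ?thesis using rep_local[OF a \<xi>] M by simp
  next
    case False
    obtain \<eta> g where g: "\<eta> \<in> carrier E" "T \<eta> = (\<lambda>v. complex_of_real (g v))" "g w = 1" "\<And>v. 0 \<le> g v \<and> g v \<le> 1"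
      using peak_exists[OF \<xi> False] by blast
    let ?\<zeta> = "\<xi> \<oplus> (- T \<xi> w) \<odot> \<eta>"
    have "T ?\<zeta> w = 0" using g \<xi> by (simp add: T_add T_scale)
    then have "T (\<pi> a ?\<zeta>) w = 0" using g \<xi> a by (intro rep_local) auto
    then have "T (\<pi> a \<xi>) w = T \<xi> w * T (\<pi> a \<eta>) w" using g \<xi> a by (simp add: rep_add rep_scale T_add T_scale)
    moreover have "cmod (T (\<pi> a \<eta>) w) \<le> M"
    proof -
      have "cmod (T (\<pi> a \<eta>) w) \<le> nrm E (\<pi> a \<eta>)" using g a by (intro T_le) auto
      also have "\<dots> \<le> M * nrm E \<eta>" using g a M by (intro rep_bound) auto
      also have "nrm E \<eta> = nrm (C0 \<Omega>) (T \<eta>)" using T_iso[OF g(1)] by simp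
      also have "\<dots> \<le> 1" using g by (intro C0_nrm_le) auto
      finally show ?thesis using M by (simp add: mult_left_mono)
    qed
    ultimately show ?thesis using mult_left_mono[of "cmod (T (\<pi> a \<eta>) w)" M "cmod (T \<xi> w)"] by (simp add: norm_mult mult.commute)
  qed
  then show "eventually (\<lambda>w. cmod (T (\<pi> a \<xi>) w) \<le> M * cmod (T \<xi> w)) (principal {w})"
    by (simp add: eventually_principal)
qed (simp_all add: eventually_principal T_add T_scale)

lemma matrix_bound:
  fixes a :: "'i \<Rightarrow> 'j \<Rightarrow> 'x \<Rightarrow> complex"
  assumes fin: "finite I" "finite J" and C0: "0 \<le> C"
    and a: "\<And>i j. i \<in> I \<Longrightarrow> j \<in> J \<Longrightarrow> a i j \<in> carrier (C0 X)"
    and C: "\<And>x c. x \<in> topspace X \<Longrightarrow> lpn \<infinity> I (\<lambda>i. cmod (\<Sum>j\<in>J. a i j x * c j)) \<le> C * lpn \<infinity> J (\<lambda>j. cmod (c j))"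
    and \<xi>: "\<And>j. j \<in> J \<Longrightarrow> \<xi> j \<in> carrier E"
  shows "lpn \<infinity> I (\<lambda>i. nrm E (finsum E (\<lambda>j. \<pi> (a i j) (\<xi> j)) J)) \<le> C * lpn \<infinity> J (\<lambda>j. nrm E (\<xi> j))"
    (is "lpn \<infinity> I (\<lambda>i. nrm E (?y i)) \<le> C * ?N")
proof -
  have "cmod (T (?y i) w) \<le> C * ?N" if i: "i \<in> I" for i w
  proof -
    interpret local_rep E X \<pi> T "principal {w}" by (rule local_rep_T)
    have "eventually (\<lambda>w. lpn \<infinity> I (\<lambda>i. cmod (T (?y i) w)) \<le> C * lpn \<infinity> J (\<lambda>j. cmod (T (\<xi> j) w))) (principal {w})"
      by (rule local_matrix_bound[OF _ fin _ C0 a C \<xi>]) (auto simp: eventually_principal)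
    then have "lpn \<infinity> I (\<lambda>i. cmod (T (?y i) w)) \<le> C * lpn \<infinity> J (\<lambda>j. cmod (T (\<xi> j) w))"
      by (simp add: eventually_principal)
    also have "\<dots> \<le> C * ?N"
      using fin C0 \<xi> T_le[of _ w] by (intro mult_left_mono lpn_mono) auto
    finally show ?thesis using lpn_member[OF fin(1) _ i, of \<infinity> "\<lambda>i. cmod (T (?y i) w)"] by simp
  qed
  moreover have y: "?y i \<in> carrier E" if "i \<in> I" for i using that a \<xi> by (intro finsum_sub_closed) auto
  ultimately have "nrm E (?y i) \<le> C * ?N" if "i \<in> I" for i
    using C0_nrm_le[of "T (?y i)" "C * ?N" \<Omega>] T_iso[OF y[OF that]] that by simp
  then show ?thesis using fin C0 y by (auto simp: lpn_inf_le_iff)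
qed

end

section \<open>Function models of \<open>L\<^sup>p\<close>-spaces\<close>

text \<open>\<open>R\<close> selects a function from the class of each vector, so linearity holds
  only almost everywhere. \<open>R_surj\<close> allows vectors to be defined by cutting functions
  down to measurable sets.\<close>

locale Lp_model = function_model E R "ae_filter M"
  for E :: "'e nspace" (structure) and R :: "'e \<Rightarrow> 'm \<Rightarrow> complex" and M :: "'m measure" +
  fixes r :: real
  assumes r: "1 \<le> r"
    and R_measurable [measurable]: "x \<in> carrier E \<Longrightarrow> R x \<in> borel_measurable M"
    and R_integrable: "x \<in> carrier E \<Longrightarrow> integrable M (\<lambda>w. cmod (R x w) powr r)"
    and R_nrm: "x \<in> carrier E \<Longrightarrow> (LINT w|M. cmod (R x w) powr r) = nrm E x powr r"
    and R_surj: "f \<in> borel_measurable M \<Longrightarrow> integrable M (\<lambda>w. cmod (f w) powr r)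
      \<Longrightarrow> \<exists>x\<in>carrier E. AE w in M. R x w = f w"

lemma Lp_model_exists:
  fixes E :: "'e nspace" (structure)
  assumes "is_Lp_space TYPE('m) (ereal r) E" "1 \<le> r"
  obtains R and M :: "'m measure" where "Lp_model E R M r"
proof -
  have banach: "complex_banach_space E" using assms by (simp add: is_Lp_space_def)
  then interpret cbanach E by unfold_locales
  obtain M :: "'m measure" and T where T: "linear_map E (Lp M r) T" "bij_betw T (carrier E) (carrier (Lp M r))"
      "\<And>x. x \<in> carrier E \<Longrightarrow> nrm (Lp M r) (T x) = nrm E x"
    using assms by (auto simp: is_Lp_space_def isometrically_isomorphic_def)
  define R where "R x = (SOME f. f \<in> T x)" for x
  let ?D = "{f \<in> borel_measurable M. integrable M (\<lambda>x. cmod (f x) powr r)}"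
  have carr: "carrier (Lp M r) = AE_class M ` ?D" by (simp add: Lp_def)
  have cls: "f \<in> borel_measurable M \<Longrightarrow> f \<in> AE_class M f" for f by (simp add: AE_class_def)
  have RT: "R x \<in> T x" if "x \<in> carrier E" for x
  proof -
    have "T x \<in> AE_class M ` ?D" using T(1) that carr by (auto simp: linear_map_def)
    then have "\<exists>f. f \<in> T x" using cls by blast
    then show ?thesis unfolding R_def by (rule someI_ex)
  qed
  have TxD: "\<exists>f\<in>?D. T x = AE_class M f" if "x \<in> carrier E" for x
  proof -
    have "T x \<in> AE_class M ` ?D" using T(1) that carr by (auto simp: linear_map_def)
    then show ?thesis by blast
  qed
  have same: "AE w in M. g w = R x w" if x: "x \<in> carrier E" and g: "g \<in> T x" for x g
  proof -
    obtain f where "T x = AE_class M f" using TxD[OF x] by blast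
    then have "AE w in M. R x w = f w" "AE w in M. g w = f w" using RT[OF x] g by (auto simp: AE_class_def)
    then show ?thesis by eventually_elim simp
  qed
  have "Lp_model E R M r"
  proof unfold_locales
    fix x y assume x: "x \<in> carrier E" and y: "y \<in> carrier E"
    have "R (x \<oplus> y) \<in> T x \<oplus>\<^bsub>Lp M r\<^esub> T y" using RT[of "x \<oplus> y"] x y T(1) by (simp add: linear_map_def)
    then obtain f g where fg: "f \<in> T x" "g \<in> T y" "R (x \<oplus> y) \<in> AE_class M (\<lambda>w. f w + g w)"
      by (auto simp: Lp_def)
    then have "AE w in M. R (x \<oplus> y) w = f w + g w" by (simp add: AE_class_def)
    with same[OF x fg(1)] same[OF y fg(2)] show "AE w in M. R (x \<oplus> y) w = R x w + R y w"
      by eventually_elim simp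
  next
    fix x c assume x: "x \<in> carrier E"
    have "R (c \<odot> x) \<in> c \<odot>\<^bsub>Lp M r\<^esub> T x" using RT[of "c \<odot> x"] x T(1) by (simp add: linear_map_def)
    then obtain f where fg: "f \<in> T x" "R (c \<odot> x) \<in> AE_class M (\<lambda>w. c * f w)"
      by (auto simp: Lp_def)
    then have "AE w in M. R (c \<odot> x) w = c * f w" by (simp add: AE_class_def)
    with same[OF x fg(1)] show "AE w in M. R (c \<odot> x) w = c * R x w"
      by eventually_elim simp
  next
    fix x assume x: "x \<in> carrier E"
    obtain f where f: "f \<in> ?D" "T x = AE_class M f" using TxD[OF x] by blast
    then have R: "R x \<in> borel_measurable M" "AE w in M. R x w = f w" using RT[OF x] by (auto simp: AE_class_def)
    show "R x \<in> borel_measurable M" by fact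
    have [measurable]: "R x \<in> borel_measurable M" "f \<in> borel_measurable M" using R f by auto
    have "integrable M (\<lambda>w. cmod (R x w) powr r) \<longleftrightarrow> integrable M (\<lambda>w. cmod (f w) powr r)"
      using R(2) by (intro integrable_cong_AE) auto
    then show "integrable M (\<lambda>w. cmod (R x w) powr r)" using f by simp
    have "nrm E x = (LINT w|M. cmod (R x w) powr r) powr (1 / r)"
      using T(3)[OF x] by (simp add: Lp_def R_def)
    moreover have "0 \<le> (LINT w|M. cmod (R x w) powr r)" by simp
    ultimately show "(LINT w|M. cmod (R x w) powr r) = nrm E x powr r"
      using assms(2) by (simp add: powr_powr)
  next
    fix f assume f: "f \<in> borel_measurable M" "integrable M (\<lambda>w. cmod (f w) powr r)"
    then have "AE_class M f \<in> T ` carrier E" using T(2) carr by (auto simp: bij_betw_def)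
    then obtain x where x: "x \<in> carrier E" "T x = AE_class M f" by auto
    then have "R x \<in> AE_class M f" using RT by metis
    then show "\<exists>x\<in>carrier E. AE w in M. R x w = f w" using x(1) by (auto simp: AE_class_def)
  qed (use assms in auto)
  then show ?thesis by (rule that)
qed

text \<open>\<open>x \<mapsto> star r \<circ> x\<close> is the duality map of \<open>L\<^sup>r\<close>, up to normalisation.\<close>

definition star :: "real \<Rightarrow> complex \<Rightarrow> complex" where
  "star r z = cnj z * of_real (cmod z powr (r - 2))"

lemma star_0 [simp]: "star r 0 = 0"
  by (simp add: star_def)

lemma star_2 [simp]: "star 2 z = cnj z"
  by (cases "z = 0") (simp_all add: star_def)

lemma norm_star: "cmod (star r z) = cmod z powr (r - 1)"
proof (cases "z = 0")
  case False
  then have "cmod z * cmod z powr (r - 2) = cmod z powr (1 + (r - 2))"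
    by (subst powr_add) simp
  then show ?thesis by (simp add: star_def norm_mult)
qed simp

lemma mult_star: "z * star r z = of_real (cmod z powr r)"
proof (cases "z = 0")
  case False
  then have "cmod z ^ 2 * cmod z powr (r - 2) = cmod z powr (2 + (r - 2))"
    by (subst powr_add) (simp add: powr_numeral)
  moreover have "z * star r z = of_real (cmod z ^ 2 * cmod z powr (r - 2))"
    using complex_norm_square[of z] by (simp add: star_def mult_ac)
  ultimately show ?thesis by simp
qed simp

lemma star_unit_mult: "cmod c = 1 \<Longrightarrow> star r (c * z) = cnj c * star r z"
  by (simp add: star_def norm_mult)

text \<open>Positive scalars come out with the power r - 1, phases only conjugated.
  \<open>pairing_disjoint\<close> exploits this discrepancy when r \<noteq> 2.\<close>

lemma star_pos_mult:
  assumes "0 < t"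
  shows "star r (of_real t * z) = of_real (t powr (r - 1)) * star r z"
proof -
  have "t * t powr (r - 2) = t powr (1 + (r - 2))" using assms by (subst powr_add) simp
  then have e: "complex_of_real t * of_real (t powr (r - 2)) = of_real (t powr (r - 1))"
    by (metis add_diff_eq diff_add_eq of_real_mult one_add_one add_diff_cancel_left diff_diff_eq2 add.commute)
  show ?thesis
    using assms by (simp add: star_def norm_mult powr_mult e[symmetric])
qed

text \<open>r Re (w * star r z) is the derivative of |.|^r at z in direction w, and convexity keeps
  the tangent below the graph.\<close>

lemma Re_mult_star_le:
  assumes "1 \<le> r"
  shows "r * Re (w * star r z) \<le> (r - 1) * cmod z powr r + cmod w powr r"
proof -
  have "Re (w * star r z) \<le> cmod z powr (r - 1) * cmod w"
    using complex_Re_le_cmod[of "w * star r z"] by (simp add: norm_mult norm_star mult.commute)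
  then have "r * Re (w * star r z) \<le> r * (cmod z powr (r - 1) * cmod w)"
    using assms by (intro mult_left_mono) auto
  also have "\<dots> \<le> (r - 1) * cmod z powr r + cmod w powr r" using assms by (intro powr_tangent) auto
  finally show ?thesis .
qed

lemma norm_mult_star_le:
  assumes "1 \<le> r"
  shows "cmod (w * star r z) \<le> cmod z powr r + cmod w powr r"
proof -
  have "r * cmod (w * star r z) \<le> (r - 1) * cmod z powr r + cmod w powr r"
    using powr_tangent[OF assms, of "cmod z" "cmod w"] by (simp add: norm_mult norm_star mult.commute)
  also have "\<dots> \<le> r * cmod z powr r + r * cmod w powr r"
    using assms mult_right_mono[of 1 r "cmod w powr r"] by (intro add_mono mult_right_mono) auto
  finally have "r * cmod (w * star r z) \<le> r * (cmod z powr r + cmod w powr r)" by (simp add: distrib_left)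
  then show ?thesis using assms by simp
qed

lemma star_measurable [measurable]: "star r \<in> borel_measurable borel"
proof -
  have "cnj \<in> borel_measurable borel" "complex_of_real \<in> borel_measurable borel"
    by (intro borel_measurable_continuous_onI continuous_intros)+
  moreover have "(\<lambda>z::complex. cmod z powr (r - 2)) \<in> borel_measurable borel" by measurable
  ultimately show ?thesis
    unfolding star_def[abs_def] by (intro borel_measurable_times) (auto dest: measurable_compose)
qed

context Lp_model
begin

lemma pairing_integrable:
  assumes x: "x \<in> carrier E" and g: "g \<in> borel_measurable M" "integrable M (\<lambda>w. cmod (g w) powr r)"
  shows "integrable M (\<lambda>w. R x w * star r (g w))"
proof (rule Bochner_Integration.integrable_bound[of M "\<lambda>w. cmod (g w) powr r + cmod (R x w) powr r"])
  show "integrable M (\<lambda>w. cmod (g w) powr r + cmod (R x w) powr r)" using x g R_integrable by auto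
  show "(\<lambda>w. R x w * star r (g w)) \<in> borel_measurable M" using x g by measurable
  show "AE w in M. norm (R x w * star r (g w)) \<le> norm (cmod (g w) powr r + cmod (R x w) powr r)"
    using norm_mult_star_le[OF r] by (intro always_eventually allI) (simp add: order_trans[OF _ abs_ge_self])
qed

text \<open>Lumer's semi-inner product of L^r without its normalising factor: linear in x, and
  giving the r-th power of the norm on the diagonal. For r = 2 it is the inner product.\<close>

definition pairing :: "'e \<Rightarrow> 'e \<Rightarrow> complex" where
  "pairing x y = (LINT w|M. R x w * star r (R y w))"

lemma pairing_int: "x \<in> carrier E \<Longrightarrow> y \<in> carrier E \<Longrightarrow> integrable M (\<lambda>w. R x w * star r (R y w))"
  by (intro pairing_integrable R_measurable R_integrable)

lemma pairing_self: "x \<in> carrier E \<Longrightarrow> pairing x x = of_real (nrm E x powr r)"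
  by (simp add: pairing_def mult_star R_nrm)

lemma pairing_combination:
  assumes x: "x \<in> carrier E" "y \<in> carrier E" "z \<in> carrier E"
  shows "pairing (a \<odot> x \<oplus> b \<odot> y) z = a * pairing x z + b * pairing y z"
proof -
  have "AE w in M. R (a \<odot> x \<oplus> b \<odot> y) w * star r (R z w) = a * (R x w * star r (R z w)) + b * (R y w * star r (R z w))"
    using R_add[of "a \<odot> x" "b \<odot> y"] R_scale[of x a] R_scale[of y b] x
    by (auto simp: algebra_simps elim!: eventually_elim2 intro: eventually_rev_mp)
  then have "pairing (a \<odot> x \<oplus> b \<odot> y) z = (LINT w|M. a * (R x w * star r (R z w)) + b * (R y w * star r (R z w)))"
    unfolding pairing_def using x by (intro integral_cong_AE) auto
  also have "\<dots> = a * pairing x z + b * pairing y z"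
    using pairing_int x by (simp add: pairing_def)
  finally show ?thesis .
qed

text \<open>Integrated form of \<open>Re_mult_star_le\<close>: pairing with x supports the convex
  function norm^r at x. For r = 2 it replaces the Cauchy-Schwarz inequality.\<close>

lemma pairing_tangent:
  assumes "x \<in> carrier E" "y \<in> carrier E"
  shows "r * Re (pairing y x) \<le> (r - 1) * nrm E x powr r + nrm E y powr r"
proof -
  have "r * Re (pairing y x) = (LINT w|M. r * Re (R y w * star r (R x w)))"
    using integral_Re[OF pairing_int[OF assms(2,1)]] by (simp add: pairing_def del: times_complex.sel)
  also have "\<dots> \<le> (LINT w|M. (r - 1) * cmod (R x w) powr r + cmod (R y w) powr r)"
    using pairing_int assms R_integrable Re_mult_star_le[OF r]
    by (intro integral_mono) (auto simp del: times_complex.sel)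
  also have "\<dots> = (r - 1) * nrm E x powr r + nrm E y powr r"
    using assms R_integrable by (simp add: R_nrm)
  finally show ?thesis .
qed

end

section \<open>Hermitian operators and the duality pairing of L^r\<close>

locale C0_rep_on_Lp = C0_rep E X \<pi> + Lp_model E R M r
  for E :: "'e nspace" (structure) and X :: "'x topology" and \<pi> and R :: "'e \<Rightarrow> 'm \<Rightarrow> complex" and M r
begin

text \<open>Apply \<open>pairing_tangent\<close> at \<xi> to \<xi> + i\<theta>H\<xi>. The left side
  moves by \<theta> times the imaginary part in question, while norm^r grows by O(\<theta>^2) only,
  by \<open>rep_hermitian\<close>. So H has real numerical range.\<close>

lemma pairing_real:
  assumes a: "(\<lambda>x. complex_of_real (a x)) \<in> carrier (C0 X)" and x: "\<xi> \<in> carrier E"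
  shows "Im (pairing (\<pi> (\<lambda>x. of_real (a x)) \<xi>) \<xi>) = 0"
proof -
  let ?H = "\<pi> (\<lambda>x. complex_of_real (a x))"
  define K where "K = nrm (C0 X) (\<lambda>x. complex_of_real (a x))"
  have K: "0 \<le> K" "\<bar>a x\<bar> \<le> K" for x using a C0_le_nrm[OF a, of x] by (auto simp: K_def)
  have Hx: "?H \<xi> \<in> carrier E" using a x by auto
  have "\<theta> * (- Im (pairing (?H \<xi>) \<xi>)) \<le> (1 + K\<^sup>2) powr (r - 1) * K\<^sup>2 * nrm E \<xi> powr r * \<theta>\<^sup>2" if \<theta>: "\<bar>\<theta>\<bar> \<le> 1" for \<theta>
  proof -
    let ?c = "\<i> * complex_of_real \<theta>" and ?b = "1 + K\<^sup>2 * \<theta>\<^sup>2"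
    let ?y = "1 \<odot> \<xi> \<oplus> ?c \<odot> ?H \<xi>"
    have y: "?y \<in> carrier E" using x Hx by auto
    have b: "1 \<le> ?b" by simp
    have "?b \<le> 1 + K\<^sup>2" using \<theta> mult_left_mono[of "\<theta>\<^sup>2" 1 "K\<^sup>2"] by (simp add: abs_square_le_1)
    then have bb: "?b powr (r - 1) \<le> (1 + K\<^sup>2) powr (r - 1)" using r b by (intro powr_mono2) auto
    have "nrm E ?y \<le> ?b * nrm E \<xi>" using rep_hermitian[OF a K x, of \<theta>] x by simp
    then have ny: "nrm E ?y powr r \<le> ?b powr r * nrm E \<xi> powr r"
      using r y x b by (subst powr_mult[symmetric]) (auto intro!: powr_mono2)
    have "pairing ?y \<xi> = of_real (nrm E \<xi> powr r) + ?c * pairing (?H \<xi>) \<xi>"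
      using x Hx by (simp only: pairing_combination pairing_self mult_1)
    then have "r * (nrm E \<xi> powr r - \<theta> * Im (pairing (?H \<xi>) \<xi>)) \<le> (r - 1) * nrm E \<xi> powr r + nrm E ?y powr r"
      using pairing_tangent[OF x y] by simp
    then have "r * (\<theta> * (- Im (pairing (?H \<xi>) \<xi>))) \<le> nrm E ?y powr r - nrm E \<xi> powr r" by (simp add: algebra_simps)
    also have "\<dots> \<le> (?b powr r - 1) * nrm E \<xi> powr r" using ny by (simp add: algebra_simps)
    \<comment> \<open>Convexity again: b^r - 1 \<le> r b^(r-1) (b - 1) is the tangent inequality at
      b, evaluated at 1.\<close>
    also have "?b powr r - 1 \<le> r * (?b powr (r - 1) * (K\<^sup>2 * \<theta>\<^sup>2))"
    proof -
      have "?b powr (r - 1) * (K\<^sup>2 * \<theta>\<^sup>2) = ?b powr r - ?b powr (r - 1)"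
        using powr_diff_one_mult[of ?b r] by (simp add: algebra_simps)
      then show ?thesis using powr_tangent[OF r, of ?b 1] by (simp add: left_diff_distrib right_diff_distrib)
    qed
    also have "\<dots> \<le> r * ((1 + K\<^sup>2) powr (r - 1) * (K\<^sup>2 * \<theta>\<^sup>2))"
      using bb r by (intro mult_left_mono mult_right_mono) auto
    finally have "r * (\<theta> * (- Im (pairing (?H \<xi>) \<xi>))) \<le> r * ((1 + K\<^sup>2) powr (r - 1) * (K\<^sup>2 * \<theta>\<^sup>2)) * nrm E \<xi> powr r"
      by (simp add: mult_right_mono)
    then have "r * (\<theta> * (- Im (pairing (?H \<xi>) \<xi>))) \<le> r * ((1 + K\<^sup>2) powr (r - 1) * K\<^sup>2 * nrm E \<xi> powr r * \<theta>\<^sup>2)"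
      by (simp only: mult_ac)
    then show ?thesis using r by (subst (asm) mult_le_cancel_left_pos) auto
  qed
  from linear_le_quadratic[OF this] show ?thesis by simp
qed

text \<open>A polarisation argument: expand the pairing of Hz with z for z = t x + c y. The diagonal
  terms are real, so the mixed ones are too. The assumption on \<open>star\<close> is what the
  expansion needs; it is met by disjoint supports with s = t^(r-1), and by r = 2 with s = t =
  1.\<close>

lemma pairing_cross:
  assumes a: "(\<lambda>x. complex_of_real (a x)) \<in> carrier (C0 X)" and x: "x \<in> carrier E" "y \<in> carrier E"
    and star: "AE w in M. star r (of_real t * R x w + c * R y w)
      = of_real s * star r (R x w) + cnj c * star r (R y w)"
    and c: "cmod c = 1"
  shows "Im (of_real t * cnj c * pairing (\<pi> (\<lambda>x. of_real (a x)) x) y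
      + c * of_real s * pairing (\<pi> (\<lambda>x. of_real (a x)) y) x) = 0"
proof -
  let ?H = "\<pi> (\<lambda>x. complex_of_real (a x))"
  let ?z = "of_real t \<odot> x \<oplus> c \<odot> y"
  have z: "?z \<in> carrier E" using x by auto
  have Hxy: "?H x \<in> carrier E" "?H y \<in> carrier E" using a x by auto
  have int: "pairing u ?z = of_real s * pairing u x + cnj c * pairing u y" if u: "u \<in> carrier E" for u
  proof -
    have "AE w in M. R u w * star r (R ?z w) = of_real s * (R u w * star r (R x w)) + cnj c * (R u w * star r (R y w))"
      using R_add[of "of_real t \<odot> x" "c \<odot> y", OF scale_closed[OF x(1)] scale_closed[OF x(2)]]
        R_scale[OF x(1), of "of_real t"] R_scale[OF x(2), of c] star
      by eventually_elim (simp add: algebra_simps)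
    then have "pairing u ?z = (LINT w|M. of_real s * (R u w * star r (R x w)) + cnj c * (R u w * star r (R y w)))"
      unfolding pairing_def using x u z by (intro integral_cong_AE) auto
    also have "\<dots> = of_real s * pairing u x + cnj c * pairing u y"
      using pairing_int x u by (simp add: pairing_def)
    finally show ?thesis .
  qed
  have "?H ?z = of_real t \<odot> ?H x \<oplus> c \<odot> ?H y" using a x by (simp add: rep_add rep_scale)
  then have "pairing (?H ?z) ?z = of_real t * pairing (?H x) ?z + c * pairing (?H y) ?z"
    using pairing_combination Hxy z by simp
  also have "\<dots> = of_real t * of_real s * pairing (?H x) x + c * cnj c * pairing (?H y) y
      + (of_real t * cnj c * pairing (?H x) y + c * of_real s * pairing (?H y) x)"
    using int Hxy by (simp add: algebra_simps)
  finally have e: "pairing (?H ?z) ?z = of_real t * of_real s * pairing (?H x) x + c * cnj c * pairing (?H y) y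
      + (of_real t * cnj c * pairing (?H x) y + c * of_real s * pairing (?H y) x)" .
  have "c * cnj c = 1" using c complex_norm_square[of c] by simp
  then have "Im (of_real t * of_real s * pairing (?H x) x + c * cnj c * pairing (?H y) y) = 0"
    using pairing_real[OF a x(1)] pairing_real[OF a x(2)] by (simp only: Im_complex_of_real) simp
  then show ?thesis using e pairing_real[OF a z] by simp
qed

end

context Lp_model
begin

text \<open>Raising to the power r and integrating exchanges the l^r-sum with the L^r-norm, because
  the exponents of the sequence space and of \<open>E\<close> agree.\<close>

lemma lpn_integrate:
  assumes fin: "finite I" "finite J" and C: "0 \<le> C"
    and y: "\<And>i. i \<in> I \<Longrightarrow> y i \<in> carrier E" and \<xi>: "\<And>j. j \<in> J \<Longrightarrow> \<xi> j \<in> carrier E"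
    and ae: "AE w in M. lpn (ereal r) I (\<lambda>i. cmod (R (y i) w)) \<le> C * lpn (ereal r) J (\<lambda>j. cmod (R (\<xi> j) w))"
  shows "lpn (ereal r) I (\<lambda>i. nrm E (y i)) \<le> C * lpn (ereal r) J (\<lambda>j. nrm E (\<xi> j))"
proof -
  have CJ: "(C * lpn (ereal r) J v) powr r = C powr r * (\<Sum>j\<in>J. \<bar>v j\<bar> powr r)" for v
    using C fin r by (simp add: powr_mult lpn_powr)
  have "(\<Sum>i\<in>I. nrm E (y i) powr r) = (LINT w|M. (\<Sum>i\<in>I. cmod (R (y i) w) powr r))"
    using y R_integrable by (simp add: R_nrm)
  also have "\<dots> \<le> (LINT w|M. C powr r * (\<Sum>j\<in>J. cmod (R (\<xi> j) w) powr r))"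
  proof (rule integral_mono_AE)
    show "AE w in M. (\<Sum>i\<in>I. cmod (R (y i) w) powr r) \<le> C powr r * (\<Sum>j\<in>J. cmod (R (\<xi> j) w) powr r)"
      using ae
    proof eventually_elim
      case (elim w)
      then have "(\<Sum>i\<in>I. \<bar>cmod (R (y i) w)\<bar> powr r) \<le> (C * lpn (ereal r) J (\<lambda>j. cmod (R (\<xi> j) w))) powr r"
        using C fin r by (intro iffD1[OF lpn_real_le_iff]) auto
      then show ?case unfolding CJ by simp
    qed
  qed (use y \<xi> R_integrable in auto)
  also have "\<dots> = C powr r * (\<Sum>j\<in>J. nrm E (\<xi> j) powr r)"
    using \<xi> R_integrable by (simp add: R_nrm)
  finally have "(\<Sum>i\<in>I. \<bar>nrm E (y i)\<bar> powr r) \<le> (C * lpn (ereal r) J (\<lambda>j. nrm E (\<xi> j))) powr r"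
    unfolding CJ using y \<xi> by simp
  then show ?thesis using C fin r by (intro iffD2[OF lpn_real_le_iff]) auto
qed

lemma R_nrm_le:
  assumes "x \<in> carrier E" "y \<in> carrier E" "0 \<le> C" "nrm E x \<le> C * nrm E y"
  shows "(LINT w|M. cmod (R x w) powr r) \<le> C powr r * (LINT w|M. cmod (R y w) powr r)"
  using assms r powr_mono2[of r "nrm E x" "C * nrm E y"] by (simp add: R_nrm powr_mult)

text \<open>Multiplication by an indicator function, realised inside \<open>E\<close>: the source of
  the disjointly supported vectors on which locality is tested.\<close>

lemma R_restrict:
  assumes x: "x \<in> carrier E" and S: "S \<in> sets M"
  obtains y where "y \<in> carrier E" "AE w in M. R y w = (if w \<in> S then R x w else 0)"
proof -
  have [measurable]: "S \<in> sets M" "R x \<in> borel_measurable M" using S x by auto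
  have "\<exists>y\<in>carrier E. AE w in M. R y w = (if w \<in> S then R x w else 0)"
  proof (rule R_surj)
    show "integrable M (\<lambda>w. cmod (if w \<in> S then R x w else 0) powr r)"
      by (rule Bochner_Integration.integrable_bound[OF R_integrable[OF x]]) (auto intro!: AE_I2)
  qed measurable
  then show ?thesis using that by blast
qed

end

context C0_rep_on_Lp
begin

text \<open>For \<open>r \<noteq> 2\<close> the duality map is not real linear, and Hermitian operators are local.\<close>

lemma pairing_disjoint:
  assumes r2: "r \<noteq> 2" and a: "(\<lambda>x. complex_of_real (a x)) \<in> carrier (C0 X)"
    and x: "x \<in> carrier E" "y \<in> carrier E" and dis: "AE w in M. R x w = 0 \<or> R y w = 0"
  shows "pairing (\<pi> (\<lambda>x. of_real (a x)) y) x = 0"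
proof -
  let ?A = "pairing (\<pi> (\<lambda>x. of_real (a x)) x) y" and ?B = "pairing (\<pi> (\<lambda>x. of_real (a x)) y) x"
  have cross: "Im (of_real t * cnj c * ?A + c * of_real (t powr (r - 1)) * ?B) = 0" if t: "0 < t" and c: "cmod c = 1" for t c
  proof (rule pairing_cross[OF a x _ c])
    show "AE w in M. star r (of_real t * R x w + c * R y w)
        = of_real (t powr (r - 1)) * star r (R x w) + cnj c * star r (R y w)"
      using dis by eventually_elim (auto simp: star_unit_mult[OF c] star_pos_mult[OF t])
  qed
  \<comment> \<open>t = 2 adds a second pair of equations, in which the weights are 2 and 2^(r-1).
    The systems for the real and for the imaginary parts are nonsingular because 2^(r-1) \<noteq>
    2.\<close>
  define s where "s = (2::real) powr (r - 1)"
  have "s \<noteq> 2"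
  proof
    assume "s = 2"
    then have "(2::real) powr (r - 1) = 2 powr 1" by (simp add: s_def)
    then show False using r2 by (subst (asm) powr_inj) auto
  qed
  have "Im ?A + Im ?B = 0" "Re ?B - Re ?A = 0" "2 * Im ?A + s * Im ?B = 0" "s * Re ?B - 2 * Re ?A = 0"
    using cross[of 1 1] cross[of 1 \<i>] cross[of 2 1] cross[of 2 \<i>] by (auto simp: s_def)
  moreover have "q = 0 \<and> b = 0" if "p + q = 0" "b - a = 0" "2 * p + s * q = 0" "s * b - 2 * a = 0" for p q a b :: real
  proof -
    have "(s - 2) * q = (2 * p + s * q) - 2 * (p + q)" "(s - 2) * b = (s * b - 2 * a) - 2 * (b - a)"
      by (simp_all add: algebra_simps)
    then have "(s - 2) * q = 0" "(s - 2) * b = 0" unfolding that by simp_all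
    with \<open>s \<noteq> 2\<close> show ?thesis by simp
  qed
  ultimately have "Im ?B = 0 \<and> Re ?B = 0" by blast
  then show ?thesis by (simp add: complex_eq_iff)
qed

text \<open>Let x be Hy cut down to the zero set of y. It is disjoint from y, so the pairing of Hy
  with x is 0; but this pairing is the integral of |x|^r.\<close>

lemma rep_real_local_AE:
  assumes r2: "r \<noteq> 2" and a: "(\<lambda>x. complex_of_real (a x)) \<in> carrier (C0 X)" and y: "y \<in> carrier E"
  shows "AE w in M. R y w = 0 \<longrightarrow> R (\<pi> (\<lambda>x. of_real (a x)) y) w = 0"
proof -
  let ?Hy = "\<pi> (\<lambda>x. complex_of_real (a x)) y"
  have Hy: "?Hy \<in> carrier E" using a y by auto
  have [measurable]: "R y \<in> borel_measurable M" "R ?Hy \<in> borel_measurable M" using y Hy by auto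
  let ?S = "{w \<in> space M. R y w = 0}"
  have S: "?S \<in> sets M" by measurable
  obtain x where x: "x \<in> carrier E" "AE w in M. R x w = (if w \<in> ?S then R ?Hy w else 0)"
    by (rule R_restrict[OF Hy S])
  have "AE w in M. R x w = 0 \<or> R y w = 0" using x(2) by eventually_elim auto
  then have "0 = pairing ?Hy x" using pairing_disjoint[OF r2 a x(1) y] by simp
  also have "\<dots> = (LINT w|M. complex_of_real (cmod (R x w) powr r))"
    unfolding pairing_def
  proof (rule integral_cong_AE)
    show "AE w in M. R ?Hy w * star r (R x w) = complex_of_real (cmod (R x w) powr r)"
      using x(2) by eventually_elim (auto simp: mult_star)
  qed (use x Hy in auto)
  finally have "(LINT w|M. cmod (R x w) powr r) = 0" by simp
  then have "AE w in M. cmod (R x w) powr r = 0"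
    by (subst (asm) integral_nonneg_eq_0_iff_AE[OF R_integrable[OF x(1)]]) auto
  with x(2) AE_space show ?thesis by eventually_elim auto
qed

lemma rep_local_AE:
  assumes r2: "r \<noteq> 2" and a: "a \<in> carrier (C0 X)" and y: "y \<in> carrier E"
  shows "AE w in M. R y w = 0 \<longrightarrow> R (\<pi> a y) w = 0"
proof -
  let ?r = "\<lambda>x. complex_of_real (Re (a x))" and ?i = "\<lambda>x. complex_of_real (Im (a x))"
  have cl: "\<pi> ?r y \<in> carrier E" "\<pi> ?i y \<in> carrier E" using C0_Re[OF a] C0_Im[OF a] y by auto
  have "a = (\<lambda>x. ?r x + \<i> * ?i x)" by (simp add: complex_eq_iff fun_eq_iff)
  then have "\<pi> a y = \<pi> (\<lambda>x. ?r x + \<i> * ?i x) y" by metis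
  also have "\<dots> = \<pi> ?r y \<oplus> \<i> \<odot> \<pi> ?i y"
    using C0_Re[OF a] C0_Im[OF a] y by (simp add: rep_C0_add C0_scale rep_C0_scale)
  finally have e: "\<pi> a y = \<pi> ?r y \<oplus> \<i> \<odot> \<pi> ?i y" .
  show ?thesis unfolding e
    using R_add[OF cl(1) scale_closed[OF cl(2)], of \<i>] R_scale[OF cl(2), of \<i>]
      rep_real_local_AE[OF r2 C0_Re[OF a] y] rep_real_local_AE[OF r2 C0_Im[OF a] y]
    by eventually_elim simp
qed

text \<open>On the set S where the bound fails, locality allows y to be replaced by its restriction
  y1 to S. The norm bound for y1 then says that a function positive on S and 0 elsewhere has
  integral at most 0, so S is null.\<close>

lemma rep_bound_AE:
  assumes r2: "r \<noteq> 2" and a: "a \<in> carrier (C0 X)" and y: "y \<in> carrier E"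
    and K: "0 \<le> K" "\<And>x. x \<in> topspace X \<Longrightarrow> cmod (a x) \<le> K"
  shows "AE w in M. cmod (R (\<pi> a y) w) \<le> K * cmod (R y w)"
proof -
  have Ay: "\<pi> a y \<in> carrier E" using a y by auto
  have [measurable]: "R y \<in> borel_measurable M" "R (\<pi> a y) \<in> borel_measurable M" using y Ay by auto
  define S where "S = {w \<in> space M. K * cmod (R y w) < cmod (R (\<pi> a y) w)}"
  have S [measurable]: "S \<in> sets M" unfolding S_def by measurable
  obtain y1 where y1: "y1 \<in> carrier E" "AE w in M. R y1 w = (if w \<in> S then R y w else 0)"
    by (rule R_restrict[OF y S])
  let ?y2 = "y \<ominus> y1"
  have y2: "?y2 \<in> carrier E" using y y1 by auto
  have A1: "\<pi> a y1 \<in> carrier E" and A2: "\<pi> a ?y2 \<in> carrier E" using a y1 y2 by auto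
  have "\<pi> a y = \<pi> a (?y2 \<oplus> y1)" using y y1 by (simp add: diff_add_cancel)
  then have split: "\<pi> a y = \<pi> a ?y2 \<oplus> \<pi> a y1" using y1 y2 a by (simp add: rep_add)
  have on: "AE w in M. w \<in> S \<longrightarrow> R (\<pi> a y) w = R (\<pi> a y1) w"
    using R_diff[OF y y1(1)] y1(2) rep_local_AE[OF r2 a y2] R_add[OF A2 A1] unfolding split[symmetric]
    by eventually_elim simp
  let ?g = "\<lambda>w. if w \<in> S then cmod (R (\<pi> a y) w) powr r - K powr r * cmod (R y w) powr r else 0"
  have pos: "0 < ?g w" if "w \<in> S" for w
  proof -
    have "(K * cmod (R y w)) powr r < cmod (R (\<pi> a y) w) powr r"
      using that r K by (intro powr_less_mono2) (auto simp: S_def)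
    then show ?thesis using that K by (simp add: powr_mult)
  qed
  then have nonneg: "0 \<le> ?g w" for w by (cases "w \<in> S") (auto intro: less_imp_le)
  have i1: "integrable M (\<lambda>w. cmod (R (\<pi> a y1) w) powr r)" "integrable M (\<lambda>w. cmod (R y1 w) powr r)"
    using A1 y1 R_integrable by auto
  have le: "AE w in M. ?g w \<le> cmod (R (\<pi> a y1) w) powr r - K powr r * cmod (R y1 w) powr r"
    using on y1(2) by eventually_elim auto
  have gint: "integrable M ?g"
  proof (rule Bochner_Integration.integrable_bound)
    show "integrable M (\<lambda>w. cmod (R (\<pi> a y1) w) powr r - K powr r * cmod (R y1 w) powr r)" using i1 by auto
    show "AE w in M. norm (?g w) \<le> norm (cmod (R (\<pi> a y1) w) powr r - K powr r * cmod (R y1 w) powr r)"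
      using le by eventually_elim (use nonneg in \<open>simp add: order_trans[OF _ abs_ge_self]\<close>)
  qed measurable
  have "(LINT w|M. ?g w) \<le> (LINT w|M. cmod (R (\<pi> a y1) w) powr r - K powr r * cmod (R y1 w) powr r)"
    using le gint i1 by (intro integral_mono_AE) auto
  also have "\<dots> = (LINT w|M. cmod (R (\<pi> a y1) w) powr r) - K powr r * (LINT w|M. cmod (R y1 w) powr r)"
    using i1 by simp
  also have "\<dots> \<le> 0"
    using R_nrm_le[OF A1 y1(1) K(1) rep_bound[OF a y1(1) K]] by simp
  finally have "(LINT w|M. ?g w) = 0" using integral_nonneg_AE[of ?g M] nonneg by (intro antisym) auto
  then have "AE w in M. ?g w = 0"
    using integral_nonneg_eq_0_iff_AE[OF gint] nonneg by auto
  with AE_space show ?thesis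
  proof eventually_elim
    case (elim w)
    have "w \<notin> S" using pos[of w] elim(2) by (metis less_irrefl)
    then show ?case using elim(1) by (simp add: not_less S_def)
  qed
qed

lemma matrix_bound_not_2:
  fixes a :: "'i \<Rightarrow> 'j \<Rightarrow> 'x \<Rightarrow> complex"
  assumes r2: "r \<noteq> 2" and fin: "finite I" "finite J" and C0: "0 \<le> C"
    and a: "\<And>i j. i \<in> I \<Longrightarrow> j \<in> J \<Longrightarrow> a i j \<in> carrier (C0 X)"
    and C: "\<And>x c. x \<in> topspace X \<Longrightarrow> lpn (ereal r) I (\<lambda>i. cmod (\<Sum>j\<in>J. a i j x * c j)) \<le> C * lpn (ereal r) J (\<lambda>j. cmod (c j))"
    and \<xi>: "\<And>j. j \<in> J \<Longrightarrow> \<xi> j \<in> carrier E"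
  shows "lpn (ereal r) I (\<lambda>i. nrm E (finsum E (\<lambda>j. \<pi> (a i j) (\<xi> j)) J)) \<le> C * lpn (ereal r) J (\<lambda>j. nrm E (\<xi> j))"
proof -
  interpret local_rep E X \<pi> R "ae_filter M"
    by unfold_locales (rule rep_bound_AE[OF r2])
  show ?thesis
  proof (rule lpn_integrate[OF fin C0 _ \<xi>])
    show "finsum E (\<lambda>j. \<pi> (a i j) (\<xi> j)) J \<in> carrier E" if "i \<in> I" for i
      using that a \<xi> by (intro finsum_sub_closed) auto
    show "AE w in M. lpn (ereal r) I (\<lambda>i. cmod (R (finsum E (\<lambda>j. \<pi> (a i j) (\<xi> j)) J) w))
        \<le> C * lpn (ereal r) J (\<lambda>j. cmod (R (\<xi> j) w))"
      by (rule local_matrix_bound[OF _ fin _ C0 a C \<xi>]) (use r in \<open>auto simp: AE_ball_countable\<close>)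
  qed
qed

end

section \<open>Representations on Hilbert spaces\<close>

locale C0_rep_on_L2 = C0_rep_on_Lp E X \<pi> R M 2
  for E :: "'e nspace" (structure) and X :: "'x topology" and \<pi> and R :: "'e \<Rightarrow> 'm \<Rightarrow> complex" and M
begin

lemma pairing_commute: "x \<in> carrier E \<Longrightarrow> y \<in> carrier E \<Longrightarrow> pairing x y = cnj (pairing y x)"
  using Bochner_Integration.integral_cnj[of M "\<lambda>w. R y w * cnj (R x w)"] by (simp add: pairing_def mult.commute)

lemma pairing_combination_right:
  assumes "x \<in> carrier E" "y \<in> carrier E" "z \<in> carrier E"
  shows "pairing z (a \<odot> x \<oplus> b \<odot> y) = cnj a * pairing z x + cnj b * pairing z y"
  using pairing_combination[OF assms, of a b] pairing_commute[of z] assms by simp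

text \<open>For r = 2 the duality map is conjugation, hence additive, and
  \<open>pairing_cross\<close> applies to any two vectors; the phases 1 and i settle the imaginary
  and the real part.\<close>

lemma rep_real_adjoint:
  assumes a: "(\<lambda>x. complex_of_real (a x)) \<in> carrier (C0 X)" and x: "x \<in> carrier E" "y \<in> carrier E"
  shows "pairing (\<pi> (\<lambda>x. of_real (a x)) x) y = pairing x (\<pi> (\<lambda>x. of_real (a x)) y)"
proof -
  let ?A = "pairing (\<pi> (\<lambda>x. of_real (a x)) x) y" and ?B = "pairing (\<pi> (\<lambda>x. of_real (a x)) y) x"
  have cross: "Im (of_real 1 * cnj c * ?A + c * of_real 1 * ?B) = 0" if c: "cmod c = 1" for c
    by (rule pairing_cross[OF a x _ c]) simp
  have "?A = cnj ?B"
    using cross[of 1] cross[of \<i>] by (simp add: complex_eq_iff)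
  then show ?thesis using pairing_commute[of x "\<pi> (\<lambda>x. of_real (a x)) y"] a x by simp
qed

lemma rep_adjoint:
  assumes a: "a \<in> carrier (C0 X)" and x: "x \<in> carrier E" "y \<in> carrier E"
  shows "pairing (\<pi> a x) y = pairing x (\<pi> (\<lambda>x. cnj (a x)) y)"
proof -
  let ?r = "\<lambda>x. complex_of_real (Re (a x))" and ?i = "\<lambda>x. complex_of_real (Im (a x))"
  note C = C0_Re[OF a] C0_Im[OF a]
  have "a = (\<lambda>x. 1 * ?r x + \<i> * ?i x)" by (simp add: complex_eq_iff fun_eq_iff)
  then have "\<pi> a x = \<pi> (\<lambda>x. 1 * ?r x + \<i> * ?i x) x" by metis
  also have "\<dots> = 1 \<odot> \<pi> ?r x \<oplus> \<i> \<odot> \<pi> ?i x"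
    using C x by (simp add: rep_C0_add C0_scale rep_C0_scale)
  finally have 1: "\<pi> a x = 1 \<odot> \<pi> ?r x \<oplus> \<i> \<odot> \<pi> ?i x" .
  have "(\<lambda>x. cnj (a x)) = (\<lambda>x. 1 * ?r x + (-\<i>) * ?i x)" by (simp add: complex_eq_iff fun_eq_iff)
  then have "\<pi> (\<lambda>x. cnj (a x)) y = \<pi> (\<lambda>x. 1 * ?r x + (-\<i>) * ?i x) y" by metis
  also have "\<dots> = 1 \<odot> \<pi> ?r y \<oplus> (-\<i>) \<odot> \<pi> ?i y"
    using C x by (simp only: rep_C0_add C0_scale rep_C0_scale)
  finally have 2: "\<pi> (\<lambda>x. cnj (a x)) y = 1 \<odot> \<pi> ?r y \<oplus> (-\<i>) \<odot> \<pi> ?i y" .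
  show ?thesis
    unfolding 1 2 using C x by (simp add: pairing_combination pairing_combination_right rep_real_adjoint del: scale_one)
qed

definition mat_app :: "('i \<Rightarrow> 'j \<Rightarrow> 'x \<Rightarrow> complex) \<Rightarrow> 'j set \<Rightarrow> ('j \<Rightarrow> 'e) \<Rightarrow> 'i \<Rightarrow> 'e" where
  "mat_app a J \<xi> i = finsum E (\<lambda>j. \<pi> (a i j) (\<xi> j)) J"

lemma mat_app_closed:
  "(\<And>j. j \<in> J \<Longrightarrow> a i j \<in> carrier (C0 X)) \<Longrightarrow> (\<And>j. j \<in> J \<Longrightarrow> \<xi> j \<in> carrier E) \<Longrightarrow> mat_app a J \<xi> i \<in> carrier E"
  unfolding mat_app_def by (intro finsum_sub_closed) auto

lemma pairing_finsum:
  assumes "finite J" "\<And>j. j \<in> J \<Longrightarrow> f j \<in> carrier E" "z \<in> carrier E"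
  shows "pairing (finsum E f J) z = (\<Sum>j\<in>J. pairing (f j) z)"
  using assms(1,2)
proof (induction J rule: finite_induct)
  case empty
  have "pairing \<zero> z = 0" using pairing_combination[of \<zero> \<zero> z 0 0] assms by simp
  then show ?case by simp
next
  case (insert j J)
  then have "pairing (1 \<odot> f j \<oplus> 1 \<odot> finsum E f J) z = pairing (f j) z + pairing (finsum E f J) z"
    using assms by (simp only: pairing_combination finsum_sub_closed insert_iff simp_thms mult_1)
  then show ?case using insert by (simp add: finsum_insert' finsum_sub_closed)
qed

text \<open>With b = a^* a / C the left side is C times the real part of <b \<xi>, \<xi>>, and 2 Re
  <y, x> \<le> |x|^2 + |y|^2. The scale C is left open: it is 1 in the iteration and the square of
  the bound in \<open>matrix_bound_2\<close>.\<close>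

lemma sum_nrm_mat_app_le:
  assumes fin: "finite I" "finite J"
    and a: "\<And>i j. i \<in> I \<Longrightarrow> j \<in> J \<Longrightarrow> a i j \<in> carrier (C0 X)" and \<xi>: "\<And>j. j \<in> J \<Longrightarrow> \<xi> j \<in> carrier E"
    and C: "0 < C"
    and b: "\<And>j k. j \<in> J \<Longrightarrow> k \<in> J \<Longrightarrow> b j k \<in> carrier (C0 X)"
      "\<And>j k x. j \<in> J \<Longrightarrow> k \<in> J \<Longrightarrow> (\<Sum>i\<in>I. cnj (a i j x) * a i k x) = of_real C * b j k x"
  shows "(\<Sum>i\<in>I. (nrm E (mat_app a J \<xi> i))\<^sup>2) \<le> C * ((\<Sum>j\<in>J. (nrm E (\<xi> j))\<^sup>2) + (\<Sum>j\<in>J. (nrm E (mat_app b J \<xi> j))\<^sup>2)) / 2"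
proof -
  have cl: "mat_app a J \<xi> i \<in> carrier E" if "i \<in> I" for i using that a \<xi> by (intro mat_app_closed) auto
  have clb: "mat_app b J \<xi> j \<in> carrier E" if "j \<in> J" for j using that b \<xi> by (intro mat_app_closed) auto
  have "complex_of_real (\<Sum>i\<in>I. (nrm E (mat_app a J \<xi> i))\<^sup>2) = (\<Sum>i\<in>I. pairing (mat_app a J \<xi> i) (mat_app a J \<xi> i))"
    using cl by (simp add: pairing_self powr_numeral)
  also have "\<dots> = (\<Sum>i\<in>I. \<Sum>k\<in>J. pairing (\<pi> (a i k) (\<xi> k)) (mat_app a J \<xi> i))"
    using cl fin a \<xi> by (intro sum.cong refl) (subst (1) mat_app_def, auto intro: pairing_finsum)
  also have "\<dots> = (\<Sum>i\<in>I. \<Sum>k\<in>J. \<Sum>j\<in>J. pairing (\<xi> k) (\<pi> (\<lambda>x. cnj (a i k x)) (\<pi> (a i j) (\<xi> j))))"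
  proof (intro sum.cong refl)
    fix i k assume i: "i \<in> I" and k: "k \<in> J"
    let ?q = "\<lambda>x. cnj (a i k x)"
    have q: "?q \<in> carrier (C0 X)" using a[OF i k] by (rule C0_cnj)
    have "pairing (\<pi> (a i k) (\<xi> k)) (mat_app a J \<xi> i) = pairing (\<xi> k) (\<pi> ?q (mat_app a J \<xi> i))"
      using i k a \<xi> cl by (intro rep_adjoint) auto
    also have "\<pi> ?q (mat_app a J \<xi> i) = finsum E (\<lambda>j. \<pi> ?q (\<pi> (a i j) (\<xi> j))) J"
      unfolding mat_app_def using q fin a i \<xi> by (intro rep_finsum) auto
    also have "pairing (\<xi> k) \<dots> = cnj (pairing \<dots> (\<xi> k))"
      using q a i \<xi> k by (intro pairing_commute finsum_sub_closed) auto
    also have "\<dots> = cnj (\<Sum>j\<in>J. pairing (\<pi> ?q (\<pi> (a i j) (\<xi> j))) (\<xi> k))"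
      using q a i \<xi> k fin by (subst pairing_finsum) auto
    also have "\<dots> = (\<Sum>j\<in>J. pairing (\<xi> k) (\<pi> ?q (\<pi> (a i j) (\<xi> j))))"
      unfolding cnj_sum using q a i \<xi> k by (intro sum.cong refl pairing_commute[symmetric]) auto
    finally show "pairing (\<pi> (a i k) (\<xi> k)) (mat_app a J \<xi> i)
        = (\<Sum>j\<in>J. pairing (\<xi> k) (\<pi> ?q (\<pi> (a i j) (\<xi> j))))" .
  qed
  also have "\<dots> = (\<Sum>k\<in>J. \<Sum>j\<in>J. \<Sum>i\<in>I. pairing (\<xi> k) (\<pi> (\<lambda>x. cnj (a i k x)) (\<pi> (a i j) (\<xi> j))))"
    by (subst sum.swap) (intro sum.cong refl sum.swap)
  also have "\<dots> = (\<Sum>k\<in>J. of_real C * cnj (pairing (mat_app b J \<xi> k) (\<xi> k)))"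
  proof (intro sum.cong refl)
    fix k assume k: "k \<in> J"
    have "(\<Sum>i\<in>I. pairing (\<xi> k) (\<pi> (\<lambda>x. cnj (a i k x)) (\<pi> (a i j) (\<xi> j)))) = of_real C * cnj (pairing (\<pi> (b k j) (\<xi> j)) (\<xi> k))"
      if j: "j \<in> J" for j
    proof -
      have q: "(\<lambda>x. cnj (a i k x)) \<in> carrier (C0 X)" if "i \<in> I" for i using a[OF that k] by (rule C0_cnj)
      have "(\<Sum>i\<in>I. pairing (\<xi> k) (\<pi> (\<lambda>x. cnj (a i k x)) (\<pi> (a i j) (\<xi> j))))
          = cnj (\<Sum>i\<in>I. pairing (\<pi> (\<lambda>x. cnj (a i k x) * a i j x) (\<xi> j)) (\<xi> k))"
        unfolding cnj_sum
      proof (intro sum.cong refl)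
        fix i assume i: "i \<in> I"
        show "pairing (\<xi> k) (\<pi> (\<lambda>x. cnj (a i k x)) (\<pi> (a i j) (\<xi> j)))
          = cnj (pairing (\<pi> (\<lambda>x. cnj (a i k x) * a i j x) (\<xi> j)) (\<xi> k))"
          using q[OF i] a[OF i j] \<xi> j k by (simp add: rep_C0_mult pairing_commute[of "\<xi> k"])
      qed
      also have "(\<Sum>i\<in>I. pairing (\<pi> (\<lambda>x. cnj (a i k x) * a i j x) (\<xi> j)) (\<xi> k))
          = pairing (finsum E (\<lambda>i. \<pi> (\<lambda>x. cnj (a i k x) * a i j x) (\<xi> j)) I) (\<xi> k)"
        using q a \<xi> j k fin by (intro pairing_finsum[symmetric] rep_closed C0_mult) auto
      also have "finsum E (\<lambda>i. \<pi> (\<lambda>x. cnj (a i k x) * a i j x) (\<xi> j)) I = \<pi> (\<lambda>x. \<Sum>i\<in>I. cnj (a i k x) * a i j x) (\<xi> j)"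
        using q a \<xi> j k fin by (intro rep_C0_sum[symmetric] C0_mult) auto
      also have "\<dots> = of_real C \<odot> \<pi> (b k j) (\<xi> j)"
        using b(2)[OF k j] b(1)[OF k j] \<xi>[OF j] by (simp add: rep_C0_scale)
      also have "pairing \<dots> (\<xi> k) = of_real C * pairing (\<pi> (b k j) (\<xi> j)) (\<xi> k)"
        using pairing_combination[of "\<pi> (b k j) (\<xi> j)" \<zero> "\<xi> k" "of_real C" 0] b(1)[OF k j] \<xi> j k by simp
      finally show ?thesis by simp
    qed
    then have "(\<Sum>j\<in>J. \<Sum>i\<in>I. pairing (\<xi> k) (\<pi> (\<lambda>x. cnj (a i k x)) (\<pi> (a i j) (\<xi> j))))
        = of_real C * cnj (\<Sum>j\<in>J. pairing (\<pi> (b k j) (\<xi> j)) (\<xi> k))"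
      by (simp add: sum_distrib_left)
    also have "(\<Sum>j\<in>J. pairing (\<pi> (b k j) (\<xi> j)) (\<xi> k)) = pairing (mat_app b J \<xi> k) (\<xi> k)"
      unfolding mat_app_def using b \<xi> k fin by (intro pairing_finsum[symmetric]) auto
    finally show "(\<Sum>j\<in>J. \<Sum>i\<in>I. pairing (\<xi> k) (\<pi> (\<lambda>x. cnj (a i k x)) (\<pi> (a i j) (\<xi> j))))
        = of_real C * cnj (pairing (mat_app b J \<xi> k) (\<xi> k))" .
  qed
  finally have "complex_of_real (\<Sum>i\<in>I. (nrm E (mat_app a J \<xi> i))\<^sup>2)
      = (\<Sum>k\<in>J. of_real C * cnj (pairing (mat_app b J \<xi> k) (\<xi> k)))" .
  then have "Re (complex_of_real (\<Sum>i\<in>I. (nrm E (mat_app a J \<xi> i))\<^sup>2))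
      = Re (\<Sum>k\<in>J. of_real C * cnj (pairing (mat_app b J \<xi> k) (\<xi> k)))" by (rule arg_cong)
  then have "(\<Sum>i\<in>I. (nrm E (mat_app a J \<xi> i))\<^sup>2) = (\<Sum>k\<in>J. C * Re (pairing (mat_app b J \<xi> k) (\<xi> k)))"
    by simp
  also have "\<dots> \<le> (\<Sum>k\<in>J. C * (((nrm E (\<xi> k))\<^sup>2 + (nrm E (mat_app b J \<xi> k))\<^sup>2) / 2))"
  proof (intro sum_mono mult_left_mono)
    fix k assume "k \<in> J"
    then show "Re (pairing (mat_app b J \<xi> k) (\<xi> k)) \<le> ((nrm E (\<xi> k))\<^sup>2 + (nrm E (mat_app b J \<xi> k))\<^sup>2) / 2"
      using pairing_tangent[of "\<xi> k" "mat_app b J \<xi> k"] \<xi> clb by (simp add: powr_numeral)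
  qed (use C in auto)
  also have "\<dots> = C * ((\<Sum>j\<in>J. (nrm E (\<xi> j))\<^sup>2) + (\<Sum>j\<in>J. (nrm E (mat_app b J \<xi> j))\<^sup>2)) / 2"
    by (simp add: sum_distrib_left[symmetric] sum_divide_distrib[symmetric] sum.distrib)
  finally show ?thesis .
qed

end

lemma lpn_2_le_iff:
  assumes "finite I" "finite J" "0 \<le> C"
  shows "lpn (ereal 2) I u \<le> C * lpn (ereal 2) J v \<longleftrightarrow> (\<Sum>i\<in>I. (u i)\<^sup>2) \<le> C\<^sup>2 * (\<Sum>j\<in>J. (v j)\<^sup>2)"
proof -
  have "(C * lpn (ereal 2) J v) powr 2 = C\<^sup>2 * (\<Sum>j\<in>J. (v j)\<^sup>2)"
    using assms lpn_powr[of 2 J v] by (simp add: power_mult_distrib)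
  then show ?thesis
    using assms lpn_real_le_iff[of 2 "C * lpn (ereal 2) J v" I u] by simp
qed

context C0_rep_on_L2
begin

definition hermitian_contraction :: "'j set \<Rightarrow> ('j \<Rightarrow> 'j \<Rightarrow> 'x \<Rightarrow> complex) \<Rightarrow> bool" where
  "hermitian_contraction J b \<longleftrightarrow> (\<forall>j\<in>J. \<forall>k\<in>J. b j k \<in> carrier (C0 X)) \<and>
     (\<forall>j\<in>J. \<forall>k\<in>J. \<forall>x. cnj (b j k x) = b k j x) \<and>
     (\<forall>x\<in>topspace X. \<forall>c. (\<Sum>j\<in>J. (cmod (\<Sum>k\<in>J. b j k x * c k))\<^sup>2) \<le> (\<Sum>k\<in>J. (cmod (c k))\<^sup>2))"

text \<open>What matters is that the constant depends on the number of indices alone and so is the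
  same for all iterated squares of a given matrix.\<close>

lemma mat_app_crude_bound:
  assumes J: "finite J" and b: "hermitian_contraction J b" and \<xi>: "\<And>j. j \<in> J \<Longrightarrow> \<xi> j \<in> carrier E"
  shows "(\<Sum>j\<in>J. (nrm E (mat_app b J \<xi> j))\<^sup>2) \<le> (real (card J))\<^sup>2 * (\<Sum>j\<in>J. (nrm E (\<xi> j))\<^sup>2)"
proof -
  have b1: "cmod (b j k x) \<le> 1" if "j \<in> J" "k \<in> J" "x \<in> topspace X" for j k x
  proof -
    define c where "c = (\<lambda>i. if i = k then 1 else 0 :: complex)"
    have "(\<Sum>i\<in>J. b j i x * c i) = b j k x" for j
      using J that by (simp add: c_def if_distrib[of "\<lambda>c. _ * c"] cong: if_cong)
    moreover have "(\<Sum>i\<in>J. (cmod (c i))\<^sup>2) = 1"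
      using J that by (simp add: c_def if_distrib[of cmod] if_distrib[of "\<lambda>c. c\<^sup>2"] cong: if_cong)
    moreover have "(\<Sum>j\<in>J. (cmod (\<Sum>i\<in>J. b j i x * c i))\<^sup>2) \<le> (\<Sum>i\<in>J. (cmod (c i))\<^sup>2)"
      using b that by (simp add: hermitian_contraction_def)
    ultimately have "(\<Sum>j\<in>J. (cmod (b j k x))\<^sup>2) \<le> 1" by simp
    moreover have "(cmod (b j k x))\<^sup>2 \<le> (\<Sum>j\<in>J. (cmod (b j k x))\<^sup>2)"
      using J that by (intro member_le_sum) auto
    ultimately have "(cmod (b j k x))\<^sup>2 \<le> 1\<^sup>2" by simp
    then show ?thesis by (rule power2_le_imp_le) simp
  qed
  have "(nrm E (mat_app b J \<xi> j))\<^sup>2 \<le> (\<Sum>k\<in>J. (nrm E (\<xi> k))\<^sup>2) * card J" if j: "j \<in> J" for j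
  proof -
    have bC: "b j k \<in> carrier (C0 X)" if "k \<in> J" for k using b j that by (simp add: hermitian_contraction_def)
    have "nrm E (mat_app b J \<xi> j) \<le> (\<Sum>k\<in>J. nrm E (\<pi> (b j k) (\<xi> k)))"
      unfolding mat_app_def using J bC \<xi> by (intro nrm_finsum_le) auto
    also have "\<dots> \<le> (\<Sum>k\<in>J. nrm E (\<xi> k))"
    proof (intro sum_mono)
      fix k assume k: "k \<in> J"
      show "nrm E (\<pi> (b j k) (\<xi> k)) \<le> nrm E (\<xi> k)"
        using rep_bound[OF bC[OF k] \<xi>[OF k], of 1] b1[OF j k] by simp
    qed
    finally have "nrm E (mat_app b J \<xi> j) \<le> (\<Sum>k\<in>J. nrm E (\<xi> k))" .
    moreover have "mat_app b J \<xi> j \<in> carrier E" using bC \<xi> by (intro mat_app_closed) auto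
    ultimately have "(nrm E (mat_app b J \<xi> j))\<^sup>2 \<le> (\<Sum>k\<in>J. nrm E (\<xi> k))\<^sup>2" by (intro power_mono) auto
    also have "\<dots> \<le> (\<Sum>k\<in>J. (nrm E (\<xi> k))\<^sup>2) * card J" by (rule sum_squared_le_sum_of_squares)
    finally show ?thesis .
  qed
  then have "(\<Sum>j\<in>J. (nrm E (mat_app b J \<xi> j))\<^sup>2) \<le> (\<Sum>j\<in>J. (\<Sum>k\<in>J. (nrm E (\<xi> k))\<^sup>2) * card J)"
    by (intro sum_mono)
  then show ?thesis by (simp add: power2_eq_square mult_ac)
qed

text \<open>Keeps the iteration inside the class with a common crude bound. As the adjoint of b is
  b, the new matrix is a product of two contractions.\<close>

lemma hermitian_contraction_square:
  assumes J: "finite J" and b: "hermitian_contraction J b"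
  shows "hermitian_contraction J (\<lambda>j k x. \<Sum>i\<in>J. cnj (b i j x) * b i k x)"
  unfolding hermitian_contraction_def
proof (intro conjI ballI allI)
  fix j k assume "j \<in> J" "k \<in> J"
  then show "(\<lambda>x. \<Sum>i\<in>J. cnj (b i j x) * b i k x) \<in> carrier (C0 X)"
    using J b by (intro C0_sum C0_mult C0_cnj) (auto simp: hermitian_contraction_def)
next
  fix j k x assume "j \<in> J" "k \<in> J"
  show "cnj (\<Sum>i\<in>J. cnj (b i j x) * b i k x) = (\<Sum>i\<in>J. cnj (b i k x) * b i j x)"
    by (simp add: mult.commute)
next
  fix x c assume x: "x \<in> topspace X"
  have "(\<Sum>j\<in>J. (cmod (\<Sum>k\<in>J. (\<Sum>i\<in>J. cnj (b i j x) * b i k x) * c k))\<^sup>2)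
      = (\<Sum>j\<in>J. (cmod (\<Sum>i\<in>J. b j i x * (\<Sum>k\<in>J. b i k x * c k)))\<^sup>2)"
  proof (rule sum.cong[OF refl], rule arg_cong[of _ _ "\<lambda>z. (cmod z)\<^sup>2"])
    fix j assume j: "j \<in> J"
    have "(\<Sum>k\<in>J. (\<Sum>i\<in>J. cnj (b i j x) * b i k x) * c k) = (\<Sum>k\<in>J. \<Sum>i\<in>J. b j i x * (b i k x * c k))"
      using b j by (simp add: hermitian_contraction_def sum_distrib_right mult.assoc)
    also have "\<dots> = (\<Sum>i\<in>J. b j i x * (\<Sum>k\<in>J. b i k x * c k))"
      by (subst sum.swap) (simp add: sum_distrib_left)
    finally show "(\<Sum>k\<in>J. (\<Sum>i\<in>J. cnj (b i j x) * b i k x) * c k) = (\<Sum>i\<in>J. b j i x * (\<Sum>k\<in>J. b i k x * c k))" .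
  qed
  also have "\<dots> \<le> (\<Sum>i\<in>J. (cmod (\<Sum>k\<in>J. b i k x * c k))\<^sup>2)"
    using b x by (simp add: hermitian_contraction_def)
  also have "\<dots> \<le> (\<Sum>k\<in>J. (cmod (c k))\<^sup>2)" using b x by (simp add: hermitian_contraction_def)
  finally show "(\<Sum>j\<in>J. (cmod (\<Sum>k\<in>J. (\<Sum>i\<in>J. cnj (b i j x) * b i k x) * c k))\<^sup>2) \<le> (\<Sum>k\<in>J. (cmod (c k))\<^sup>2)" .
qed

text \<open>Replacing \<open>b\<close> by \<open>b\<^sup>*b\<close> halves the excess over \<open>1\<close> of a uniform bound.\<close>

lemma mat_app_contraction:
  assumes J: "finite J" and b: "hermitian_contraction J b" and \<xi>: "\<And>j. j \<in> J \<Longrightarrow> \<xi> j \<in> carrier E"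
  shows "(\<Sum>j\<in>J. (nrm E (mat_app b J \<xi> j))\<^sup>2) \<le> (\<Sum>j\<in>J. (nrm E (\<xi> j))\<^sup>2)"
proof -
  let ?S = "\<Sum>j\<in>J. (nrm E (\<xi> j))\<^sup>2"
  define N where "N = (real (card J))\<^sup>2"
  have "(\<Sum>j\<in>J. (nrm E (mat_app b J \<xi> j))\<^sup>2) \<le> (1 + N / 2 ^ m) * ?S" if "hermitian_contraction J b" for b m
    using that
  proof (induction m arbitrary: b)
    case 0
    have "0 \<le> ?S" by (simp add: sum_nonneg)
    then show ?case using mat_app_crude_bound[where \<xi> = \<xi>, OF J 0 \<xi>] by (simp add: N_def distrib_right)
  next
    case (Suc m)
    let ?b = "\<lambda>j k x. \<Sum>i\<in>J. cnj (b i j x) * b i k x"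
    have b2: "hermitian_contraction J ?b" by (rule hermitian_contraction_square[OF J Suc.prems])
    have "(\<Sum>j\<in>J. (nrm E (mat_app b J \<xi> j))\<^sup>2) \<le> 1 * (?S + (\<Sum>j\<in>J. (nrm E (mat_app ?b J \<xi> j))\<^sup>2)) / 2"
      using Suc.prems b2 J \<xi> by (intro sum_nrm_mat_app_le) (auto simp: hermitian_contraction_def)
    also have "\<dots> \<le> 1 * (?S + (1 + N / 2 ^ m) * ?S) / 2"
      using Suc.IH[OF b2] by simp
    also have "\<dots> = (1 + N / 2 ^ Suc m) * ?S" by (simp add: field_simps)
    finally show ?case .
  qed
  then have "\<And>m. (\<Sum>j\<in>J. (nrm E (mat_app b J \<xi> j))\<^sup>2) \<le> (1 + N / 2 ^ m) * ?S" using b by blast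
  moreover have "(\<lambda>m. (1 + N / 2 ^ m) * ?S) \<longlonglongrightarrow> (1 + 0) * ?S"
  proof (intro tendsto_intros)
    have "(\<lambda>m. N * (1 / 2) ^ m) \<longlonglongrightarrow> N * 0" by (intro tendsto_intros LIMSEQ_power_zero) simp
    then show "(\<lambda>m. N / 2 ^ m) \<longlonglongrightarrow> 0" by (simp add: power_one_over field_simps)
  qed
  ultimately show ?thesis by (intro LIMSEQ_le_const[of "\<lambda>m. (1 + N / 2 ^ m) * ?S"]) auto
qed

text \<open>The values of b = a^* a / C^2 are Hermitian contractions, so
  \<open>mat_app_contraction\<close> controls its action, and \<open>sum_nrm_mat_app_le\<close>
  leads from b back to a.\<close>

lemma matrix_bound_2:
  fixes a :: "'i \<Rightarrow> 'j \<Rightarrow> 'x \<Rightarrow> complex"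
  assumes fin: "finite I" "finite J" and C0: "0 < C"
    and a: "\<And>i j. i \<in> I \<Longrightarrow> j \<in> J \<Longrightarrow> a i j \<in> carrier (C0 X)"
    and C: "\<And>x c. x \<in> topspace X \<Longrightarrow> lpn (ereal 2) I (\<lambda>i. cmod (\<Sum>j\<in>J. a i j x * c j)) \<le> C * lpn (ereal 2) J (\<lambda>j. cmod (c j))"
    and \<xi>: "\<And>j. j \<in> J \<Longrightarrow> \<xi> j \<in> carrier E"
  shows "lpn (ereal 2) I (\<lambda>i. nrm E (finsum E (\<lambda>j. \<pi> (a i j) (\<xi> j)) J)) \<le> C * lpn (ereal 2) J (\<lambda>j. nrm E (\<xi> j))"
proof -
  define b where "b j k x = of_real (1 / C\<^sup>2) * (\<Sum>i\<in>I. cnj (a i j x) * a i k x)" for j k x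
  have Ca: "(\<Sum>i\<in>I. (cmod (\<Sum>j\<in>J. a i j x * c j))\<^sup>2) \<le> C\<^sup>2 * (\<Sum>j\<in>J. (cmod (c j))\<^sup>2)" if "x \<in> topspace X" for x c
    using C[OF that, of c] C0 fin by (subst (asm) lpn_2_le_iff) auto
  \<comment> \<open>The adjoint matrices obey the same bound: for w = a^* v one has |w|^2 = Re <v, a
    w>, and 2 Re <v, a w> \<le> C^2 |v|^2 + |a w|^2 / C^2 \<le> C^2 |v|^2 + |w|^2.\<close>
  have adj: "(\<Sum>j\<in>J. (cmod (\<Sum>i\<in>I. cnj (a i j x) * v i))\<^sup>2) \<le> C\<^sup>2 * (\<Sum>i\<in>I. (cmod (v i))\<^sup>2)"
    if x: "x \<in> topspace X" for x v
  proof -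
    define w where "w j = (\<Sum>i\<in>I. cnj (a i j x) * v i)" for j
    define y where "y i = (\<Sum>j\<in>J. a i j x * w j)" for i
    have "complex_of_real (\<Sum>j\<in>J. (cmod (w j))\<^sup>2) = (\<Sum>j\<in>J. w j * cnj (w j))"
      by (simp only: of_real_sum complex_norm_square)
    also have "\<dots> = (\<Sum>j\<in>J. \<Sum>i\<in>I. v i * cnj (a i j x * w j))"
      by (rule sum.cong[OF refl], subst (1) w_def) (simp add: sum_distrib_right sum_distrib_left mult_ac)
    also have "\<dots> = (\<Sum>i\<in>I. v i * cnj (y i))"
      by (subst sum.swap) (simp add: y_def sum_distrib_left)
    finally have "Re (complex_of_real (\<Sum>j\<in>J. (cmod (w j))\<^sup>2)) = Re (\<Sum>i\<in>I. v i * cnj (y i))" by (rule arg_cong)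
    then have "2 * (\<Sum>j\<in>J. (cmod (w j))\<^sup>2) = (\<Sum>i\<in>I. 2 * Re (v i * cnj (y i)))"
      by (simp add: sum_distrib_left)
    also have "\<dots> \<le> (\<Sum>i\<in>I. C\<^sup>2 * (cmod (v i))\<^sup>2 + (cmod (y i))\<^sup>2 / C\<^sup>2)"
    proof (intro sum_mono)
      fix i
      have "Re (v i * cnj (y i)) \<le> cmod (v i) * cmod (y i)"
        using complex_Re_le_cmod[of "v i * cnj (y i)"] by (simp add: norm_mult)
      moreover have "0 \<le> (C * cmod (v i) - cmod (y i) / C)\<^sup>2" by simp
      then have "2 * (cmod (v i) * cmod (y i)) \<le> C\<^sup>2 * (cmod (v i))\<^sup>2 + (cmod (y i))\<^sup>2 / C\<^sup>2"
        using C0 by (simp add: power2_diff power_mult_distrib power_divide)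
      ultimately show "2 * Re (v i * cnj (y i)) \<le> C\<^sup>2 * (cmod (v i))\<^sup>2 + (cmod (y i))\<^sup>2 / C\<^sup>2" by linarith
    qed
    also have "\<dots> = C\<^sup>2 * (\<Sum>i\<in>I. (cmod (v i))\<^sup>2) + (\<Sum>i\<in>I. (cmod (y i))\<^sup>2) / C\<^sup>2"
      by (simp add: sum.distrib sum_distrib_left sum_divide_distrib)
    also have "(\<Sum>i\<in>I. (cmod (y i))\<^sup>2) / C\<^sup>2 \<le> (\<Sum>j\<in>J. (cmod (w j))\<^sup>2)"
      using Ca[OF x, of w] C0 by (simp add: y_def divide_le_eq mult.commute)
    finally show ?thesis by (simp add: w_def)
  qed
  have b: "hermitian_contraction J b"
    unfolding hermitian_contraction_def
  proof (intro conjI ballI allI)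
    fix j k assume "j \<in> J" "k \<in> J"
    then show "b j k \<in> carrier (C0 X)"
      unfolding b_def[abs_def] using fin a by (intro C0_scale C0_sum C0_mult C0_cnj) auto
  next
    fix j k x show "cnj (b j k x) = b k j x" by (simp add: b_def mult.commute)
  next
    fix x c assume x: "x \<in> topspace X"
    define v where "v i = (\<Sum>k\<in>J. a i k x * c k)" for i
    have e: "(\<Sum>k\<in>J. b j k x * c k) = of_real (1 / C\<^sup>2) * (\<Sum>i\<in>I. cnj (a i j x) * v i)" for j
    proof -
      have "(\<Sum>k\<in>J. b j k x * c k) = of_real (1 / C\<^sup>2) * (\<Sum>k\<in>J. \<Sum>i\<in>I. cnj (a i j x) * (a i k x * c k))"
        by (simp add: b_def sum_distrib_left sum_distrib_right mult_ac)
      also have "(\<Sum>k\<in>J. \<Sum>i\<in>I. cnj (a i j x) * (a i k x * c k)) = (\<Sum>i\<in>I. cnj (a i j x) * v i)"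
        by (subst sum.swap) (simp add: v_def sum_distrib_left)
      finally show ?thesis .
    qed
    have "(\<Sum>j\<in>J. (cmod (\<Sum>k\<in>J. b j k x * c k))\<^sup>2) = (1 / C\<^sup>2)\<^sup>2 * (\<Sum>j\<in>J. (cmod (\<Sum>i\<in>I. cnj (a i j x) * v i))\<^sup>2)"
      unfolding e norm_mult power_mult_distrib norm_of_real by (simp add: sum_distrib_left)
    also have "\<dots> \<le> (1 / C\<^sup>2)\<^sup>2 * (C\<^sup>2 * (C\<^sup>2 * (\<Sum>k\<in>J. (cmod (c k))\<^sup>2)))"
      using adj[OF x, of v] Ca[OF x, of c] by (intro mult_left_mono order_trans[OF adj[OF x]]) (auto simp: v_def)
    also have "\<dots> = (\<Sum>k\<in>J. (cmod (c k))\<^sup>2)" using C0 by (simp add: power2_eq_square)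
    finally show "(\<Sum>j\<in>J. (cmod (\<Sum>k\<in>J. b j k x * c k))\<^sup>2) \<le> (\<Sum>k\<in>J. (cmod (c k))\<^sup>2)" .
  qed
  have "(\<Sum>i\<in>I. (nrm E (mat_app a J \<xi> i))\<^sup>2) \<le> C\<^sup>2 * ((\<Sum>j\<in>J. (nrm E (\<xi> j))\<^sup>2) + (\<Sum>j\<in>J. (nrm E (mat_app b J \<xi> j))\<^sup>2)) / 2"
    using fin a \<xi> b C0 by (intro sum_nrm_mat_app_le) (auto simp: hermitian_contraction_def b_def)
  also have "\<dots> \<le> C\<^sup>2 * ((\<Sum>j\<in>J. (nrm E (\<xi> j))\<^sup>2) + (\<Sum>j\<in>J. (nrm E (\<xi> j))\<^sup>2)) / 2"
    using mat_app_contraction[OF fin(2) b \<xi>] by (intro divide_right_mono mult_left_mono add_left_mono) auto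
  finally have "(\<Sum>i\<in>I. (nrm E (mat_app a J \<xi> i))\<^sup>2) \<le> C\<^sup>2 * (\<Sum>j\<in>J. (nrm E (\<xi> j))\<^sup>2)" by simp
  then show ?thesis using fin C0 by (subst lpn_2_le_iff) (auto simp: mat_app_def)
qed

end

text \<open>The two index types are free: besides square sections, columns and rows with an index of
  type \<open>unit\<close> occur, so that this bound also controls maps from \<open>E\<close> into a
  finite sum of copies of \<open>E\<close> and back.\<close>

theorem matrix_lemma:
  fixes E :: "'e nspace" and a :: "'i \<Rightarrow> 'j \<Rightarrow> 'x \<Rightarrow> complex"
  assumes p: "1 \<le> p" and E: "space_for_exponent TYPE('m) p E" and \<pi>: "nondegenerate_representation (C0 X) E \<pi>"
    and fin: "finite I" "finite J" and C0: "0 \<le> C"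
    and a: "\<And>i j. i \<in> I \<Longrightarrow> j \<in> J \<Longrightarrow> a i j \<in> carrier (C0 X)"
    and C: "\<And>x c. x \<in> topspace X \<Longrightarrow> lpn p I (\<lambda>i. cmod (\<Sum>j\<in>J. a i j x * c j)) \<le> C * lpn p J (\<lambda>j. cmod (c j))"
    and \<xi>: "\<And>j. j \<in> J \<Longrightarrow> \<xi> j \<in> carrier E"
  shows "lpn p I (\<lambda>i. nrm E (finsum E (\<lambda>j. \<pi> (a i j) (\<xi> j)) J)) \<le> C * lpn p J (\<lambda>j. nrm E (\<xi> j))"
proof -
  have "complex_banach_space E" using E by (auto simp: space_for_exponent_def is_Lp_space_def is_C0_space_def split: if_splits)
  then interpret nondeg_rep E "C0 X" \<pi> using \<pi> by (rule nondeg_repI)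
  interpret C0_rep E X \<pi> ..
  show ?thesis
    using p
  proof (cases rule: exponent_cases)
    case 1
    then obtain \<Omega> :: "'m topology" and T where T: "linear_map E (C0 \<Omega>) T" "bij_betw T (carrier E) (carrier (C0 \<Omega>))"
        "\<And>x. x \<in> carrier E \<Longrightarrow> nrm (C0 \<Omega>) (T x) = nrm E x"
      using E by (auto simp: space_for_exponent_def is_C0_space_def isometrically_isomorphic_def)
    interpret C0_rep_on_C0 E X \<pi> \<Omega> T by unfold_locales (use T in auto)
    show ?thesis unfolding 1 by (intro matrix_bound fin C0 a C[unfolded 1] \<xi>)
  next
    case (2 r)
    then have "is_Lp_space TYPE('m) (ereal r) E" using E by (simp add: space_for_exponent_def)
    then obtain R and M :: "'m measure" where "Lp_model E R M r" using Lp_model_exists 2 by blast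
    then interpret Lp_model E R M r .
    interpret C0_rep_on_Lp E X \<pi> R M r ..
    show ?thesis
    proof (cases "r = 2")
      case False
      show ?thesis unfolding 2 by (intro matrix_bound_not_2 False fin C0 a C[unfolded 2] \<xi>)
    next
      case True
      have "C0_rep_on_L2 E X \<pi> R M"
        using C0_rep_on_Lp_axioms unfolding True C0_rep_on_L2_def .
      then interpret L2: C0_rep_on_L2 E X \<pi> R M .
      let ?N = "lpn p J (\<lambda>j. nrm E (\<xi> j))"
      show ?thesis
      proof (rule field_le_epsilon)
        fix e :: real assume e: "0 < e"
        have N: "0 \<le> ?N" using fin by simp
        \<comment> \<open>\<open>matrix_bound_2\<close> divides by the bound, so C = 0 is reached by
          approximation; the denominator ?N + 1 keeps the error at most e.\<close>
        define C' where "C' = C + e / (?N + 1)"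
        have C': "0 < C'" "C \<le> C'" using e C0 N by (auto simp: C'_def intro: add_nonneg_pos)
        have "lpn p I (\<lambda>i. nrm E (finsum E (\<lambda>j. \<pi> (a i j) (\<xi> j)) J)) \<le> C' * ?N"
          unfolding 2 True
        proof (rule L2.matrix_bound_2[OF fin C'(1) a _ \<xi>])
          fix x c assume "x \<in> topspace X"
          then have "lpn p I (\<lambda>i. cmod (\<Sum>j\<in>J. a i j x * c j)) \<le> C * lpn p J (\<lambda>j. cmod (c j))" by (rule C)
          also have "\<dots> \<le> C' * lpn p J (\<lambda>j. cmod (c j))" using C'(2) fin by (intro mult_right_mono) auto
          finally show "lpn (ereal 2) I (\<lambda>i. cmod (\<Sum>j\<in>J. a i j x * c j)) \<le> C' * lpn (ereal 2) J (\<lambda>j. cmod (c j))"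
            unfolding 2 True .
        qed
        also have "C' * ?N = C * ?N + e * (?N / (?N + 1))" by (simp add: C'_def distrib_right)
        also have "\<dots> \<le> C * ?N + e * 1" using N e by (intro add_left_mono mult_left_mono) (auto simp: divide_le_eq)
        finally show "lpn p I (\<lambda>i. nrm E (finsum E (\<lambda>j. \<pi> (a i j) (\<xi> j)) J)) \<le> C * ?N + e" by simp
      qed
    qed
  qed
qed

section \<open>The norms of \<open>\<ell>\<^sup>p\<close>-sums\<close>

lemma lp_sum_simps:
  "zero (lp_sum p I E) = (\<lambda>_. zero E)" "add (lp_sum p I E) \<xi> \<eta> = (\<lambda>i. add E (\<xi> i) (\<eta> i))"
  "smult (lp_sum p I E) c \<xi> = (\<lambda>i. smult E c (\<xi> i))"
  by (simp_all add: lp_sum_def)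

lemma lp_sum_carrier:
  "\<xi> \<in> carrier (lp_sum p I E) \<longleftrightarrow> (\<forall>i\<in>I. \<xi> i \<in> carrier E) \<and> (\<forall>i. i \<notin> I \<longrightarrow> \<xi> i = zero E) \<and>
     (if p = \<infinity> then \<forall>\<epsilon>>0. finite {i \<in> I. \<epsilon> \<le> nrm E (\<xi> i)}
      else (\<lambda>i. nrm E (\<xi> i) powr real_of_ereal p) summable_on I)"
  by (simp add: lp_sum_def)

lemma lp_sum_nrm:
  "nrm (lp_sum p I E) \<xi> = (if p = \<infinity> then SUP i. nrm E (\<xi> i)
     else (\<Sum>\<^sub>\<infinity>i\<in>I. nrm E (\<xi> i) powr real_of_ereal p) powr (1 / real_of_ereal p))"
  by (simp add: lp_sum_def)

text \<open>Turns membership in l^r into boundedness of finite sections, so that \<open>lpn\<close>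
  estimates decide it.\<close>

lemma summable_on_powr_iff:
  fixes v :: "'i \<Rightarrow> real"
  assumes r: "1 \<le> r" and v: "\<And>i. i \<in> I \<Longrightarrow> 0 \<le> v i"
  shows "(\<lambda>i. v i powr r) summable_on I \<longleftrightarrow> (\<exists>C. \<forall>F. finite F \<longrightarrow> F \<subseteq> I \<longrightarrow> lpn (ereal r) F v \<le> C)"
proof
  assume s: "(\<lambda>i. v i powr r) summable_on I"
  have "lpn (ereal r) F v \<le> (infsum (\<lambda>i. v i powr r) I) powr (1 / r)" if F: "finite F" "F \<subseteq> I" for F
  proof -
    have "(\<Sum>i\<in>F. \<bar>v i\<bar> powr r) = (\<Sum>i\<in>F. v i powr r)" using v F by (intro sum.cong) auto
    also have "\<dots> \<le> infsum (\<lambda>i. v i powr r) I" using s F by (intro finite_sum_le_infsum) auto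
    finally show ?thesis using r by (auto simp: lpn_real intro!: powr_mono2 sum_nonneg)
  qed
  then show "\<exists>C. \<forall>F. finite F \<longrightarrow> F \<subseteq> I \<longrightarrow> lpn (ereal r) F v \<le> C" by blast
next
  assume "\<exists>C. \<forall>F. finite F \<longrightarrow> F \<subseteq> I \<longrightarrow> lpn (ereal r) F v \<le> C"
  then obtain C where C: "\<And>F. finite F \<Longrightarrow> F \<subseteq> I \<Longrightarrow> lpn (ereal r) F v \<le> C" by blast
  have C0: "0 \<le> C" using C[of "{}"] by simp
  show "(\<lambda>i. v i powr r) summable_on I"
  proof (rule nonneg_bdd_above_summable_on)
    show "bdd_above (sum (\<lambda>i. v i powr r) ` {F. F \<subseteq> I \<and> finite F})"
    proof (rule bdd_aboveI2)
      fix F assume F: "F \<in> {F. F \<subseteq> I \<and> finite F}"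
      then have "(\<Sum>i\<in>F. v i powr r) = (\<Sum>i\<in>F. \<bar>v i\<bar> powr r)" using v by (intro sum.cong) auto
      also have "\<dots> \<le> C powr r" using C[of F] F C0 r by (subst lpn_real_le_iff[symmetric]) auto
      finally show "(\<Sum>i\<in>F. v i powr r) \<le> C powr r" .
    qed
  qed auto
qed

text \<open>The following two lemmas do not ask for \<open>\<xi>\<close> to lie in the carrier: if \<open>\<xi>\<close> is not
  \<open>p\<close>-summable, then its norm is \<open>0\<close>.\<close>

lemma lp_sum_nrm_le:
  assumes p: "1 \<le> p" and pos: "\<And>i. i \<in> I \<Longrightarrow> 0 \<le> nrm E (\<xi> i)"
    and le: "\<And>F. finite F \<Longrightarrow> F \<subseteq> I \<Longrightarrow> lpn p F (\<lambda>i. nrm E (\<xi> i)) \<le> C"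
    and out: "\<And>i. i \<notin> I \<Longrightarrow> nrm E (\<xi> i) \<le> C"
  shows "nrm (lp_sum p I E) \<xi> \<le> C"
  using p
proof (cases rule: exponent_cases)
  case 1
  have "nrm E (\<xi> i) \<le> C" for i
  proof (cases "i \<in> I")
    case True
    then show ?thesis using le[of "{i}"] p by simp
  qed (rule out)
  then show ?thesis using 1 by (auto simp: lp_sum_nrm intro!: cSUP_least)
next
  case (2 r)
  have C0: "0 \<le> C" using le[of "{}"] by simp
  have "(\<Sum>\<^sub>\<infinity>i\<in>I. nrm E (\<xi> i) powr r) \<le> C powr r"
  proof (rule infsum_le_finite_sums)
    show "(\<lambda>i. nrm E (\<xi> i) powr r) summable_on I"
      using le 2 pos by (subst summable_on_powr_iff) auto
    fix F assume F: "finite F" "F \<subseteq> I"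
    then have "(\<Sum>i\<in>F. nrm E (\<xi> i) powr r) = (\<Sum>i\<in>F. \<bar>nrm E (\<xi> i)\<bar> powr r)" using pos by (intro sum.cong) auto
    also have "\<dots> \<le> C powr r" using le[OF F] C0 2 by (subst lpn_real_le_iff[symmetric]) auto
    finally show "(\<Sum>i\<in>F. nrm E (\<xi> i) powr r) \<le> C powr r" .
  qed
  then show ?thesis using 2 C0 by (simp add: lp_sum_nrm powr_root_le_iff infsum_nonneg)
qed

lemma lpn_le_lp_sum_nrm:
  assumes p: "1 \<le> p" and pos: "\<And>i. i \<in> I \<Longrightarrow> 0 \<le> nrm E (\<xi> i)"
    and le: "\<And>F. finite F \<Longrightarrow> F \<subseteq> I \<Longrightarrow> lpn p F (\<lambda>i. nrm E (\<xi> i)) \<le> C"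
    and out: "\<And>i. i \<notin> I \<Longrightarrow> nrm E (\<xi> i) = 0"
    and F: "finite F" "F \<subseteq> I"
  shows "lpn p F (\<lambda>i. nrm E (\<xi> i)) \<le> nrm (lp_sum p I E) \<xi>"
  using p
proof (cases rule: exponent_cases)
  case 1
  have C0: "0 \<le> C" using le[of "{}"] by simp
  have bd: "nrm E (\<xi> i) \<le> C" for i
  proof (cases "i \<in> I")
    case True
    then show ?thesis using le[of "{i}"] p by simp
  qed (use out C0 in simp)
  have "nrm E (\<xi> i) \<le> (SUP i. nrm E (\<xi> i))" for i
    using bd by (intro cSUP_upper bdd_aboveI2) auto
  moreover have "0 \<le> (SUP i. nrm E (\<xi> i))"
  proof (rule cSUP_upper2[where x = undefined])
    show "bdd_above (range (\<lambda>i. nrm E (\<xi> i)))" using bd by (intro bdd_aboveI2) auto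
    show "0 \<le> nrm E (\<xi> undefined)" using pos[of undefined] out[of undefined] by (cases "undefined \<in> I") auto
  qed auto
  ultimately show ?thesis using 1 F pos by (auto simp: lp_sum_nrm lpn_inf_le_iff subset_iff)
next
  case (2 r)
  have "(\<Sum>i\<in>F. \<bar>nrm E (\<xi> i)\<bar> powr r) = (\<Sum>i\<in>F. nrm E (\<xi> i) powr r)" using pos F by (intro sum.cong) auto
  also have "\<dots> \<le> (\<Sum>\<^sub>\<infinity>i\<in>I. nrm E (\<xi> i) powr r)"
  proof (rule finite_sum_le_infsum)
    show "(\<lambda>i. nrm E (\<xi> i) powr r) summable_on I"
      using le 2 pos by (subst summable_on_powr_iff) auto
  qed (use F in auto)
  finally show ?thesis using 2 by (auto simp: lp_sum_nrm lpn_real intro!: powr_mono2 sum_nonneg)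
qed

lemma lp_sum_lpn_bounded:
  assumes p: "1 \<le> p" and \<xi>: "\<xi> \<in> carrier (lp_sum p I E)" and pos: "\<And>x. x \<in> carrier E \<Longrightarrow> 0 \<le> nrm E x"
  obtains C where "\<And>F. finite F \<Longrightarrow> F \<subseteq> I \<Longrightarrow> lpn p F (\<lambda>i. nrm E (\<xi> i)) \<le> C"
proof -
  have pos': "0 \<le> nrm E (\<xi> i)" if "i \<in> I" for i using \<xi> pos that by (simp add: lp_sum_carrier)
  have "\<exists>C. \<forall>F. finite F \<longrightarrow> F \<subseteq> I \<longrightarrow> lpn p F (\<lambda>i. nrm E (\<xi> i)) \<le> C"
    using p
  proof (cases rule: exponent_cases)
    case 1
    \<comment> \<open>All but finitely many coordinates are below 1; the finitely many others are
      bounded by their own norm.\<close>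
    let ?G = "{i \<in> I. 1 \<le> nrm E (\<xi> i)}"
    have G: "finite ?G" using \<xi> 1 by (simp add: lp_sum_carrier)
    define C where "C = max 1 (lpn \<infinity> ?G (\<lambda>i. nrm E (\<xi> i)))"
    have "nrm E (\<xi> i) \<le> C" if "i \<in> I" for i
      using lpn_member[OF G, of \<infinity> i "\<lambda>i. nrm E (\<xi> i)"] that by (cases "1 \<le> nrm E (\<xi> i)") (auto simp: C_def)
    then show ?thesis using 1 pos' by (intro exI[of _ C]) (auto simp: lpn_inf_le_iff C_def subset_iff)
  next
    case (2 r)
    then show ?thesis using \<xi> pos' summable_on_powr_iff[of r I "\<lambda>i. nrm E (\<xi> i)"] by (simp add: lp_sum_carrier)
  qed
  then show ?thesis using that by blast
qed

lemma lpn_le_nrm: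
  assumes p: "1 \<le> p" and \<xi>: "\<xi> \<in> carrier (lp_sum p I E)" and pos: "\<And>x. x \<in> carrier E \<Longrightarrow> 0 \<le> nrm E x"
    and z: "nrm E (zero E) = 0" and F: "finite F" "F \<subseteq> I"
  shows "lpn p F (\<lambda>i. nrm E (\<xi> i)) \<le> nrm (lp_sum p I E) \<xi>"
proof -
  obtain C where "\<And>F. finite F \<Longrightarrow> F \<subseteq> I \<Longrightarrow> lpn p F (\<lambda>i. nrm E (\<xi> i)) \<le> C"
    using lp_sum_lpn_bounded[OF p \<xi> pos] by blast
  then show ?thesis using \<xi> pos z F by (intro lpn_le_lp_sum_nrm[OF p]) (auto simp: lp_sum_carrier)
qed

subsection \<open>Scalar sequence spaces\<close>

lemma complex_space_simps [simp]:
  "carrier complex_space = UNIV" "zero complex_space = 0" "add complex_space x y = x + y"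
  "smult complex_space c x = c * x" "nrm complex_space x = cmod x"
  by (simp_all add: complex_space_def)

abbreviation lp :: "ereal \<Rightarrow> 'i set \<Rightarrow> ('i \<Rightarrow> complex) nspace" where
  "lp p I \<equiv> lp_sum p I complex_space"

lemma lp_lpn_le: "1 \<le> p \<Longrightarrow> \<xi> \<in> carrier (lp p I) \<Longrightarrow> finite F \<Longrightarrow> F \<subseteq> I \<Longrightarrow> lpn p F (\<lambda>i. cmod (\<xi> i)) \<le> nrm (lp p I) \<xi>"
  using lpn_le_nrm[of p \<xi> I complex_space F] by simp

lemma lp_nrm_le:
  assumes "1 \<le> p" "\<And>F. finite F \<Longrightarrow> F \<subseteq> I \<Longrightarrow> lpn p F (\<lambda>i. cmod (\<xi> i)) \<le> C" "\<And>i. i \<notin> I \<Longrightarrow> \<xi> i = 0"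
  shows "nrm (lp p I) \<xi> \<le> C"
  using assms assms(2)[of "{}"] by (intro lp_sum_nrm_le) auto

lemma lp_nrm_nonneg: "1 \<le> p \<Longrightarrow> \<xi> \<in> carrier (lp p I) \<Longrightarrow> 0 \<le> nrm (lp p I) \<xi>"
  using lp_lpn_le[of p \<xi> I "{}"] by simp

lemma lp_carrier_out: "\<xi> \<in> carrier (lp p I) \<Longrightarrow> i \<notin> I \<Longrightarrow> \<xi> i = 0"
  by (simp add: lp_sum_carrier)

lemma lp_inf_level: "\<xi> \<in> carrier (lp \<infinity> I) \<Longrightarrow> 0 < \<epsilon> \<Longrightarrow> finite {i \<in> I. \<epsilon> \<le> cmod (\<xi> i)}"
  by (simp add: lp_sum_carrier)

lemma lp_pointwise_le: "1 \<le> p \<Longrightarrow> \<xi> \<in> carrier (lp p I) \<Longrightarrow> cmod (\<xi> i) \<le> nrm (lp p I) \<xi>"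
  using lp_lpn_le[of p \<xi> I "{i}"] lp_nrm_nonneg[of p \<xi> I] by (cases "i \<in> I") (auto simp: lp_carrier_out)

text \<open>For \<open>p = \<infinity>\<close> membership in \<open>c\<^sub>0\<close> is not a matter of boundedness; approximation by elements
  already known to lie in the space covers both cases.\<close>

lemma lp_carrier_approx:
  assumes p: "1 \<le> p" and out: "\<And>i. i \<notin> I \<Longrightarrow> \<xi> i = 0"
    and ap: "\<And>\<epsilon>. 0 < \<epsilon> \<Longrightarrow> \<exists>\<eta>\<in>carrier (lp p I). \<forall>F. finite F \<longrightarrow> F \<subseteq> I \<longrightarrow> lpn p F (\<lambda>i. cmod (\<xi> i - \<eta> i)) \<le> \<epsilon>"
  shows "\<xi> \<in> carrier (lp p I)"
  using p
proof (cases rule: exponent_cases)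
  case 1
  have "finite {i \<in> I. \<epsilon> \<le> cmod (\<xi> i)}" if \<epsilon>: "0 < \<epsilon>" for \<epsilon>
  proof -
    obtain \<eta> where \<eta>: "\<eta> \<in> carrier (lp p I)" "\<And>F. finite F \<Longrightarrow> F \<subseteq> I \<Longrightarrow> lpn p F (\<lambda>i. cmod (\<xi> i - \<eta> i)) \<le> \<epsilon> / 2"
      using ap[of "\<epsilon> / 2"] \<epsilon> by auto
    have "finite {i \<in> I. \<epsilon> / 2 \<le> cmod (\<eta> i)}" using lp_inf_level[OF _ half_gt_zero[OF \<epsilon>]] \<eta>(1) unfolding 1 .
    moreover have "{i \<in> I. \<epsilon> \<le> cmod (\<xi> i)} \<subseteq> {i \<in> I. \<epsilon> / 2 \<le> cmod (\<eta> i)}"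
    proof
      fix i assume i: "i \<in> {i \<in> I. \<epsilon> \<le> cmod (\<xi> i)}"
      then have "cmod (\<xi> i - \<eta> i) \<le> \<epsilon> / 2" using \<eta>(2)[of "{i}"] p by simp
      moreover have "cmod (\<xi> i) \<le> cmod (\<eta> i) + cmod (\<xi> i - \<eta> i)" by (rule norm_triangle_sub)
      moreover have "\<epsilon> \<le> cmod (\<xi> i)" using i by simp
      ultimately have "\<epsilon> / 2 \<le> cmod (\<eta> i)" by argo
      then show "i \<in> {i \<in> I. \<epsilon> / 2 \<le> cmod (\<eta> i)}" using i by simp
    qed
    ultimately show ?thesis by (rule rev_finite_subset)
  qed
  then show ?thesis using 1 out by (simp add: lp_sum_carrier)
next
  case (2 r)
  obtain \<eta> where \<eta>: "\<eta> \<in> carrier (lp p I)" "\<And>F. finite F \<Longrightarrow> F \<subseteq> I \<Longrightarrow> lpn p F (\<lambda>i. cmod (\<xi> i - \<eta> i)) \<le> 1"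
    using ap[of 1] by auto
  have "lpn (ereal r) F (\<lambda>i. cmod (\<xi> i)) \<le> nrm (lp p I) \<eta> + 1" if F: "finite F" "F \<subseteq> I" for F
  proof -
    have "lpn p F (\<lambda>i. cmod (\<xi> i)) \<le> lpn p F (\<lambda>i. cmod (\<eta> i) + cmod (\<xi> i - \<eta> i))"
      using F p by (intro lpn_mono) (auto intro: order_trans[OF norm_triangle_sub] abs_ge_self)
    also have "\<dots> \<le> lpn p F (\<lambda>i. cmod (\<eta> i)) + lpn p F (\<lambda>i. cmod (\<xi> i - \<eta> i))" by (rule lpn_triangle[OF F(1) p])
    also have "\<dots> \<le> nrm (lp p I) \<eta> + 1" using lp_lpn_le[OF p \<eta>(1) F] \<eta>(2)[OF F] by linarith
    finally show ?thesis using 2 by simp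
  qed
  then have "(\<lambda>i. cmod (\<xi> i) powr r) summable_on I" using 2 by (subst summable_on_powr_iff) auto
  then show ?thesis using 2 out by (simp add: lp_sum_carrier)
qed

lemma lp_finite_support:
  assumes p: "1 \<le> p" and J: "finite J" "J \<subseteq> I"
  shows "(\<lambda>i. if i \<in> J then c i else 0) \<in> carrier (lp p I)"
    and "nrm (lp p I) (\<lambda>i. if i \<in> J then c i else 0) = lpn p J (\<lambda>i. cmod (c i))"
proof -
  let ?\<xi> = "\<lambda>i. if i \<in> J then c i else 0"
  have le: "lpn p F (\<lambda>i. cmod (?\<xi> i)) \<le> lpn p J (\<lambda>i. cmod (c i))" if F: "finite F" for F
    using p
  proof (cases rule: exponent_cases)
    case 1
    then show ?thesis using F J lpn_member[OF J(1) p, of _ "\<lambda>i. cmod (c i)"] by (auto simp: lpn_inf_le_iff)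
  next
    case (2 r)
    have "(\<Sum>i\<in>F. \<bar>cmod (?\<xi> i)\<bar> powr r) = (\<Sum>i\<in>F. if i \<in> J then cmod (c i) powr r else 0)"
      by (intro sum.cong) auto
    also have "\<dots> = (\<Sum>i\<in>F \<inter> J. cmod (c i) powr r)" using F by (simp add: sum.inter_restrict)
    also have "\<dots> \<le> (\<Sum>i\<in>J. cmod (c i) powr r)" using J by (intro sum_mono2) auto
    finally show ?thesis unfolding 2 using 2 J by (auto simp: lpn_real intro!: powr_mono2 sum_nonneg)
  qed
  show c: "?\<xi> \<in> carrier (lp p I)"
    using p
  proof (cases rule: exponent_cases)
    case 1
    have "finite {i \<in> I. \<epsilon> \<le> cmod (?\<xi> i)}" if "0 < \<epsilon>" for \<epsilon>
      using that by (intro finite_subset[OF _ J(1)]) auto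
    then show ?thesis using 1 J by (auto simp: lp_sum_carrier)
  next
    case (2 r)
    then have "(\<lambda>i. cmod (?\<xi> i) powr r) summable_on I" using le by (subst summable_on_powr_iff) auto
    then show ?thesis using 2 J by (auto simp: lp_sum_carrier)
  qed
  have "lpn p J (\<lambda>i. cmod (c i)) = lpn p J (\<lambda>i. cmod (?\<xi> i))" by (intro lpn_cong) auto
  also have "\<dots> \<le> nrm (lp p I) ?\<xi>" by (rule lp_lpn_le[OF p c J])
  finally have 1: "lpn p J (\<lambda>i. cmod (c i)) \<le> nrm (lp p I) ?\<xi>" .
  have "nrm (lp p I) ?\<xi> \<le> lpn p J (\<lambda>i. cmod (c i))" using J by (intro lp_nrm_le[OF p] le) auto
  with 1 show "nrm (lp p I) ?\<xi> = lpn p J (\<lambda>i. cmod (c i))" by simp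
qed

lemma lp_scale:
  assumes p: "1 \<le> p" and \<xi>: "\<xi> \<in> carrier (lp p I)"
  shows "(\<lambda>i. c * \<xi> i) \<in> carrier (lp p I)" and "nrm (lp p I) (\<lambda>i. c * \<xi> i) = cmod c * nrm (lp p I) \<xi>"
proof -
  have mem: "(\<lambda>i. c * \<xi> i) \<in> carrier (lp p I)" if \<xi>: "\<xi> \<in> carrier (lp p I)" for c \<xi>
    using p
  proof (cases rule: exponent_cases)
    case 1
    have "finite {i \<in> I. \<epsilon> \<le> cmod (c * \<xi> i)}" if \<epsilon>: "0 < \<epsilon>" for \<epsilon>
    proof (cases "c = 0")
      case False
      then have "finite {i \<in> I. \<epsilon> / cmod c \<le> cmod (\<xi> i)}" using \<xi> \<epsilon> 1 by (simp add: lp_sum_carrier)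
      then show ?thesis using False by (simp add: norm_mult divide_le_eq mult.commute)
    qed (use \<epsilon> in simp)
    then show ?thesis using 1 \<xi> by (simp add: lp_sum_carrier)
  next
    case (2 r)
    have "(\<lambda>i. cmod c powr r * cmod (\<xi> i) powr r) summable_on I"
      using \<xi> 2 by (intro summable_on_cmult_right) (simp add: lp_sum_carrier)
    then show ?thesis using 2 \<xi> by (simp add: lp_sum_carrier norm_mult powr_mult)
  qed
  show "(\<lambda>i. c * \<xi> i) \<in> carrier (lp p I)" by (rule mem[OF \<xi>])
  have le: "nrm (lp p I) (\<lambda>i. c * \<xi> i) \<le> cmod c * nrm (lp p I) \<xi>" if \<xi>: "\<xi> \<in> carrier (lp p I)" for c \<xi>
  proof (rule lp_nrm_le[OF p])
    fix F assume F: "finite F" "F \<subseteq> I"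
    have "lpn p F (\<lambda>i. cmod (c * \<xi> i)) = cmod c * lpn p F (\<lambda>i. cmod (\<xi> i))"
      using lpn_scale[OF F(1) p, of "cmod c" "\<lambda>i. cmod (\<xi> i)"] by (simp add: norm_mult)
    also have "\<dots> \<le> cmod c * nrm (lp p I) \<xi>" by (intro mult_left_mono lp_lpn_le[OF p \<xi> F]) auto
    finally show "lpn p F (\<lambda>i. cmod (c * \<xi> i)) \<le> cmod c * nrm (lp p I) \<xi>" .
  qed (use \<xi> in \<open>simp add: lp_sum_carrier\<close>)
  show "nrm (lp p I) (\<lambda>i. c * \<xi> i) = cmod c * nrm (lp p I) \<xi>"
  proof (cases "c = 0")
    case True
    then show ?thesis using le[OF \<xi>, of c] lp_nrm_nonneg[OF p mem[OF \<xi>, of c]] by simp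
  next
    case False
    have "cmod c * nrm (lp p I) (\<lambda>i. inverse c * (c * \<xi> i)) \<le> cmod c * (cmod (inverse c) * nrm (lp p I) (\<lambda>i. c * \<xi> i))"
      by (intro mult_left_mono le mem \<xi>) auto
    then have "cmod c * nrm (lp p I) \<xi> \<le> nrm (lp p I) (\<lambda>i. c * \<xi> i)"
      using False by (simp add: mult.assoc[symmetric] norm_mult[symmetric])
    with le[OF \<xi>, of c] show ?thesis by simp
  qed
qed

lemma lp_add:
  assumes p: "1 \<le> p" and \<xi>: "\<xi> \<in> carrier (lp p I)" and \<eta>: "\<eta> \<in> carrier (lp p I)"
  shows "(\<lambda>i. \<xi> i + \<eta> i) \<in> carrier (lp p I)" and "nrm (lp p I) (\<lambda>i. \<xi> i + \<eta> i) \<le> nrm (lp p I) \<xi> + nrm (lp p I) \<eta>"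
proof -
  have le: "lpn p F (\<lambda>i. cmod (\<xi> i + \<eta> i)) \<le> nrm (lp p I) \<xi> + nrm (lp p I) \<eta>" if F: "finite F" "F \<subseteq> I" for F
  proof -
    have "lpn p F (\<lambda>i. cmod (\<xi> i + \<eta> i)) \<le> lpn p F (\<lambda>i. cmod (\<xi> i) + cmod (\<eta> i))"
      using F p by (intro lpn_mono) (auto intro: norm_triangle_ineq)
    also have "\<dots> \<le> lpn p F (\<lambda>i. cmod (\<xi> i)) + lpn p F (\<lambda>i. cmod (\<eta> i))" by (rule lpn_triangle[OF F(1) p])
    finally show ?thesis using lp_lpn_le[OF p \<xi> F] lp_lpn_le[OF p \<eta> F] by linarith
  qed
  have out: "\<xi> i + \<eta> i = 0" if "i \<notin> I" for i using \<xi> \<eta> that by (simp add: lp_sum_carrier)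
  show "nrm (lp p I) (\<lambda>i. \<xi> i + \<eta> i) \<le> nrm (lp p I) \<xi> + nrm (lp p I) \<eta>"
    by (intro lp_nrm_le[OF p] le out)
  show "(\<lambda>i. \<xi> i + \<eta> i) \<in> carrier (lp p I)"
    using p
  proof (cases rule: exponent_cases)
    case 1
    have "finite {i \<in> I. \<epsilon> \<le> cmod (\<xi> i + \<eta> i)}" if \<epsilon>: "0 < \<epsilon>" for \<epsilon>
    proof -
      have "finite ({i \<in> I. \<epsilon> / 2 \<le> cmod (\<xi> i)} \<union> {i \<in> I. \<epsilon> / 2 \<le> cmod (\<eta> i)})"
        using lp_inf_level[OF _ half_gt_zero[OF \<epsilon>]] \<xi> \<eta> unfolding 1 by blast
      moreover have "{i \<in> I. \<epsilon> \<le> cmod (\<xi> i + \<eta> i)} \<subseteq> {i \<in> I. \<epsilon> / 2 \<le> cmod (\<xi> i)} \<union> {i \<in> I. \<epsilon> / 2 \<le> cmod (\<eta> i)}"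
      proof
        fix i assume i: "i \<in> {i \<in> I. \<epsilon> \<le> cmod (\<xi> i + \<eta> i)}"
        have "\<epsilon> \<le> cmod (\<xi> i) + cmod (\<eta> i)" using i norm_triangle_ineq[of "\<xi> i" "\<eta> i"] by auto
        then have "\<epsilon> / 2 \<le> cmod (\<xi> i) \<or> \<epsilon> / 2 \<le> cmod (\<eta> i)" by argo
        then show "i \<in> {i \<in> I. \<epsilon> / 2 \<le> cmod (\<xi> i)} \<union> {i \<in> I. \<epsilon> / 2 \<le> cmod (\<eta> i)}" using i by simp
      qed
      ultimately show ?thesis by (rule rev_finite_subset)
    qed
    then show ?thesis using 1 out by (simp add: lp_sum_carrier)
  next
    case (2 r)
    then have "(\<lambda>i. cmod (\<xi> i + \<eta> i) powr r) summable_on I" using le by (subst summable_on_powr_iff) auto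
    then show ?thesis using 2 out by (simp add: lp_sum_carrier)
  qed
qed

lemma lp_zero: "1 \<le> p \<Longrightarrow> (\<lambda>_. 0) \<in> carrier (lp p I)" "1 \<le> p \<Longrightarrow> nrm (lp p I) (\<lambda>_. 0) = 0"
  using lp_finite_support[of p "{}" I] by simp_all

lemma lp_nrm_eq_0:
  assumes "1 \<le> p" "\<xi> \<in> carrier (lp p I)" "nrm (lp p I) \<xi> = 0"
  shows "\<xi> = (\<lambda>_. 0)"
  using lp_pointwise_le[OF assms(1,2)] assms(3) by auto

text \<open>The limit is taken coordinatewise. That it lies in the space, which for p = \<infinity>
  is c_0, follows from \<open>lp_carrier_approx\<close> with members of the sequence as
  approximants.\<close>

lemma lp_complete:
  fixes \<sigma> :: "nat \<Rightarrow> 'i \<Rightarrow> complex"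
  assumes p: "1 \<le> p" and \<sigma>: "\<And>n. \<sigma> n \<in> carrier (lp p I)"
    and cau: "\<And>\<epsilon>. 0 < \<epsilon> \<Longrightarrow> \<exists>N. \<forall>m\<ge>N. \<forall>n\<ge>N. nrm (lp p I) (\<lambda>i. \<sigma> m i - \<sigma> n i) < \<epsilon>"
  obtains \<xi> where "\<xi> \<in> carrier (lp p I)" "\<And>\<epsilon>. 0 < \<epsilon> \<Longrightarrow> \<exists>N. \<forall>n\<ge>N. nrm (lp p I) (\<lambda>i. \<sigma> n i - \<xi> i) < \<epsilon>"
proof -
  have diff: "(\<lambda>i. \<sigma> m i - \<sigma> n i) \<in> carrier (lp p I)" for m n
    using lp_add(1)[OF p \<sigma> lp_scale(1)[OF p \<sigma>, of "-1"]] by simp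
  have "Cauchy (\<lambda>n. \<sigma> n i)" for i
  proof (rule CauchyI)
    fix \<epsilon> :: real assume "0 < \<epsilon>"
    then obtain N where "\<forall>m\<ge>N. \<forall>n\<ge>N. nrm (lp p I) (\<lambda>i. \<sigma> m i - \<sigma> n i) < \<epsilon>" using cau by blast
    then show "\<exists>N. \<forall>m\<ge>N. \<forall>n\<ge>N. norm (\<sigma> m i - \<sigma> n i) < \<epsilon>"
      using lp_pointwise_le[OF p diff] by (meson le_less_trans)
  qed
  then have "\<exists>l. (\<lambda>n. \<sigma> n i) \<longlonglongrightarrow> l" for i using Cauchy_convergent_iff convergent_def by blast
  then obtain \<xi> where \<xi>: "\<And>i. (\<lambda>n. \<sigma> n i) \<longlonglongrightarrow> \<xi> i" by metis
  have out: "\<xi> i = 0" if "i \<notin> I" for i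
  proof -
    have "(\<lambda>n. \<sigma> n i) = (\<lambda>_. 0)" using \<sigma> that by (simp add: lp_sum_carrier)
    then show ?thesis using \<xi>[of i] LIMSEQ_unique tendsto_const by metis
  qed
  have near: "\<exists>N. \<forall>m\<ge>N. \<forall>F. finite F \<longrightarrow> F \<subseteq> I \<longrightarrow> lpn p F (\<lambda>i. cmod (\<sigma> m i - \<xi> i)) \<le> \<epsilon>" if \<epsilon>: "0 < \<epsilon>" for \<epsilon>
  proof -
    obtain N where N: "\<forall>m\<ge>N. \<forall>n\<ge>N. nrm (lp p I) (\<lambda>i. \<sigma> m i - \<sigma> n i) < \<epsilon>" using cau[OF \<epsilon>] by blast
    have "lpn p F (\<lambda>i. cmod (\<sigma> m i - \<xi> i)) \<le> \<epsilon>" if m: "m \<ge> N" and F: "finite F" "F \<subseteq> I" for m F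
    proof (rule lpn_limit_le[OF F(1) p sequentially_bot])
      show "((\<lambda>n. cmod (\<sigma> m i - \<sigma> n i)) \<longlongrightarrow> cmod (\<sigma> m i - \<xi> i)) sequentially" for i
        by (intro tendsto_intros \<xi>)
      show "eventually (\<lambda>n. lpn p F (\<lambda>i. cmod (\<sigma> m i - \<sigma> n i)) \<le> \<epsilon>) sequentially"
        unfolding eventually_sequentially
      proof (intro exI[of _ N] allI impI)
        fix n assume "N \<le> n"
        then have "nrm (lp p I) (\<lambda>i. \<sigma> m i - \<sigma> n i) < \<epsilon>" using N m by blast
        then show "lpn p F (\<lambda>i. cmod (\<sigma> m i - \<sigma> n i)) \<le> \<epsilon>" using lp_lpn_le[OF p diff F, of m n] by simp
      qed
    qed
    then show ?thesis by blast
  qed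
  show ?thesis
  proof (rule that)
    show \<xi>c: "\<xi> \<in> carrier (lp p I)"
    proof (rule lp_carrier_approx[OF p out])
      fix \<epsilon> :: real assume "0 < \<epsilon>"
      then obtain N where N: "\<forall>m\<ge>N. \<forall>F. finite F \<longrightarrow> F \<subseteq> I \<longrightarrow> lpn p F (\<lambda>i. cmod (\<sigma> m i - \<xi> i)) \<le> \<epsilon>"
        using near by blast
      then have "\<forall>F. finite F \<longrightarrow> F \<subseteq> I \<longrightarrow> lpn p F (\<lambda>i. cmod (\<xi> i - \<sigma> N i)) \<le> \<epsilon>"
        by (simp add: norm_minus_commute)
      then show "\<exists>\<eta>\<in>carrier (lp p I). \<forall>F. finite F \<longrightarrow> F \<subseteq> I \<longrightarrow> lpn p F (\<lambda>i. cmod (\<xi> i - \<eta> i)) \<le> \<epsilon>"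
        using \<sigma> by blast
    qed
    fix \<epsilon> :: real assume \<epsilon>: "0 < \<epsilon>"
    obtain N where N: "\<And>m F. m \<ge> N \<Longrightarrow> finite F \<Longrightarrow> F \<subseteq> I \<Longrightarrow> lpn p F (\<lambda>i. cmod (\<sigma> m i - \<xi> i)) \<le> \<epsilon> / 2"
      using near[OF half_gt_zero[OF \<epsilon>]] by blast
    have "nrm (lp p I) (\<lambda>i. \<sigma> n i - \<xi> i) < \<epsilon>" if "n \<ge> N" for n
    proof -
      have "nrm (lp p I) (\<lambda>i. \<sigma> n i - \<xi> i) \<le> \<epsilon> / 2"
        using N[OF that] out \<sigma>[of n] by (intro lp_nrm_le[OF p]) (auto simp: lp_sum_carrier)
      then show ?thesis using \<epsilon> by linarith
    qed
    then show "\<exists>N. \<forall>n\<ge>N. nrm (lp p I) (\<lambda>i. \<sigma> n i - \<xi> i) < \<epsilon>" by blast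
  qed
qed

section \<open>Copies of sequence spaces in the universe\<close>

text \<open>The point \<open>undefined\<close> serves as an arbitrary base point of the type \<open>'x\<close>; it need not lie in
  the space \<open>X\<close>.\<close>

definition spread :: "('g \<Rightarrow> complex) \<Rightarrow> ('x, 'g, 'i) points \<Rightarrow> complex" where
  "spread \<xi> = (\<lambda>s. case s of Inl (x, g) \<Rightarrow> if x = undefined then \<xi> g else 0 | Inr _ \<Rightarrow> 0)"

text \<open>Elements of \<open>universe\<close> are sets of functions, so a sequence is coded by a
  singleton; the agreement with a genuine \<open>Lp\<close> or \<open>C0\<close> is shown afterwards
  by an isometry.\<close>

definition embed :: "('g \<Rightarrow> complex) \<Rightarrow> ('x, 'g, 'i) universe" where
  "embed \<xi> = {spread \<xi>}"

definition unembed :: "('x, 'g, 'i) universe \<Rightarrow> 'g \<Rightarrow> complex" where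
  "unembed u g = (SOME f. f \<in> u) (Inl (undefined, g))"

lemma unembed_embed [simp]: "unembed (embed \<xi> :: ('x, 'g, 'i) universe) = \<xi>"
proof
  fix g
  have "(SOME f. f \<in> (embed \<xi> :: ('x, 'g, 'i) universe)) = spread \<xi>"
    unfolding embed_def by (rule some_equality) auto
  then show "unembed (embed \<xi> :: ('x, 'g, 'i) universe) g = \<xi> g"
    by (simp add: unembed_def spread_def)
qed

text \<open>The suprema range over spaces carried by \<open>universe\<close>, whereas the elements
  of \<open>lp p I\<close> are functions on the group; the structure is therefore transported along
  \<open>embed\<close>.\<close>

definition lp_copy :: "ereal \<Rightarrow> 'g set \<Rightarrow> ('x, 'g, 'i) universe nspace" where
  "lp_copy p I = \<lparr>carrier = embed ` carrier (lp p I), mult = undefined, one = undefined,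
     zero = embed (\<lambda>_. 0), add = (\<lambda>u v. embed (\<lambda>i. unembed u i + unembed v i)),
     smult = (\<lambda>c u. embed (\<lambda>i. c * unembed u i)), nrm = (\<lambda>u. nrm (lp p I) (unembed u))\<rparr>"

lemma lp_copy_simps [simp]:
  "carrier (lp_copy p I) = embed ` carrier (lp p I)" "zero (lp_copy p I) = embed (\<lambda>_. 0)"
  "add (lp_copy p I) u v = embed (\<lambda>i. unembed u i + unembed v i)"
  "smult (lp_copy p I) c u = embed (\<lambda>i. c * unembed u i)"
  "nrm (lp_copy p I) u = nrm (lp p I) (unembed u)"
  by (simp_all add: lp_copy_def)

lemma lp_copy_banach:
  assumes p: "1 \<le> p"
  shows "complex_banach_space (lp_copy p I :: ('x, 'g, 'i) universe nspace)"
proof (rule complex_banach_spaceI)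
  let ?E = "lp_copy p I :: ('x, 'g, 'i) universe nspace"
  fix \<sigma> :: "nat \<Rightarrow> ('x, 'g, 'i) universe"
  assume cl: "\<And>n. \<sigma> n \<in> carrier ?E"
    and cau: "\<And>\<epsilon>. 0 < \<epsilon> \<Longrightarrow> \<exists>N. \<forall>m\<ge>N. \<forall>n\<ge>N. nrm ?E (add ?E (\<sigma> m) (smult ?E (-1) (\<sigma> n))) < \<epsilon>"
  have \<sigma>: "unembed (\<sigma> n) \<in> carrier (lp p I)" for n using cl[of n] by auto
  have c: "\<exists>N. \<forall>m\<ge>N. \<forall>n\<ge>N. nrm (lp p I) (\<lambda>i. unembed (\<sigma> m) i - unembed (\<sigma> n) i) < \<epsilon>" if "0 < \<epsilon>" for \<epsilon>
    using cau[OF that] by simp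
  obtain \<xi> where "\<xi> \<in> carrier (lp p I)"
      "\<And>\<epsilon>. 0 < \<epsilon> \<Longrightarrow> \<exists>N. \<forall>n\<ge>N. nrm (lp p I) (\<lambda>i. unembed (\<sigma> n) i - \<xi> i) < \<epsilon>"
    using lp_complete[of p "\<lambda>n. unembed (\<sigma> n)" I, OF p \<sigma> c] by blast
  then show "\<exists>x\<in>carrier ?E. \<forall>\<epsilon>>0. \<exists>N. \<forall>n\<ge>N. nrm ?E (add ?E (\<sigma> n) (smult ?E (-1) x)) < \<epsilon>"
    by (intro bexI[of _ "embed \<xi>"]) auto
qed (auto simp: lp_add[OF p] lp_scale[OF p] lp_zero[OF p] lp_nrm_nonneg[OF p] algebra_simps
      dest: lp_nrm_eq_0[OF p] intro!: arg_cong[of _ _ embed])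

lemma spread_Inl [simp]: "spread \<xi> (Inl (undefined, g)) = \<xi> g"
  by (simp add: spread_def)

lemma AE_class_count_space: "AE_class (count_space S) f = {g. \<forall>s\<in>S. g s = f s}"
  by (simp add: AE_class_def AE_count_space)

lemma Lp_count_space_add:
  "add (Lp (count_space S) r) (AE_class (count_space S) f) (AE_class (count_space S) g)
    = AE_class (count_space S) (\<lambda>s. f s + g s)"
proof (intro equalityI subsetI)
  fix h assume "h \<in> AE_class (count_space S) (\<lambda>s. f s + g s)"
  then have "h \<in> (\<Union>f'\<in>AE_class (count_space S) f. \<Union>g'\<in>AE_class (count_space S) g. AE_class (count_space S) (\<lambda>s. f' s + g' s))"
    by (intro UN_I[of f] UN_I[of g]) (simp_all add: AE_class_count_space)
  then show "h \<in> add (Lp (count_space S) r) (AE_class (count_space S) f) (AE_class (count_space S) g)"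
    by (simp add: Lp_def)
qed (auto simp: Lp_def AE_class_count_space split: if_splits)

lemma Lp_count_space_smult:
  "smult (Lp (count_space S) r) c (AE_class (count_space S) f) = AE_class (count_space S) (\<lambda>s. c * f s)"
proof (intro equalityI subsetI)
  fix h assume "h \<in> AE_class (count_space S) (\<lambda>s. c * f s)"
  then have "h \<in> (\<Union>f'\<in>AE_class (count_space S) f. AE_class (count_space S) (\<lambda>s. c * f' s))"
    by (intro UN_I[of f]) (simp_all add: AE_class_count_space)
  then show "h \<in> smult (Lp (count_space S) r) c (AE_class (count_space S) f)"
    by (simp add: Lp_def)
qed (auto simp: Lp_def AE_class_count_space split: if_splits)

text \<open>Counting measure on a copy of \<open>I\<close> among the points: equality almost
  everywhere is equality on that copy, and Bochner integrability of |f|^r is its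
  summability.\<close>

lemma lp_copy_Lp:
  assumes r: "1 \<le> r"
  shows "isometrically_isomorphic (lp_copy (ereal r) I :: ('x, 'g, 'i) universe nspace)
    (Lp (count_space ((\<lambda>g. Inl (undefined, g)) ` I) :: ('x, 'g, 'i) points measure) r)"
proof -
  let ?h = "\<lambda>g. Inl (undefined, g) :: ('x, 'g, 'i) points"
  define S where "S = ?h ` I"
  let ?L = "Lp (count_space S :: ('x, 'g, 'i) points measure) r" and ?E = "lp_copy (ereal r) I :: ('x, 'g, 'i) universe nspace"
  have p: "1 \<le> ereal r" using r by simp
  have inj: "inj_on ?h I" by (auto simp: inj_on_def)
  define T :: "('x, 'g, 'i) universe \<Rightarrow> (('x, 'g, 'i) points \<Rightarrow> complex) set"
    where "T u = AE_class (count_space S) (spread (unembed u))" for u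
  have sum_eq: "(\<lambda>s. cmod (f s) powr r) summable_on S \<longleftrightarrow> (\<lambda>g. cmod (f (?h g)) powr r) summable_on I"
    "infsum (\<lambda>s. cmod (f s) powr r) S = infsum (\<lambda>g. cmod (f (?h g)) powr r) I" for f
    unfolding S_def using summable_on_reindex[OF inj, of "\<lambda>s. cmod (f s) powr r"]
      infsum_reindex[OF inj, of "\<lambda>s. cmod (f s) powr r"] by (auto simp: o_def)
  have int_iff: "integrable (count_space S) (\<lambda>s. cmod (f s) powr r) \<longleftrightarrow> (\<lambda>g. cmod (f (?h g)) powr r) summable_on I" for f
  proof -
    have "integrable (count_space S) (\<lambda>s. cmod (f s) powr r) \<longleftrightarrow> Infinite_Set_Sum.abs_summable_on (\<lambda>s. cmod (f s) powr r) S"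
      by (simp add: Infinite_Set_Sum.abs_summable_on_def)
    also have "\<dots> \<longleftrightarrow> (\<lambda>s. norm (cmod (f s) powr r)) summable_on S"
      by (rule abs_summable_equivalent[symmetric])
    finally show ?thesis by (simp add: sum_eq)
  qed
  have carr: "carrier ?L = AE_class (count_space S) ` {f. (\<lambda>g. cmod (f (?h g)) powr r) summable_on I}"
    by (simp add: Lp_def int_iff)
  have cls: "AE_class (count_space S) f = AE_class (count_space S) f' \<longleftrightarrow> (\<forall>g\<in>I. f (?h g) = f' (?h g))" for f f'
  proof -
    have "f \<in> AE_class (count_space S) f" by (simp add: AE_class_count_space)
    then show ?thesis by (auto simp: AE_class_count_space S_def)
  qed
  have nrmT: "nrm ?L (AE_class (count_space S) (spread \<xi>)) = nrm (lp (ereal r) I) \<xi>" if \<xi>: "\<xi> \<in> carrier (lp (ereal r) I)" for \<xi>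
  proof -
    let ?A = "AE_class (count_space S) (spread \<xi> :: ('x, 'g, 'i) points \<Rightarrow> complex)"
    let ?f = "SOME f. f \<in> ?A"
    have "?f \<in> ?A" by (rule someI[of _ "spread \<xi>"]) (simp add: AE_class_count_space)
    then have f: "?f (?h g) = \<xi> g" if "g \<in> I" for g using that by (auto simp: AE_class_count_space S_def)
    have sm: "(\<lambda>g. cmod (\<xi> g) powr r) summable_on I" using \<xi> by (simp add: lp_sum_carrier)
    then have "(\<lambda>g. cmod (?f (?h g)) powr r) summable_on I"
      using f by (subst summable_on_cong[where g = "\<lambda>g. cmod (\<xi> g) powr r"]) auto
    then have "(\<lambda>s. norm (cmod (?f s) powr r)) summable_on S" by (simp add: sum_eq)
    then have "infsetsum (\<lambda>s. cmod (?f s) powr r) S = infsum (\<lambda>s. cmod (?f s) powr r) S"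
      by (intro infsetsum_infsum iffD1[OF abs_summable_equivalent])
    then have "(LINT s|count_space S. cmod (?f s) powr r) = infsum (\<lambda>s. cmod (?f s) powr r) S"
      by (simp add: infsetsum_def)
    also have "\<dots> = infsum (\<lambda>g. cmod (\<xi> g) powr r) I"
      unfolding sum_eq using f by (intro infsum_cong) simp
    finally show ?thesis by (simp add: Lp_def lp_sum_nrm)
  qed
  have "linear_map ?E ?L T"
    unfolding linear_map_def
  proof (intro conjI ballI allI)
    show "T \<in> carrier ?E \<rightarrow> carrier ?L"
      unfolding carr by (auto simp: T_def lp_sum_carrier intro!: imageI)
    fix u v assume "u \<in> carrier ?E" "v \<in> carrier ?E"
    show "T (add ?E u v) = add ?L (T u) (T v)"
      unfolding T_def Lp_count_space_add cls by simp
  next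
    fix c u assume "u \<in> carrier ?E"
    show "T (smult ?E c u) = smult ?L c (T u)"
      unfolding T_def Lp_count_space_smult cls by simp
  qed
  moreover have "bij_betw T (carrier ?E) (carrier ?L)"
    unfolding bij_betw_def
  proof (intro conjI inj_onI)
    fix u v assume "u \<in> carrier ?E" "v \<in> carrier ?E" "T u = T v"
    then obtain \<xi> \<eta> where e: "u = embed \<xi>" "v = embed \<eta>" "\<xi> \<in> carrier (lp (ereal r) I)" "\<eta> \<in> carrier (lp (ereal r) I)"
      and eq: "\<And>g. g \<in> I \<Longrightarrow> \<xi> g = \<eta> g"
      by (auto simp: T_def cls)
    have "\<xi> = \<eta>"
    proof
      fix g show "\<xi> g = \<eta> g" using eq[of g] lp_carrier_out[OF e(3), of g] lp_carrier_out[OF e(4), of g] by (cases "g \<in> I") auto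
    qed
    then show "u = v" using e by simp
  next
    show "T ` carrier ?E = carrier ?L"
    proof (intro equalityI subsetI)
      fix A assume "A \<in> T ` carrier ?E"
      then show "A \<in> carrier ?L" unfolding carr by (auto simp: T_def lp_sum_carrier intro!: imageI)
    next
      fix A assume "A \<in> carrier ?L"
      then obtain f where f: "(\<lambda>g. cmod (f (?h g)) powr r) summable_on I" "A = AE_class (count_space S) f"
        unfolding carr by auto
      define \<xi> where "\<xi> g = (if g \<in> I then f (?h g) else 0)" for g
      have "(\<lambda>g. cmod (\<xi> g) powr r) summable_on I"
        using f(1) by (subst summable_on_cong[where g = "\<lambda>g. cmod (f (?h g)) powr r"]) (auto simp: \<xi>_def)
      then have "\<xi> \<in> carrier (lp (ereal r) I)" by (simp add: lp_sum_carrier \<xi>_def)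
      moreover have "T (embed \<xi>) = A" unfolding f(2) T_def cls by (simp add: \<xi>_def)
      ultimately show "A \<in> T ` carrier ?E" by (metis imageI lp_copy_simps(1))
    qed
  qed
  moreover have "nrm ?L (T u) = nrm ?E u" if "u \<in> carrier ?E" for u
    using that nrmT by (auto simp: T_def)
  ultimately show ?thesis unfolding isometrically_isomorphic_def S_def by blast
qed

text \<open>In a discrete space compact means finite, so functions vanishing at infinity are exactly
  the c_0-families.\<close>

lemma lp_copy_C0:
  "isometrically_isomorphic (lp_copy \<infinity> I :: ('x, 'g, 'i) universe nspace)
    (C0 (discrete_topology ((\<lambda>g. Inl (undefined, g)) ` I) :: ('x, 'g, 'i) points topology))"
proof -
  let ?h = "\<lambda>g. Inl (undefined, g) :: ('x, 'g, 'i) points"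
  let ?S = "?h ` I"
  let ?L = "C0 (discrete_topology ?S)" and ?E = "lp_copy \<infinity> I :: ('x, 'g, 'i) universe nspace"
  define T :: "('x, 'g, 'i) universe \<Rightarrow> ('x, 'g, 'i) points \<Rightarrow> complex" where "T u = spread (unembed u)" for u
  have out: "spread \<xi> s = 0" if \<xi>: "\<xi> \<in> carrier (lp \<infinity> I)" and s: "s \<notin> ?S" for \<xi> and s :: "('x, 'g, 'i) points"
    using s lp_carrier_out[OF \<xi>] by (auto simp: spread_def split: sum.splits)
  have level: "{s \<in> ?S. \<epsilon> \<le> cmod (f s)} = ?h ` {g \<in> I. \<epsilon> \<le> cmod (f (?h g))}" for f :: "('x, 'g, 'i) points \<Rightarrow> complex" and \<epsilon>
    by auto
  have mem: "spread \<xi> \<in> carrier ?L" if \<xi>: "\<xi> \<in> carrier (lp \<infinity> I)" for \<xi>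
    using out[OF \<xi>] lp_inf_level[OF \<xi>] by (auto simp: C0_iff compactin_discrete_topology level)
  have nrmT: "nrm ?L (spread \<xi>) = nrm (lp \<infinity> I) \<xi>" if \<xi>: "\<xi> \<in> carrier (lp \<infinity> I)" for \<xi>
  proof (rule antisym)
    have p: "1 \<le> (\<infinity>::ereal)" by simp
    show "nrm ?L (spread \<xi>) \<le> nrm (lp \<infinity> I) \<xi>"
    proof (rule C0_nrm_le)
      fix s :: "('x, 'g, 'i) points"
      show "cmod (spread \<xi> s) \<le> nrm (lp \<infinity> I) \<xi>"
        using lp_pointwise_le[OF p \<xi>] lp_nrm_nonneg[OF p \<xi>] by (auto simp: spread_def split: sum.splits)
    qed
    have "cmod (\<xi> g) \<le> nrm ?L (spread \<xi>)" for g
      using C0_le_nrm[OF mem[OF \<xi>], of "?h g"] by simp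
    then show "nrm (lp \<infinity> I) \<xi> \<le> nrm ?L (spread \<xi>)"
      using C0_nrm_nonneg[OF mem[OF \<xi>]] \<xi> by (intro lp_nrm_le) (auto simp: lpn_inf_le_iff lp_carrier_out)
  qed
  have "linear_map ?E ?L T"
    using mem by (auto simp: linear_map_def T_def) (auto simp: spread_def fun_eq_iff split: sum.splits)
  moreover have "bij_betw T (carrier ?E) (carrier ?L)"
    unfolding bij_betw_def
  proof (intro conjI inj_onI)
    fix u v assume "u \<in> carrier ?E" "v \<in> carrier ?E" and eq: "T u = T v"
    then obtain \<xi> \<eta> where e: "u = embed \<xi>" "v = embed \<eta>" by auto
    have "\<xi> g = \<eta> g" for g using fun_cong[OF eq, of "?h g"] by (simp add: T_def e)
    then have "\<xi> = \<eta>" by (rule ext)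
    then show "u = v" using e by simp
  next
    show "T ` carrier ?E = carrier ?L"
    proof (intro equalityI subsetI)
      fix f assume "f \<in> T ` carrier ?E"
      then show "f \<in> carrier ?L" using mem by (auto simp: T_def)
    next
      fix f assume f: "f \<in> carrier ?L"
      define \<xi> where "\<xi> g = f (?h g)" for g
      have "\<xi> g = 0" if "g \<notin> I" for g using C0_outside[OF f, of "?h g"] that by (auto simp: \<xi>_def)
      moreover have "finite {g \<in> I. \<epsilon> \<le> cmod (\<xi> g)}" if "0 < \<epsilon>" for \<epsilon>
      proof -
        have "finite (?h ` {g \<in> I. \<epsilon> \<le> cmod (f (?h g))})"
          using C0_level_compact[OF f that] by (simp add: compactin_discrete_topology level)
        then show ?thesis unfolding \<xi>_def by (rule finite_imageD) (auto simp: inj_on_def)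
      qed
      ultimately have "\<xi> \<in> carrier (lp \<infinity> I)" by (simp add: lp_sum_carrier)
      moreover have "T (embed \<xi>) = f"
      proof
        fix s show "T (embed \<xi>) s = f s"
          using C0_outside[OF f, of s] by (auto simp: T_def \<xi>_def spread_def split: sum.splits)
      qed
      ultimately show "f \<in> T ` carrier ?E" by (metis imageI lp_copy_simps(1))
    qed
  qed
  moreover have "nrm ?L (T u) = nrm ?E u" if "u \<in> carrier ?E" for u
    using that nrmT by (auto simp: T_def)
  ultimately show ?thesis unfolding isometrically_isomorphic_def by blast
qed

lemma lp_copy_space_for_exponent:
  assumes p: "1 \<le> p"
  shows "space_for_exponent TYPE(('x, 'g, 'i) points) p (lp_copy p I :: ('x, 'g, 'i) universe nspace)"
  using p
proof (cases rule: exponent_cases)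
  case 1
  then show ?thesis using lp_copy_banach[OF p] lp_copy_C0 by (auto simp: space_for_exponent_def is_C0_space_def)
next
  case (2 r)
  then show ?thesis using lp_copy_banach[OF p] lp_copy_Lp by (auto simp: space_for_exponent_def is_Lp_space_def)
qed

section \<open>Twisted actions and the regular representation\<close>

text \<open>The additive group is noncommutative. This is the substitution r = s^{-1} t, s = t
  r^{-1} that turns sums over s into matrix rows.\<close>

lemma diff_shift [simp]: "t - (- s + t) = (s::'g::group_add)"
  by (simp only: diff_conv_add_uminus minus_add minus_minus add.assoc[symmetric] right_minus add_0_left)

lemma diff_left_cancel [simp]: "t - x = t - y \<longleftrightarrow> x = (y::'g::group_add)"
  by (metis diff_conv_add_uminus add_left_cancel neg_equal_iff_equal)

lemma summable_on_bounded_mult: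
  fixes f g :: "'a \<Rightarrow> real"
  assumes "f summable_on A" "\<And>a. a \<in> A \<Longrightarrow> 0 \<le> f a" "\<And>a. a \<in> A \<Longrightarrow> 0 \<le> g a \<and> g a \<le> K * f a"
  shows "g summable_on A"
  by (rule summable_on_comparison_test[OF summable_on_cmult_right[OF assms(1), of K]]) (use assms in auto)

locale twisted_action =
  fixes X :: "'x topology" and \<phi> :: "'g::group_add \<Rightarrow> 'x \<Rightarrow> 'x" and u :: "'g \<Rightarrow> 'g \<Rightarrow> 'x \<Rightarrow> complex"
  assumes action: "group_action_on X \<phi>" and cocycle: "normalised_cocycle X \<phi> u"
begin

lemma phi_closed [simp, intro]: "x \<in> topspace X \<Longrightarrow> \<phi> s x \<in> topspace X"
  using action homeomorphic_imp_surjective_map unfolding group_action_on_def by blast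

lemma phi_continuous: "continuous_map X X (\<phi> s)"
  using action homeomorphic_imp_continuous_map unfolding group_action_on_def by blast

lemma phi_0 [simp]: "x \<in> topspace X \<Longrightarrow> \<phi> 0 x = x"
  and phi_phi [simp]: "x \<in> topspace X \<Longrightarrow> \<phi> s (\<phi> t x) = \<phi> (s + t) x"
  using action by (simp_all add: group_action_on_def)

lemma alpha_apply [simp]: "x \<in> topspace X \<Longrightarrow> alpha X \<phi> s a x = a (\<phi> (- s) x)"
  and alpha_outside [simp]: "x \<notin> topspace X \<Longrightarrow> alpha X \<phi> s a x = 0"
  by (simp_all add: alpha_def)

lemma alpha_continuous:
  assumes "continuous_map X euclidean a"
  shows "continuous_map X euclidean (alpha X \<phi> s a)"
  by (rule continuous_map_eq[OF continuous_map_compose[OF phi_continuous[of "- s"] assms]]) simp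

lemma alpha_C0 [intro]:
  fixes a :: "'x \<Rightarrow> complex"
  assumes a: "a \<in> carrier (C0 X)"
  shows "alpha X \<phi> s a \<in> carrier (C0 X)"
  unfolding C0_iff
proof (intro conjI allI impI alpha_continuous C0_continuous[OF a] alpha_outside)
  fix \<epsilon> :: real assume "0 < \<epsilon>"
  then have "compactin X (\<phi> s ` {x \<in> topspace X. \<epsilon> \<le> cmod (a x)})"
    using C0_level_compact[OF a] image_compactin phi_continuous by blast
  moreover have "{x \<in> topspace X. \<epsilon> \<le> cmod (alpha X \<phi> s a x)} = \<phi> s ` {x \<in> topspace X. \<epsilon> \<le> cmod (a x)}"
  proof (intro equalityI subsetI)
    fix x assume x: "x \<in> {x \<in> topspace X. \<epsilon> \<le> cmod (alpha X \<phi> s a x)}"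
    then have "x = \<phi> s (\<phi> (- s) x)" by simp
    then show "x \<in> \<phi> s ` {x \<in> topspace X. \<epsilon> \<le> cmod (a x)}" using x by (intro image_eqI[of _ _ "\<phi> (- s) x"]) auto
  qed auto
  ultimately show "compactin X {x \<in> topspace X. \<epsilon> \<le> cmod (alpha X \<phi> s a x)}" by simp
qed

lemma u_norm: "x \<in> topspace X \<Longrightarrow> cmod (u s t x) = 1"
  and u_outside: "x \<notin> topspace X \<Longrightarrow> u s t x = 0"
  and u_continuous: "continuous_map X euclidean (u s t)"
  using cocycle by (auto simp: normalised_cocycle_def Cu_def Cb_def)

lemma u_norm_le: "cmod (u s t x) \<le> 1"
  using u_norm[of x s t] u_outside[of x s t] by (cases "x \<in> topspace X") auto

lemma u_nonzero: "x \<in> topspace X \<Longrightarrow> u s t x \<noteq> 0"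
  using u_norm[of x s t] by auto

lemma u_cocycle: "x \<in> topspace X \<Longrightarrow> u s t (\<phi> (- r) x) * u r (s + t) x = u r s x * u (r + s) t x"
  using cocycle unfolding normalised_cocycle_def by (metis alpha_apply)

text \<open>The normalisation at (0, 0) spreads by the cocycle identity for (0, 0, t), where a
  nonzero value of u cancels.\<close>

lemma u_0_left [simp]: "x \<in> topspace X \<Longrightarrow> u 0 t x = 1"
proof -
  assume x: "x \<in> topspace X"
  have "u 0 0 x = 1" using cocycle x by (simp add: normalised_cocycle_def)
  then show ?thesis using u_cocycle[OF x, of 0 t 0] u_nonzero[OF x, of 0 t] x by simp
qed

lemma u_0_right [simp]: "x \<in> topspace X \<Longrightarrow> u s 0 x = 1"
  using u_cocycle[of x 0 0 s] u_nonzero[of x s 0] by simp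

lemma u_cnj: "x \<in> topspace X \<Longrightarrow> u s t x * cnj (u s t x) = 1"
  using u_norm[of x s t] complex_norm_square[of "u s t x"] by simp

section \<open>The l^1-algebra and the scalar matrices of its elements\<close>

lemma F_carrier:
  "b \<in> carrier (F_alg X \<phi> u) \<longleftrightarrow> (\<forall>s. b s \<in> carrier (C0 X)) \<and> (\<lambda>s. nrm (C0 X) (b s)) summable_on UNIV"
proof -
  have "(\<forall>s. b s \<in> carrier (C0 X)) \<Longrightarrow> (\<lambda>s. nrm (C0 X) (b s) powr 1) = (\<lambda>s. nrm (C0 X) (b s))"
    by (simp add: powr_one)
  then show ?thesis by (auto simp: F_alg_def lp_sum_carrier)
qed

lemma F_nrm: "b \<in> carrier (F_alg X \<phi> u) \<Longrightarrow> nrm (F_alg X \<phi> u) b = (\<Sum>\<^sub>\<infinity>s. nrm (C0 X) (b s))"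
  using F_carrier[of b] by (simp add: F_alg_def lp_sum_nrm powr_one infsum_nonneg cong: infsum_cong)

lemma F_C0: "b \<in> carrier (F_alg X \<phi> u) \<Longrightarrow> b s \<in> carrier (C0 X)"
  and F_summable: "b \<in> carrier (F_alg X \<phi> u) \<Longrightarrow> (\<lambda>s. nrm (C0 X) (b s)) summable_on UNIV"
  by (auto simp: F_carrier)

lemma F_nrm_nonneg: "b \<in> carrier (F_alg X \<phi> u) \<Longrightarrow> 0 \<le> nrm (F_alg X \<phi> u) b"
  by (simp add: F_nrm infsum_nonneg F_C0)

lemma F_finite_sum_le: "b \<in> carrier (F_alg X \<phi> u) \<Longrightarrow> finite S \<Longrightarrow> (\<Sum>s\<in>S. nrm (C0 X) (b s)) \<le> nrm (F_alg X \<phi> u) b"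
  unfolding F_nrm by (intro finite_sum_le_infsum F_summable) (auto simp: F_C0)

text \<open>The kernel of \<open>Ind\<close>: the function that \<pi> is applied to in component t
  against \<xi> r, with s rewritten as t - r.\<close>

definition mat :: "('g \<Rightarrow> 'x \<Rightarrow> complex) \<Rightarrow> 'g \<Rightarrow> 'g \<Rightarrow> 'x \<Rightarrow> complex" where
  "mat b t r = alpha X \<phi> (- t) (\<lambda>x. b (t - r) x * u (t - r) r x)"

lemma mat_apply: "x \<in> topspace X \<Longrightarrow> mat b t r x = b (t - r) (\<phi> t x) * u (t - r) r (\<phi> t x)"
  by (simp add: mat_def)

lemma C0_mult_u: "a \<in> carrier (C0 X) \<Longrightarrow> (\<lambda>x. a x * u s t x) \<in> carrier (C0 X)"
  by (rule C0_mult_bounded[OF _ u_continuous u_norm_le])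

lemma mat_C0: "b (t - r) \<in> carrier (C0 X) \<Longrightarrow> mat b t r \<in> carrier (C0 X)"
  unfolding mat_def by (intro alpha_C0 C0_mult_u)

lemma mat_norm_le: "b (t - r) \<in> carrier (C0 X) \<Longrightarrow> cmod (mat b t r x) \<le> nrm (C0 X) (b (t - r))"
  using C0_le_nrm[of "b (t - r)" X "\<phi> t x"] C0_nrm_nonneg[of "b (t - r)" X]
  by (cases "x \<in> topspace X") (auto simp: mat_apply norm_mult u_norm mat_def)

text \<open>One constant for all points and all finite sections. The condition 0 \<le> C speaks for
  itself only when \<open>topspace X\<close> is empty and the second part is vacuous.\<close>

definition matrix_bounded :: "ereal \<Rightarrow> real \<Rightarrow> ('g \<Rightarrow> 'x \<Rightarrow> complex) \<Rightarrow> bool" where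
  "matrix_bounded p C b \<longleftrightarrow> 0 \<le> C \<and> (\<forall>x\<in>topspace X. \<forall>I J c. finite I \<longrightarrow> finite J \<longrightarrow>
     lpn p I (\<lambda>t. cmod (\<Sum>r\<in>J. mat b t r x * c r)) \<le> C * lpn p J (\<lambda>r. cmod (c r)))"

lemma matrix_boundedD:
  "matrix_bounded p C b \<Longrightarrow> x \<in> topspace X \<Longrightarrow> finite I \<Longrightarrow> finite J \<Longrightarrow>
    lpn p I (\<lambda>t. cmod (\<Sum>r\<in>J. mat b t r x * c r)) \<le> C * lpn p J (\<lambda>r. cmod (c r))"
  by (simp add: matrix_bounded_def)

lemma matrix_boundedI:
  assumes p: "1 \<le> p" and C: "0 \<le> C"
    and le: "\<And>x I J c. x \<in> topspace X \<Longrightarrow> finite I \<Longrightarrow> finite J \<Longrightarrow> lpn p J (\<lambda>r. cmod (c r)) \<le> 1 \<Longrightarrow>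
      lpn p I (\<lambda>t. cmod (\<Sum>r\<in>J. mat b t r x * c r)) \<le> C"
  shows "matrix_bounded p C b"
  unfolding matrix_bounded_def
proof (intro conjI ballI allI impI C)
  fix x and I J :: "'g set" and c :: "'g \<Rightarrow> complex" assume x: "x \<in> topspace X" and fin: "finite I" "finite J"
  let ?N = "lpn p J (\<lambda>r. cmod (c r))"
  show "lpn p I (\<lambda>t. cmod (\<Sum>r\<in>J. mat b t r x * c r)) \<le> C * ?N"
  proof (cases "?N = 0")
    case True
    then have "c r = 0" if "r \<in> J" for r using lpn_member[OF fin(2) p that, of "\<lambda>r. cmod (c r)"] by simp
    then show ?thesis using True by (simp add: lpn_zero[OF fin(1) p])
  next
    case False
    then have N: "0 < ?N" using fin by (simp add: less_le)
    let ?d = "complex_of_real (1 / ?N)"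
    have d: "cmod ?d = 1 / ?N" using N by (simp add: norm_divide)
    have "lpn p J (\<lambda>r. cmod (?d * c r)) \<le> 1"
      unfolding norm_mult d lpn_scale[OF fin(2) p] using N by simp
    then have "lpn p I (\<lambda>t. cmod (\<Sum>r\<in>J. mat b t r x * (?d * c r))) \<le> C" by (rule le[OF x fin])
    moreover have "(\<Sum>r\<in>J. mat b t r x * (?d * c r)) = ?d * (\<Sum>r\<in>J. mat b t r x * c r)" for t
      by (simp add: sum_distrib_left mult_ac)
    ultimately have "lpn p I (\<lambda>t. 1 / ?N * cmod (\<Sum>r\<in>J. mat b t r x * c r)) \<le> C"
      by (simp only: norm_mult d)
    then have "1 / ?N * lpn p I (\<lambda>t. cmod (\<Sum>r\<in>J. mat b t r x * c r)) \<le> C"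
      unfolding lpn_scale[OF fin(1) p] using N by simp
    then show ?thesis using N by (simp add: divide_le_eq)
  qed
qed

lemma summable_row: "b \<in> carrier (F_alg X \<phi> u) \<Longrightarrow> (\<lambda>r. nrm (C0 X) (b (t - r))) summable_on UNIV"
proof -
  assume b: "b \<in> carrier (F_alg X \<phi> u)"
  have "bij (\<lambda>r. t - r)" by (rule bij_betwI[of _ _ _ "\<lambda>s. - s + t"]) (auto simp: diff_shift)
  from summable_on_reindex_bij_betw[OF this, of "\<lambda>s. nrm (C0 X) (b s)"] show ?thesis using F_summable[OF b] by simp
qed

text \<open>The matrix is a sum of its diagonals t - r = s, each a shift with entries bounded by the
  norm of b s. This a priori bound is what keeps the suprema finite later.\<close>

lemma matrix_bounded_nrm:
  assumes p: "1 \<le> p" and b: "b \<in> carrier (F_alg X \<phi> u)"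
  shows "matrix_bounded p (nrm (F_alg X \<phi> u) b) b"
  unfolding matrix_bounded_def
proof (intro conjI ballI allI impI)
  show "0 \<le> nrm (F_alg X \<phi> u) b" by (rule F_nrm_nonneg[OF b])
  fix x and I J :: "'g set" and c :: "'g \<Rightarrow> complex" assume x: "x \<in> topspace X" and fin: "finite I" "finite J"
  define S where "S = (\<lambda>(t, r). t - r) ` (I \<times> J)"
  have S: "finite S" using fin by (simp add: S_def)
  define c0 where "c0 r = (if r \<in> J then c r else 0)" for r
  let ?N = "lpn p J (\<lambda>r. cmod (c r))" and ?n = "\<lambda>s. nrm (C0 X) (b s)"
  have shift: "lpn p I (\<lambda>t. cmod (c0 (- s + t))) \<le> ?N" for s
  proof -
    have "lpn p I (\<lambda>t. cmod (c0 (- s + t))) = lpn p ((\<lambda>t. - s + t) ` I) (\<lambda>r. cmod (c0 r))"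
      by (rule lpn_reindex[symmetric]) (auto simp: inj_on_def)
    also have "\<dots> \<le> nrm (lp p UNIV) c0"
      unfolding c0_def using fin p lp_finite_support(1)[OF p fin(2)] by (intro lp_lpn_le) auto
    also have "\<dots> = ?N" unfolding c0_def by (rule lp_finite_support(2)[OF p fin(2)]) simp
    finally show ?thesis .
  qed
  have "lpn p I (\<lambda>t. cmod (\<Sum>r\<in>J. mat b t r x * c r)) \<le> lpn p I (\<lambda>t. \<Sum>s\<in>S. ?n s * cmod (c0 (- s + t)))"
  proof (rule lpn_mono[OF fin(1) p])
    fix t assume t: "t \<in> I"
    have "cmod (\<Sum>r\<in>J. mat b t r x * c r) \<le> (\<Sum>r\<in>J. ?n (t - r) * cmod (c0 r))"
      using F_C0[OF b] by (intro sum_norm_le) (auto simp: norm_mult c0_def intro!: mult_right_mono mat_norm_le)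
    also have "\<dots> = (\<Sum>s\<in>(\<lambda>r. t - r) ` J. ?n s * cmod (c0 (- s + t)))"
      by (subst sum.reindex) (auto simp: inj_on_def)
    also have "\<dots> \<le> (\<Sum>s\<in>S. ?n s * cmod (c0 (- s + t)))"
      using S t F_C0[OF b] by (intro sum_mono2) (auto simp: S_def)
    finally show "\<bar>cmod (\<Sum>r\<in>J. mat b t r x * c r)\<bar> \<le> \<bar>\<Sum>s\<in>S. ?n s * cmod (c0 (- s + t))\<bar>" by simp
  qed
  also have "\<dots> \<le> (\<Sum>s\<in>S. lpn p I (\<lambda>t. ?n s * cmod (c0 (- s + t))))" by (rule lpn_sum_le[OF fin(1) p S])
  also have "\<dots> \<le> (\<Sum>s\<in>S. ?n s * ?N)"
    using F_C0[OF b] by (intro sum_mono) (simp add: lpn_scale[OF fin(1) p] mult_left_mono shift)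
  also have "\<dots> \<le> nrm (F_alg X \<phi> u) b * ?N"
    using F_finite_sum_le[OF b S] fin by (simp add: sum_distrib_right[symmetric] mult_right_mono)
  finally show "lpn p I (\<lambda>t. cmod (\<Sum>r\<in>J. mat b t r x * c r)) \<le> nrm (F_alg X \<phi> u) b * ?N" .
qed

lemma row_summable:
  assumes b: "b \<in> carrier (F_alg X \<phi> u)" and \<xi>: "\<And>r. cmod (\<xi> r) \<le> K"
  shows "(\<lambda>r. mat b t r x * \<xi> r) summable_on UNIV"
proof (rule abs_summable_summable, rule summable_on_bounded_mult[OF summable_row[OF b, of t]])
  fix r
  have "cmod (mat b t r x) * cmod (\<xi> r) \<le> nrm (C0 X) (b (t - r)) * K"
    using F_C0[OF b] \<xi> by (intro mult_mono mat_norm_le) auto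
  then show "0 \<le> cmod (mat b t r x * \<xi> r) \<and> cmod (mat b t r x * \<xi> r) \<le> K * nrm (C0 X) (b (t - r))"
    by (simp add: norm_mult mult.commute)
qed (auto simp: F_C0[OF b])

lemma row_tendsto:
  assumes b: "b \<in> carrier (F_alg X \<phi> u)" and \<xi>: "\<And>r. cmod (\<xi> r) \<le> K"
  shows "((\<lambda>J. cmod (\<Sum>r\<in>J. mat b t r x * \<xi> r)) \<longlongrightarrow> cmod (\<Sum>\<^sub>\<infinity>r. mat b t r x * \<xi> r)) (finite_subsets_at_top UNIV)"
  using has_sum_infsum[OF row_summable[OF assms]] unfolding has_sum_def by (rule tendsto_norm)

lemma matrix_bounded_infsum:
  assumes p: "1 \<le> p" and b: "b \<in> carrier (F_alg X \<phi> u)" and mb: "matrix_bounded p C b" and x: "x \<in> topspace X"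
    and \<xi>: "\<And>J. finite J \<Longrightarrow> lpn p J (\<lambda>r. cmod (\<xi> r)) \<le> N" and I: "finite I"
  shows "lpn p I (\<lambda>t. cmod (\<Sum>\<^sub>\<infinity>r. mat b t r x * \<xi> r)) \<le> C * N"
proof (rule lpn_limit_le[OF I p finite_subsets_at_top_neq_bot])
  have "cmod (\<xi> r) \<le> N" for r using \<xi>[of "{r}"] p by simp
  then show "((\<lambda>J. cmod (\<Sum>r\<in>J. mat b t r x * \<xi> r)) \<longlongrightarrow> cmod (\<Sum>\<^sub>\<infinity>r. mat b t r x * \<xi> r)) (finite_subsets_at_top UNIV)" for t
    by (rule row_tendsto[OF b])
  have "lpn p I (\<lambda>t. cmod (\<Sum>r\<in>J. mat b t r x * \<xi> r)) \<le> C * N" if J: "finite J" for J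
    using matrix_boundedD[OF mb x I J, of \<xi>] mult_left_mono[OF \<xi>[OF J], of C] mb by (simp add: matrix_bounded_def)
  then show "\<forall>\<^sub>F J in finite_subsets_at_top UNIV. lpn p I (\<lambda>t. cmod (\<Sum>r\<in>J. mat b t r x * \<xi> r)) \<le> C * N"
    by (auto simp: eventually_finite_subsets_at_top)
qed

text \<open>On the orbit of \<open>x\<close>, listed as \<open>t \<mapsto> (\<phi> t x, t)\<close>, the regular representation is
  multiplication by the matrix \<open>mat b\<close> at \<open>x\<close>.\<close>

definition orbit :: "'x \<times> 'g \<Rightarrow> 'x \<times> 'g" where
  "orbit = (\<lambda>(x, t). (\<phi> t x, t))"

lemma orbit_inj: "inj_on orbit (topspace X \<times> UNIV)"
proof (rule inj_onI)
  fix a b assume a: "a \<in> topspace X \<times> UNIV" and b: "b \<in> topspace X \<times> UNIV" and e: "orbit a = orbit b"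
  obtain x t where at: "a = (x, t)" by force
  obtain y s where bs: "b = (y, s)" by force
  have "t = s" "\<phi> t x = \<phi> t y" using e by (auto simp: at bs orbit_def)
  then have "\<phi> (- t) (\<phi> t x) = \<phi> (- t) (\<phi> t y)" by simp
  then show "a = b" using a b \<open>t = s\<close> by (simp add: at bs)
qed

lemma Lambda_orbit:
  assumes "x \<in> topspace X"
  shows "Lambda X \<phi> u b \<xi> (orbit (x, t)) = (\<Sum>\<^sub>\<infinity>r. mat b t r x * \<xi> (orbit (x, r)))"
proof -
  let ?f = "\<lambda>s. b s (\<phi> t x) * u s (- s + t) (\<phi> t x) * \<xi> (\<phi> (- s + t) x, - s + t)"
  have "Lambda X \<phi> u b \<xi> (orbit (x, t)) = infsum ?f UNIV"
    using assms by (simp add: Lambda_def orbit_def)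
  also have "\<dots> = infsum (\<lambda>r. ?f (t - r)) UNIV"
    by (rule infsum_reindex_bij_betw[symmetric], rule bij_betwI[of _ _ _ "\<lambda>s. - s + t"])
      (auto simp: diff_shift)
  also have "\<dots> = (\<Sum>\<^sub>\<infinity>r. mat b t r x * \<xi> (orbit (x, r)))"
    using assms by (intro infsum_cong) (simp add: mat_apply orbit_def)
  finally show ?thesis .
qed

text \<open>\<open>orbit\<close> rearranges X x G into copies of G, one for each x. A finite F is
  enlarged to the image of a rectangle A x B; for each x in A the matrix bound applies, and
  \<open>lpn_Sigma\<close> reassembles the pieces.\<close>

lemma Lambda_lpn_le:
  assumes p: "1 \<le> p" and b: "b \<in> carrier (F_alg X \<phi> u)" and mb: "matrix_bounded p C b"
    and \<xi>: "\<xi> \<in> carrier (lp p (topspace X \<times> UNIV))" and F: "finite F" "F \<subseteq> topspace X \<times> UNIV"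
  shows "lpn p F (\<lambda>i. cmod (Lambda X \<phi> u b \<xi> i)) \<le> C * nrm (lp p (topspace X \<times> UNIV)) \<xi>"
proof -
  let ?N = "nrm (lp p (topspace X \<times> UNIV)) \<xi>"
  define A where "A = (\<lambda>(y, t). \<phi> (- t) y) ` F"
  define B where "B = snd ` F"
  have fin: "finite A" "finite B" using F by (auto simp: A_def B_def)
  have A: "A \<subseteq> topspace X" using F by (auto simp: A_def)
  have FAB: "F \<subseteq> orbit ` (A \<times> B)"
  proof
    fix i assume i: "i \<in> F"
    obtain y t where yt: "i = (y, t)" by force
    have "y \<in> topspace X" using i F yt by auto
    then have "i = orbit (\<phi> (- t) y, t)" by (simp add: orbit_def yt)
    then show "i \<in> orbit ` (A \<times> B)" using i yt by (force simp: A_def B_def)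
  qed
  have inj: "inj_on orbit (A \<times> J)" for J using A by (intro inj_on_subset[OF orbit_inj]) auto
  let ?v = "\<lambda>J. \<lambda>(x, t). cmod (\<Sum>r\<in>J. mat b t r x * \<xi> (orbit (x, r)))"
  have fJ: "lpn p (A \<times> B) (?v J) \<le> C * ?N" if J: "finite J" for J
  proof -
    have "lpn p (A \<times> B) (?v J) = lpn p A (\<lambda>x. lpn p B (\<lambda>t. cmod (\<Sum>r\<in>J. mat b t r x * \<xi> (orbit (x, r)))))"
      using fin p by (subst lpn_Sigma) auto
    also have "\<dots> \<le> lpn p A (\<lambda>x. C * lpn p J (\<lambda>r. cmod (\<xi> (orbit (x, r)))))"
      using A fin J mb by (intro lpn_mono[OF fin(1) p]) (auto simp: matrix_bounded_def intro!: order_trans[OF _ abs_ge_self])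
    also have "\<dots> = C * lpn p (A \<times> J) (\<lambda>i. cmod (\<xi> (orbit i)))"
      using fin J p mb by (simp add: lpn_scale lpn_Sigma matrix_bounded_def)
    also have "lpn p (A \<times> J) (\<lambda>i. cmod (\<xi> (orbit i))) = lpn p (orbit ` (A \<times> J)) (\<lambda>i. cmod (\<xi> i))"
      by (rule lpn_reindex[OF inj, symmetric])
    also have "C * \<dots> \<le> C * ?N"
      using fin J A mb by (intro mult_left_mono lp_lpn_le[OF p \<xi>]) (auto simp: matrix_bounded_def orbit_def)
    finally show ?thesis .
  qed
  have "lpn p F (\<lambda>i. cmod (Lambda X \<phi> u b \<xi> i)) \<le> lpn p (orbit ` (A \<times> B)) (\<lambda>i. cmod (Lambda X \<phi> u b \<xi> i))"
    using fin FAB p by (intro lpn_mono_set) auto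
  also have "\<dots> = lpn p (A \<times> B) (\<lambda>i. cmod (Lambda X \<phi> u b \<xi> (orbit i)))"
    by (rule lpn_reindex[OF inj])
  also have "\<dots> \<le> C * ?N"
  proof (rule lpn_limit_le[OF _ p finite_subsets_at_top_neq_bot])
    show "finite (A \<times> B)" using fin by simp
    fix i assume i: "i \<in> A \<times> B"
    obtain x t where xt: "i = (x, t)" "x \<in> topspace X" using i A by auto
    have "((\<lambda>J. cmod (\<Sum>r\<in>J. mat b t r x * \<xi> (orbit (x, r)))) \<longlongrightarrow> cmod (\<Sum>\<^sub>\<infinity>r. mat b t r x * \<xi> (orbit (x, r)))) (finite_subsets_at_top UNIV)"
      using lp_pointwise_le[OF p \<xi>] by (rule row_tendsto[OF b])
    then show "((\<lambda>J. ?v J i) \<longlongrightarrow> cmod (Lambda X \<phi> u b \<xi> (orbit i))) (finite_subsets_at_top UNIV)"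
      using xt by (simp add: Lambda_orbit)
  next
    show "\<forall>\<^sub>F J in finite_subsets_at_top UNIV. lpn p (A \<times> B) (?v J) \<le> C * ?N"
      using fJ by (auto simp: eventually_finite_subsets_at_top)
  qed
  finally show ?thesis .
qed

lemma Lambda_outside: "i \<notin> topspace X \<times> UNIV \<Longrightarrow> Lambda X \<phi> u b \<xi> i = 0"
  by (auto simp: Lambda_def split: prod.split)

lemma Lambda_nrm_le:
  assumes "1 \<le> p" "b \<in> carrier (F_alg X \<phi> u)" "matrix_bounded p C b" "\<xi> \<in> carrier (lp p (topspace X \<times> UNIV))"
  shows "nrm (lp p (topspace X \<times> UNIV)) (Lambda X \<phi> u b \<xi>) \<le> C * nrm (lp p (topspace X \<times> UNIV)) \<xi>"
  by (intro lp_nrm_le Lambda_lpn_le Lambda_outside assms)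

lemma norm_Lp_red_le:
  assumes p: "1 \<le> p" and b: "b \<in> carrier (F_alg X \<phi> u)" and mb: "matrix_bounded p C b"
  shows "norm_Lp_red X \<phi> u p b \<le> C"
  unfolding norm_Lp_red_def
proof (rule opnorm_le)
  let ?L = "lp p (topspace X \<times> (UNIV :: 'g set))"
  show "\<exists>x\<in>carrier ?L. nrm ?L x \<le> 1" by (intro bexI[of _ "\<lambda>_. 0"]) (simp_all add: lp_zero[OF p])
  fix \<xi> assume \<xi>: "\<xi> \<in> carrier ?L" "nrm ?L \<xi> \<le> 1"
  have "nrm ?L (Lambda X \<phi> u b \<xi>) \<le> C * nrm ?L \<xi>" by (rule Lambda_nrm_le[OF p b mb \<xi>(1)])
  also have "\<dots> \<le> C * 1" using \<xi> mb by (intro mult_left_mono) (auto simp: matrix_bounded_def)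
  finally show "nrm ?L (Lambda X \<phi> u b \<xi>) \<le> C" by simp
qed

lemma norm_Lp_red_nonneg:
  assumes p: "1 \<le> p" and b: "b \<in> carrier (F_alg X \<phi> u)"
  shows "0 \<le> norm_Lp_red X \<phi> u p b"
proof -
  let ?L = "lp p (topspace X \<times> (UNIV :: 'g set))" and ?C = "nrm (F_alg X \<phi> u) b"
  have mb: "matrix_bounded p ?C b" by (rule matrix_bounded_nrm[OF p b])
  have "nrm ?L (Lambda X \<phi> u b (\<lambda>_. 0)) \<le> norm_Lp_red X \<phi> u p b"
    unfolding norm_Lp_red_def
  proof (rule le_opnorm)
    fix \<xi> assume \<xi>: "\<xi> \<in> carrier ?L" "nrm ?L \<xi> \<le> 1"
    show "nrm ?L (Lambda X \<phi> u b \<xi>) \<le> ?C"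
      using Lambda_nrm_le[OF p b mb \<xi>(1)] mult_left_mono[OF \<xi>(2) F_nrm_nonneg[OF b]] by simp
  qed (simp_all add: lp_zero[OF p])
  moreover have "Lambda X \<phi> u b (\<lambda>_. 0) = (\<lambda>_. 0)" by (auto simp: Lambda_def)
  ultimately show ?thesis by (simp add: lp_zero[OF p])
qed

text \<open>Vectors placed on the single orbit {x} x J see just the matrix at x. With
  \<open>norm_Lp_red_le\<close> this identifies the reduced norm as the least admissible matrix
  bound.\<close>

lemma matrix_bounded_norm_Lp_red:
  assumes p: "1 \<le> p" and b: "b \<in> carrier (F_alg X \<phi> u)"
  shows "matrix_bounded p (norm_Lp_red X \<phi> u p b) b"
proof (rule matrix_boundedI[OF p norm_Lp_red_nonneg[OF p b]])
  let ?L = "lp p (topspace X \<times> (UNIV :: 'g set))" and ?K = "nrm (F_alg X \<phi> u) b"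
  fix x and I J :: "'g set" and c :: "'g \<Rightarrow> complex"
  assume x: "x \<in> topspace X" and fin: "finite I" "finite J" and c1: "lpn p J (\<lambda>r. cmod (c r)) \<le> 1"
  have mb: "matrix_bounded p ?K b" by (rule matrix_bounded_nrm[OF p b])
  have inj: "inj_on orbit ({x} \<times> J)" for J using x by (intro inj_on_subset[OF orbit_inj]) auto
  have one: "lpn p (orbit ` ({x} \<times> J)) v = lpn p J (\<lambda>r. v (orbit (x, r)))" if "finite J" for J v
    using lpn_reindex[OF inj] that p by (simp add: lpn_Sigma)
  define \<xi> where "\<xi> = (\<lambda>i. if i \<in> orbit ` ({x} \<times> J) then c (snd i) else 0)"
  have sub: "orbit ` ({x} \<times> J) \<subseteq> topspace X \<times> UNIV" for J using x by (auto simp: orbit_def)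
  have \<xi>: "\<xi> \<in> carrier ?L" "nrm ?L \<xi> = lpn p J (\<lambda>r. cmod (c r))"
    unfolding \<xi>_def using lp_finite_support[OF p _ sub, of J "\<lambda>i. c (snd i)"] fin one[OF fin(2)]
    by (auto simp: orbit_def)
  have \<xi>r: "\<xi> (orbit (x, r)) = (if r \<in> J then c r else 0)" for r
  proof -
    have "orbit (x, r) \<in> orbit ` ({x} \<times> J) \<longleftrightarrow> r \<in> J" by (auto simp: orbit_def)
    then show ?thesis by (simp add: \<xi>_def orbit_def)
  qed
  have L: "Lambda X \<phi> u b \<xi> (orbit (x, t)) = (\<Sum>r\<in>J. mat b t r x * c r)" for t
  proof -
    have "Lambda X \<phi> u b \<xi> (orbit (x, t)) = (\<Sum>\<^sub>\<infinity>r. mat b t r x * (if r \<in> J then c r else 0))"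
      by (simp add: Lambda_orbit[OF x] \<xi>r)
    also have "\<dots> = (\<Sum>\<^sub>\<infinity>r\<in>J. mat b t r x * c r)" by (intro infsum_cong_neutral) auto
    also have "\<dots> = (\<Sum>r\<in>J. mat b t r x * c r)" using fin by simp
    finally show ?thesis .
  qed
  have "lpn p I (\<lambda>t. cmod (\<Sum>r\<in>J. mat b t r x * c r)) = lpn p (orbit ` ({x} \<times> I)) (\<lambda>i. cmod (Lambda X \<phi> u b \<xi> i))"
    unfolding one[OF fin(1)] L ..
  also have "\<dots> = lpn p (orbit ` ({x} \<times> I)) (\<lambda>i. nrm complex_space (Lambda X \<phi> u b \<xi> i))" by simp
  \<comment> \<open>Bounds on the finite sections of the image are at hand, not its membership in
    the space; hence \<open>lpn_le_lp_sum_nrm\<close> instead of \<open>lp_lpn_le\<close>.\<close>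
  also have "\<dots> \<le> nrm ?L (Lambda X \<phi> u b \<xi>)"
    using fin sub[of I] Lambda_lpn_le[OF p b mb \<xi>(1)] Lambda_outside
    by (intro lpn_le_lp_sum_nrm[OF p]) auto
  also have "\<dots> \<le> norm_Lp_red X \<phi> u p b"
    unfolding norm_Lp_red_def
  proof (rule le_opnorm)
    fix \<eta> assume \<eta>: "\<eta> \<in> carrier ?L" "nrm ?L \<eta> \<le> 1"
    show "nrm ?L (Lambda X \<phi> u b \<eta>) \<le> ?K"
      using Lambda_nrm_le[OF p b mb \<eta>(1)] mult_left_mono[OF \<eta>(2) F_nrm_nonneg[OF b]] by simp
  qed (use \<xi> c1 in auto)
  finally show "lpn p I (\<lambda>t. cmod (\<Sum>r\<in>J. mat b t r x * c r)) \<le> norm_Lp_red X \<phi> u p b" .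
qed

end

section \<open>Induced representations\<close>

lemma space_for_exponent_banach: "space_for_exponent T p E \<Longrightarrow> complex_banach_space E"
  by (auto simp: space_for_exponent_def is_Lp_space_def is_C0_space_def split: if_splits)

lemma C0_rep_intro:
  assumes "complex_banach_space E" "nondegenerate_representation (C0 X) E \<pi>"
  shows "C0_rep E X \<pi>"
proof -
  interpret nondeg_rep E "C0 X" \<pi> using assms by (rule nondeg_repI)
  show ?thesis ..
qed

text \<open>Reindexing an unconditional sum by a bijection transports the net of finite sets: the
  image of J contains S as soon as J contains the preimage of S.\<close>

lemma filterlim_image_finite_subsets:
  fixes h :: "'a \<Rightarrow> 'b"
  assumes "bij h"
  shows "filterlim (\<lambda>J. h ` J) (finite_subsets_at_top UNIV) (finite_subsets_at_top UNIV)"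
  unfolding filterlim_iff
proof (intro allI impI)
  fix P :: "'b set \<Rightarrow> bool" assume "eventually P (finite_subsets_at_top UNIV)"
  then obtain S where S: "finite S" "\<And>F. finite F \<Longrightarrow> S \<subseteq> F \<Longrightarrow> P F"
    by (auto simp: eventually_finite_subsets_at_top)
  have "P (h ` J)" if J: "finite J" "inv_into UNIV h ` S \<subseteq> J" for J
  proof (rule S(2))
    have "h ` inv_into UNIV h ` S = S" using assms by (simp add: image_image bij_is_surj f_inv_into_f)
    then show "S \<subseteq> h ` J" using J(2) by blast
  qed (use J in simp)
  then show "eventually (\<lambda>J. P (h ` J)) (finite_subsets_at_top UNIV)"
    unfolding eventually_finite_subsets_at_top using S(1) by (intro exI[of _ "inv_into UNIV h ` S"]) auto
qed

context twisted_action
begin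

context
  fixes E :: "'e nspace" and \<pi> :: "('x \<Rightarrow> complex) \<Rightarrow> 'e \<Rightarrow> 'e"
  assumes E: "complex_banach_space E" and \<pi>: "nondegenerate_representation (C0 X) E \<pi>"
begin

interpretation C0_rep E X \<pi>
  using E \<pi> by (rule C0_rep_intro)

text \<open>Summability of the norms of b s and boundedness of \<xi> make the series in
  \<open>Ind\<close> converge absolutely. Its index s is traded for r = - s + t, so that its partial
  sums become parts of a row of \<open>mat\<close>.\<close>

lemma Ind_tendsto:
  assumes b: "b \<in> carrier (F_alg X \<phi> u)" and \<xi>: "\<And>r. \<xi> r \<in> carrier E" "\<And>r. nrm E (\<xi> r) \<le> K"
  shows Ind_closed: "Ind X \<phi> u E \<pi> b \<xi> t \<in> carrier E"
    and Ind_nrm_tendsto: "((\<lambda>J. nrm E (finsum E (\<lambda>r. \<pi> (mat b t r) (\<xi> r)) J)) \<longlongrightarrow> nrm E (Ind X \<phi> u E \<pi> b \<xi> t))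
      (finite_subsets_at_top UNIV)"
proof -
  define g where "g s = \<pi> (mat b t (- s + t)) (\<xi> (- s + t))" for s
  have Ind: "Ind X \<phi> u E \<pi> b \<xi> t = infsum_in E g UNIV"
    unfolding Ind_def g_def mat_def by simp
  have C: "mat b t r \<in> carrier (C0 X)" for r using F_C0[OF b] by (rule mat_C0)
  have g: "g s \<in> carrier E" for s using C \<xi> by (auto simp: g_def)
  have K: "0 \<le> K" using order_trans[OF nrm_nonneg[OF \<xi>(1)] \<xi>(2)] .
  have sm: "(\<lambda>s. nrm E (g s)) summable_on UNIV"
  proof (rule summable_on_bounded_mult[OF F_summable[OF b], of _ K])
    fix s
    have n: "cmod (mat b t (- s + t) x) \<le> nrm (C0 X) (b s)" for x
      using mat_norm_le[of b t "- s + t" x] F_C0[OF b] by simp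
    have "nrm E (g s) \<le> nrm (C0 X) (b s) * nrm E (\<xi> (- s + t))"
      unfolding g_def using C \<xi> n F_C0[OF b] by (intro rep_bound) auto
    also have "\<dots> \<le> nrm (C0 X) (b s) * K" using \<xi> F_C0[OF b] by (intro mult_left_mono) auto
    finally show "0 \<le> nrm E (g s) \<and> nrm E (g s) \<le> K * nrm (C0 X) (b s)"
      using g by (simp add: mult.commute)
  qed (auto simp: F_C0[OF b])
  show "Ind X \<phi> u E \<pi> b \<xi> t \<in> carrier E" unfolding Ind using g sm by (intro infsum_in_closed) auto
  have "bij (\<lambda>r. t - r)" by (rule bij_betwI[of _ _ _ "\<lambda>s. - s + t"]) auto
  note fl = filterlim_image_finite_subsets[OF this]
  have "((\<lambda>S. nrm E (finsum E g S)) \<longlongrightarrow> nrm E (infsum_in E g UNIV)) (finite_subsets_at_top UNIV)"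
    using g sm by (intro nrm_infsum_in_tendsto) auto
  from filterlim_compose[OF this fl]
  have "((\<lambda>J. nrm E (finsum E g ((\<lambda>r. t - r) ` J))) \<longlongrightarrow> nrm E (Ind X \<phi> u E \<pi> b \<xi> t)) (finite_subsets_at_top UNIV)"
    unfolding Ind .
  moreover have "finsum E g ((\<lambda>r. t - r) ` J) = finsum E (\<lambda>r. \<pi> (mat b t r) (\<xi> r)) J" for J
    using g by (subst M.add.finprod_reindex) (auto simp: g_def inj_on_def)
  ultimately show "((\<lambda>J. nrm E (finsum E (\<lambda>r. \<pi> (mat b t r) (\<xi> r)) J)) \<longlongrightarrow> nrm E (Ind X \<phi> u E \<pi> b \<xi> t))
      (finite_subsets_at_top UNIV)" by simp
qed

lemma lp_sum_nrm_pointwise_le: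
  assumes p: "1 \<le> p" and \<xi>: "\<xi> \<in> carrier (lp_sum p UNIV E)" and F: "finite F"
  shows "lpn p F (\<lambda>r. nrm E (\<xi> r)) \<le> nrm (lp_sum p UNIV E) \<xi>"
  using lpn_le_nrm[OF p \<xi> _ _ F] by simp

text \<open>\<open>matrix_lemma\<close> is applied to finite rectangles; with the rows fixed, the
  set of columns then grows to the whole group.\<close>

lemma Ind_lpn_le:
  assumes p: "1 \<le> p" and sp: "space_for_exponent TYPE('m) p E"
    and b: "b \<in> carrier (F_alg X \<phi> u)" and mb: "matrix_bounded p C b"
    and \<xi>: "\<xi> \<in> carrier (lp_sum p UNIV E)" and I: "finite I"
  shows "lpn p I (\<lambda>t. nrm E (Ind X \<phi> u E \<pi> b \<xi> t)) \<le> C * nrm (lp_sum p UNIV E) \<xi>"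
proof (rule lpn_limit_le[OF I p finite_subsets_at_top_neq_bot])
  let ?N = "nrm (lp_sum p UNIV E) \<xi>"
  have cl: "\<xi> r \<in> carrier E" for r using \<xi> by (simp add: lp_sum_carrier)
  have "nrm E (\<xi> r) \<le> ?N" for r using lp_sum_nrm_pointwise_le[OF p \<xi>, of "{r}"] p cl by simp
  then show "((\<lambda>J. nrm E (finsum E (\<lambda>r. \<pi> (mat b t r) (\<xi> r)) J)) \<longlongrightarrow> nrm E (Ind X \<phi> u E \<pi> b \<xi> t))
      (finite_subsets_at_top UNIV)" for t
    by (rule Ind_nrm_tendsto[OF b cl])
  have "lpn p I (\<lambda>t. nrm E (finsum E (\<lambda>r. \<pi> (mat b t r) (\<xi> r)) J)) \<le> C * ?N" if J: "finite J" for J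
  proof -
    have "lpn p I (\<lambda>t. nrm E (finsum E (\<lambda>r. \<pi> (mat b t r) (\<xi> r)) J)) \<le> C * lpn p J (\<lambda>r. nrm E (\<xi> r))"
      using mb I J cl F_C0[OF b] by (intro matrix_lemma[OF p sp \<pi>]) (auto simp: matrix_bounded_def intro: mat_C0)
    also have "\<dots> \<le> C * ?N"
      using mb J by (intro mult_left_mono lp_sum_nrm_pointwise_le[OF p \<xi>]) (auto simp: matrix_bounded_def)
    finally show ?thesis .
  qed
  then show "\<forall>\<^sub>F J in finite_subsets_at_top UNIV. lpn p I (\<lambda>t. nrm E (finsum E (\<lambda>r. \<pi> (mat b t r) (\<xi> r)) J)) \<le> C * ?N"
    by (auto simp: eventually_finite_subsets_at_top)
qed

lemma Ind_nrm_le: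
  assumes p: "1 \<le> p" and sp: "space_for_exponent TYPE('m) p E"
    and b: "b \<in> carrier (F_alg X \<phi> u)" and mb: "matrix_bounded p C b"
    and \<xi>: "\<xi> \<in> carrier (lp_sum p UNIV E)"
  shows "nrm (lp_sum p UNIV E) (Ind X \<phi> u E \<pi> b \<xi>) \<le> C * nrm (lp_sum p UNIV E) \<xi>"
    and "finite I \<Longrightarrow> lpn p I (\<lambda>t. nrm E (Ind X \<phi> u E \<pi> b \<xi> t)) \<le> nrm (lp_sum p UNIV E) (Ind X \<phi> u E \<pi> b \<xi>)"
proof -
  let ?N = "nrm (lp_sum p UNIV E) \<xi>"
  have cl: "\<xi> r \<in> carrier E" for r using \<xi> by (simp add: lp_sum_carrier)
  have bd: "nrm E (\<xi> r) \<le> ?N" for r using lp_sum_nrm_pointwise_le[OF p \<xi>, of "{r}"] p cl by simp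
  have pos: "0 \<le> nrm E (Ind X \<phi> u E \<pi> b \<xi> t)" for t using Ind_closed[OF b cl bd] by simp
  show "nrm (lp_sum p UNIV E) (Ind X \<phi> u E \<pi> b \<xi>) \<le> C * ?N"
    using pos Ind_lpn_le[OF p sp b mb \<xi>] by (intro lp_sum_nrm_le[OF p]) auto
  show "lpn p I (\<lambda>t. nrm E (Ind X \<phi> u E \<pi> b \<xi> t)) \<le> nrm (lp_sum p UNIV E) (Ind X \<phi> u E \<pi> b \<xi>)" if "finite I"
    using that pos Ind_lpn_le[OF p sp b mb \<xi>] by (intro lpn_le_lp_sum_nrm[OF p]) auto
qed

lemma lp_sum_zero:
  assumes p: "1 \<le> p"
  shows "(\<lambda>_. zero E) \<in> carrier (lp_sum p UNIV E)" "nrm (lp_sum p UNIV E) (\<lambda>_. zero E) = 0"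
  using p by (auto elim!: exponent_cases simp: lp_sum_carrier lp_sum_nrm)

lemma opnorm_Ind_le:
  assumes p: "1 \<le> p" and sp: "space_for_exponent TYPE('m) p E"
    and b: "b \<in> carrier (F_alg X \<phi> u)" and mb: "matrix_bounded p C b"
  shows "opnorm (lp_sum p UNIV E) (Ind X \<phi> u E \<pi> b) \<le> C"
proof (rule opnorm_le)
  show "\<exists>x\<in>carrier (lp_sum p UNIV E). nrm (lp_sum p UNIV E) x \<le> 1"
    by (intro bexI[of _ "\<lambda>_. zero E"]) (simp_all add: lp_sum_zero[OF p])
  fix \<xi> :: "'g \<Rightarrow> 'e" assume \<xi>: "\<xi> \<in> carrier (lp_sum p UNIV E)" "nrm (lp_sum p UNIV E) \<xi> \<le> 1"
  show "nrm (lp_sum p UNIV E) (Ind X \<phi> u E \<pi> b \<xi>) \<le> C"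
    using Ind_nrm_le(1)[OF p sp b mb \<xi>(1)] mult_left_mono[OF \<xi>(2), of C] mb by (simp add: matrix_bounded_def)
qed

lemma Ind_nrm_le_opnorm:
  assumes p: "1 \<le> p" and sp: "space_for_exponent TYPE('m) p E"
    and b: "b \<in> carrier (F_alg X \<phi> u)"
    and \<xi>: "\<xi> \<in> carrier (lp_sum p UNIV E)" "nrm (lp_sum p UNIV E) \<xi> \<le> 1"
  shows "nrm (lp_sum p UNIV E) (Ind X \<phi> u E \<pi> b \<xi>) \<le> opnorm (lp_sum p UNIV E) (Ind X \<phi> u E \<pi> b)"
proof (rule le_opnorm)
  fix \<eta> :: "'g \<Rightarrow> 'e" assume \<eta>: "\<eta> \<in> carrier (lp_sum p UNIV E)" "nrm (lp_sum p UNIV E) \<eta> \<le> 1"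
  show "nrm (lp_sum p UNIV E) (Ind X \<phi> u E \<pi> b \<eta>) \<le> nrm (F_alg X \<phi> u) b"
    using Ind_nrm_le(1)[OF p sp b matrix_bounded_nrm[OF p b] \<eta>(1)]
      mult_left_mono[OF \<eta>(2) F_nrm_nonneg[OF b]] by simp
qed (use \<xi> in auto)

lemma opnorm_Ind_nonneg:
  assumes p: "1 \<le> p" and sp: "space_for_exponent TYPE('m) p E"
    and b: "b \<in> carrier (F_alg X \<phi> u)"
  shows "0 \<le> opnorm (lp_sum p UNIV E) (Ind X \<phi> u E \<pi> b)"
proof -
  have "0 \<le> nrm (lp_sum p UNIV E) (Ind X \<phi> u E \<pi> b (\<lambda>_. zero E))"
    using Ind_nrm_le(2)[OF p sp b matrix_bounded_nrm[OF p b] lp_sum_zero(1)[OF p], of "{}"] by simp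
  also have "\<dots> \<le> opnorm (lp_sum p UNIV E) (Ind X \<phi> u E \<pi> b)"
    by (intro Ind_nrm_le_opnorm[OF p sp b]) (simp_all add: lp_sum_zero[OF p])
  finally show ?thesis .
qed

end

end

subsection \<open>Evaluation at a point\<close>

text \<open>Evaluation at x, acting by scalars on a copy of \<open>lp p I\<close>. It is used with
  one index, which is the character itself, and with none, which is the zero space.\<close>

definition eval_rep :: "'x \<Rightarrow> ('x \<Rightarrow> complex) \<Rightarrow> ('x, 'g, 'i) universe \<Rightarrow> ('x, 'g, 'i) universe" where
  "eval_rep x a w = embed (\<lambda>i. a x * unembed w i)"

lemma lp_copy_finsum:
  assumes p: "1 \<le> p" and f: "\<And>j. j \<in> J \<Longrightarrow> f j \<in> carrier (lp_copy p I)" and J: "finite J"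
  shows "finsum (lp_copy p I :: ('x, 'g, 'i) universe nspace) f J = embed (\<lambda>i. \<Sum>j\<in>J. unembed (f j) i)"
proof -
  interpret cbanach "lp_copy p I :: ('x, 'g, 'i) universe nspace" by unfold_locales (rule lp_copy_banach[OF p])
  show ?thesis
    using J f
  proof (induction J rule: finite_induct)
    case (insert j J)
    have "finsum (lp_copy p I) f (insert j J) = add (lp_copy p I) (f j) (finsum (lp_copy p I) f J)"
      using insert by (intro finsum_insert') auto
    then show ?case using insert by simp
  qed simp
qed

lemma lp_copy_opnorm_le:
  assumes p: "1 \<le> p" and C: "0 \<le> C"
    and le: "\<And>\<xi>. \<xi> \<in> carrier (lp p I) \<Longrightarrow> nrm (lp p I) (unembed (T (embed \<xi>))) \<le> C * nrm (lp p I) \<xi>"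
  shows "opnorm (lp_copy p I :: ('x, 'g, 'i) universe nspace) T \<le> C"
proof -
  interpret cbanach "lp_copy p I :: ('x, 'g, 'i) universe nspace" by unfold_locales (rule lp_copy_banach[OF p])
  show ?thesis by (rule opnorm_leI) (use le C in auto)
qed

text \<open>A single function with a x \<noteq> 0, rescaled to value 1 at x, already fixes every
  vector; on the zero space any function will do.\<close>

lemma eval_rep_nondegenerate:
  assumes p: "1 \<le> p" and x: "I = {} \<or> (\<exists>a\<in>carrier (C0 X). a x \<noteq> 0)"
  shows "nondegenerate_representation (C0 X) (lp_copy p I :: ('x, 'g, 'i) universe nspace) (eval_rep x)"
proof -
  let ?E = "lp_copy p I :: ('x, 'g, 'i) universe nspace"
  interpret cbanach ?E by unfold_locales (rule lp_copy_banach[OF p])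
  have nb: "nrm (lp p I) (\<lambda>i. a x * \<xi> i) \<le> nrm (C0 X) a * nrm (lp p I) \<xi>"
    if "a \<in> carrier (C0 X)" "\<xi> \<in> carrier (lp p I)" for a \<xi>
    using that lp_nrm_nonneg[OF p that(2)] by (simp add: lp_scale[OF p] mult_right_mono C0_le_nrm)
  have lin: "linear_map ?E ?E (eval_rep x a)" for a
    by (auto simp: linear_map_def eval_rep_def lp_scale[OF p] distrib_left mult.left_commute intro!: arg_cong[of _ _ embed])
  have rep: "representation (C0 X) ?E (eval_rep x)"
    unfolding representation_def bounded_operator_def
  proof (intro conjI ballI allI lin)
    fix a assume a: "a \<in> carrier (C0 X)"
    show "\<exists>C. \<forall>w\<in>carrier ?E. nrm ?E (eval_rep x a w) \<le> C * nrm ?E w"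
      using nb[OF a] by (intro exI[of _ "nrm (C0 X) a"]) (auto simp: eval_rep_def)
    show "opnorm ?E (eval_rep x a) \<le> nrm (C0 X) a"
      using nb[OF a] a by (intro lp_copy_opnorm_le[OF p]) (auto simp: eval_rep_def)
  qed (auto simp: eval_rep_def algebra_simps intro!: arg_cong[of _ _ embed])
  have "w \<in> {eval_rep x a v |a v. a \<in> carrier (C0 X) \<and> v \<in> carrier ?E}" if w: "w \<in> carrier ?E" for w
  proof -
    obtain \<xi> where \<xi>: "w = embed \<xi>" "\<xi> \<in> carrier (lp p I)" using w by auto
    from x show ?thesis
    proof
      assume "I = {}"
      then have "\<xi> = (\<lambda>_. 0)" using lp_carrier_out[OF \<xi>(2)] by auto
      then have "w = eval_rep x (\<lambda>_. 0) w" using \<xi> by (simp add: eval_rep_def)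
      then show ?thesis using w C0_zero by blast
    next
      assume "\<exists>a\<in>carrier (C0 X). a x \<noteq> 0"
      then obtain a where a: "a \<in> carrier (C0 X)" "a x \<noteq> 0" by blast
      have "w = eval_rep x (\<lambda>y. (1 / a x) * a y) w" using \<xi> a by (simp add: eval_rep_def)
      then show ?thesis using w C0_scale[OF a(1)] by blast
    qed
  qed
  then have 1: "carrier ?E \<subseteq> {eval_rep x a v |a v. a \<in> carrier (C0 X) \<and> v \<in> carrier ?E}" by blast
  have "{eval_rep x a v |a v. a \<in> carrier (C0 X) \<and> v \<in> carrier ?E} \<subseteq> topspace metric.mtopology"
    unfolding metric.topspace_mtopology by (auto simp: eval_rep_def lp_scale[OF p])
  note 2 = order_trans[OF 1 closure_of_subset[OF this]]
  have "metric.mtopology closure_of {eval_rep x a v |a v. a \<in> carrier (C0 X) \<and> v \<in> carrier ?E} = carrier ?E"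
    by (rule antisym[OF closure_of_subset_topspace[of metric.mtopology, unfolded metric.topspace_mtopology] 2])
  then show ?thesis using rep by (simp add: nondegenerate_representation_def)
qed

section \<open>The reduced norm as a supremum over induced representations\<close>

context twisted_action
begin

lemma mat_vanishes:
  assumes x: "x \<in> topspace X" and van: "\<And>a. a \<in> carrier (C0 X) \<Longrightarrow> a x = 0" and b: "b \<in> carrier (F_alg X \<phi> u)"
  shows "mat b t r x = 0"
  using van[OF mat_C0[OF F_C0[OF b]]] .

text \<open>The reduced norm is an admissible matrix bound, so \<open>opnorm_Ind_le\<close> gives
  one inequality. Conversely, inducing evaluation at x from a one-dimensional space returns the
  matrix of b at x, which makes the supremum an admissible bound at every point.\<close>

theorem norm_P_red_eq_Sup_Ind:
  assumes P: "P \<noteq> {}" "P \<subseteq> {1..\<infinity>}" and b: "b \<in> carrier (F_alg X \<phi> u)"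
  shows "norm_P_red X \<phi> u P b =
            Sup {opnorm (lp_sum p UNIV E) (Ind X \<phi> u E \<pi> b) |
                   p (E :: ('x, 'g, 'i) universe nspace) \<pi>.
                   p \<in> P \<and> space_for_exponent TYPE(('x, 'g, 'i) points) p E \<and>
                   nondegenerate_representation (C0 X) E \<pi>}" (is "_ = Sup ?S")
proof -
  let ?K = "nrm (F_alg X \<phi> u) b"
  have P1: "1 \<le> p" if "p \<in> P" for p using P that by auto
  have red: "norm_Lp_red X \<phi> u p b \<le> ?K" if "p \<in> P" for p
    using norm_Lp_red_le[OF P1[OF that] b matrix_bounded_nrm[OF P1[OF that] b]] .
  have bdd: "bdd_above ((\<lambda>p. norm_Lp_red X \<phi> u p b) ` P)" using red by (intro bdd_aboveI2) auto
  have S_le: "s \<le> (SUP p\<in>P. norm_Lp_red X \<phi> u p b)" if "s \<in> ?S" for s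
  proof -
    obtain p E \<pi> where s: "s = opnorm (lp_sum p UNIV E) (Ind X \<phi> u E \<pi> b)" and p: "p \<in> P"
      and sp: "space_for_exponent TYPE(('x, 'g, 'i) points) p (E :: ('x, 'g, 'i) universe nspace)"
      and \<pi>: "nondegenerate_representation (C0 X) E \<pi>" using \<open>s \<in> ?S\<close> by blast
    have "s \<le> norm_Lp_red X \<phi> u p b"
      unfolding s by (rule opnorm_Ind_le[OF space_for_exponent_banach[OF sp] \<pi> P1[OF p] sp b
          matrix_bounded_norm_Lp_red[OF P1[OF p] b]])
    also have "\<dots> \<le> (SUP p\<in>P. norm_Lp_red X \<phi> u p b)" by (rule cSUP_upper[OF p bdd])
    finally show ?thesis .
  qed
  then have bddS: "bdd_above ?S" by (auto simp: bdd_above_def)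
  have mem: "opnorm (lp_sum p UNIV (lp_copy p I)) (Ind X \<phi> u (lp_copy p I :: ('x, 'g, 'i) universe nspace) (eval_rep x) b) \<in> ?S"
    if "p \<in> P" "I = {} \<or> (\<exists>a\<in>carrier (C0 X). a x \<noteq> 0)" for p I x
    using that eval_rep_nondegenerate[OF P1[OF that(1)] that(2)] lp_copy_space_for_exponent[OF P1[OF that(1)]] by blast
  obtain p0 where p0: "p0 \<in> P" using P by blast
  \<comment> \<open>Inducing from the zero space puts a nonnegative number into ?S for every X, so
    that Sup ?S can serve as a bound.\<close>
  have S0: "0 \<le> Sup ?S"
  proof (rule cSup_upper2[OF mem[OF p0] _ bddS])
    show "0 \<le> opnorm (lp_sum p0 UNIV (lp_copy p0 {})) (Ind X \<phi> u (lp_copy p0 {} :: ('x, 'g, 'i) universe nspace) (eval_rep undefined) b)"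
      by (rule opnorm_Ind_nonneg[OF lp_copy_banach eval_rep_nondegenerate _ lp_copy_space_for_exponent b])
        (simp_all add: P1[OF p0])
  qed simp
  have "norm_Lp_red X \<phi> u p b \<le> Sup ?S" if p: "p \<in> P" for p
  proof (rule norm_Lp_red_le[OF P1[OF p] b matrix_boundedI[OF P1[OF p] S0]])
    note p1 = P1[OF p]
    fix x and I J :: "'g set" and c :: "'g \<Rightarrow> complex"
    assume x: "x \<in> topspace X" and fin: "finite I" "finite J" and c1: "lpn p J (\<lambda>r. cmod (c r)) \<le> 1"
    show "lpn p I (\<lambda>t. cmod (\<Sum>r\<in>J. mat b t r x * c r)) \<le> Sup ?S"
    proof (cases "\<exists>a\<in>carrier (C0 X). a x \<noteq> 0")
      \<comment> \<open>Here all matrix entries vanish at x, and evaluation at x would be degenerate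
        on a one-dimensional space.\<close>
      case False
      then have "lpn p I (\<lambda>t. cmod (\<Sum>r\<in>J. mat b t r x * c r)) = 0"
        using mat_vanishes[OF x _ b] by (intro lpn_zero[OF fin(1) p1]) auto
      then show ?thesis using S0 by simp
    next
      case True
      let ?E = "lp_copy p {0} :: ('x, 'g, 'i) universe nspace"
      interpret cbanach ?E by unfold_locales (rule lp_copy_banach[OF p1])
      have \<pi>: "nondegenerate_representation (C0 X) ?E (eval_rep x)" using True by (intro eval_rep_nondegenerate[OF p1]) simp
      have sp: "space_for_exponent TYPE(('x, 'g, 'i) points) p ?E" by (rule lp_copy_space_for_exponent[OF p1])
      define e where "e z i = (if i \<in> {0::'g} then z else 0 :: complex)" for z i
      have e: "e z \<in> carrier (lp p {0})" "nrm (lp p {0}) (e z) = cmod z" for z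
        unfolding e_def using lp_finite_support[OF p1, of "{0}" "{0}" "\<lambda>_. z"] p1 by auto
      define \<xi> where "\<xi> r = (embed (e (if r \<in> J then c r else 0)) :: ('x, 'g, 'i) universe)" for r
      have \<xi>c: "\<xi> r \<in> carrier ?E" for r using e by (simp add: \<xi>_def)
      have n\<xi>: "nrm ?E (\<xi> r) = cmod (if r \<in> J then c r else 0)" for r by (simp add: \<xi>_def e del: if_image_distrib)
      have c0: "(\<lambda>r. if r \<in> J then c r else 0) \<in> carrier (lp p UNIV)" by (rule lp_finite_support(1)[OF p1 fin(2)]) simp
      have \<xi>: "\<xi> \<in> carrier (lp_sum p UNIV ?E)" "nrm (lp_sum p UNIV ?E) \<xi> \<le> 1"
      proof -
        have "(\<forall>\<epsilon>>0. finite {i. \<epsilon> \<le> nrm ?E (\<xi> i)}) \<and> p = \<infinity> \<or> (\<lambda>i. nrm ?E (\<xi> i) powr real_of_ereal p) summable_on UNIV \<and> p \<noteq> \<infinity>"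
          using c0 unfolding n\<xi> by (cases "p = \<infinity>") (auto simp: lp_sum_carrier)
        then show "\<xi> \<in> carrier (lp_sum p UNIV ?E)" using \<xi>c by (auto simp: lp_sum_carrier)
        have "nrm (lp_sum p UNIV ?E) \<xi> = nrm (lp p UNIV) (\<lambda>r. if r \<in> J then c r else 0)"
          unfolding lp_sum_nrm n\<xi> by simp
        then show "nrm (lp_sum p UNIV ?E) \<xi> \<le> 1" using c1 lp_finite_support(2)[OF p1 fin(2), of UNIV c] by simp
      qed
      have "nrm ?E (Ind X \<phi> u ?E (eval_rep x) b \<xi> t) = cmod (\<Sum>r\<in>J. mat b t r x * c r)" for t
      proof -
        have "nrm ?E (\<xi> r) \<le> 1" for r
          using lp_sum_nrm_pointwise_le[OF banach \<pi> p1 \<xi>(1), of "{r}"] \<xi>(2) p1 nrm_nonneg[OF \<xi>c, of r] by simp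
        note lim = Ind_nrm_tendsto[OF banach \<pi> b \<xi>c this, of t]
        \<comment> \<open>The vector vanishes off J, so the partial sums are constant from J on, and
          this constant is the limit.\<close>
        have fs: "nrm ?E (finsum ?E (\<lambda>r. eval_rep x (mat b t r) (\<xi> r)) J') = cmod (\<Sum>r\<in>J. mat b t r x * c r)"
          if J': "finite J'" "J \<subseteq> J'" for J'
        proof -
          have "finsum ?E (\<lambda>r. eval_rep x (mat b t r) (\<xi> r)) J' = embed (\<lambda>i. \<Sum>r\<in>J'. mat b t r x * e (if r \<in> J then c r else 0) i)"
            using e J' by (subst lp_copy_finsum[OF p1]) (auto simp: eval_rep_def \<xi>_def lp_scale[OF p1])
          also have "(\<lambda>i. \<Sum>r\<in>J'. mat b t r x * e (if r \<in> J then c r else 0) i) = e (\<Sum>r\<in>J'. mat b t r x * (if r \<in> J then c r else 0))"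
            by (auto simp: e_def)
          also have "(\<Sum>r\<in>J'. mat b t r x * (if r \<in> J then c r else 0)) = (\<Sum>r\<in>J. mat b t r x * c r)"
            using J' by (intro sum.mono_neutral_cong_right) auto
          finally show ?thesis by (simp add: e)
        qed
        have "\<forall>\<^sub>F J' in finite_subsets_at_top UNIV. nrm ?E (finsum ?E (\<lambda>r. eval_rep x (mat b t r) (\<xi> r)) J') = cmod (\<Sum>r\<in>J. mat b t r x * c r)"
          unfolding eventually_finite_subsets_at_top using fin fs by (intro exI[of _ J]) auto
        then have "((\<lambda>J'. nrm ?E (finsum ?E (\<lambda>r. eval_rep x (mat b t r) (\<xi> r)) J')) \<longlongrightarrow> cmod (\<Sum>r\<in>J. mat b t r x * c r)) (finite_subsets_at_top UNIV)"
          by (rule tendsto_eventually)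
        then show ?thesis using lim by (rule tendsto_unique[OF finite_subsets_at_top_neq_bot, rotated])
      qed
      then have "lpn p I (\<lambda>t. cmod (\<Sum>r\<in>J. mat b t r x * c r)) = lpn p I (\<lambda>t. nrm ?E (Ind X \<phi> u ?E (eval_rep x) b \<xi> t))" by simp
      also have "\<dots> \<le> nrm (lp_sum p UNIV ?E) (Ind X \<phi> u ?E (eval_rep x) b \<xi>)"
        by (rule Ind_nrm_le(2)[OF banach \<pi> p1 sp b matrix_bounded_nrm[OF p1 b] \<xi>(1) fin(1)])
      also have "\<dots> \<le> opnorm (lp_sum p UNIV ?E) (Ind X \<phi> u ?E (eval_rep x) b)"
        by (rule Ind_nrm_le_opnorm[OF banach \<pi> p1 sp b \<xi>])
      also have "\<dots> \<le> Sup ?S" using True by (intro cSup_upper[OF mem[OF p] bddS]) simp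
      finally show ?thesis .
    qed
  qed
  then have "(SUP p\<in>P. norm_Lp_red X \<phi> u p b) \<le> Sup ?S" using P by (intro cSUP_least) auto
  moreover have "Sup ?S \<le> (SUP p\<in>P. norm_Lp_red X \<phi> u p b)"
  proof (rule cSup_least)
    show "?S \<noteq> {}" by (rule ex_in_conv[THEN iffD1, OF exI, OF mem[OF p0 disjI1[OF refl]]])
  qed (rule S_le)
  ultimately show ?thesis using P by (simp add: norm_P_red_def)
qed

end

section \<open>Representations of the twisted convolution algebra\<close>

lemma (in cbanach) closure_eq_carrierI:
  assumes "S \<subseteq> carrier E" "\<And>\<xi> \<epsilon>. \<xi> \<in> carrier E \<Longrightarrow> 0 < \<epsilon> \<Longrightarrow> \<exists>\<eta>\<in>S. nrm E (\<xi> \<ominus> \<eta>) < \<epsilon>"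
  shows "metric.mtopology closure_of S = carrier E"
  unfolding metric.metric_closure_of
proof (intro equalityI subsetI CollectI conjI allI impI)
  fix \<xi> \<epsilon> assume "\<xi> \<in> carrier E" "(0::real) < \<epsilon>"
  then obtain \<eta> where "\<eta> \<in> S" "nrm E (\<xi> \<ominus> \<eta>) < \<epsilon>" using assms(2) by blast
  then show "\<exists>y\<in>S. y \<in> metric.mball \<xi> \<epsilon>"
    using assms(1) \<open>\<xi> \<in> carrier E\<close> by (intro bexI[of _ \<eta>]) (auto simp: ndist_def)
qed auto

definition single :: "'g \<Rightarrow> ('x \<Rightarrow> complex) \<Rightarrow> 'g \<Rightarrow> 'x \<Rightarrow> complex" where
  "single s a = (\<lambda>t. if t = s then a else (\<lambda>_. 0))"

context twisted_action
begin

lemma F_simps [simp]: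
  "add (F_alg X \<phi> u) b c = (\<lambda>s x. b s x + c s x)" "smult (F_alg X \<phi> u) z b = (\<lambda>s x. z * b s x)"
  "zero (F_alg X \<phi> u) = (\<lambda>_ _. 0)" "mult (F_alg X \<phi> u) b c = twisted_conv X \<phi> u b c"
  by (simp_all add: F_alg_def lp_sum_simps)

lemma F_dominated:
  assumes "\<And>s. d s \<in> carrier (C0 X)" "\<And>s. nrm (C0 X) (d s) \<le> K * nrm (C0 X) (b s)" "b \<in> carrier (F_alg X \<phi> u)"
  shows "d \<in> carrier (F_alg X \<phi> u)"
  unfolding F_carrier using assms
  by (intro conjI allI summable_on_bounded_mult[OF F_summable[OF assms(3)], of _ K]) (auto simp: F_C0)

lemma F_nrm_leI:
  assumes d: "d \<in> carrier (F_alg X \<phi> u)" and le: "\<And>F. finite F \<Longrightarrow> (\<Sum>s\<in>F. nrm (C0 X) (d s)) \<le> C"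
  shows "nrm (F_alg X \<phi> u) d \<le> C"
  unfolding F_nrm[OF d] by (rule infsum_le_finite_sums[OF F_summable[OF d]]) (use le in auto)

lemma C0_nrm_triangle:
  "a \<in> carrier (C0 X) \<Longrightarrow> b \<in> carrier (C0 X) \<Longrightarrow> nrm (C0 X) (\<lambda>x. a x + b x) \<le> nrm (C0 X) a + nrm (C0 X) b"
  by (intro C0_nrm_le order_trans[OF norm_triangle_ineq] add_mono C0_le_nrm)

lemma C0_nrm_scale_le: "a \<in> carrier (C0 X) \<Longrightarrow> nrm (C0 X) (\<lambda>x. z * a x) \<le> cmod z * nrm (C0 X) a"
  by (intro C0_nrm_le) (simp add: norm_mult mult_left_mono C0_le_nrm)

lemma F_add:
  assumes "b \<in> carrier (F_alg X \<phi> u)" "c \<in> carrier (F_alg X \<phi> u)"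
  shows "(\<lambda>s x. b s x + c s x) \<in> carrier (F_alg X \<phi> u)"
  unfolding F_carrier
proof (intro conjI allI C0_add F_C0 assms)
  show "(\<lambda>s. nrm (C0 X) (\<lambda>x. b s x + c s x)) summable_on UNIV"
    by (rule summable_on_bounded_mult[OF summable_on_add[OF F_summable[OF assms(1)] F_summable[OF assms(2)]], of _ 1])
      (use F_C0[OF assms(1)] F_C0[OF assms(2)] in \<open>auto simp: C0_nrm_triangle C0_add\<close>)
qed

lemma F_scale: "b \<in> carrier (F_alg X \<phi> u) \<Longrightarrow> (\<lambda>s x. z * b s x) \<in> carrier (F_alg X \<phi> u)"
  using F_dominated[of "\<lambda>s x. z * b s x" "cmod z" b] by (simp add: C0_scale F_C0 C0_nrm_scale_le)

lemma F_diff: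
  assumes "b \<in> carrier (F_alg X \<phi> u)" "c \<in> carrier (F_alg X \<phi> u)"
  shows "(\<lambda>s x. b s x - c s x) \<in> carrier (F_alg X \<phi> u)"
  using F_add[OF assms(1) F_scale[OF assms(2), of "-1"]] by simp

lemma single_F:
  assumes a: "a \<in> carrier (C0 X)"
  shows "single s a \<in> carrier (F_alg X \<phi> u)" "nrm (F_alg X \<phi> u) (single s a) = nrm (C0 X) a"
proof -
  have "nrm (C0 X) (\<lambda>_. 0) = 0" by (simp add: C0_nrm)
  then have n: "nrm (C0 X) (single s a t) = (if t = s then nrm (C0 X) a else 0)" for t by (simp add: single_def)
  have "(\<lambda>t. if t = s then nrm (C0 X) a else 0) summable_on UNIV \<longleftrightarrow> (\<lambda>t. nrm (C0 X) a) summable_on {s}"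
    by (rule summable_on_cong_neutral) auto
  then have "(\<lambda>t. nrm (C0 X) (single s a t)) summable_on UNIV" unfolding n by simp
  then show c: "single s a \<in> carrier (F_alg X \<phi> u)" using a by (simp add: F_carrier) (simp add: single_def)
  have "(\<Sum>\<^sub>\<infinity>t. nrm (C0 X) (single s a t)) = (\<Sum>\<^sub>\<infinity>t\<in>{s}. nrm (C0 X) a)"
    unfolding n by (intro infsum_cong_neutral) auto
  then show "nrm (F_alg X \<phi> u) (single s a) = nrm (C0 X) a" by (simp add: F_nrm[OF c])
qed

lemma twisted_conv_single:
  assumes "a \<in> carrier (C0 X)"
  shows "twisted_conv X \<phi> u (single s a) (single t b) = single (s + t) (\<lambda>x. a x * alpha X \<phi> s b x * u s t x)"
proof (intro ext)
  fix r x
  have "twisted_conv X \<phi> u (single s a) (single t b) r x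
      = (\<Sum>\<^sub>\<infinity>(s', t')\<in>{(s', t'). s' + t' = r} \<inter> {(s, t)}. a x * alpha X \<phi> s b x * u s t x)"
    unfolding twisted_conv_def by (rule infsum_cong_neutral) (auto simp: single_def alpha_def split: if_splits)
  also have "\<dots> = single (s + t) (\<lambda>x. a x * alpha X \<phi> s b x * u s t x) r x"
    by (auto simp: single_def)
  finally show "twisted_conv X \<phi> u (single s a) (single t b) r x
      = single (s + t) (\<lambda>x. a x * alpha X \<phi> s b x * u s t x) r x" .
qed

text \<open>Off a finite S the total mass of b is at most \<epsilon>, so anything dominated by K b
  has mass at most K \<epsilon> there. The statement quantifies over d because S must be fixed
  before the approximant of b is built.\<close>

lemma F_approx:
  assumes b: "b \<in> carrier (F_alg X \<phi> u)" and \<epsilon>: "0 < \<epsilon>"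
  obtains S where "finite S"
    "\<And>d K \<delta>. (\<And>s. d s \<in> carrier (C0 X)) \<Longrightarrow> 0 \<le> K \<Longrightarrow> (\<And>s. nrm (C0 X) (d s) \<le> K * nrm (C0 X) (b s)) \<Longrightarrow>
      (\<And>s. s \<in> S \<Longrightarrow> nrm (C0 X) (d s) \<le> \<delta>) \<Longrightarrow> nrm (F_alg X \<phi> u) d \<le> real (card S) * \<delta> + K * \<epsilon>"
proof -
  obtain S where S: "finite S" "S \<subseteq> UNIV" "\<And>F. finite F \<Longrightarrow> F \<subseteq> UNIV \<Longrightarrow> F \<inter> S = {} \<Longrightarrow> (\<Sum>s\<in>F. nrm (C0 X) (b s)) \<le> \<epsilon>"
    by (rule summable_on_tail[OF F_summable[OF b] \<epsilon>]) (rule that)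
  show ?thesis
  proof (rule that[OF S(1)])
    fix d K \<delta> assume d: "\<And>s. d s \<in> carrier (C0 X)" and K: "0 \<le> K"
      and dK: "\<And>s. nrm (C0 X) (d s) \<le> K * nrm (C0 X) (b s)" and d\<delta>: "\<And>s. s \<in> S \<Longrightarrow> nrm (C0 X) (d s) \<le> \<delta>"
    show "nrm (F_alg X \<phi> u) d \<le> real (card S) * \<delta> + K * \<epsilon>"
    proof (rule F_nrm_leI[OF F_dominated[OF d dK b]])
      fix F :: "'g set" assume F: "finite F"
      have "(\<Sum>s\<in>F. nrm (C0 X) (d s)) = (\<Sum>s\<in>F \<inter> S. nrm (C0 X) (d s)) + (\<Sum>s\<in>F - S. nrm (C0 X) (d s))"
        by (rule sum.Int_Diff[OF F])
      also have "\<dots> \<le> (\<Sum>s\<in>S. nrm (C0 X) (d s)) + (\<Sum>s\<in>F - S. K * nrm (C0 X) (b s))"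
        using S d dK by (intro add_mono sum_mono2 sum_mono) auto
      also have "\<dots> \<le> real (card S) * \<delta> + K * \<epsilon>"
      proof (intro add_mono)
        show "(\<Sum>s\<in>S. nrm (C0 X) (d s)) \<le> real (card S) * \<delta>" using d\<delta> by (rule sum_bounded_above)
        show "(\<Sum>s\<in>F - S. K * nrm (C0 X) (b s)) \<le> K * \<epsilon>"
          unfolding sum_distrib_left[symmetric] using S(1) F by (intro mult_left_mono[OF S(3) K]) auto
      qed
      finally show "(\<Sum>s\<in>F. nrm (C0 X) (d s)) \<le> real (card S) * \<delta> + K * \<epsilon>" .
    qed
  qed
qed

end

locale F_rep = twisted_action X \<phi> u + nondeg_rep E "F_alg X \<phi> u" \<psi>
  for X :: "'x topology" and \<phi> :: "'g::group_add \<Rightarrow> 'x \<Rightarrow> 'x" and u and E :: "'e nspace" (structure) and \<psi>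
begin

text \<open>In a covariant representation this is \<pi>(a) v_s. The factor v_s has no meaning by
  itself here; \<open>act s k\<close> with a cutoff k approximates it.\<close>

definition act :: "'g \<Rightarrow> ('x \<Rightarrow> complex) \<Rightarrow> 'e \<Rightarrow> 'e" where
  "act s a = \<psi> (single s a)"

lemma act_closed [simp, intro]: "a \<in> carrier (C0 X) \<Longrightarrow> \<xi> \<in> carrier E \<Longrightarrow> act s a \<xi> \<in> carrier E"
  by (simp add: act_def single_F)

lemma act_nrm_le:
  assumes "a \<in> carrier (C0 X)" "\<xi> \<in> carrier E" "0 \<le> M" "\<And>x. x \<in> topspace X \<Longrightarrow> cmod (a x) \<le> M"
  shows "nrm E (act s a \<xi>) \<le> M * nrm E \<xi>"
  using rep_nrm_le[OF single_F(1)[OF assms(1)] assms(2), of s] single_F(2)[OF assms(1), of s]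
    mult_right_mono[OF C0_nrm_le_on[OF assms(1,3,4)] nrm_nonneg[OF assms(2)]]
  by (simp add: act_def)

lemma act_act:
  assumes "a \<in> carrier (C0 X)" "b \<in> carrier (C0 X)" "\<xi> \<in> carrier E"
  shows "act s a (act t b \<xi>) = act (s + t) (\<lambda>x. a x * alpha X \<phi> s b x * u s t x) \<xi>"
  using rep_mult[OF single_F(1)[OF assms(1)] single_F(1)[OF assms(2)] assms(3), of s t]
  by (simp add: act_def twisted_conv_single[OF assms(1)])

lemma act_0_left:
  assumes "a \<in> carrier (C0 X)" "b \<in> carrier (C0 X)" "\<xi> \<in> carrier E"
  shows "act 0 a (act t b \<xi>) = act t (\<lambda>x. a x * b x) \<xi>"
proof -
  have "a x * alpha X \<phi> 0 b x * u 0 t x = a x * b x" for x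
    using C0_outside[OF assms(1), of x] by (cases "x \<in> topspace X") auto
  then show ?thesis by (simp only: act_act[OF assms] add_0_left)
qed

lemma act_0_right:
  assumes "a \<in> carrier (C0 X)" "b \<in> carrier (C0 X)" "\<xi> \<in> carrier E"
  shows "act s a (act 0 b \<xi>) = act s (\<lambda>x. a x * alpha X \<phi> s b x) \<xi>"
proof -
  have "a x * alpha X \<phi> s b x * u s 0 x = a x * alpha X \<phi> s b x" for x
    using C0_outside[OF assms(1), of x] by (cases "x \<in> topspace X") auto
  then show ?thesis by (simp only: act_act[OF assms] add_0_right)
qed

lemma psi_sum:
  assumes "finite I" "\<And>i. i \<in> I \<Longrightarrow> f i \<in> carrier (F_alg X \<phi> u)" "\<xi> \<in> carrier E"
  shows "(\<lambda>s x. \<Sum>i\<in>I. f i s x) \<in> carrier (F_alg X \<phi> u) \<and> \<psi> (\<lambda>s x. \<Sum>i\<in>I. f i s x) \<xi> = finsum E (\<lambda>i. \<psi> (f i) \<xi>) I"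
  using assms(1,2)
proof (induction I rule: finite_induct)
  case empty
  have z: "single (0::'g) (\<lambda>_::'x. 0) = (\<lambda>_ _. 0)" by (auto simp: single_def)
  then have "(\<lambda>_ _. 0) \<in> carrier (F_alg X \<phi> u)" using single_F(1)[OF C0_zero, of 0] by simp
  then show ?case using rep_smult[of "\<lambda>_ _. 0" \<xi> 0] assms(3) by simp
next
  case (insert i I)
  have IH: "(\<lambda>s x. \<Sum>i\<in>I. f i s x) \<in> carrier (F_alg X \<phi> u)" "\<psi> (\<lambda>s x. \<Sum>i\<in>I. f i s x) \<xi> = finsum E (\<lambda>i. \<psi> (f i) \<xi>) I"
    using insert by auto
  show ?case
    using rep_plus[of "f i" "\<lambda>s x. \<Sum>i\<in>I. f i s x" \<xi>] F_add[OF _ IH(1), of "f i"] IH insert assms(3)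
    by (simp add: finsum_insert')
qed

lemma psi_diff:
  assumes "b \<in> carrier (F_alg X \<phi> u)" "c \<in> carrier (F_alg X \<phi> u)" "\<xi> \<in> carrier E"
  shows "nrm E (\<psi> b \<xi> \<ominus> \<psi> c \<xi>) \<le> nrm (F_alg X \<phi> u) (\<lambda>s x. b s x - c s x) * nrm E \<xi>"
proof -
  have "\<psi> (\<lambda>s x. b s x + (-1) * c s x) \<xi> = \<psi> b \<xi> \<oplus> (-1) \<odot> \<psi> c \<xi>"
    using rep_plus[OF assms(1) F_scale[OF assms(2), of "-1"] assms(3)] rep_smult[OF assms(2,3), of "-1"] by simp
  then have "\<psi> b \<xi> \<ominus> \<psi> c \<xi> = \<psi> (\<lambda>s x. b s x - c s x) \<xi>" using assms by (simp add: diff_eq)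
  then show ?thesis using rep_nrm_le[OF F_diff[OF assms(1,2)] assms(3)] by simp
qed

text \<open>The cutoff in front can be split off from each term in several ways: as
  \<open>act 0 k\<close> on the left for non-degeneracy, as \<open>act s k\<close> on the left when
  p = 1, and as \<open>act s k\<close> on the right when p = \<infinity>.\<close>

definition cut :: "('x \<Rightarrow> real) \<Rightarrow> 'g set \<Rightarrow> ('g \<Rightarrow> 'x \<Rightarrow> complex) \<Rightarrow> 'g \<Rightarrow> 'x \<Rightarrow> complex" where
  "cut k S b = (\<lambda>s x. \<Sum>s'\<in>S. single s' (\<lambda>x. of_real (k x) * b s' x) s x)"

lemma cut_apply: "finite S \<Longrightarrow> cut k S b s x = (if s \<in> S then of_real (k x) * b s x else 0)"
proof -
  assume S: "finite S"
  have "cut k S b s x = (\<Sum>s'\<in>S. if s' = s then of_real (k x) * b s x else 0)"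
    unfolding cut_def by (intro sum.cong) (auto simp: single_def)
  then show ?thesis using S by simp
qed

text \<open>The tail outside S and the errors on S, at most \<delta> for each of the
  \<open>card S\<close> coefficients, contribute \<epsilon>/2 each; 1 - k lies in [0, 1], so the
  domination constant is 1.\<close>

lemma cut_approx:
  assumes b: "b \<in> carrier (F_alg X \<phi> u)" and \<epsilon>: "0 < \<epsilon>"
  obtains S k where "finite S" "cutoff X k" "cut k S b \<in> carrier (F_alg X \<phi> u)"
    "\<And>\<xi>. \<xi> \<in> carrier E \<Longrightarrow> nrm E (\<psi> b \<xi> \<ominus> \<psi> (cut k S b) \<xi>) \<le> \<epsilon> * nrm E \<xi>"
    "\<And>\<xi>. \<xi> \<in> carrier E \<Longrightarrow> \<psi> (cut k S b) \<xi> = finsum E (\<lambda>s. act s (\<lambda>x. of_real (k x) * b s x) \<xi>) S"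
proof -
  obtain S where S: "finite S"
    "\<And>d K \<delta>. (\<And>s. d s \<in> carrier (C0 X)) \<Longrightarrow> 0 \<le> K \<Longrightarrow> (\<And>s. nrm (C0 X) (d s) \<le> K * nrm (C0 X) (b s)) \<Longrightarrow>
      (\<And>s. s \<in> S \<Longrightarrow> nrm (C0 X) (d s) \<le> \<delta>) \<Longrightarrow> nrm (F_alg X \<phi> u) d \<le> real (card S) * \<delta> + K * (\<epsilon> / 2)"
    using F_approx[OF b half_gt_zero[OF \<epsilon>]] by blast
  define \<delta> where "\<delta> = \<epsilon> / (2 * (1 + real (card S)))"
  have \<delta>: "0 < \<delta>" "real (card S) * \<delta> \<le> \<epsilon> / 2" using \<epsilon> by (auto simp: \<delta>_def field_simps)
  obtain k where k: "cutoff X k" "\<And>s x. s \<in> S \<Longrightarrow> cmod (b s x - of_real (k x) * b s x) \<le> \<delta>"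
    using cutoff_exists[of S b X \<delta>] S(1) F_C0[OF b] \<delta>(1) by blast
  have kC: "(\<lambda>x. complex_of_real (k x)) \<in> carrier (C0 X)" and k01: "0 \<le> k x" "k x \<le> 1" for x
    using k(1) by (auto simp: cutoff_def)
  have kb: "(\<lambda>x. of_real (k x) * b s x) \<in> carrier (C0 X)" for s using kC F_C0[OF b] by (rule C0_mult)
  have ap: "nrm (F_alg X \<phi> u) (\<lambda>s x. b s x - cut k S b s x) \<le> \<epsilon>"
  proof -
    have "nrm (F_alg X \<phi> u) (\<lambda>s x. b s x - cut k S b s x) \<le> real (card S) * \<delta> + 1 * (\<epsilon> / 2)"
    proof (rule S(2))
      fix s
      have "(\<lambda>x. b s x - (if s \<in> S then of_real (k x) * b s x else 0)) \<in> carrier (C0 X)"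
        using F_C0[OF b] kb by (cases "s \<in> S") (auto intro: C0_diff)
      then show c: "(\<lambda>x. b s x - cut k S b s x) \<in> carrier (C0 X)" by (simp add: cut_apply S)
      show "nrm (C0 X) (\<lambda>x. b s x - cut k S b s x) \<le> 1 * nrm (C0 X) (b s)"
      proof (rule C0_nrm_le)
        fix x
        have "b s x - of_real (k x) * b s x = of_real (1 - k x) * b s x" by (simp add: algebra_simps)
        then have "cmod (b s x - of_real (k x) * b s x) = \<bar>1 - k x\<bar> * cmod (b s x)"
          by (simp only: norm_mult norm_of_real)
        also have "\<dots> \<le> 1 * cmod (b s x)" using k01[of x] by (intro mult_right_mono) auto
        finally have "cmod (b s x - of_real (k x) * b s x) \<le> cmod (b s x)" by simp
        then have "cmod (b s x - cut k S b s x) \<le> cmod (b s x)" by (simp add: cut_apply S)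
        then show "cmod (b s x - cut k S b s x) \<le> 1 * nrm (C0 X) (b s)"
          using C0_le_nrm[OF F_C0[OF b], of s x] by linarith
      qed
      show "nrm (C0 X) (\<lambda>x. b s x - cut k S b s x) \<le> \<delta>" if "s \<in> S"
        using k(2) that by (intro C0_nrm_le) (simp add: cut_apply S)
    qed simp
    then show ?thesis using \<delta>(2) by linarith
  qed
  have c: "cut k S b \<in> carrier (F_alg X \<phi> u)"
    unfolding cut_def using psi_sum[OF S(1), of "\<lambda>s. single s (\<lambda>x. of_real (k x) * b s x)" \<zero>] kb single_F by blast
  show ?thesis
  proof (rule that[OF S(1) k(1) c])
    fix \<xi> assume \<xi>: "\<xi> \<in> carrier E"
    show "nrm E (\<psi> b \<xi> \<ominus> \<psi> (cut k S b) \<xi>) \<le> \<epsilon> * nrm E \<xi>"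
      using psi_diff[OF b c \<xi>] mult_right_mono[OF ap nrm_nonneg[OF \<xi>]] by linarith
    show "\<psi> (cut k S b) \<xi> = finsum E (\<lambda>s. act s (\<lambda>x. of_real (k x) * b s x) \<xi>) S"
      unfolding cut_def act_def using psi_sum[OF S(1), of "\<lambda>s. single s (\<lambda>x. of_real (k x) * b s x)" \<xi>] kb single_F \<xi> by blast
  qed
qed

text \<open>A vector \<psi> b \<eta> is close to \<psi> (cut k S b) \<eta>, and the latter is in the
  range of \<open>act 0 k\<close> because the cutoff stands in front of every term.\<close>

lemma act_0_nondegenerate: "nondegenerate_representation (C0 X) E (act 0)"
proof -
  have rep: "representation (C0 X) E (act 0)"
    unfolding representation_def
  proof (intro conjI ballI allI)
    fix a assume a: "a \<in> carrier (C0 X)"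
    show "bounded_operator E (act 0 a)" unfolding act_def by (intro rep_bounded single_F a)
    show "opnorm E (act 0 a) \<le> nrm (C0 X) a"
      unfolding act_def single_F(2)[OF a, of 0, symmetric] by (rule rep_opnorm[OF single_F(1)[OF a]])
    fix \<xi> assume \<xi>: "\<xi> \<in> carrier E"
    show "act 0 (c \<odot>\<^bsub>C0 X\<^esub> a) \<xi> = c \<odot> act 0 a \<xi>" for c
    proof -
      have e: "single 0 (c \<odot>\<^bsub>C0 X\<^esub> a) = c \<odot>\<^bsub>F_alg X \<phi> u\<^esub> single 0 a" by (auto simp: single_def)
      show ?thesis unfolding act_def e by (rule rep_smult[OF single_F(1)[OF a] \<xi>])
    qed
    fix b assume b: "b \<in> carrier (C0 X)"
    show "act 0 (a \<oplus>\<^bsub>C0 X\<^esub> b) \<xi> = act 0 a \<xi> \<oplus> act 0 b \<xi>"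
    proof -
      have e: "single 0 (a \<oplus>\<^bsub>C0 X\<^esub> b) = single 0 a \<oplus>\<^bsub>F_alg X \<phi> u\<^esub> single 0 b" by (auto simp: single_def)
      show ?thesis unfolding act_def e by (rule rep_plus[OF single_F(1)[OF a] single_F(1)[OF b] \<xi>])
    qed
    show "act 0 (a \<otimes>\<^bsub>C0 X\<^esub> b) \<xi> = act 0 a (act 0 b \<xi>)" using act_0_left[OF a b \<xi>] by simp
  qed
  have "metric.mtopology closure_of {act 0 a \<xi> |a \<xi>. a \<in> carrier (C0 X) \<and> \<xi> \<in> carrier E} = carrier E"
  proof (rule closure_eq_carrierI)
    fix \<xi> and \<epsilon> :: real assume \<xi>: "\<xi> \<in> carrier E" and \<epsilon>: "0 < \<epsilon>"
    obtain b \<eta> where b: "b \<in> carrier (F_alg X \<phi> u)" "\<eta> \<in> carrier E" "nrm E (\<xi> \<ominus> \<psi> b \<eta>) < \<epsilon> / 2"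
      using nondeg_approx[OF \<xi> half_gt_zero[OF \<epsilon>]] by blast
    define \<delta> where "\<delta> = \<epsilon> / (2 * (1 + nrm E \<eta>))"
    have n: "0 \<le> nrm E \<eta>" using b by simp
    have \<delta>: "0 < \<delta>" using \<epsilon> n by (simp add: \<delta>_def)
    obtain S k where S: "finite S" "cutoff X k" "cut k S b \<in> carrier (F_alg X \<phi> u)"
      and ap': "\<And>\<xi>. \<xi> \<in> carrier E \<Longrightarrow> nrm E (\<psi> b \<xi> \<ominus> \<psi> (cut k S b) \<xi>) \<le> \<delta> * nrm E \<xi>"
      and eq': "\<And>\<xi>. \<xi> \<in> carrier E \<Longrightarrow> \<psi> (cut k S b) \<xi> = finsum E (\<lambda>s. act s (\<lambda>x. of_real (k x) * b s x) \<xi>) S"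
      by (rule cut_approx[OF b(1) \<delta>]) (rule that)
    note ap = ap'[OF b(2)] and eq = eq'[OF b(2)]
    let ?k = "\<lambda>x. complex_of_real (k x)"
    have kC: "?k \<in> carrier (C0 X)" using S by (simp add: cutoff_def)
    let ?v = "finsum E (\<lambda>s. act s (b s) \<eta>) S"
    have v: "?v \<in> carrier E" using F_C0[OF b(1)] b(2) by (intro finsum_sub_closed) auto
    have "act 0 ?k ?v = finsum E (\<lambda>s. act 0 ?k (act s (b s) \<eta>)) S"
      unfolding act_def[of 0] using kC F_C0[OF b(1)] b(2) S(1) by (intro rep_finsum) (auto simp: single_F)
    also have "\<dots> = \<psi> (cut k S b) \<eta>"
      unfolding eq using kC F_C0[OF b(1)] b(2)
      by (intro M.finsum_cong') (auto simp: act_0_left intro!: act_closed C0_mult)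
    finally have e: "act 0 ?k ?v = \<psi> (cut k S b) \<eta>" .
    have "nrm E (\<xi> \<ominus> \<psi> (cut k S b) \<eta>) \<le> nrm E (\<xi> \<ominus> \<psi> b \<eta>) + nrm E (\<psi> b \<eta> \<ominus> \<psi> (cut k S b) \<eta>)"
      using \<xi> b S by (intro nrm_diff_triangle) auto
    also have "\<dots> < \<epsilon> / 2 + \<delta> * nrm E \<eta>" using b(3) ap by linarith
    also have "\<delta> * nrm E \<eta> \<le> \<epsilon> / 2" using \<epsilon> n by (simp add: \<delta>_def field_simps)
    finally have lt: "nrm E (\<xi> \<ominus> act 0 ?k ?v) < \<epsilon>" by (simp add: e)
    show "\<exists>\<zeta>\<in>{act 0 a \<xi> |a \<xi>. a \<in> carrier (C0 X) \<and> \<xi> \<in> carrier E}. nrm E (\<xi> \<ominus> \<zeta>) < \<epsilon>"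
      by (rule bexI[of _ "act 0 ?k ?v"], rule lt) (use kC v in blast)
  qed auto
  with rep show ?thesis by (simp add: nondegenerate_representation_def)
qed

lemma opnorm_le_of_approx:
  assumes b: "b \<in> carrier (F_alg X \<phi> u)" and C: "0 \<le> C"
    and le: "\<And>\<xi> \<epsilon>. \<xi> \<in> carrier E \<Longrightarrow> 0 < \<epsilon> \<Longrightarrow> nrm E (\<psi> b \<xi>) \<le> (C + \<epsilon>) * nrm E \<xi>"
  shows "opnorm E (\<psi> b) \<le> C"
proof (rule field_le_epsilon)
  fix \<epsilon> :: real assume "0 < \<epsilon>"
  then show "opnorm E (\<psi> b) \<le> C + \<epsilon>" using C le by (intro opnorm_leI) auto
qed

text \<open>For \<open>p = 1\<close> and \<open>p = \<infinity>\<close> only the columns, respectively the rows, of the matrix matter, and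
  these are already controlled by the covariance of \<open>act\<close>.\<close>

lemma psi_le_1_infinity:
  assumes b: "b \<in> carrier (F_alg X \<phi> u)" and p: "p = 1 \<or> p = \<infinity>" and sp: "space_for_exponent TYPE('m) p E"
    and mb: "matrix_bounded p C b"
  shows "opnorm E (\<psi> b) \<le> C"
proof (rule opnorm_le_of_approx[OF b])
  show C: "0 \<le> C" using mb by (simp add: matrix_bounded_def)
  fix \<xi> and \<epsilon> :: real assume \<xi>: "\<xi> \<in> carrier E" and \<epsilon>: "0 < \<epsilon>"
  obtain S k where S: "finite S" "cutoff X k" "cut k S b \<in> carrier (F_alg X \<phi> u)"
    and ap': "\<And>\<xi>. \<xi> \<in> carrier E \<Longrightarrow> nrm E (\<psi> b \<xi> \<ominus> \<psi> (cut k S b) \<xi>) \<le> \<epsilon> * nrm E \<xi>"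
    and eq': "\<And>\<xi>. \<xi> \<in> carrier E \<Longrightarrow> \<psi> (cut k S b) \<xi> = finsum E (\<lambda>s. act s (\<lambda>x. of_real (k x) * b s x) \<xi>) S"
    by (rule cut_approx[OF b \<epsilon>]) (rule that)
  note ap = ap'[OF \<xi>] and eq = eq'[OF \<xi>]
  let ?k = "\<lambda>x. complex_of_real (k x)"
  have kC: "?k \<in> carrier (C0 X)" and k1: "cmod (?k x) \<le> 1" for x using S by (auto simp: cutoff_def)
  have bC: "b s \<in> carrier (C0 X)" for s by (rule F_C0[OF b])
  note \<pi> = act_0_nondegenerate
  have main: "nrm E (\<psi> (cut k S b) \<xi>) \<le> C * nrm E \<xi>"
    using p
  proof
    \<comment> \<open>The column r = 0 has entries alpha (- s) (b s), up to phases. It bounds the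
      sum of the norms of their actions on \<xi>, and the contractions \<open>act s k\<close> carry
      these vectors to the summands of \<psi> (cut k S b) \<xi>.\<close>
    assume p: "p = 1"
    then have p1: "1 \<le> p" "p = ereal 1" by (simp_all add: one_ereal_def)
    have cl: "act 0 (alpha X \<phi> (- s) (b s)) \<xi> \<in> carrier E" for s using bC \<xi> by auto
    have "nrm E (\<psi> (cut k S b) \<xi>) \<le> (\<Sum>s\<in>S. nrm E (act s (\<lambda>x. ?k x * b s x) \<xi>))"
      unfolding eq using S(1) kC bC \<xi> by (intro nrm_finsum_le act_closed C0_mult)
    also have "\<dots> \<le> (\<Sum>s\<in>S. nrm E (act 0 (alpha X \<phi> (- s) (b s)) \<xi>))"
    proof (intro sum_mono)
      fix s
      have "(\<lambda>x. ?k x * alpha X \<phi> s (alpha X \<phi> (- s) (b s)) x) = (\<lambda>x. ?k x * b s x)"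
        using C0_outside[OF kC] by (auto simp: fun_eq_iff alpha_def)
      then have "act s (\<lambda>x. ?k x * b s x) \<xi> = act s ?k (act 0 (alpha X \<phi> (- s) (b s)) \<xi>)"
        using act_0_right[OF kC alpha_C0[OF bC] \<xi>, of s "- s" s] by simp
      then show "nrm E (act s (\<lambda>x. ?k x * b s x) \<xi>) \<le> nrm E (act 0 (alpha X \<phi> (- s) (b s)) \<xi>)"
        using act_nrm_le[OF kC cl[of s], of 1 s] k1 by simp
    qed
    also have "\<dots> = lpn p S (\<lambda>s. nrm E (finsum E (\<lambda>j::unit. act 0 (alpha X \<phi> (- s) (b s)) \<xi>) {()}))"
      using cl by (simp add: p1(2) lpn_real sum_nonneg)
    also have "\<dots> \<le> C * lpn p {()} (\<lambda>_::unit. nrm E \<xi>)"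
    proof (rule matrix_lemma[OF p1(1) sp \<pi> S(1) _ C])
      fix x and c :: "unit \<Rightarrow> complex" assume x: "x \<in> topspace X"
      have "lpn p S (\<lambda>s. cmod (\<Sum>j\<in>{()}. alpha X \<phi> (- s) (b s) x * c j)) = lpn p S (\<lambda>s. cmod (\<Sum>r\<in>{0}. mat b s r x * c ()))"
        using x by (intro lpn_cong) (simp add: mat_apply norm_mult u_norm)
      also have "\<dots> \<le> C * lpn p {0::'g} (\<lambda>r. cmod (c ()))" by (rule matrix_boundedD[OF mb x S(1)]) simp
      finally show "lpn p S (\<lambda>s. cmod (\<Sum>j\<in>{()}. alpha X \<phi> (- s) (b s) x * c j)) \<le> C * lpn p {()} (\<lambda>j. cmod (c j))"
        using p1 by simp
    qed (use bC \<xi> in auto)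
    finally show ?thesis using p1 \<xi> by simp
  next
    \<comment> \<open>Now the group part acts first: each \<open>act s k\<close> \<xi> has norm at
      most that of \<xi>, which is all that the sup norm asks for, and the row t = 0 is applied to
      this family.\<close>
    assume p: "p = \<infinity>"
    then have p1: "1 \<le> p" by simp
    have cl: "act s ?k \<xi> \<in> carrier E" for s using kC \<xi> by auto
    have "\<psi> (cut k S b) \<xi> = finsum E (\<lambda>s. act 0 (b s) (act s ?k \<xi>)) S"
      unfolding eq using kC bC \<xi> by (intro M.finsum_cong') (auto simp: act_0_left mult.commute intro!: act_closed C0_mult)
    then have "nrm E (\<psi> (cut k S b) \<xi>) = lpn p {()} (\<lambda>i::unit. nrm E (finsum E (\<lambda>s. act 0 (b s) (act s ?k \<xi>)) S))"
      using p1 bC cl by (simp add: finsum_sub_closed)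
    also have "\<dots> \<le> C * lpn p S (\<lambda>s. nrm E (act s ?k \<xi>))"
    proof (rule matrix_lemma[OF p1 sp \<pi> _ S(1) C])
      fix x and c :: "'g \<Rightarrow> complex" assume x: "x \<in> topspace X"
      \<comment> \<open>In row 0 the cocycle contributes one phase per column; it is absorbed into
        the vector without changing the norm.\<close>
      let ?d = "\<lambda>r. cnj (u (- r) r x) * c (- r)"
      have inj: "inj_on uminus S" by (simp add: inj_on_def)
      have "(\<Sum>r\<in>uminus ` S. mat b 0 r x * ?d r) = (\<Sum>s\<in>S. b s x * (u s (- s) x * cnj (u s (- s) x)) * c s)"
        using x inj by (subst sum.reindex) (auto simp: mat_apply mult_ac)
      also have "\<dots> = (\<Sum>s\<in>S. b s x * c s)" by (simp only: u_cnj[OF x] mult_1_right)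
      finally have e: "(\<Sum>r\<in>uminus ` S. mat b 0 r x * ?d r) = (\<Sum>s\<in>S. b s x * c s)" .
      have "lpn p {()} (\<lambda>i::unit. cmod (\<Sum>s\<in>S. b s x * c s)) = lpn p {0::'g} (\<lambda>t. cmod (\<Sum>r\<in>uminus ` S. mat b t r x * ?d r))"
        using p1 e by simp
      also have "\<dots> \<le> C * lpn p (uminus ` S) (\<lambda>r. cmod (?d r))" by (rule matrix_boundedD[OF mb x]) (use S(1) in auto)
      also have "lpn p (uminus ` S) (\<lambda>r. cmod (?d r)) = lpn p S (\<lambda>s. cmod (c s))"
        using inj x by (simp add: lpn_reindex norm_mult u_norm)
      finally show "lpn p {()} (\<lambda>i::unit. cmod (\<Sum>s\<in>S. b s x * c s)) \<le> C * lpn p S (\<lambda>s. cmod (c s))" .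
    qed (use bC cl in auto)
    also have "\<dots> \<le> C * nrm E \<xi>"
      using C S(1) \<xi> cl act_nrm_le[OF kC \<xi>, of 1] k1 by (intro mult_left_mono) (auto simp: p lpn_inf_le_iff)
    finally show ?thesis .
  qed
  have "nrm E (\<psi> b \<xi>) \<le> nrm E (\<psi> (cut k S b) \<xi>) + nrm E (\<psi> b \<xi> \<ominus> \<psi> (cut k S b) \<xi>)"
    using b S \<xi> by (intro nrm_le_diff) auto
  then show "nrm E (\<psi> b \<xi>) \<le> (C + \<epsilon>) * nrm E \<xi>" using main ap by (simp add: distrib_right)
qed

end

section \<open>Amenable actions\<close>

text \<open>For 0 < s \<le> 1 the power s is subadditive, hence Hoelder continuous with constant 1.
  It converts the l^1-estimate of amenability into an l^r-estimate for r-th roots.\<close>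

lemma abs_powr_diff_le:
  fixes a c s :: real
  assumes "0 \<le> a" "0 \<le> c" "0 < s" "s \<le> 1"
  shows "\<bar>a powr s - c powr s\<bar> \<le> \<bar>a - c\<bar> powr s"
proof -
  have sub: "(x + y) powr s \<le> x powr s + y powr s" if "0 \<le> x" "0 \<le> y" for x y
  proof (cases "x + y = 0")
    case False
    then have pos: "0 < x + y" using that by simp
    have le: "z / (x + y) \<le> (z / (x + y)) powr s" if "0 \<le> z" "z \<le> x + y" for z
    proof (cases "z = 0")
      case False
      then have "0 < z / (x + y)" "z / (x + y) \<le> 1" using that pos by auto
      then show ?thesis using powr_mono'[of s 1 "z / (x + y)"] assms that pos by simp
    qed simp
    have "1 = x / (x + y) + y / (x + y)" using pos by (simp add: add_divide_distrib[symmetric])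
    also have "\<dots> \<le> (x / (x + y)) powr s + (y / (x + y)) powr s" using that by (intro add_mono le) auto
    finally show ?thesis using pos that by (simp add: powr_divide add_divide_distrib[symmetric] le_divide_eq)
  qed (use that in \<open>simp add: add_nonneg_eq_0_iff\<close>)
  have mono: "x powr s - y powr s \<le> \<bar>x - y\<bar> powr s" if "0 \<le> x" "0 \<le> y" for x y
  proof (cases "y \<le> x")
    case True
    then show ?thesis using sub[of "x - y" y] that by simp
  next
    case False
    then have "x powr s \<le> y powr s" using that assms by (intro powr_mono2) auto
    then show ?thesis using powr_ge_zero[of "\<bar>x - y\<bar>" s] by linarith
  qed
  show ?thesis using mono[OF assms(1,2)] mono[OF assms(2,1)] by (simp add: abs_minus_commute abs_le_iff)
qed

context twisted_action
begin

text \<open>One member of the net serves finitely many s, one compact set and one tolerance.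
  Replacing t by - s + t puts the invariance estimate in the form in which it is met on the support
  T.\<close>

lemma amenable_function:
  assumes am: "amenable_action X \<phi>" and S: "finite S" and K: "compactin X K" and \<delta>: "0 < \<delta>"
  obtains f T where "\<And>t. f t \<in> Cc_pos X" "finite T" "\<And>t x. t \<notin> T \<Longrightarrow> f t x = 0"
    "\<And>x. x \<in> K \<Longrightarrow> \<bar>(\<Sum>t\<in>T. f t x) - 1\<bar> \<le> \<delta>"
    "\<And>s x. s \<in> S \<Longrightarrow> x \<in> K \<Longrightarrow> (\<Sum>t\<in>T. \<bar>f (- s + t) (\<phi> (- s) x) - f t x\<bar>) \<le> \<delta>"
proof -
  obtain \<F> :: "('g \<Rightarrow> 'x \<Rightarrow> real) filter" where F: "\<F> \<noteq> bot"
    "\<forall>\<^sub>F f in \<F>. (\<forall>t. f t \<in> Cc_pos X) \<and> finite {t. f t \<noteq> (\<lambda>_. 0)}"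
    "uniform_limit K (\<lambda>f x. \<Sum>\<^sub>\<infinity>t. f t x) (\<lambda>_. 1) \<F>"
    "\<And>s. uniform_limit K (\<lambda>f x. \<Sum>\<^sub>\<infinity>t. \<bar>alpha X \<phi> s (f t) x - f (s + t) x\<bar>) (\<lambda>_. 0) \<F>"
    using am K unfolding amenable_action_def by blast
  have "\<forall>\<^sub>F f in \<F>. \<forall>s\<in>S. \<forall>x\<in>K. dist (\<Sum>\<^sub>\<infinity>t. \<bar>alpha X \<phi> s (f t) x - f (s + t) x\<bar>) 0 < \<delta>"
    using S F(4) \<delta> by (intro eventually_ball_finite ballI uniform_limitD) auto
  with uniform_limitD[OF F(3) \<delta>] F(2)
  have "\<forall>\<^sub>F f in \<F>. (\<forall>t. f t \<in> Cc_pos X) \<and> finite {t. f t \<noteq> (\<lambda>_. 0)} \<and> (\<forall>x\<in>K. dist (\<Sum>\<^sub>\<infinity>t. f t x) 1 < \<delta>) \<and>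
      (\<forall>s\<in>S. \<forall>x\<in>K. dist (\<Sum>\<^sub>\<infinity>t. \<bar>alpha X \<phi> s (f t) x - f (s + t) x\<bar>) 0 < \<delta>)"
    by eventually_elim simp
  then obtain f where f: "\<And>t. f t \<in> Cc_pos X" "finite {t. f t \<noteq> (\<lambda>_. 0)}"
    "\<And>x. x \<in> K \<Longrightarrow> dist (\<Sum>\<^sub>\<infinity>t. f t x) 1 < \<delta>"
    "\<And>s x. s \<in> S \<Longrightarrow> x \<in> K \<Longrightarrow> dist (\<Sum>\<^sub>\<infinity>t. \<bar>alpha X \<phi> s (f t) x - f (s + t) x\<bar>) 0 < \<delta>"
    using eventually_happens'[OF F(1)] by blast
  define T where "T = {t. f t \<noteq> (\<lambda>_. 0)}"
  have T: "finite T" "\<And>t x. t \<notin> T \<Longrightarrow> f t x = 0" using f(2) by (auto simp: T_def)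
  show ?thesis
  proof (rule that[OF f(1) T])
    fix x assume x: "x \<in> K"
    have "(\<Sum>\<^sub>\<infinity>t. f t x) = (\<Sum>\<^sub>\<infinity>t\<in>T. f t x)" using T by (intro infsum_cong_neutral) auto
    then show "\<bar>(\<Sum>t\<in>T. f t x) - 1\<bar> \<le> \<delta>" using f(3)[OF x] T(1) by (simp add: dist_real_def)
    have xX: "x \<in> topspace X" using K x compactin_subset_topspace by blast
    fix s assume s: "s \<in> S"
    let ?d = "\<lambda>t. \<bar>alpha X \<phi> s (f t) x - f (s + t) x\<bar>"
    \<comment> \<open>Summability has to be secured, since \<open>infsum\<close> of a non-summable
      family is 0 by default and would not dominate its finite sums.\<close>
    have 1: "?d summable_on T \<union> (\<lambda>t. - s + t) ` T" by (rule summable_on_finite) (use T in simp)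
    have "?d summable_on UNIV \<longleftrightarrow> ?d summable_on T \<union> (\<lambda>t. - s + t) ` T"
    proof (rule summable_on_cong_neutral)
      fix t assume "t \<in> UNIV - (T \<union> (\<lambda>t. - s + t) ` T)"
      then have "t \<notin> T" "s + t \<notin> T" by (auto simp: image_iff add.assoc[symmetric] dest: bspec[of _ _ "s + t"])
      then show "?d t = 0" using xX T by simp
    qed auto
    then have sm: "?d summable_on UNIV" using 1 by simp
    have "(\<Sum>t\<in>T. \<bar>f (- s + t) (\<phi> (- s) x) - f t x\<bar>) = (\<Sum>t\<in>(\<lambda>t. - s + t) ` T. ?d t)"
      using xX by (subst sum.reindex) (auto simp: inj_on_def add.assoc[symmetric])
    also have "\<dots> \<le> infsum ?d UNIV" using sm T by (intro finite_sum_le_infsum) auto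
    also have "\<dots> \<le> \<delta>" using f(4)[OF s x] by (simp add: dist_real_def)
    finally show "(\<Sum>t\<in>T. \<bar>f (- s + t) (\<phi> (- s) x) - f t x\<bar>) \<le> \<delta>" .
  qed
qed

end

lemma continuous_powr_of_real:
  fixes f :: "'x \<Rightarrow> real"
  assumes f: "continuous_map X euclideanreal f" "\<And>x. 0 \<le> f x" and s: "0 < s"
  shows "continuous_map X euclidean (\<lambda>x. complex_of_real (f x powr s))"
proof -
  have "continuous_on UNIV (\<lambda>y. complex_of_real (max 0 y powr s))"
    using s by (intro continuous_on_of_real continuous_on_powr' continuous_intros) auto
  then have "continuous_map X euclidean ((\<lambda>y. complex_of_real (max 0 y powr s)) \<circ> f)"
    by (intro continuous_map_compose[OF f(1)]) simp
  then show ?thesis using f(2) by (simp add: o_def)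
qed

text \<open>(r - 1)/r is 1/q for the exponent q conjugate to r; this is Hoelder's inequality for the
  q-th roots of a family y with total mass at most D.\<close>

lemma powr_sum_holder:
  fixes y z :: "'t \<Rightarrow> real"
  assumes T: "finite T" and r: "1 < r" and y: "\<And>t. t \<in> T \<Longrightarrow> 0 \<le> y t" and D: "(\<Sum>t\<in>T. y t) \<le> D" "1 \<le> D"
  shows "(\<Sum>t\<in>T. y t powr ((r - 1) / r) * \<bar>z t\<bar>) \<le> D powr ((r - 1) / r) * lpn (ereal r) T z"
proof -
  have lp: "lpn (ereal r) T (\<lambda>t. y t powr (1 / r)) = (\<Sum>t\<in>T. y t) powr (1 / r)"
    using r y by (simp add: lpn_real powr_powr)
  have "(\<Sum>t\<in>T. y t powr ((r - 1) / r) * \<bar>z t\<bar>) = (\<Sum>t\<in>T. \<bar>y t powr (1 / r)\<bar> powr (r - 1) * \<bar>z t\<bar>)"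
    by (simp add: powr_powr)
  also have "\<dots> \<le> ((\<Sum>t\<in>T. y t) powr (1 / r)) powr (r - 1) * lpn (ereal r) T z"
    using lpn_holder[OF T, of r "\<lambda>t. y t powr (1 / r)" z] r unfolding lp by simp
  also have "\<dots> \<le> D powr ((r - 1) / r) * lpn (ereal r) T z"
    using D r y T by (intro mult_right_mono) (auto simp: powr_powr intro!: powr_mono2 sum_nonneg)
  finally show ?thesis .
qed

section \<open>Amenability: representations as approximate compressions of induced ones\<close>

context F_rep
begin

text \<open>Write v_t for the operator attached to t and q for the exponent conjugate to r.
  Formally, V \<xi> is the family v_t^{-1} f(t)^{1/r} \<xi>, and W sends a family \<zeta> to the sum
  of f(t)^{1/q} v_t \<zeta>(t). Then W Ind(b) V is \<psi> of the element with coefficients \<Theta>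
  s b s, where \<Theta> s is the sum over t of f(t)^{1/q} \<alpha>_s(f(s^{-1}t))^{1/r}. V and W have
  norm about 1, and amenability pushes \<Theta> s to 1 for the finitely many s that matter. Cutoffs
  make this meaningful without the v_t.\<close>

lemma psi_le_amenable:
  assumes am: "amenable_action X \<phi>" and b: "b \<in> carrier (F_alg X \<phi> u)" and r: "1 < r"
    and sp: "space_for_exponent TYPE('m) (ereal r) E" and mb: "matrix_bounded (ereal r) C b"
  shows "opnorm E (\<psi> b) \<le> C"
proof (rule opnorm_le_of_approx[OF b])
  let ?p = "ereal r" and ?N = "nrm (F_alg X \<phi> u) b"
  have p1: "1 \<le> ?p" and r0: "1 \<le> r" using r by simp_all
  show C: "0 \<le> C" using mb by (simp add: matrix_bounded_def)
  note \<pi> = act_0_nondegenerate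
  have bC: "b s \<in> carrier (C0 X)" for s by (rule F_C0[OF b])
  have N: "0 \<le> ?N" by (rule F_nrm_nonneg[OF b])
  have bN: "cmod (b s x) \<le> ?N" for s x
    using C0_le_nrm[OF bC, of s x] F_finite_sum_le[OF b, of "{s}"] by simp
  fix \<xi> and \<epsilon> :: real assume \<xi>: "\<xi> \<in> carrier E" and \<epsilon>: "0 < \<epsilon>"
  \<comment> \<open>b - B will be dominated by 3 |b|, so the part outside S costs
    \<epsilon>/4.\<close>
  have "0 < \<epsilon> / 12" using \<epsilon> by simp
  then obtain S where S: "finite S"
    "\<And>d K \<delta>. (\<And>s. d s \<in> carrier (C0 X)) \<Longrightarrow> 0 \<le> K \<Longrightarrow> (\<And>s. nrm (C0 X) (d s) \<le> K * nrm (C0 X) (b s)) \<Longrightarrow>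
      (\<And>s. s \<in> S \<Longrightarrow> nrm (C0 X) (d s) \<le> \<delta>) \<Longrightarrow> nrm (F_alg X \<phi> u) d \<le> real (card S) * \<delta> + K * (\<epsilon> / 12)"
    using F_approx[OF b, of "\<epsilon> / 12"] by blast
  define n where "n = real (card S)"
  have n: "0 \<le> n" by (simp add: n_def)
  \<comment> \<open>The factor 4 in the next line comes from k^2 k'^2, the cutoffs left over in B: 1
    - k^2 k'^2 \<le> 2 (1 - k) + 2 (1 - k').\<close>
  define \<delta>1 where "\<delta>1 = \<epsilon> / (16 * (1 + n))"
  have \<delta>1: "0 < \<delta>1" "n * (4 * \<delta>1) \<le> \<epsilon> / 4" using \<epsilon> n by (auto simp: \<delta>1_def field_simps)
  \<comment> \<open>An error 3\<theta> occurs twice, as D^2 - 1 in front of C and in the distance of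
    \<Theta> from 1, where it is multiplied by n ?N; together they get \<epsilon>/2.\<close>
  define \<theta> where "\<theta> = min 1 (\<epsilon> / (6 * (C + n * ?N + 1)))"
  have CN: "0 \<le> C + n * ?N" using C n N by simp
  then have \<theta>: "0 < \<theta>" "\<theta> \<le> 1" using \<epsilon> by (auto simp: \<theta>_def)
  have \<theta>\<epsilon>: "3 * \<theta> * (C + n * ?N) \<le> \<epsilon> / 2"
  proof -
    have "\<theta> * (6 * (C + n * ?N + 1)) \<le> \<epsilon>"
      using CN by (simp add: \<theta>_def min_le_iff_disj pos_le_divide_eq[symmetric])
    moreover have "\<theta> * (6 * (C + n * ?N)) \<le> \<theta> * (6 * (C + n * ?N + 1))" using \<theta> by (intro mult_left_mono) auto
    ultimately show ?thesis by (simp add: algebra_simps)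
  qed
  \<comment> \<open>Taking r-th roots turns an l^1-error \<delta> into an l^r-error \<delta>^(1/r),
    which is to be \<theta>.\<close>
  define \<delta> where "\<delta> = \<theta> powr r"
  have \<delta>: "0 < \<delta>" "\<delta> \<le> \<theta>" "\<delta> powr (1 / r) = \<theta>"
    using \<theta> r powr_mono'[of 1 r \<theta>] by (auto simp: \<delta>_def powr_powr)
  \<comment> \<open>A common bound for the mass of f on K and, because D \<ge> 1, for its powers
    with exponent at most 1.\<close>
  define D where "D = 1 + \<theta>"
  have D: "1 \<le> D" "D \<le> 2" using \<theta> by (auto simp: D_def)
  have Dp: "D powr s \<le> D" if "s \<le> 1" for s using powr_mono[OF that D(1)] D(1) by simp
  have fin0: "finite (S \<times> (UNIV :: bool set))" using S(1) by simp
  \<comment> \<open>Both b s and its translate enter the choice of k, so that k is near 1 at x and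
    at \<phi> (- s) x wherever b s x is not small.\<close>
  have fam: "(if v then b s else alpha X \<phi> (- s) (b s)) \<in> carrier (C0 X)" for s v using bC by auto
  obtain k where k: "cutoff X k"
    and ka: "\<And>i x. i \<in> S \<times> (UNIV :: bool set) \<Longrightarrow>
      cmod ((if snd i then b (fst i) else alpha X \<phi> (- fst i) (b (fst i))) x
        - of_real (k x) * (if snd i then b (fst i) else alpha X \<phi> (- fst i) (b (fst i))) x) \<le> \<delta>1"
    by (rule cutoff_exists[OF fin0, of "\<lambda>i. if snd i then b (fst i) else alpha X \<phi> (- fst i) (b (fst i))" X, OF fam \<delta>1(1)]) (rule that)
  let ?k = "\<lambda>x. complex_of_real (k x)"
  have kC: "?k \<in> carrier (C0 X)" and k01: "0 \<le> k x" "k x \<le> 1" for x using k by (auto simp: cutoff_def)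
  have norm_sub: "cmod (z - of_real (k x) * z) = (1 - k x) * cmod z" for z x
  proof -
    have "z - of_real (k x) * z = of_real (1 - k x) * z" by (simp add: algebra_simps)
    then show ?thesis using k01[of x] by (simp only: norm_mult norm_of_real)
  qed
  have k1: "(1 - k x) * cmod (b s x) \<le> \<delta>1" if "s \<in> S" for s x
    using ka[of "(s, True)" x] that by (simp add: norm_sub)
  have k2: "(1 - k (\<phi> (- s) x)) * cmod (b s x) \<le> \<delta>1" if "s \<in> S" "x \<in> topspace X" for s x
    using ka[of "(s, False)" "\<phi> (- s) x"] that by (simp add: norm_sub)
  obtain K where K: "compactin X K" "\<And>x. k x \<noteq> 0 \<Longrightarrow> x \<in> K" using k by (auto simp: cutoff_def)
  obtain f T where f: "\<And>t. f t \<in> Cc_pos X" and T: "finite T" and fT: "\<And>t x. t \<notin> T \<Longrightarrow> f t x = 0"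
    and f1: "\<And>x. x \<in> K \<Longrightarrow> \<bar>(\<Sum>t\<in>T. f t x) - 1\<bar> \<le> \<delta>"
    and f2: "\<And>s x. s \<in> S \<Longrightarrow> x \<in> K \<Longrightarrow> (\<Sum>t\<in>T. \<bar>f (- s + t) (\<phi> (- s) x) - f t x\<bar>) \<le> \<delta>"
    by (rule amenable_function[OF am S(1) K(1) \<delta>(1)]) (rule that)
  have f0: "0 \<le> f t x" and fc: "continuous_map X euclideanreal (f t)" for t x
    using f[of t] by (auto simp: Cc_pos_def)
  have fD: "(\<Sum>t\<in>T. f t x) \<le> D" if "x \<in> K" for x using f1[OF that] \<delta>(2) by (simp add: D_def)
  have fD1: "f t x \<le> D" if "x \<in> K" for t x
  proof (cases "t \<in> T")
    case True
    then have "f t x \<le> (\<Sum>t\<in>T. f t x)" using f0 T by (intro member_le_sum) auto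
    then show ?thesis using fD[OF that] by simp
  qed (use fT D in simp)
  define m where "m s t x = complex_of_real (f t x powr s) * ?k x" for s t x
  have mC: "m s t \<in> carrier (C0 X)" if s: "0 < s" "s \<le> 1" for s t
  proof (rule C0_dominated[OF kC, of _ D])
    show "continuous_map X euclidean (m s t)"
      unfolding m_def by (intro continuous_map_complex_mult continuous_powr_of_real fc f0 s C0_continuous[OF kC])
    show "cmod (m s t x) \<le> D * cmod (?k x)" for x
    proof (cases "k x = 0")
      case False
      have "f t x powr s \<le> D powr s" using fD1[OF K(2)[OF False]] f0 s by (intro powr_mono2) auto
      then have "f t x powr s \<le> D" using Dp[OF s(2)] by linarith
      then show ?thesis by (simp add: m_def norm_mult mult_right_mono)
    qed (simp add: m_def)
  qed
  define g where "g t = m (1 / r) t" for t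
  define h where "h t = m ((r - 1) / r) t" for t
  have gC: "g t \<in> carrier (C0 X)" and hC: "h t \<in> carrier (C0 X)" for t
    unfolding g_def h_def using r by (auto intro!: mC simp: divide_le_eq)
  \<comment> \<open>From v_{-t} v_t = u(-t, t) one gets v_t^{-1} = conj(u(-t, t)) v_{-t}; hence
    \<open>act (- t) (w t)\<close> stands for v_t^{-1} followed by nothing but preceded by
    multiplication with k.\<close>
  define w where "w t x = cnj (u (- t) t x) * alpha X \<phi> (- t) ?k x" for t x
  have wC: "w t \<in> carrier (C0 X)" for t
  proof -
    have "continuous_map X euclidean (\<lambda>x. cnj (u (- t) t x))"
      by (rule continuous_map_euclidean_compose[OF u_continuous]) (intro continuous_intros)
    then have "(\<lambda>x. alpha X \<phi> (- t) ?k x * cnj (u (- t) t x)) \<in> carrier (C0 X)"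
      using u_norm_le by (intro C0_mult_bounded[OF alpha_C0[OF kC]]) auto
    then show ?thesis by (simp add: w_def[abs_def] mult.commute)
  qed
  have w1: "cmod (w t x) \<le> 1" if "x \<in> topspace X" for t x
    using that k01 by (simp add: w_def norm_mult u_norm)
  define \<eta> where "\<eta> t = act (- t) (w t) (act 0 (g t) \<xi>)" for t
  define \<zeta> where "\<zeta> t = finsum E (\<lambda>r'. act 0 (mat b t r') (\<eta> r')) T" for t
  define Y where "Y = finsum E (\<lambda>t. act 0 (h t) (act t ?k (\<zeta> t))) T"
  have matC: "mat b t r' \<in> carrier (C0 X)" for t r' by (rule mat_C0[OF bC])
  have \<eta>: "\<eta> t \<in> carrier E" for t using wC gC \<xi> by (auto simp: \<eta>_def)
  have \<zeta>: "\<zeta> t \<in> carrier E" for t using matC \<eta> unfolding \<zeta>_def by (intro finsum_sub_closed) auto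
  have \<zeta>k: "act t ?k (\<zeta> t) \<in> carrier E" for t using kC \<zeta> by auto
  \<comment> \<open>The factors are estimated from the outside in: the row h by D, the cut-off
    translations by 1, the matrix of b by C, the operators with coefficient w by 1, and the column g
    by D.\<close>
  have "nrm E Y = lpn ?p {()} (\<lambda>i::unit. nrm E (finsum E (\<lambda>t. act 0 (h t) (act t ?k (\<zeta> t))) T))"
    using p1 hC \<zeta>k by (simp add: Y_def finsum_sub_closed)
  also have "\<dots> \<le> D * lpn ?p T (\<lambda>t. nrm E (act t ?k (\<zeta> t)))"
  proof (rule matrix_lemma[OF p1 sp \<pi> _ T])
    fix x and c :: "'g \<Rightarrow> complex" assume x: "x \<in> topspace X"
    have "cmod (\<Sum>t\<in>T. h t x * c t) \<le> D * lpn ?p T (\<lambda>t. cmod (c t))"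
    proof (cases "k x = 0")
      case True
      then have "(\<Sum>t\<in>T. h t x * c t) = 0" by (simp add: h_def m_def)
      then show ?thesis using D T by simp
    next
      case False
      have "cmod (\<Sum>t\<in>T. h t x * c t) \<le> (\<Sum>t\<in>T. f t x powr ((r - 1) / r) * \<bar>cmod (c t)\<bar>)"
      proof (rule sum_norm_le)
        fix t
        have "f t x powr ((r - 1) / r) * k x * cmod (c t) \<le> f t x powr ((r - 1) / r) * 1 * cmod (c t)"
          using k01 by (intro mult_right_mono mult_left_mono) auto
        then show "cmod (h t x * c t) \<le> f t x powr ((r - 1) / r) * \<bar>cmod (c t)\<bar>"
          using k01 by (simp add: h_def m_def norm_mult)
      qed
      also have "\<dots> \<le> D powr ((r - 1) / r) * lpn ?p T (\<lambda>t. cmod (c t))"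
        using f0 by (intro powr_sum_holder[OF T r _ fD[OF K(2)[OF False]] D(1)])
      also have "\<dots> \<le> D * lpn ?p T (\<lambda>t. cmod (c t))"
        using T r by (intro mult_right_mono Dp) (auto simp: divide_le_eq)
      finally show ?thesis .
    qed
    then show "lpn ?p {()} (\<lambda>i::unit. cmod (\<Sum>t\<in>T. h t x * c t)) \<le> D * lpn ?p T (\<lambda>t. cmod (c t))"
      using p1 by simp
  qed (use D hC \<zeta>k in auto)
  also have "lpn ?p T (\<lambda>t. nrm E (act t ?k (\<zeta> t))) \<le> lpn ?p T (\<lambda>t. nrm E (\<zeta> t))"
    using T p1 \<zeta>k \<zeta> act_nrm_le[OF kC \<zeta>, of 1] k01 by (intro lpn_mono) auto
  also have "lpn ?p T (\<lambda>t. nrm E (\<zeta> t)) \<le> C * lpn ?p T (\<lambda>t. nrm E (\<eta> t))"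
    unfolding \<zeta>_def by (rule matrix_lemma[OF p1 sp \<pi> T T C]) (use matC \<eta> matrix_boundedD[OF mb _ T T] in auto)
  also have "lpn ?p T (\<lambda>t. nrm E (\<eta> t)) \<le> lpn ?p T (\<lambda>t. nrm E (finsum E (\<lambda>j::unit. act 0 (g t) \<xi>) {()}))"
  proof (rule lpn_mono[OF T p1])
    fix t
    have "act 0 (g t) \<xi> \<in> carrier E" using gC \<xi> by auto
    then show "\<bar>nrm E (\<eta> t)\<bar> \<le> \<bar>nrm E (finsum E (\<lambda>j::unit. act 0 (g t) \<xi>) {()})\<bar>"
      using act_nrm_le[OF wC, of "act 0 (g t) \<xi>" 1] w1 \<eta>[of t] by (simp add: \<eta>_def)
  qed
  also have "lpn ?p T (\<lambda>t. nrm E (finsum E (\<lambda>j::unit. act 0 (g t) \<xi>) {()})) \<le> D * lpn ?p {()} (\<lambda>_::unit. nrm E \<xi>)"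
  proof (rule matrix_lemma[OF p1 sp \<pi> T])
    fix x and c :: "unit \<Rightarrow> complex" assume x: "x \<in> topspace X"
    have "lpn ?p T (\<lambda>t. cmod (g t x)) \<le> D"
    proof (cases "k x = 0")
      case True
      then have "lpn ?p T (\<lambda>t. cmod (g t x)) = 0" using T p1 by (intro lpn_zero) (simp_all add: g_def m_def)
      then show ?thesis using D by simp
    next
      case False
      have "(\<Sum>t\<in>T. \<bar>cmod (g t x)\<bar> powr r) \<le> (\<Sum>t\<in>T. f t x)"
      proof (rule sum_mono)
        fix t
        have "cmod (g t x) \<le> f t x powr (1 / r) * 1"
          using k01[of x] by (simp add: g_def m_def norm_mult mult_left_le)
        then have "\<bar>cmod (g t x)\<bar> powr r \<le> (f t x powr (1 / r)) powr r" using r by (intro powr_mono2) auto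
        then show "\<bar>cmod (g t x)\<bar> powr r \<le> f t x" using r f0 by (simp add: powr_powr)
      qed
      also have "\<dots> \<le> D" by (rule fD[OF K(2)[OF False]])
      also have "D \<le> D powr r" using powr_mono[OF r0 D(1)] D(1) by simp
      finally show ?thesis using r0 D by (subst lpn_real_le_iff) auto
    qed
    then have "cmod (c ()) * lpn ?p T (\<lambda>t. cmod (g t x)) \<le> cmod (c ()) * D" by (intro mult_left_mono) auto
    moreover have "lpn ?p T (\<lambda>t. cmod (c ()) * cmod (g t x)) = \<bar>cmod (c ())\<bar> * lpn ?p T (\<lambda>t. cmod (g t x))"
      by (rule lpn_scale[OF T p1])
    ultimately show "lpn ?p T (\<lambda>t. cmod (\<Sum>j\<in>{()}. g t x * c j)) \<le> D * lpn ?p {()} (\<lambda>j. cmod (c j))"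
      using p1 by (simp add: norm_mult mult.commute)
  qed (use D gC \<xi> in auto)
  finally have nY: "nrm E Y \<le> D * (C * (D * nrm E \<xi>))"
    using D C p1 \<xi> by (simp add: mult_left_mono)
  \<comment> \<open>The coefficient at t - r' of the product of all factors. \<open>h\<close> and
    \<open>g\<close> contain a cutoff each, so both cutoffs appear squared.\<close>
  define a where "a t r' x = b (t - r') x * (?k x * h t x) * alpha X \<phi> (t - r') (\<lambda>x. ?k x * g r' x) x" for t r' x
  have aC: "a t r' \<in> carrier (C0 X)" for t r'
    unfolding a_def[abs_def] by (intro C0_mult bC kC hC alpha_C0 gC)
  have act_a: "act 0 (h t) (act t ?k (act 0 (mat b t r') (\<eta> r'))) = act (t - r') (a t r') \<xi>" for t r'
  proof -
    have 1: "\<eta> r' = act (- r') (\<lambda>x. w r' x * alpha X \<phi> (- r') (g r') x) \<xi>"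
      unfolding \<eta>_def by (rule act_0_right[OF wC gC \<xi>])
    have wg: "(\<lambda>x. w r' x * alpha X \<phi> (- r') (g r') x) \<in> carrier (C0 X)" by (intro C0_mult wC alpha_C0 gC)
    let ?v = "\<lambda>x. mat b t r' x * (w r' x * alpha X \<phi> (- r') (g r') x)"
    have 2: "act 0 (mat b t r') (\<eta> r') = act (- r') ?v \<xi>" unfolding 1 by (rule act_0_left[OF matC wg \<xi>])
    have vC: "?v \<in> carrier (C0 X)" by (rule C0_mult[OF matC wg])
    have kvC: "(\<lambda>x. ?k x * alpha X \<phi> t ?v x * u t (- r') x) \<in> carrier (C0 X)"
      by (intro C0_mult_u C0_mult kC alpha_C0 vC)
    have "act 0 (h t) (act t ?k (act 0 (mat b t r') (\<eta> r'))) = act (t + - r') (\<lambda>x. h t x * (?k x * alpha X \<phi> t ?v x * u t (- r') x)) \<xi>"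
      unfolding 2 act_act[OF kC vC \<xi>] by (rule act_0_left[OF hC kvC \<xi>])
    also have "(\<lambda>x. h t x * (?k x * alpha X \<phi> t ?v x * u t (- r') x)) = a t r'"
    proof
      fix x show "h t x * (?k x * alpha X \<phi> t ?v x * u t (- r') x) = a t r' x"
      proof (cases "x \<in> topspace X")
        case False
        then show ?thesis using C0_outside[OF hC] by (simp add: a_def)
      next
        case True
        then have x: "\<phi> (- t) x \<in> topspace X" by simp
        \<comment> \<open>The cocycle identity for (t, - r', r') groups all phases into conjugate
          pairs, which \<open>u_cnj\<close> removes.\<close>
        have "u (- r') r' (\<phi> (- t) x) * u t (- r' + r') x = u t (- r') x * u (t + - r') r' x"
          by (rule u_cocycle[OF True])
        then have uu: "cnj (u (- r') r' (\<phi> (- t) x)) = cnj (u t (- r') x) * cnj (u (t - r') r' x)" using True by simp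
        have e: "\<phi> (- (- r')) (\<phi> (- t) x) = \<phi> (- (t - r')) x" using True by simp
        have "h t x * (?k x * alpha X \<phi> t ?v x * u t (- r') x)
            = h t x * (?k x * (b (t - r') x * u (t - r') r' x * (cnj (u (- r') r' (\<phi> (- t) x)) * ?k (\<phi> (- (t - r')) x)
              * g r' (\<phi> (- (t - r')) x))) * u t (- r') x)"
          using True x by (simp add: mat_apply w_def e)
        also have "\<dots> = h t x * (?k x * (b (t - r') x * ?k (\<phi> (- (t - r')) x) * g r' (\<phi> (- (t - r')) x)))
            * (u t (- r') x * cnj (u t (- r') x)) * (u (t - r') r' x * cnj (u (t - r') r' x))"
          unfolding uu by (simp add: mult_ac)
        also have "\<dots> = a t r' x" unfolding u_cnj[OF True] using True by (simp add: a_def mult_ac)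
        finally show ?thesis .
      qed
    qed
    finally show ?thesis by simp
  qed
  \<comment> \<open>\<open>\<psi> B\<close> is a compression of the matrix \<open>mat b\<close>: it is preceded by \<open>\<xi> \<mapsto> (\<eta> r')\<close> and followed
    by \<open>(\<zeta> t) \<mapsto> \<Sum>t. act 0 (h t) (act t k (\<zeta> t))\<close>, both almost contractive.  The factor
    \<open>cnj (u (- t) t x)\<close> in \<open>w\<close> cancels the cocycle, and amenability makes \<open>B\<close> close to \<open>b\<close>.\<close>
  define B where "B = (\<lambda>s x. \<Sum>t\<in>T. \<Sum>r'\<in>T. single (t - r') (a t r') s x)"
  have Bin: "(\<lambda>s x. \<Sum>r'\<in>T. single (t - r') (a t r') s x) \<in> carrier (F_alg X \<phi> u) \<and>
      \<psi> (\<lambda>s x. \<Sum>r'\<in>T. single (t - r') (a t r') s x) \<xi> = finsum E (\<lambda>r'. act (t - r') (a t r') \<xi>) T" for t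
    unfolding act_def by (rule psi_sum[OF T _ \<xi>]) (rule single_F(1)[OF aC])
  have BF: "B \<in> carrier (F_alg X \<phi> u)" and B\<psi>: "\<psi> B \<xi> = finsum E (\<lambda>t. finsum E (\<lambda>r'. act (t - r') (a t r') \<xi>) T) T"
    unfolding B_def using psi_sum[OF T, of "\<lambda>t s x. \<Sum>r'\<in>T. single (t - r') (a t r') s x" \<xi>] Bin \<xi> by auto
  have "act 0 (h t) (act t ?k (\<zeta> t)) = finsum E (\<lambda>r'. act (t - r') (a t r') \<xi>) T" for t
  proof -
    have cl: "act 0 (mat b t r') (\<eta> r') \<in> carrier E" for r' using matC \<eta> by auto
    have "act t ?k (\<zeta> t) = finsum E (\<lambda>r'. act t ?k (act 0 (mat b t r') (\<eta> r'))) T"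
      unfolding \<zeta>_def act_def[of t] by (rule rep_finsum[OF single_F(1)[OF kC] T cl])
    then have "act 0 (h t) (act t ?k (\<zeta> t)) = finsum E (\<lambda>r'. act 0 (h t) (act t ?k (act 0 (mat b t r') (\<eta> r')))) T"
      unfolding act_def[of 0 "h t"] using rep_finsum[OF single_F(1)[OF hC] T, of "\<lambda>r'. act t ?k (act 0 (mat b t r') (\<eta> r'))"] cl kC by auto
    then show ?thesis by (simp add: act_a)
  qed
  then have YB: "Y = \<psi> B \<xi>" by (simp add: Y_def B\<psi>)
  define \<Theta> where "\<Theta> s x = (\<Sum>t\<in>T. f t x powr ((r - 1) / r) * f (- s + t) (\<phi> (- s) x) powr (1 / r))" for s x
  have Bx: "B s x = b s x * of_real ((k x)\<^sup>2 * (k (\<phi> (- s) x))\<^sup>2 * \<Theta> s x)" if x: "x \<in> topspace X" for s x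
  proof -
    have "B s x = (\<Sum>t\<in>T. a t (- s + t) x)"
      unfolding B_def
    proof (rule sum.cong[OF refl])
      fix t assume "t \<in> T"
      have "(\<Sum>r'\<in>T. single (t - r') (a t r') s x) = (\<Sum>r'\<in>T. if r' = - s + t then a t (- s + t) x else 0)"
      proof (rule sum.cong[OF refl])
        fix r'
        have "s = t - r' \<longleftrightarrow> r' = - s + t"
        proof
          assume "s = t - r'" then show "r' = - s + t" by simp
        qed simp
        then show "single (t - r') (a t r') s x = (if r' = - s + t then a t (- s + t) x else 0)"
          by (auto simp: single_def)
      qed
      \<comment> \<open>If - s + t is not in T, the sum is empty of nonzero terms, and the entry on
        the right is 0 as well because f vanishes there.\<close>
      also have "\<dots> = a t (- s + t) x"
        using T fT r x by (cases "- s + t \<in> T") (auto simp: a_def g_def m_def)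
      finally show "(\<Sum>r'\<in>T. single (t - r') (a t r') s x) = a t (- s + t) x" .
    qed
    also have "\<dots> = b s x * of_real ((k x)\<^sup>2 * (k (\<phi> (- s) x))\<^sup>2 * \<Theta> s x)"
      using x by (simp add: a_def g_def h_def m_def \<Theta>_def sum_distrib_left power2_eq_square mult_ac)
    finally show ?thesis .
  qed
  have \<Theta>0: "0 \<le> \<Theta> s x" for s x unfolding \<Theta>_def by (intro sum_nonneg) auto
  \<comment> \<open>Hoelder with both masses at most D gives D^(1/q) D^(1/r) = D. The translated
    family has no more mass than f, which vanishes off T.\<close>
  have \<Theta>D: "\<Theta> s x \<le> D" if x: "x \<in> K" "\<phi> (- s) x \<in> K" for s x
  proof -
    have "(\<Sum>t\<in>T. f (- s + t) (\<phi> (- s) x)) = (\<Sum>t\<in>(\<lambda>t. - s + t) ` T. f t (\<phi> (- s) x))"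
      by (subst sum.reindex) (auto simp: inj_on_def)
    also have "\<dots> \<le> (\<Sum>t\<in>T \<union> (\<lambda>t. - s + t) ` T. f t (\<phi> (- s) x))" using T f0 by (intro sum_mono2) auto
    also have "\<dots> = (\<Sum>t\<in>T. f t (\<phi> (- s) x))" using T fT by (intro sum.mono_neutral_right) auto
    also have "\<dots> \<le> D" by (rule fD[OF x(2)])
    finally have D2: "(\<Sum>t\<in>T. f (- s + t) (\<phi> (- s) x)) \<le> D" .
    have "\<Theta> s x = (\<Sum>t\<in>T. f t x powr ((r - 1) / r) * \<bar>f (- s + t) (\<phi> (- s) x) powr (1 / r)\<bar>)" by (simp add: \<Theta>_def)
    also have "\<dots> \<le> D powr ((r - 1) / r) * lpn ?p T (\<lambda>t. f (- s + t) (\<phi> (- s) x) powr (1 / r))"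
      by (rule powr_sum_holder[OF T r f0 fD[OF x(1)] D(1)])
    also have "lpn ?p T (\<lambda>t. f (- s + t) (\<phi> (- s) x) powr (1 / r)) = (\<Sum>t\<in>T. f (- s + t) (\<phi> (- s) x)) powr (1 / r)"
      using r f0 by (simp add: lpn_real powr_powr)
    also have "\<dots> \<le> D powr (1 / r)" using D2 r f0 by (intro powr_mono2) (auto intro: sum_nonneg)
    also have "D powr ((r - 1) / r) * D powr (1 / r) = D"
      using D r by (simp add: powr_add[symmetric] add_divide_distrib[symmetric])
    finally show ?thesis using D by (simp add: mult_left_mono)
  qed
  \<comment> \<open>With the translate of f replaced by f itself, \<Theta> would be the mass of f,
    which is within \<delta> \<le> \<theta> of 1. The replacement costs D \<theta> \<le>
    2\<theta>.\<close>
  have \<Theta>1: "\<bar>\<Theta> s x - 1\<bar> \<le> 3 * \<theta>" if s: "s \<in> S" and x: "x \<in> K" for s x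
  proof -
    have split: "f t x powr ((r - 1) / r) * f t x powr (1 / r) = f t x" for t
      using r f0[of t x] by (cases "f t x = 0") (simp_all add: powr_add[symmetric] add_divide_distrib[symmetric])
    have "\<Theta> s x - (\<Sum>t\<in>T. f t x) = (\<Sum>t\<in>T. f t x powr ((r - 1) / r) * (f (- s + t) (\<phi> (- s) x) powr (1 / r) - f t x powr (1 / r)))"
      by (simp add: \<Theta>_def sum_subtractf right_diff_distrib split)
    then have "\<bar>\<Theta> s x - (\<Sum>t\<in>T. f t x)\<bar>
        \<le> (\<Sum>t\<in>T. \<bar>f t x powr ((r - 1) / r) * (f (- s + t) (\<phi> (- s) x) powr (1 / r) - f t x powr (1 / r))\<bar>)"
      by (simp only: sum_abs)
    also have "\<dots> = (\<Sum>t\<in>T. f t x powr ((r - 1) / r) * \<bar>f (- s + t) (\<phi> (- s) x) powr (1 / r) - f t x powr (1 / r)\<bar>)"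
      by (simp add: abs_mult)
    also have "\<dots> \<le> D powr ((r - 1) / r) * lpn ?p T (\<lambda>t. f (- s + t) (\<phi> (- s) x) powr (1 / r) - f t x powr (1 / r))"
      by (rule powr_sum_holder[OF T r f0 fD[OF x] D(1)])
    also have "\<dots> \<le> D * \<theta>"
    proof (intro mult_mono Dp)
      have "(\<Sum>t\<in>T. \<bar>f (- s + t) (\<phi> (- s) x) powr (1 / r) - f t x powr (1 / r)\<bar> powr r)
          \<le> (\<Sum>t\<in>T. \<bar>f (- s + t) (\<phi> (- s) x) - f t x\<bar>)"
      proof (rule sum_mono)
        fix t
        have "\<bar>f (- s + t) (\<phi> (- s) x) powr (1 / r) - f t x powr (1 / r)\<bar> powr r \<le> (\<bar>f (- s + t) (\<phi> (- s) x) - f t x\<bar> powr (1 / r)) powr r"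
          using r f0 by (intro powr_mono2 abs_powr_diff_le) auto
        then show "\<bar>f (- s + t) (\<phi> (- s) x) powr (1 / r) - f t x powr (1 / r)\<bar> powr r \<le> \<bar>f (- s + t) (\<phi> (- s) x) - f t x\<bar>"
          using r by (simp add: powr_powr)
      qed
      also have "\<dots> \<le> \<delta>" by (rule f2[OF s x])
      also have "\<delta> = \<theta> powr r" by (simp add: \<delta>_def)
      finally show "lpn ?p T (\<lambda>t. f (- s + t) (\<phi> (- s) x) powr (1 / r) - f t x powr (1 / r)) \<le> \<theta>"
        using r0 \<theta> by (subst lpn_real_le_iff) auto
    qed (use D T r in \<open>auto simp: divide_le_eq\<close>)
    also have "D * \<theta> \<le> 2 * \<theta>" using D \<theta> by (intro mult_right_mono) auto
    finally show ?thesis using f1[OF x] \<delta>(2) by linarith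
  qed
  \<comment> \<open>\<open>F_approx\<close> asks for two estimates: domination by 3 |b| for all s,
    which handles the tail, and smallness for s in S.\<close>
  have est: "cmod (b s x - B s x) \<le> 3 * cmod (b s x)"
    and est': "s \<in> S \<Longrightarrow> cmod (b s x - B s x) \<le> 4 * \<delta>1 + ?N * (3 * \<theta>)" if x: "x \<in> topspace X" for s x
  proof -
    define \<kappa> where "\<kappa> = (k x)\<^sup>2 * (k (\<phi> (- s) x))\<^sup>2"
    have \<kappa>: "0 \<le> \<kappa>" "\<kappa> \<le> 1" using k01[of x] k01[of "\<phi> (- s) x"] by (auto simp: \<kappa>_def power_le_one mult_le_one)
    have "b s x - B s x = b s x * of_real (1 - \<kappa> * \<Theta> s x)" using x by (simp add: Bx \<kappa>_def right_diff_distrib)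
    then have n: "cmod (b s x - B s x) = cmod (b s x) * \<bar>1 - \<kappa> * \<Theta> s x\<bar>" by (simp only: norm_mult norm_of_real)
    have "\<kappa> * \<Theta> s x \<le> 2"
    proof (cases "\<kappa> = 0")
      case False
      then have "x \<in> K" "\<phi> (- s) x \<in> K" using K(2) by (auto simp: \<kappa>_def)
      then have "\<Theta> s x \<le> 2" using \<Theta>D[of x s] D by simp
      then have "\<kappa> * \<Theta> s x \<le> 1 * 2" using \<kappa> \<Theta>0 by (intro mult_mono) auto
      then show ?thesis by simp
    qed simp
    moreover have "0 \<le> \<kappa> * \<Theta> s x" using \<kappa> \<Theta>0 by simp
    ultimately have "\<bar>1 - \<kappa> * \<Theta> s x\<bar> \<le> 3" by simp
    then have "cmod (b s x) * \<bar>1 - \<kappa> * \<Theta> s x\<bar> \<le> cmod (b s x) * 3" by (rule mult_left_mono) simp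
    then show "cmod (b s x - B s x) \<le> 3 * cmod (b s x)" using n by simp
    assume s: "s \<in> S"
    \<comment> \<open>Add (1 - c)^2, (1 - d)^2 and (1 - c^2)(1 - d^2), all nonnegative; the sum is
      right side minus left side.\<close>
    have two: "1 - c\<^sup>2 * d\<^sup>2 \<le> 2 * (1 - c) + 2 * (1 - d)" if "0 \<le> c" "c \<le> 1" "0 \<le> d" "d \<le> 1" for c d :: real
    proof -
      have "0 \<le> (1 - c)\<^sup>2" "0 \<le> (1 - d)\<^sup>2" "0 \<le> (1 - c\<^sup>2) * (1 - d\<^sup>2)" using that by (simp_all add: power_le_one)
      then show ?thesis by (simp add: power2_eq_square algebra_simps)
    qed
    have "\<bar>1 - \<kappa> * \<Theta> s x\<bar> \<le> (1 - \<kappa>) + \<kappa> * \<bar>\<Theta> s x - 1\<bar>"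
    proof -
      have "\<kappa> * \<Theta> s x - \<kappa> = \<kappa> * (\<Theta> s x - 1)" by (simp add: right_diff_distrib)
      then have "\<kappa> * \<bar>\<Theta> s x - 1\<bar> = \<bar>\<kappa> * \<Theta> s x - \<kappa>\<bar>" using \<kappa> by (simp only: abs_mult abs_of_nonneg)
      then show ?thesis using \<kappa> by linarith
    qed
    also have "\<kappa> * \<bar>\<Theta> s x - 1\<bar> \<le> 3 * \<theta>"
    proof (cases "\<kappa> = 0")
      case False
      then have "x \<in> K" using K(2) by (auto simp: \<kappa>_def)
      then have "\<kappa> * \<bar>\<Theta> s x - 1\<bar> \<le> 1 * (3 * \<theta>)" using \<kappa> \<Theta>1[OF s] by (intro mult_mono) auto
      then show ?thesis by simp
    qed (use \<theta> in simp)
    also have "1 - \<kappa> \<le> 2 * (1 - k x) + 2 * (1 - k (\<phi> (- s) x))" unfolding \<kappa>_def using k01 by (intro two)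
    finally have "\<bar>1 - \<kappa> * \<Theta> s x\<bar> \<le> 2 * (1 - k x) + 2 * (1 - k (\<phi> (- s) x)) + 3 * \<theta>" by simp
    then have "cmod (b s x) * \<bar>1 - \<kappa> * \<Theta> s x\<bar> \<le> cmod (b s x) * (2 * (1 - k x) + 2 * (1 - k (\<phi> (- s) x)) + 3 * \<theta>)"
      by (rule mult_left_mono) simp
    also have "\<dots> = 2 * ((1 - k x) * cmod (b s x)) + 2 * ((1 - k (\<phi> (- s) x)) * cmod (b s x)) + cmod (b s x) * (3 * \<theta>)"
      by (simp add: algebra_simps)
    also have "\<dots> \<le> 2 * \<delta>1 + 2 * \<delta>1 + ?N * (3 * \<theta>)"
      using k1[OF s] k2[OF s x] bN \<theta> by (intro add_mono mult_left_mono mult_right_mono) auto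
    finally show "cmod (b s x - B s x) \<le> 4 * \<delta>1 + ?N * (3 * \<theta>)" using n by simp
  qed
  have dC: "(\<lambda>x. b s x - B s x) \<in> carrier (C0 X)" for s using bC F_C0[OF BF] by (rule C0_diff)
  have "nrm (F_alg X \<phi> u) (\<lambda>s x. b s x - B s x) \<le> n * (4 * \<delta>1 + ?N * (3 * \<theta>)) + 3 * (\<epsilon> / 12)"
    unfolding n_def
  proof (rule S(2)[OF dC])
    show "nrm (C0 X) (\<lambda>x. b s x - B s x) \<le> 3 * nrm (C0 X) (b s)" for s
    proof (rule C0_nrm_le_on[OF dC])
      show "0 \<le> 3 * nrm (C0 X) (b s)" using bC by simp
      fix x assume "x \<in> topspace X"
      then show "cmod (b s x - B s x) \<le> 3 * nrm (C0 X) (b s)"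
        using est[of x s] C0_le_nrm[OF bC, of s x] by linarith
    qed
    show "nrm (C0 X) (\<lambda>x. b s x - B s x) \<le> 4 * \<delta>1 + ?N * (3 * \<theta>)" if "s \<in> S" for s
    proof (rule C0_nrm_le_on[OF dC _ est'[OF _ that]])
      show "0 \<le> 4 * \<delta>1 + ?N * (3 * \<theta>)" using \<delta>1 N \<theta> by simp
    qed
  qed simp
  moreover have "n * (4 * \<delta>1 + ?N * (3 * \<theta>)) = n * (4 * \<delta>1) + 3 * \<theta> * (n * ?N)" by (simp add: algebra_simps)
  ultimately have nd: "nrm (F_alg X \<phi> u) (\<lambda>s x. b s x - B s x) \<le> \<epsilon> / 4 + 3 * \<theta> * (n * ?N) + \<epsilon> / 4"
    using \<delta>1(2) by linarith
  have "D * D \<le> 1 + 3 * \<theta>" using \<theta> mult_right_mono[of \<theta> 1 \<theta>] by (simp add: D_def algebra_simps)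
  then have "D * D * C \<le> (1 + 3 * \<theta>) * C" using C by (rule mult_right_mono)
  then have DC: "D * D * C \<le> C + 3 * \<theta> * C" by (simp add: distrib_right)
  have "nrm E (\<psi> b \<xi>) \<le> nrm E (\<psi> B \<xi>) + nrm E (\<psi> b \<xi> \<ominus> \<psi> B \<xi>)" using b BF \<xi> by (intro nrm_le_diff) auto
  also have "nrm E (\<psi> B \<xi>) \<le> D * D * C * nrm E \<xi>" using nY unfolding YB by (simp add: mult_ac)
  also have "nrm E (\<psi> b \<xi> \<ominus> \<psi> B \<xi>) \<le> (\<epsilon> / 4 + 3 * \<theta> * (n * ?N) + \<epsilon> / 4) * nrm E \<xi>"
    using psi_diff[OF b BF \<xi>] mult_right_mono[OF nd nrm_nonneg[OF \<xi>]] by linarith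
  also have "D * D * C * nrm E \<xi> + (\<epsilon> / 4 + 3 * \<theta> * (n * ?N) + \<epsilon> / 4) * nrm E \<xi>
      = (D * D * C + (\<epsilon> / 4 + 3 * \<theta> * (n * ?N) + \<epsilon> / 4)) * nrm E \<xi>" by (simp add: distrib_right)
  also have "\<dots> \<le> (C + \<epsilon>) * nrm E \<xi>"
    using DC \<theta>\<epsilon> \<xi> by (intro mult_right_mono) (simp_all add: distrib_left)
  finally show "nrm E (\<psi> b \<xi>) \<le> (C + \<epsilon>) * nrm E \<xi>" by simp
qed

end

section \<open>Representations on orbits\<close>

text \<open>For p = \<infinity> J is the set where |\<xi>| \<ge> \<epsilon>, finite because the
  space is c_0; otherwise it comes from the tail of the series.\<close>

lemma lp_finite_approx:
  assumes p: "1 \<le> p" and \<xi>: "\<xi> \<in> carrier (lp p I)" and \<epsilon>: "0 < \<epsilon>"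
  obtains J where "finite J" "J \<subseteq> I" "nrm (lp p I) (\<lambda>i. \<xi> i - (if i \<in> J then \<xi> i else 0)) \<le> \<epsilon>"
proof -
  have "\<exists>J. finite J \<and> J \<subseteq> I \<and> (\<forall>F. finite F \<longrightarrow> F \<subseteq> I \<longrightarrow> lpn p F (\<lambda>i. cmod (\<xi> i - (if i \<in> J then \<xi> i else 0))) \<le> \<epsilon>)"
    using p
  proof (cases rule: exponent_cases)
    case 1
    let ?J = "{i \<in> I. \<epsilon> \<le> cmod (\<xi> i)}"
    have "finite ?J" using lp_inf_level[of \<xi> I \<epsilon>] \<xi> \<epsilon> 1 by simp
    then show ?thesis using \<epsilon> 1 by (intro exI[of _ ?J]) (auto simp: lpn_inf_le_iff)
  next
    case (2 r)
    have sm: "(\<lambda>i. cmod (\<xi> i) powr r) summable_on I" using \<xi> 2 by (simp add: lp_sum_carrier)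
    have "0 < \<epsilon> powr r" using \<epsilon> by simp
    then obtain J where J: "finite J" "J \<subseteq> I"
      "\<And>F. finite F \<Longrightarrow> F \<subseteq> I \<Longrightarrow> F \<inter> J = {} \<Longrightarrow> (\<Sum>i\<in>F. cmod (\<xi> i) powr r) \<le> \<epsilon> powr r"
      by (rule summable_on_tail[OF sm]) (rule that)
    have "lpn p F (\<lambda>i. cmod (\<xi> i - (if i \<in> J then \<xi> i else 0))) \<le> \<epsilon>" if F: "finite F" "F \<subseteq> I" for F
    proof -
      have "(\<Sum>i\<in>F. \<bar>cmod (\<xi> i - (if i \<in> J then \<xi> i else 0))\<bar> powr r) = (\<Sum>i\<in>F - J. cmod (\<xi> i) powr r)"
        using F by (intro sum.mono_neutral_cong_right) auto
      also have "\<dots> \<le> \<epsilon> powr r" using F by (intro J(3)) auto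
      finally show ?thesis unfolding 2(1) using 2 \<epsilon> by (subst lpn_real_le_iff) auto
    qed
    then show ?thesis using J by blast
  qed
  then obtain J where J: "finite J" "J \<subseteq> I"
    "\<And>F. finite F \<Longrightarrow> F \<subseteq> I \<Longrightarrow> lpn p F (\<lambda>i. cmod (\<xi> i - (if i \<in> J then \<xi> i else 0))) \<le> \<epsilon>" by blast
  show ?thesis
    using J lp_carrier_out[OF \<xi>] by (intro that[OF J(1,2)] lp_nrm_le[OF p]) auto
qed

context twisted_action
begin

text \<open>The induced representation of evaluation at x, written directly on l^p(G). Below it is
  needed as a representation of the convolution algebra, not just as an operator with the right
  norm.\<close>

definition row_sum :: "'x \<Rightarrow> ('g \<Rightarrow> 'x \<Rightarrow> complex) \<Rightarrow> ('g \<Rightarrow> complex) \<Rightarrow> 'g \<Rightarrow> complex" where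
  "row_sum x b \<xi> t = (\<Sum>\<^sub>\<infinity>r. mat b t r x * \<xi> r)"

context
  fixes p :: ereal and x :: 'x
  assumes p: "1 \<le> p" and x: "x \<in> topspace X"
begin

lemma row_sum_lpn_le:
  assumes b: "b \<in> carrier (F_alg X \<phi> u)" and \<xi>: "\<xi> \<in> carrier (lp p UNIV)" and F: "finite F"
  shows "lpn p F (\<lambda>t. cmod (row_sum x b \<xi> t)) \<le> nrm (F_alg X \<phi> u) b * nrm (lp p UNIV) \<xi>"
  unfolding row_sum_def
  by (rule matrix_bounded_infsum[OF p b matrix_bounded_nrm[OF p b] x _ F]) (rule lp_lpn_le[OF p \<xi>], simp_all)

lemma row_sum_summable:
  assumes "b \<in> carrier (F_alg X \<phi> u)" "\<xi> \<in> carrier (lp p UNIV)"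
  shows "(\<lambda>r. mat b t r x * \<xi> r) summable_on UNIV"
  using assms(1) lp_pointwise_le[OF p assms(2)] by (rule row_summable)

lemma row_sum_add:
  assumes "b \<in> carrier (F_alg X \<phi> u)" "\<xi> \<in> carrier (lp p UNIV)" "\<eta> \<in> carrier (lp p UNIV)"
  shows "row_sum x b (\<lambda>r. \<xi> r + \<eta> r) t = row_sum x b \<xi> t + row_sum x b \<eta> t"
  unfolding row_sum_def distrib_left by (intro infsum_add row_sum_summable assms)

lemma row_sum_scale: "row_sum x b (\<lambda>r. c * \<xi> r) t = c * row_sum x b \<xi> t"
  unfolding row_sum_def by (simp add: infsum_cmult_right'[symmetric] mult_ac)

lemma row_sum_diff:
  assumes "b \<in> carrier (F_alg X \<phi> u)" "\<xi> \<in> carrier (lp p UNIV)" "\<eta> \<in> carrier (lp p UNIV)"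
  shows "row_sum x b (\<lambda>r. \<xi> r - \<eta> r) t = row_sum x b \<xi> t - row_sum x b \<eta> t"
  using row_sum_add[OF assms(1,2) lp_scale(1)[OF p assms(3)], of "-1" t] row_sum_scale[of b "-1" \<eta> t] by simp

lemma lp_diff: "\<xi> \<in> carrier (lp p I) \<Longrightarrow> \<eta> \<in> carrier (lp p I) \<Longrightarrow> (\<lambda>i. \<xi> i - \<eta> i) \<in> carrier (lp p I)"
  using lp_add(1)[OF p _ lp_scale(1)[OF p, of \<eta> I "-1"], of \<xi>] by simp

text \<open>For p = \<infinity> the image must be shown to lie in c_0. Columns of the matrix do, as
  the norms of b s are summable; finite combinations follow, and the rest is approximation.\<close>

lemma row_sum_carrier:
  assumes b: "b \<in> carrier (F_alg X \<phi> u)" and \<xi>: "\<xi> \<in> carrier (lp p UNIV)"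
  shows "row_sum x b \<xi> \<in> carrier (lp p UNIV)"
proof -
  have unit: "row_sum x b (\<lambda>r. if r \<in> {r0} then c else 0) \<in> carrier (lp p UNIV)" for r0 c
  proof -
    have e: "row_sum x b (\<lambda>r. if r \<in> {r0} then c else 0) t = mat b t r0 x * c" for t
    proof -
      have "row_sum x b (\<lambda>r. if r \<in> {r0} then c else 0) t = (\<Sum>\<^sub>\<infinity>r\<in>{r0}. mat b t r x * c)"
        unfolding row_sum_def by (intro infsum_cong_neutral) auto
      then show ?thesis by simp
    qed
    show ?thesis
      using p
    proof (cases rule: exponent_cases)
      case (2 r)
      have "(\<lambda>t. cmod (row_sum x b (\<lambda>r. if r \<in> {r0} then c else 0) t) powr r) summable_on UNIV"
        using row_sum_lpn_le[OF b lp_finite_support(1)[OF p, of "{r0}" UNIV "\<lambda>_. c"]] 2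
        by (subst summable_on_powr_iff) auto
      then show ?thesis using 2 by (simp add: lp_sum_carrier)
    next
      case 1
      have "finite {t. \<epsilon> \<le> cmod (mat b t r0 x * c)}" if \<epsilon>: "0 < \<epsilon>" for \<epsilon>
      proof -
        \<comment> \<open>The added 1 covers c = 0, and the factor 1/2 makes the final inequality
          strict.\<close>
        define \<delta> where "\<delta> = \<epsilon> / (cmod c + 1) / 2"
        have \<delta>: "0 < \<delta>" using \<epsilon> by (simp add: \<delta>_def add_nonneg_pos)
        obtain S where S: "finite S" "S \<subseteq> UNIV" "\<And>F. finite F \<Longrightarrow> F \<subseteq> UNIV \<Longrightarrow> F \<inter> S = {} \<Longrightarrow> (\<Sum>s\<in>F. nrm (C0 X) (b s)) \<le> \<delta>"
          by (rule summable_on_tail[OF F_summable[OF b] \<delta>]) (rule that)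
        have "{t. \<epsilon> \<le> cmod (mat b t r0 x * c)} \<subseteq> (\<lambda>s. s + r0) ` S"
        proof (rule ccontr)
          assume "\<not> ?thesis"
          then obtain t where t: "\<epsilon> \<le> cmod (mat b t r0 x * c)" "t \<notin> (\<lambda>s. s + r0) ` S" by blast
          have "t - r0 \<notin> S"
          proof
            assume "t - r0 \<in> S"
            then have "(t - r0) + r0 \<in> (\<lambda>s. s + r0) ` S" by (rule imageI)
            then show False using t(2) by simp
          qed
          then have "nrm (C0 X) (b (t - r0)) \<le> \<delta>" using S(3)[of "{t - r0}"] by simp
          then have "cmod (mat b t r0 x) \<le> \<delta>" using mat_norm_le[of b t r0 x] F_C0[OF b] by (meson order_trans)
          then have "cmod (mat b t r0 x * c) \<le> \<delta> * cmod c" by (simp add: norm_mult mult_right_mono)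
          also have "\<dots> \<le> \<delta> * (cmod c + 1)" using \<delta> by (intro mult_left_mono) auto
          also have "\<dots> = \<epsilon> / 2" unfolding \<delta>_def using add_nonneg_pos[of "cmod c" 1] by (simp add: field_simps)
          also have "\<dots> < \<epsilon>" using \<epsilon> by simp
          finally show False using t(1) by simp
        qed
        then show ?thesis using S(1) finite_subset by blast
      qed
      then show ?thesis using 1 unfolding lp_sum_carrier e by simp
    qed
  qed
  have fs: "row_sum x b (\<lambda>r. if r \<in> J then \<xi> r else 0) \<in> carrier (lp p UNIV)" if "finite J" for J
    using that
  proof (induction J rule: finite_induct)
    case empty
    have "row_sum x b (\<lambda>r. if r \<in> {} then \<xi> r else 0) = (\<lambda>_. 0)" by (simp add: row_sum_def fun_eq_iff)
    then show ?case using lp_zero(1)[OF p, of UNIV] by simp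
  next
    case (insert j J)
    have "(\<lambda>r. if r \<in> insert j J then \<xi> r else 0) = (\<lambda>r. (if r \<in> {j} then \<xi> j else 0) + (if r \<in> J then \<xi> r else 0))"
      using insert by (auto simp: fun_eq_iff)
    then have "row_sum x b (\<lambda>r. if r \<in> insert j J then \<xi> r else 0)
        = (\<lambda>t. row_sum x b (\<lambda>r. if r \<in> {j} then \<xi> j else 0) t + row_sum x b (\<lambda>r. if r \<in> J then \<xi> r else 0) t)"
      using row_sum_add[OF b lp_finite_support(1)[OF p, of "{j}" UNIV "\<lambda>_. \<xi> j"] lp_finite_support(1)[OF p insert(1), of UNIV \<xi>]]
      by (simp add: fun_eq_iff)
    then show ?case using lp_add(1)[OF p unit insert.IH] by simp
  qed
  let ?N = "nrm (F_alg X \<phi> u) b"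
  have N: "0 \<le> ?N" by (rule F_nrm_nonneg[OF b])
  show ?thesis
  proof (rule lp_carrier_approx[OF p])
    fix \<epsilon> :: real assume \<epsilon>: "0 < \<epsilon>"
    have "0 < \<epsilon> / (?N + 1)" using \<epsilon> N by simp
    then obtain J where J: "finite J" "J \<subseteq> UNIV" "nrm (lp p UNIV) (\<lambda>i. \<xi> i - (if i \<in> J then \<xi> i else 0)) \<le> \<epsilon> / (?N + 1)"
      by (rule lp_finite_approx[OF p \<xi>]) (rule that)
    have c: "(\<lambda>r. if r \<in> J then \<xi> r else 0) \<in> carrier (lp p UNIV)" by (rule lp_finite_support(1)[OF p J(1,2)])
    have "lpn p F (\<lambda>t. cmod (row_sum x b \<xi> t - row_sum x b (\<lambda>r. if r \<in> J then \<xi> r else 0) t)) \<le> \<epsilon>" if F: "finite F" for F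
    proof -
      have "lpn p F (\<lambda>t. cmod (row_sum x b \<xi> t - row_sum x b (\<lambda>r. if r \<in> J then \<xi> r else 0) t))
          \<le> ?N * nrm (lp p UNIV) (\<lambda>i. \<xi> i - (if i \<in> J then \<xi> i else 0))"
        using row_sum_lpn_le[OF b lp_diff[OF \<xi> c] F] by (simp only: row_sum_diff[OF b \<xi> c])
      also have "\<dots> \<le> ?N * (\<epsilon> / (?N + 1))" using J(3) N by (intro mult_left_mono)
      also have "\<dots> \<le> \<epsilon>" using N \<epsilon> by (simp add: field_simps)
      finally show ?thesis .
    qed
    then show "\<exists>\<eta>\<in>carrier (lp p UNIV). \<forall>F. finite F \<longrightarrow> F \<subseteq> UNIV \<longrightarrow> lpn p F (\<lambda>i. cmod (row_sum x b \<xi> i - \<eta> i)) \<le> \<epsilon>"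
      using fs[OF J(1)] by blast
  next
    fix i :: 'g assume "i \<notin> UNIV"
    then show "row_sum x b \<xi> i = 0" by simp
  qed
qed

lemma row_sum_nrm_le:
  assumes "b \<in> carrier (F_alg X \<phi> u)" "\<xi> \<in> carrier (lp p UNIV)"
  shows "nrm (lp p UNIV) (row_sum x b \<xi>) \<le> nrm (F_alg X \<phi> u) b * nrm (lp p UNIV) \<xi>"
  by (intro lp_nrm_le[OF p] row_sum_lpn_le assms) auto

text \<open>Twisted convolution becomes the matrix product: the cocycle identity for (t - k, k - r,
  r) at \<phi> t x matches the three values of u.\<close>

lemma mat_conv:
  assumes b: "b \<in> carrier (F_alg X \<phi> u)" and c: "c \<in> carrier (F_alg X \<phi> u)"
  shows "mat (twisted_conv X \<phi> u b c) t r x = (\<Sum>\<^sub>\<infinity>k. mat b t k x * mat c k r x)"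
proof -
  let ?y = "\<phi> t x"
  have y: "?y \<in> topspace X" using x by simp
  let ?f = "\<lambda>(s, s'). b s ?y * alpha X \<phi> s (c s') ?y * u s s' ?y"
  have bij: "bij_betw (\<lambda>k. (t - k, k - r)) UNIV {(s, s'). s + s' = t - r}"
  proof (rule bij_betwI[of _ _ _ "\<lambda>(s, s'). s' + r"])
    show "(\<lambda>k. (t - k, k - r)) \<in> UNIV \<rightarrow> {(s, s'). s + s' = t - r}" by (auto simp: add_diff_eq)
    fix z assume "z \<in> {(s, s'). s + s' = t - r}"
    then obtain s s' where z: "z = (s, s')" "s + s' = t - r" by auto
    then have "t = s + (s' + r)" by (simp add: add.assoc[symmetric])
    then show "(t - (case z of (s, s') \<Rightarrow> s' + r), (case z of (s, s') \<Rightarrow> s' + r) - r) = z" using z by simp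
  qed auto
  have "mat (twisted_conv X \<phi> u b c) t r x = (\<Sum>\<^sub>\<infinity>z\<in>{(s, s'). s + s' = t - r}. ?f z) * u (t - r) r ?y"
    unfolding mat_apply[OF x] twisted_conv_def ..
  also have "\<dots> = (\<Sum>\<^sub>\<infinity>k. ?f (t - k, k - r)) * u (t - r) r ?y"
    by (subst infsum_reindex_bij_betw[OF bij, symmetric]) simp
  also have "\<dots> = (\<Sum>\<^sub>\<infinity>k. ?f (t - k, k - r) * u (t - r) r ?y)" by (rule infsum_cmult_left'[symmetric])
  also have "\<dots> = (\<Sum>\<^sub>\<infinity>k. mat b t k x * mat c k r x)"
  proof (rule infsum_cong)
    fix k
    have ky: "\<phi> (- (t - k)) ?y = \<phi> k x" using x by simp
    have "u (k - r) r (\<phi> (- (t - k)) ?y) * u (t - k) ((k - r) + r) ?y = u (t - k) (k - r) ?y * u ((t - k) + (k - r)) r ?y"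
      by (rule u_cocycle[OF y])
    then have uu: "u (k - r) r (\<phi> k x) * u (t - k) k ?y = u (t - k) (k - r) ?y * u (t - r) r ?y"
      unfolding ky by (simp add: add_diff_eq)
    have "?f (t - k, k - r) * u (t - r) r ?y = b (t - k) ?y * c (k - r) (\<phi> k x) * (u (t - k) (k - r) ?y * u (t - r) r ?y)"
      using y ky by simp
    also have "\<dots> = mat b t k x * mat c k r x" unfolding uu[symmetric] using x by (simp add: mat_apply mult_ac)
    finally show "?f (t - k, k - r) * u (t - r) r ?y = mat b t k x * mat c k r x" .
  qed
  finally show ?thesis .
qed

text \<open>After \<open>mat_conv\<close> only an interchange of sums is left. The double series is
  dominated by the products of the norms of b (t - k) and c (k - r) with the norm of \<xi>, which
  are summable.\<close>

lemma row_sum_mult: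
  assumes b: "b \<in> carrier (F_alg X \<phi> u)" and c: "c \<in> carrier (F_alg X \<phi> u)" and \<xi>: "\<xi> \<in> carrier (lp p UNIV)"
  shows "row_sum x (twisted_conv X \<phi> u b c) \<xi> t = row_sum x b (row_sum x c \<xi>) t"
proof -
  let ?K = "nrm (lp p UNIV) \<xi>" and ?nb = "\<lambda>k. nrm (C0 X) (b (t - k))" and ?nc = "\<lambda>k r. nrm (C0 X) (c (k - r))"
  have K: "0 \<le> ?K" by (rule lp_nrm_nonneg[OF p \<xi>])
  have nb: "0 \<le> ?nb k" and nc: "0 \<le> ?nc k r" for k r using F_C0[OF b] F_C0[OF c] by auto
  have inner: "(\<Sum>\<^sub>\<infinity>r. ?nc k r) = nrm (F_alg X \<phi> u) c" for k
  proof -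
    have "bij (\<lambda>r. k - r)" by (rule bij_betwI[of _ _ _ "\<lambda>s. - s + k"]) auto
    from infsum_reindex_bij_betw[OF this, of "\<lambda>s. nrm (C0 X) (c s)"] show ?thesis by (simp add: F_nrm[OF c])
  qed
  let ?g = "\<lambda>z. ?nb (fst z) * ?nc (fst z) (snd z) * ?K"
  have "(\<lambda>z. norm (?g z)) summable_on (UNIV \<times> UNIV)"
  proof (intro iffD2[OF Infinite_Sum.abs_summable_on_Sigma_iff] conjI ballI)
    fix k show "(\<lambda>r. norm (?g (k, r))) summable_on UNIV"
      using nb nc K summable_on_cmult_left[OF summable_on_cmult_right[OF summable_row[OF c, of k], of "?nb k"], of ?K] by simp
    have "(\<Sum>\<^sub>\<infinity>r. norm (?g (k, r))) = ?nb k * nrm (F_alg X \<phi> u) c * ?K" for k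
      using nb nc K by (simp add: infsum_cmult_left' infsum_cmult_right' inner)
    then show "(\<lambda>k. norm (\<Sum>\<^sub>\<infinity>r. norm (?g (k, r)))) summable_on UNIV"
      using nb K F_nrm_nonneg[OF c]
        summable_on_cmult_left[OF summable_on_cmult_left[OF summable_row[OF b, of t], of "nrm (F_alg X \<phi> u) c"], of ?K] by simp
  qed
  then have sg: "?g summable_on (UNIV \<times> UNIV)" using nb nc K by simp
  have "(\<lambda>(k, r). mat b t k x * mat c k r x * \<xi> r) summable_on UNIV \<times> UNIV"
  proof (rule abs_summable_summable, rule summable_on_bounded_mult[OF sg, of _ 1])
    fix z :: "'g \<times> 'g"
    obtain k r where z: "z = (k, r)" by force
    have "cmod (mat b t k x) * cmod (mat c k r x) * cmod (\<xi> r) \<le> ?nb k * ?nc k r * ?K"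
      using F_C0[OF b] F_C0[OF c] lp_pointwise_le[OF p \<xi>] nb nc by (intro mult_mono mat_norm_le mult_nonneg_nonneg) auto
    then show "0 \<le> norm (case z of (k, r) \<Rightarrow> mat b t k x * mat c k r x * \<xi> r) \<and>
        norm (case z of (k, r) \<Rightarrow> mat b t k x * mat c k r x * \<xi> r) \<le> 1 * ?g z"
      by (simp add: z norm_mult)
  qed (use nb nc K in simp)
  note swap = infsum_swap_banach[OF this]
  have "row_sum x b (row_sum x c \<xi>) t = (\<Sum>\<^sub>\<infinity>k. \<Sum>\<^sub>\<infinity>r. mat b t k x * mat c k r x * \<xi> r)"
    unfolding row_sum_def by (simp add: infsum_cmult_right'[symmetric] mult.assoc)
  also have "\<dots> = (\<Sum>\<^sub>\<infinity>r. \<Sum>\<^sub>\<infinity>k. mat b t k x * mat c k r x * \<xi> r)" by (rule swap)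
  also have "\<dots> = row_sum x (twisted_conv X \<phi> u b c) \<xi> t"
    unfolding row_sum_def mat_conv[OF b c] by (simp add: infsum_cmult_left')
  finally show ?thesis ..
qed

lemma row_sum_add_left:
  assumes "b \<in> carrier (F_alg X \<phi> u)" "c \<in> carrier (F_alg X \<phi> u)" "\<xi> \<in> carrier (lp p UNIV)"
  shows "row_sum x (\<lambda>s x. b s x + c s x) \<xi> t = row_sum x b \<xi> t + row_sum x c \<xi> t"
proof -
  have "row_sum x (\<lambda>s x. b s x + c s x) \<xi> t = (\<Sum>\<^sub>\<infinity>r. mat b t r x * \<xi> r + mat c t r x * \<xi> r)"
    unfolding row_sum_def using x by (intro infsum_cong) (simp add: mat_apply algebra_simps)
  then show ?thesis unfolding row_sum_def by (simp add: infsum_add row_sum_summable assms)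
qed

lemma row_sum_scale_left: "row_sum x (\<lambda>s x. z * b s x) \<xi> t = z * row_sum x b \<xi> t"
  unfolding row_sum_def using x by (simp add: infsum_cmult_right'[symmetric] mat_apply mult_ac)

lemma row_sum_single:
  assumes "a \<in> carrier (C0 X)"
  shows "row_sum x (single 0 a) \<xi> t = a (\<phi> t x) * \<xi> t"
proof -
  have "row_sum x (single 0 a) \<xi> t = (\<Sum>\<^sub>\<infinity>r\<in>{t}. a (\<phi> t x) * \<xi> t)"
    unfolding row_sum_def using x by (intro infsum_cong_neutral) (auto simp: mat_apply single_def)
  then show ?thesis by simp
qed

definition orbit_rep :: "('g \<Rightarrow> 'x \<Rightarrow> complex) \<Rightarrow> ('x, 'g, 'i) universe \<Rightarrow> ('x, 'g, 'i) universe" where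
  "orbit_rep b w = embed (row_sum x b (unembed w))"

text \<open>Elements supported at 0 act diagonally, by the values along the orbit of x, so finitely
  supported vectors are in the range as soon as one function is nonzero at finitely many prescribed
  orbit points.\<close>

lemma orbit_rep_nondegenerate:
  assumes a0: "a0 \<in> carrier (C0 X)" "a0 x \<noteq> 0"
  shows "nondegenerate_representation (F_alg X \<phi> u) (lp_copy p UNIV :: ('x, 'g, 'i) universe nspace) orbit_rep"
proof -
  let ?E = "lp_copy p UNIV :: ('x, 'g, 'i) universe nspace" and ?L = "lp p (UNIV :: 'g set)"
  interpret cbanach ?E by unfold_locales (rule lp_copy_banach[OF p])
  have rep: "representation (F_alg X \<phi> u) ?E orbit_rep"
    unfolding representation_def bounded_operator_def
  proof (intro conjI ballI allI)
    fix b assume b: "b \<in> carrier (F_alg X \<phi> u)"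
    show "linear_map ?E ?E (orbit_rep b)"
      unfolding linear_map_def
    proof (intro conjI ballI allI)
      show "orbit_rep b \<in> carrier ?E \<rightarrow> carrier ?E" using row_sum_carrier[OF b] by (auto simp: orbit_rep_def)
      fix v w assume "v \<in> carrier ?E" "w \<in> carrier ?E"
      then show "orbit_rep b (add ?E v w) = add ?E (orbit_rep b v) (orbit_rep b w)"
        by (auto simp: orbit_rep_def row_sum_add[OF b] intro!: arg_cong[of _ _ embed])
    next
      fix c w assume "w \<in> carrier ?E"
      show "orbit_rep b (smult ?E c w) = smult ?E c (orbit_rep b w)"
        by (auto simp: orbit_rep_def row_sum_scale intro!: arg_cong[of _ _ embed])
    qed
    show "\<exists>C. \<forall>w\<in>carrier ?E. nrm ?E (orbit_rep b w) \<le> C * nrm ?E w"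
      using row_sum_nrm_le[OF b] by (intro exI[of _ "nrm (F_alg X \<phi> u) b"]) (auto simp: orbit_rep_def)
    show "opnorm ?E (orbit_rep b) \<le> nrm (F_alg X \<phi> u) b"
      using row_sum_nrm_le[OF b] F_nrm_nonneg[OF b] by (intro lp_copy_opnorm_le[OF p]) (auto simp: orbit_rep_def)
  next
    fix b c w assume b: "b \<in> carrier (F_alg X \<phi> u)" and c: "c \<in> carrier (F_alg X \<phi> u)" and w: "w \<in> carrier ?E"
    have \<xi>: "unembed w \<in> carrier ?L" using w by auto
    show "orbit_rep (add (F_alg X \<phi> u) b c) w = add ?E (orbit_rep b w) (orbit_rep c w)"
      by (auto simp: orbit_rep_def row_sum_add_left[OF b c \<xi>] intro!: arg_cong[of _ _ embed])
    show "orbit_rep (mult (F_alg X \<phi> u) b c) w = orbit_rep b (orbit_rep c w)"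
      by (auto simp: orbit_rep_def row_sum_mult[OF b c \<xi>] intro!: arg_cong[of _ _ embed])
  next
    fix z b w
    show "orbit_rep (smult (F_alg X \<phi> u) z b) w = smult ?E z (orbit_rep b w)"
      by (auto simp: orbit_rep_def row_sum_scale_left intro!: arg_cong[of _ _ embed])
  qed
  have "metric.mtopology closure_of {orbit_rep b w |b w. b \<in> carrier (F_alg X \<phi> u) \<and> w \<in> carrier ?E} = carrier ?E"
  proof (rule closure_eq_carrierI)
    show "{orbit_rep b w |b w. b \<in> carrier (F_alg X \<phi> u) \<and> w \<in> carrier ?E} \<subseteq> carrier ?E"
      using row_sum_carrier by (auto simp: orbit_rep_def)
    fix w and \<epsilon> :: real assume w: "w \<in> carrier ?E" and \<epsilon>: "0 < \<epsilon>"
    obtain \<xi> where \<xi>: "\<xi> \<in> carrier ?L" "w = embed \<xi>" using w by auto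
    obtain J where J: "finite J" "J \<subseteq> UNIV" "nrm ?L (\<lambda>i. \<xi> i - (if i \<in> J then \<xi> i else 0)) \<le> \<epsilon> / 2"
      by (rule lp_finite_approx[OF p \<xi>(1) half_gt_zero[OF \<epsilon>]]) (rule that)
    \<comment> \<open>Its t-th summand takes the value |a0 x| > 0 at \<phi> t x, and moduli prevent
      cancellation, so one can divide by a on the support.\<close>
    define a where "a = (\<lambda>y. \<Sum>t\<in>J. complex_of_real (cmod (alpha X \<phi> t a0 y)))"
    have aC: "a \<in> carrier (C0 X)" unfolding a_def using J a0 by (intro C0_sum C0_norm alpha_C0) auto
    have anz: "a (\<phi> t x) \<noteq> 0" if t: "t \<in> J" for t
    proof -
      have "0 < cmod (alpha X \<phi> t a0 (\<phi> t x))" using x a0 by simp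
      also have "\<dots> \<le> (\<Sum>t'\<in>J. cmod (alpha X \<phi> t' a0 (\<phi> t x)))" using J t by (intro member_le_sum) auto
      finally show ?thesis unfolding a_def of_real_sum[symmetric] of_real_eq_0_iff by linarith
    qed
    let ?\<eta> = "\<lambda>t. if t \<in> J then \<xi> t / a (\<phi> t x) else 0" and ?\<zeta> = "\<lambda>t. if t \<in> J then \<xi> t else 0"
    have \<eta>: "?\<eta> \<in> carrier ?L" by (rule lp_finite_support(1)[OF p J(1,2)])
    have eq: "orbit_rep (single 0 a) (embed ?\<eta>) = embed ?\<zeta>"
      unfolding orbit_rep_def using anz by (auto simp: row_sum_single[OF aC] intro!: arg_cong[of _ _ embed])
    have \<zeta>E: "embed ?\<zeta> \<in> carrier ?E" using lp_finite_support(1)[OF p J(1,2), of \<xi>] by simp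
    have "nrm ?E (w \<ominus>\<^bsub>?E\<^esub> embed ?\<zeta>) = nrm ?L (\<lambda>i. \<xi> i - ?\<zeta> i)"
      using diff_eq[OF w \<zeta>E] \<xi>(2) by simp
    then have lt: "nrm ?E (w \<ominus>\<^bsub>?E\<^esub> embed ?\<zeta>) < \<epsilon>" using J(3) \<epsilon> by linarith
    show "\<exists>\<eta>\<in>{orbit_rep b w |b w. b \<in> carrier (F_alg X \<phi> u) \<and> w \<in> carrier ?E}. nrm ?E (w \<ominus>\<^bsub>?E\<^esub> \<eta>) < \<epsilon>"
    proof (rule bexI[of _ "embed ?\<zeta>"], rule lt)
      have "embed ?\<eta> \<in> carrier ?E" using \<eta> by simp
      then show "embed ?\<zeta> \<in> {orbit_rep b w |b w. b \<in> carrier (F_alg X \<phi> u) \<and> w \<in> carrier ?E}"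
        using eq[symmetric] single_F(1)[OF aC, of 0] by (intro CollectI exI[of _ "single 0 a"] exI[of _ "embed ?\<eta>"] conjI)
    qed
  qed
  with rep show ?thesis by (simp add: nondegenerate_representation_def)
qed

end

text \<open>On the zero space the identity is a representation. It ensures that the supremum in
  \<open>norm_Lp\<close> is taken over a nonempty set and is nonnegative.\<close>

lemma zero_rep_nondegenerate:
  assumes p: "1 \<le> p"
  shows "nondegenerate_representation (F_alg X \<phi> u) (lp_copy p {} :: ('x, 'g, 'i) universe nspace) (\<lambda>b w. w)"
proof -
  let ?E = "lp_copy p {} :: ('x, 'g, 'i) universe nspace"
  interpret cbanach ?E by unfold_locales (rule lp_copy_banach[OF p])
  have E0: "w = embed (\<lambda>_. 0)" if w: "w \<in> carrier ?E" for w
  proof -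
    obtain \<xi> where \<xi>: "\<xi> \<in> carrier (lp p ({} :: 'g set))" "w = embed \<xi>" using w by auto
    have "\<xi> = (\<lambda>_. 0)" using lp_carrier_out[OF \<xi>(1)] by (simp add: fun_eq_iff)
    then show ?thesis using \<xi>(2) by simp
  qed
  have Z: "embed (\<lambda>_. 0) \<in> carrier ?E" unfolding lp_copy_simps by (intro imageI lp_zero(1)[OF p])
  have n0: "nrm ?E w = 0" if "w \<in> carrier ?E" for w unfolding E0[OF that] using lp_zero(2)[OF p] by simp
  have bF: "single 0 (\<lambda>_. 0) \<in> carrier (F_alg X \<phi> u)" by (rule single_F) simp
  have "representation (F_alg X \<phi> u) ?E (\<lambda>b w. w)"
    unfolding representation_def bounded_operator_def
  proof (intro conjI ballI allI)
    fix b assume b: "b \<in> carrier (F_alg X \<phi> u)"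
    show "linear_map ?E ?E (\<lambda>w. w)" by (auto simp: linear_map_def)
    show "\<exists>C. \<forall>w\<in>carrier ?E. nrm ?E w \<le> C * nrm ?E w" using n0 by auto
    show "opnorm ?E (\<lambda>w. w) \<le> nrm (F_alg X \<phi> u) b"
      by (rule opnorm_leI) (use n0 F_nrm_nonneg[OF b] in auto)
  next
    fix w assume w: "w \<in> carrier ?E"
    show "w = add ?E w w" using E0[OF w] by simp
    show "w = smult ?E z w" for z using E0[OF w] by simp
  qed simp
  moreover have "metric.mtopology closure_of {w |b w. b \<in> carrier (F_alg X \<phi> u) \<and> w \<in> carrier ?E} = carrier ?E"
  proof (rule closure_eq_carrierI)
    fix w and \<epsilon> :: real assume w: "w \<in> carrier ?E" and \<epsilon>: "0 < \<epsilon>"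
    have "nrm ?E (w \<ominus>\<^bsub>?E\<^esub> w) < \<epsilon>" using w \<epsilon> nrm_0 by (simp only: diff_self)
    then show "\<exists>\<eta>\<in>{w |b w. b \<in> carrier (F_alg X \<phi> u) \<and> w \<in> carrier ?E}. nrm ?E (w \<ominus>\<^bsub>?E\<^esub> \<eta>) < \<epsilon>"
      using w bF by blast
  qed auto
  ultimately show ?thesis by (simp add: nondegenerate_representation_def)
qed

section \<open>Comparison of the full and the reduced norm\<close>

lemma norm_Lp_le:
  assumes p: "1 \<le> p" and le: "\<And>(E :: ('x, 'g, 'i) universe nspace) \<psi>. space_for_exponent TYPE(('x, 'g, 'i) points) p E \<Longrightarrow>
      nondegenerate_representation (F_alg X \<phi> u) E \<psi> \<Longrightarrow> opnorm E (\<psi> b) \<le> C"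
  shows "norm_Lp TYPE('i) X \<phi> u p b \<le> C"
  unfolding norm_Lp_def
proof (rule cSup_least)
  show "{opnorm E (\<psi> b) | (E :: ('x, 'g, 'i) universe nspace) \<psi>. space_for_exponent TYPE(('x, 'g, 'i) points) p E \<and>
      nondegenerate_representation (F_alg X \<phi> u) E \<psi>} \<noteq> {}"
    using lp_copy_space_for_exponent[OF p] zero_rep_nondegenerate[OF p] by blast
qed (use le in blast)

lemma le_norm_Lp:
  fixes E :: "('x, 'g, 'i) universe nspace"
  assumes b: "b \<in> carrier (F_alg X \<phi> u)"
    and "space_for_exponent TYPE(('x, 'g, 'i) points) p E" "nondegenerate_representation (F_alg X \<phi> u) E \<psi>"
  shows "opnorm E (\<psi> b) \<le> norm_Lp TYPE('i) X \<phi> u p b"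
  unfolding norm_Lp_def
proof (rule cSup_upper)
  show "bdd_above {opnorm E (\<psi> b) | (E :: ('x, 'g, 'i) universe nspace) \<psi>. space_for_exponent TYPE(('x, 'g, 'i) points) p E \<and>
      nondegenerate_representation (F_alg X \<phi> u) E \<psi>}"
    using b by (auto simp: bdd_above_def nondegenerate_representation_def representation_def)
qed (use assms in blast)

text \<open>The orbit representations compete in the supremum and display the matrix at x on l^p(G).
  Through \<open>norm_Lp_red_le\<close> this yields that the reduced norm is at most the full
  one.\<close>

lemma matrix_bounded_norm_Lp:
  assumes p: "1 \<le> p" and b: "b \<in> carrier (F_alg X \<phi> u)"
  shows "matrix_bounded p (norm_Lp TYPE('i) X \<phi> u p b) b"
proof (rule matrix_boundedI[OF p])
  have "0 \<le> opnorm (lp_copy p {} :: ('x, 'g, 'i) universe nspace) (\<lambda>w. w)"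
  proof -
    interpret cbanach "lp_copy p {} :: ('x, 'g, 'i) universe nspace" by unfold_locales (rule lp_copy_banach[OF p])
    show ?thesis
      using zero_rep_nondegenerate[OF p] b
      by (intro opnorm_nonneg) (auto simp: nondegenerate_representation_def representation_def)
  qed
  also have "\<dots> \<le> norm_Lp TYPE('i) X \<phi> u p b"
    by (rule le_norm_Lp[OF b lp_copy_space_for_exponent[OF p] zero_rep_nondegenerate[OF p]])
  finally show N: "0 \<le> norm_Lp TYPE('i) X \<phi> u p b" .
  fix x and I J :: "'g set" and c :: "'g \<Rightarrow> complex"
  assume x: "x \<in> topspace X" and fin: "finite I" "finite J" and c1: "lpn p J (\<lambda>r. cmod (c r)) \<le> 1"
  show "lpn p I (\<lambda>t. cmod (\<Sum>r\<in>J. mat b t r x * c r)) \<le> norm_Lp TYPE('i) X \<phi> u p b"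
  proof (cases "\<exists>a\<in>carrier (C0 X). a x \<noteq> 0")
    case False
    then have "lpn p I (\<lambda>t. cmod (\<Sum>r\<in>J. mat b t r x * c r)) = 0"
      using mat_vanishes[OF x _ b] by (intro lpn_zero[OF fin(1) p]) auto
    then show ?thesis using N by simp
  next
    case True
    then obtain a0 where a0: "a0 \<in> carrier (C0 X)" "a0 x \<noteq> 0" by blast
    let ?E = "lp_copy p UNIV :: ('x, 'g, 'i) universe nspace" and ?\<xi> = "\<lambda>r. if r \<in> J then c r else 0"
    interpret cbanach ?E by unfold_locales (rule lp_copy_banach[OF p])
    note nd = orbit_rep_nondegenerate[OF p x a0]
    have \<xi>: "?\<xi> \<in> carrier (lp p UNIV)" "nrm (lp p UNIV) ?\<xi> \<le> 1"
      using lp_finite_support[OF p fin(2), of UNIV c] c1 by auto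
    have "row_sum x b ?\<xi> t = (\<Sum>r\<in>J. mat b t r x * c r)" for t
    proof -
      have "row_sum x b ?\<xi> t = (\<Sum>\<^sub>\<infinity>r\<in>J. mat b t r x * c r)" unfolding row_sum_def by (intro infsum_cong_neutral) auto
      then show ?thesis using fin by simp
    qed
    then have "lpn p I (\<lambda>t. cmod (\<Sum>r\<in>J. mat b t r x * c r)) = lpn p I (\<lambda>t. cmod (row_sum x b ?\<xi> t))" by simp
    also have "\<dots> \<le> nrm (lp p UNIV) (row_sum x b ?\<xi>)"
      by (rule lp_lpn_le[OF p row_sum_carrier[OF p x b \<xi>(1)] fin(1)]) simp
    also have "\<dots> = nrm ?E (orbit_rep x b (embed ?\<xi>))" by (simp add: orbit_rep_def[OF p x])
    also have "\<dots> \<le> opnorm ?E (orbit_rep x b) * nrm ?E (embed ?\<xi>)"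
      using nd b \<xi> by (intro nrm_le_opnorm) (auto simp: nondegenerate_representation_def representation_def)
    also have "\<dots> \<le> opnorm ?E (orbit_rep x b) * 1"
      using nd b \<xi> by (intro mult_left_mono opnorm_nonneg) (auto simp: nondegenerate_representation_def representation_def)
    also have "\<dots> \<le> norm_Lp TYPE('i) X \<phi> u p b"
      using le_norm_Lp[OF b lp_copy_space_for_exponent[OF p] nd] by simp
    finally show ?thesis .
  qed
qed

text \<open>The reduced norm is the least admissible matrix bound, and the full norm is admissible.
  In the listed cases any admissible bound controls every \<psi> b, so the reduced norm
  does.\<close>

theorem norm_Lp_eq_norm_Lp_red:
  assumes p: "1 \<le> p" and b: "b \<in> carrier (F_alg X \<phi> u)"
    and cases: "p = 1 \<or> p = \<infinity> \<or> amenable_action X \<phi>"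
  shows "norm_Lp TYPE('i) X \<phi> u p b = norm_Lp_red X \<phi> u p b"
proof (rule antisym)
  show "norm_Lp_red X \<phi> u p b \<le> norm_Lp TYPE('i) X \<phi> u p b"
    by (rule norm_Lp_red_le[OF p b matrix_bounded_norm_Lp[OF p b]])
  note mb = matrix_bounded_norm_Lp_red[OF p b]
  show "norm_Lp TYPE('i) X \<phi> u p b \<le> norm_Lp_red X \<phi> u p b"
  proof (rule norm_Lp_le[OF p])
    fix E :: "('x, 'g, 'i) universe nspace" and \<psi>
    assume sp: "space_for_exponent TYPE(('x, 'g, 'i) points) p E"
      and nd: "nondegenerate_representation (F_alg X \<phi> u) E \<psi>"
    interpret N: nondeg_rep E "F_alg X \<phi> u" \<psi> by (rule nondeg_repI[OF space_for_exponent_banach[OF sp] nd])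
    interpret F_rep X \<phi> u E \<psi> ..
    show "opnorm E (\<psi> b) \<le> norm_Lp_red X \<phi> u p b"
    proof (cases "p = 1 \<or> p = \<infinity>")
      case True
      then show ?thesis by (rule psi_le_1_infinity[OF b _ sp mb])
    next
      case False
      then obtain r where r: "p = ereal r" "1 < r" using p by (cases p) (auto simp: one_ereal_def)
      show ?thesis using psi_le_amenable[OF _ b r(2)] sp mb cases False unfolding r(1) by blast
    qed
  qed
qed

end

theorem corollary4p14:
  fixes X :: "'x topology"
    and \<phi> :: "'g::group_add \<Rightarrow> 'x \<Rightarrow> 'x"
    and u :: "'g \<Rightarrow> 'g \<Rightarrow> 'x \<Rightarrow> complex"
    and P :: "ereal set"
  assumes "locally_compact_space X" and "Hausdorff_space X"
    and "group_action_on X \<phi>"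
    and "normalised_cocycle X \<phi> u"
    and "P \<subseteq> {1..\<infinity>}"
  shows
    "(P \<noteq> {} \<longrightarrow>
       (\<forall>b\<in>carrier (F_alg X \<phi> u).
          norm_P_red X \<phi> u P b =
            Sup {opnorm (lp_sum p UNIV E) (Ind X \<phi> u E \<pi> b) |
                   p (E :: ('x, 'g, 'i) universe nspace) \<pi>.
                   p \<in> P \<and> space_for_exponent TYPE(('x, 'g, 'i) points) p E \<and>
                   nondegenerate_representation (C0 X) E \<pi>}))
     \<and> (P \<subseteq> {1, \<infinity>} \<longrightarrow>
         (\<forall>b\<in>carrier (F_alg X \<phi> u). norm_P TYPE('i) X \<phi> u P b = norm_P_red X \<phi> u P b))
     \<and> (amenable_action X \<phi> \<longrightarrow>
         (\<forall>b\<in>carrier (F_alg X \<phi> u). norm_P TYPE('i) X \<phi> u P b = norm_P_red X \<phi> u P b))"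
proof -
  interpret twisted_action X \<phi> u by (rule twisted_action.intro[OF assms(3,4)])
  have p1: "1 \<le> p" if "p \<in> P" for p using that assms(5) by auto
  have "norm_P TYPE('i) X \<phi> u P b = norm_P_red X \<phi> u P b"
    if "b \<in> carrier (F_alg X \<phi> u)" "P \<subseteq> {1, \<infinity>} \<or> amenable_action X \<phi>" for b
  proof -
    have "norm_Lp TYPE('i) X \<phi> u p b = norm_Lp_red X \<phi> u p b" if "p \<in> P" for p
      using that \<open>P \<subseteq> {1, \<infinity>} \<or> amenable_action X \<phi>\<close>
      by (intro norm_Lp_eq_norm_Lp_red p1 \<open>b \<in> carrier (F_alg X \<phi> u)\<close>) auto
    then show ?thesis by (simp add: norm_P_def norm_P_red_def)
  qed
  moreover have "norm_P_red X \<phi> u P b =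
      Sup {opnorm (lp_sum p UNIV E) (Ind X \<phi> u E \<pi> b) |
             p (E :: ('x, 'g, 'i) universe nspace) \<pi>.
             p \<in> P \<and> space_for_exponent TYPE(('x, 'g, 'i) points) p E \<and>
             nondegenerate_representation (C0 X) E \<pi>}"
    if "P \<noteq> {}" "b \<in> carrier (F_alg X \<phi> u)" for b
    by (rule norm_P_red_eq_Sup_Ind[OF that(1) assms(5) that(2)])
  ultimately show ?thesis by blast
qed

end
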